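(* Let $h : [0,\infty) \to [0,\infty)$ be continuous and nondecreasing, and let $f$ be a Carathéodory function on $\Omega \times \mathbb{R}$ such that $|f(x,t)| \le c_1 |t|^{p-1} + c_2$ for a.a. $x \in \Omega$ and all $t \in \mathbb{R}$, for some constants $c_1, c_2 > 0$ and $1 < p < 2^*$. Assume that $h$ satisfies one of the following conditions: (i) for some constants $\eta > 0$ and $p/2 < \gamma < 2^*/2$, $h(t) \ge S^{-2^*/2}\, t^{2^*/2-1} + \eta\, t^{\gamma-1}$ for all $t \ge 0$; (ii) for some constant $b > S^{-2^*/2}$, $h(t) \ge b t^{2^*/2-1}$ for all $t \ge 0$; (iii) for some constants $b > 0$ and $\gamma > 2^*/2$, $h(t) > \max\left\{S^{-2^*/2}\, t^{2^*/2-1},\, b t^{\gamma-1}\right\}$ for all $t > 0$. Then $J$ is bounded from below, coercive, and satisfies the $(\mathrm{PS})_c$ condition for all $c \in \mathbb{R}$. In particular, $J$ has a global minimizer.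
   Context: $\Omega$ is a bounded domain in $\mathbb{R}^N$, $N \ge 3$, and $2^* = 2N/(N-2)$. $H^1_0(\Omega)$ is normed by $\|u\|^2 = \int_\Omega |\nabla u|^2\, dx$. The best Sobolev constant is $S = \inf_{u \in H^1_0(\Omega) \setminus \{0\}} \int_\Omega |\nabla u|^2\, dx \big/ \left(\int_\Omega |u|^{2^*} dx\right)^{2/2^*}$. Set $F(x,t) = \int_0^t f(x,s)\, ds$, $H(t) = \int_0^t h(s)\, ds$, and \[ J(u) = \frac{1}{2}\, H\left(\int_\Omega |\nabla u|^2\, dx\right) - \int_\Omega F(x,u)\, dx - \frac{1}{2^*} \int_\Omega |u|^{2^*} dx, \quad u \in H^1_0(\Omega). \] $J$ satisfies the $(\mathrm{PS})_c$ condition ($c \in \mathbb{R}$) if every sequence $(u_j)$ in $H^1_0(\Omega)$ with $J(u_j) \to c$ and $J'(u_j) \to 0$ has a strongly convergent subsequence. Coercive means $J(u) \to +\infty$ as $\|u\| \to \infty$. *)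

theory Defs
  imports "HOL-Analysis.Analysis"
begin

text \<open>
  Elements of \<open>L\<^sup>2\<close>, \<open>H\<^sup>1\<close> and \<open>H\<^sup>1\<^sub>0\<close> are represented by functions on the whole space of which only
  the values almost everywhere on the domain matter; there is no quotient by equality almost
  everywhere. All functionals below take equal values on representatives of the same class.
\<close>

primrec C_k :: "nat \<Rightarrow> ('a::euclidean_space \<Rightarrow> real) \<Rightarrow> bool" where
  "C_k 0 \<phi> \<longleftrightarrow> continuous_on UNIV \<phi>"
| "C_k (Suc k) \<phi> \<longleftrightarrow> (\<forall>x. \<phi> differentiable (at x)) \<and>
     (\<forall>i\<in>Basis. C_k k (\<lambda>x. frechet_derivative \<phi> (at x) i))"

definition test_functions :: "'a::euclidean_space set \<Rightarrow> ('a \<Rightarrow> real) set" where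
  "test_functions \<Omega> = {\<phi>. (\<forall>k. C_k k \<phi>) \<and>
     compact (closure {x. \<phi> x \<noteq> 0}) \<and> closure {x. \<phi> x \<noteq> 0} \<subseteq> \<Omega>}"

definition L2 :: "'a::euclidean_space set \<Rightarrow> ('a \<Rightarrow> 'b::euclidean_space) set" where
  "L2 \<Omega> = {u \<in> borel_measurable (lebesgue_on \<Omega>). integrable (lebesgue_on \<Omega>) (\<lambda>x. (norm (u x))\<^sup>2)}"

definition is_weak_gradient ::
  "'a::euclidean_space set \<Rightarrow> ('a \<Rightarrow> real) \<Rightarrow> ('a \<Rightarrow> 'a) \<Rightarrow> bool" where
  "is_weak_gradient \<Omega> u g \<longleftrightarrow> (\<forall>\<phi>\<in>test_functions \<Omega>. \<forall>i\<in>Basis.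
     (LINT x|lebesgue_on \<Omega>. u x * frechet_derivative \<phi> (at x) i) =
     - (LINT x|lebesgue_on \<Omega>. (g x \<bullet> i) * \<phi> x))"

definition H1 :: "'a::euclidean_space set \<Rightarrow> ('a \<Rightarrow> real) set" where
  "H1 \<Omega> = {u \<in> L2 \<Omega>. \<exists>g\<in>L2 \<Omega>. is_weak_gradient \<Omega> u g}"

text \<open>The weak gradient is determined up to a null set, so the choice does not affect integrals.\<close>

definition weak_gradient :: "'a::euclidean_space set \<Rightarrow> ('a \<Rightarrow> real) \<Rightarrow> 'a \<Rightarrow> 'a" where
  "weak_gradient \<Omega> u = (SOME g. g \<in> L2 \<Omega> \<and> is_weak_gradient \<Omega> u g)"

definition dirichlet :: "'a::euclidean_space set \<Rightarrow> ('a \<Rightarrow> real) \<Rightarrow> real" where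
  "dirichlet \<Omega> u = (LINT x|lebesgue_on \<Omega>. (norm (weak_gradient \<Omega> u x))\<^sup>2)"

definition H1_norm :: "'a::euclidean_space set \<Rightarrow> ('a \<Rightarrow> real) \<Rightarrow> real" where
  "H1_norm \<Omega> u = sqrt ((LINT x|lebesgue_on \<Omega>. (u x)\<^sup>2) + dirichlet \<Omega> u)"

definition H10 :: "'a::euclidean_space set \<Rightarrow> ('a \<Rightarrow> real) set" where
  "H10 \<Omega> = {u \<in> H1 \<Omega>. \<exists>\<phi>. (\<forall>n. \<phi> n \<in> test_functions \<Omega>) \<and>
     (\<lambda>n. H1_norm \<Omega> (\<lambda>x. \<phi> n x - u x)) \<longlonglongrightarrow> 0}"

definition H10_norm :: "'a::euclidean_space set \<Rightarrow> ('a \<Rightarrow> real) \<Rightarrow> real" where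
  "H10_norm \<Omega> u = sqrt (dirichlet \<Omega> u)"

text \<open>\<open>crit_exp N\<close> is the critical exponent \<open>2\<^sup>*\<close> in dimension \<open>N\<close>.\<close>

definition crit_exp :: "nat \<Rightarrow> real" where
  "crit_exp N = 2 * real N / (real N - 2)"

text \<open>The integral in the denominator is finite because \<open>H\<^sup>1\<^sub>0\<close> embeds into \<open>L\<close> with exponent \<open>2\<^sup>*\<close>.\<close>

definition sobolev_const :: "'a::euclidean_space set \<Rightarrow> real" where
  "sobolev_const \<Omega> = (INF u\<in>{u \<in> H10 \<Omega>. \<not> (AE x in lebesgue_on \<Omega>. u x = 0)}.
     dirichlet \<Omega> u /
     (LINT x|lebesgue_on \<Omega>. \<bar>u x\<bar> powr crit_exp DIM('a)) powr (2 / crit_exp DIM('a)))"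

definition caratheodory :: "'a::euclidean_space set \<Rightarrow> ('a \<Rightarrow> real \<Rightarrow> real) \<Rightarrow> bool" where
  "caratheodory \<Omega> f \<longleftrightarrow>
     (\<forall>t. (\<lambda>x. f x t) \<in> borel_measurable (lebesgue_on \<Omega>)) \<and>
     (AE x in lebesgue_on \<Omega>. continuous_on UNIV (f x))"

text \<open>The interval integral is oriented: for \<open>t < 0\<close> it is minus the integral over \<open>[t, 0]\<close>.\<close>

definition primitive :: "(real \<Rightarrow> real) \<Rightarrow> real \<Rightarrow> real" where
  "primitive g t = (LBINT s=ereal 0..ereal t. g s)"

definition energy ::
  "'a::euclidean_space set \<Rightarrow> (real \<Rightarrow> real) \<Rightarrow> ('a \<Rightarrow> real \<Rightarrow> real) \<Rightarrow> ('a \<Rightarrow> real) \<Rightarrow> real" where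
  "energy \<Omega> h f u =
     1 / 2 * primitive h (dirichlet \<Omega> u)
     - (LINT x|lebesgue_on \<Omega>. primitive (f x) (u x))
     - 1 / crit_exp DIM('a) * (LINT x|lebesgue_on \<Omega>. \<bar>u x\<bar> powr crit_exp DIM('a))"

text \<open>Frechet differentiability at \<open>u\<close> of a functional on \<open>H\<^sup>1\<^sub>0\<close>, with a bounded linear derivative \<open>L\<close>.\<close>

definition has_H10_derivative ::
  "'a::euclidean_space set \<Rightarrow> (('a \<Rightarrow> real) \<Rightarrow> real) \<Rightarrow> (('a \<Rightarrow> real) \<Rightarrow> real) \<Rightarrow> ('a \<Rightarrow> real) \<Rightarrow> bool" where
  "has_H10_derivative \<Omega> J L u \<longleftrightarrow>
     (\<forall>v\<in>H10 \<Omega>. \<forall>w\<in>H10 \<Omega>. \<forall>a b. L (\<lambda>x. a * v x + b * w x) = a * L v + b * L w) \<and>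
     (\<exists>C. \<forall>v\<in>H10 \<Omega>. \<bar>L v\<bar> \<le> C * H10_norm \<Omega> v) \<and>
     (\<forall>\<epsilon>>0. \<exists>\<delta>>0. \<forall>v\<in>H10 \<Omega>. H10_norm \<Omega> v < \<delta> \<longrightarrow>
        \<bar>J (\<lambda>x. u x + v x) - J u - L v\<bar> \<le> \<epsilon> * H10_norm \<Omega> v)"

definition H10_derivative ::
  "'a::euclidean_space set \<Rightarrow> (('a \<Rightarrow> real) \<Rightarrow> real) \<Rightarrow> ('a \<Rightarrow> real) \<Rightarrow> ('a \<Rightarrow> real) \<Rightarrow> real" where
  "H10_derivative \<Omega> J u = (SOME L. has_H10_derivative \<Omega> J L u)"

definition dual_norm :: "'a::euclidean_space set \<Rightarrow> (('a \<Rightarrow> real) \<Rightarrow> real) \<Rightarrow> real" where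
  "dual_norm \<Omega> L = (SUP v\<in>{v \<in> H10 \<Omega>. H10_norm \<Omega> v \<le> 1}. \<bar>L v\<bar>)"

definition palais_smale ::
  "'a::euclidean_space set \<Rightarrow> (('a \<Rightarrow> real) \<Rightarrow> real) \<Rightarrow> real \<Rightarrow> bool" where
  "palais_smale \<Omega> J c \<longleftrightarrow>
     (\<forall>u :: nat \<Rightarrow> 'a \<Rightarrow> real. (\<forall>j. u j \<in> H10 \<Omega>) \<and>
        (\<lambda>j. J (u j)) \<longlonglongrightarrow> c \<and> (\<lambda>j. dual_norm \<Omega> (H10_derivative \<Omega> J (u j))) \<longlonglongrightarrow> 0 \<longrightarrow>
        (\<exists>r w. strict_mono r \<and> w \<in> H10 \<Omega> \<and>
           (\<lambda>j. H10_norm \<Omega> (\<lambda>x. u (r j) x - w x)) \<longlonglongrightarrow> 0))"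

definition coercive :: "'a::euclidean_space set \<Rightarrow> (('a \<Rightarrow> real) \<Rightarrow> real) \<Rightarrow> bool" where
  "coercive \<Omega> J \<longleftrightarrow>
     (\<forall>M. \<exists>R. \<forall>u\<in>H10 \<Omega>. H10_norm \<Omega> u \<ge> R \<longrightarrow> J u \<ge> M)"

end

theory Submission
  imports Defs "HOL-Complex_Analysis.Great_Picard"
begin

text \<open>
  Write \<open>q\<close> for the critical exponent, \<open>K = S powr (-q/2)\<close> and \<open>D\<close> for the Dirichlet integral, so that the
  \<open>q\<close>-th power integral of \<open>u\<close> is at most \<open>K * D u powr (q/2)\<close>. Each of the three conditions gives
  \<open>h t > K * t powr (q/2 - 1)\<close> for \<open>t > 0\<close> and leaves a surplus of order \<open>D u powr (\<rho>/2)\<close>, \<open>\<rho> > p\<close>, in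
  \<open>1/2 * H (D u)\<close> over the critical term; this yields coercivity. A bounded sequence \<open>u\<^sub>j\<close> has a subsequence
  converging to some \<open>w\<close> weakly in \<open>H10\<close> and almost everywhere, with \<open>D u\<^sub>j\<close> tending to \<open>t = D w + s\<close>, where
  \<open>s\<close> is the limit of \<open>D (u\<^sub>j - w)\<close>. Subcritical terms pass to the limit, and the critical one splits by
  the Brezis--Lieb lemma. Testing \<open>J' (u\<^sub>j)\<close> with \<open>u\<^sub>j - w\<close> gives \<open>h t * s \<le> K * s powr (q/2)\<close>, which
  forces \<open>s = 0\<close> because \<open>s \<le> t\<close>. For a minimizing sequence, \<open>H (D w + s) - H (D w) \<ge> H s\<close> absorbs the
  critical energy carried by \<open>u\<^sub>j - w\<close>, so \<open>w\<close> is a minimizer.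

  The Sobolev inequality behind \<open>S > 0\<close> is the Gagliardo--Nirenberg inequality obtained by integrating out
  one coordinate at a time. The weak limit is constructed without weak compactness theorems: Rellich's
  theorem gives a limit in \<open>L\<^sup>2\<close>, which lies in \<open>H10\<close> by a convexity argument, and weak convergence is
  tested on smooth functions by moving both derivatives onto them.
\<close>

section \<open>Integral inequalities and the space \<open>L\<^sup>2\<close>\<close>

text \<open>Two obstacles shape the argument. The embedding into the critical Lebesgue space is not
  compact, so a bounded sequence may lose an amount \<open>s\<close> of its Dirichlet integral in
  the limit. And the coefficient is nonlocal: \<open>h (D u\<^sub>j)\<close> tends to
  \<open>h t\<close>, in general not to \<open>h (D w)\<close>, so passing to the limit in
  \<open>J' (u\<^sub>j)\<close> does not show that \<open>w\<close> is a critical point of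
  \<open>J\<close>. Testing with \<open>u\<^sub>j - w\<close> avoids any equation for
  \<open>w\<close>, since only the lost part survives. The number \<open>h t * s\<close> has
  \<open>h\<close> evaluated at the full limit \<open>t\<close>, not at the lost part alone. With
  the strict bound on \<open>h\<close> and an increasing power this excludes loss at every level
  \<open>c\<close>, whereas for constant \<open>h\<close> compactness is in general available only
  below an energy threshold. The comparison is made with the best constant, which is why the
  conditions are stated in terms of \<open>S\<close>; a cruder Sobolev constant serves only to show
  that \<open>S\<close> is positive.\<close>

lemma weighted_arith_geom_mean:
  fixes x w :: "'i \<Rightarrow> real"
  assumes "finite I" "\<And>i. i \<in> I \<Longrightarrow> 0 \<le> w i" "sum w I = 1" "\<And>i. i \<in> I \<Longrightarrow> 0 \<le> x i"
  shows "(\<Prod>i\<in>I. x i powr w i) \<le> (\<Sum>i\<in>I. w i * x i)"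
proof (cases "\<exists>i\<in>I. x i = 0")
  case True
  then have "(\<Prod>i\<in>I. x i powr w i) = 0"
    using assms(1) by auto
  moreover have "0 \<le> (\<Sum>i\<in>I. w i * x i)"
    using assms by (intro sum_nonneg mult_nonneg_nonneg) auto
  ultimately show ?thesis by simp
next
  case False
  then have pos: "x i > 0" if "i \<in> I" for i
    using assms(4) that by (metis order_le_less)
  have ne: "I \<noteq> {}" using assms(3) by auto
  have "(\<Prod>i\<in>I. x i powr w i) = (\<Prod>i\<in>I. exp (w i * ln (x i)))"
    by (intro prod.cong refl) (use pos in \<open>force simp: powr_def\<close>)
  also have "\<dots> = exp (\<Sum>i\<in>I. w i *\<^sub>R ln (x i))"
    using assms(1) by (simp add: exp_sum)
  \<comment> \<open>Jensen's inequality for \<open>exp\<close> at the points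
    \<open>ln (x i)\<close>, which is why a vanishing \<open>x i\<close> was treated apart.\<close>
  also have "\<dots> \<le> (\<Sum>i\<in>I. w i * exp (ln (x i)))"
    by (rule convex_on_sum[OF assms(1) ne _ assms(3)]) (use assms(2) exp_convex in auto)
  also have "\<dots> = (\<Sum>i\<in>I. w i * x i)"
    by (intro sum.cong refl) (use pos in simp)
  finally show ?thesis .
qed

text \<open>Once each \<open>f i\<close> is divided by its integral, the weighted mean inequality
  can be integrated term by term, and its right-hand side becomes \<open>sum w I = 1\<close>. A
  factor with integral zero cannot be normalised, but then the left-hand side vanishes. Many factors
  are allowed at once because the Gagliardo--Nirenberg induction produces a number of them that
  depends on the dimension.\<close>

lemma Holder_weighted:
  fixes f :: "'i \<Rightarrow> 'b \<Rightarrow> real" and M :: "'b measure"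
  assumes fin: "finite I" and w: "\<And>i. i \<in> I \<Longrightarrow> 0 \<le> w i" "sum w I = 1"
    and f: "\<And>i. i \<in> I \<Longrightarrow> integrable M (f i)" "\<And>i x. i \<in> I \<Longrightarrow> 0 \<le> f i x"
  shows "integrable M (\<lambda>x. \<Prod>i\<in>I. f i x powr w i)"
    and "(LINT x|M. (\<Prod>i\<in>I. f i x powr w i)) \<le> (\<Prod>i\<in>I. (LINT x|M. f i x) powr w i)"
proof -
  have meas: "f i \<in> borel_measurable M" if "i \<in> I" for i
    using f(1)[OF that] by auto
  have m: "(\<lambda>x. \<Prod>i\<in>I. f i x powr w i) \<in> borel_measurable M"
    using meas by (intro borel_measurable_prod) auto
  have le: "(\<Prod>i\<in>I. f i x powr w i) \<le> (\<Sum>i\<in>I. w i * f i x)" for x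
    by (rule weighted_arith_geom_mean) (use assms in auto)
  show int: "integrable M (\<lambda>x. \<Prod>i\<in>I. f i x powr w i)"
    by (rule Bochner_Integration.integrable_bound[where f = "\<lambda>x. \<Sum>i\<in>I. w i * f i x"])
      (use f m le in \<open>auto simp: abs_of_nonneg prod_nonneg intro!: AE_I2 intro: order_trans[OF _ abs_ge_self]\<close>)
  show "(LINT x|M. (\<Prod>i\<in>I. f i x powr w i)) \<le> (\<Prod>i\<in>I. (LINT x|M. f i x) powr w i)"
  proof (cases "\<exists>i\<in>I. (LINT x|M. f i x) = 0")
    case True
    then obtain i where i: "i \<in> I" "(LINT x|M. f i x) = 0" by auto
    then have "AE x in M. f i x = 0"
      using integral_nonneg_eq_0_iff_AE[OF f(1)[OF i(1)]] f(2) by auto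
    then have "AE x in M. (\<Prod>i\<in>I. f i x powr w i) = 0"
      by (rule AE_mp) (use i fin in auto)
    then have "(LINT x|M. (\<Prod>i\<in>I. f i x powr w i)) = 0"
      using integral_cong_AE[OF m, of "\<lambda>_. 0"] by auto
    then show ?thesis by (simp add: prod_nonneg)
  next
    case False
    define c where "c i = (LINT x|M. f i x)" for i
    have c: "c i > 0" if "i \<in> I" for i
    proof -
      have "0 \<le> c i" unfolding c_def by (rule Bochner_Integration.integral_nonneg) (use f(2) that in auto)
      then show ?thesis using False that by (auto simp: c_def order_le_less)
    qed
    have eq: "(\<Prod>i\<in>I. f i x powr w i) = (\<Prod>i\<in>I. c i powr w i) * (\<Prod>i\<in>I. (f i x / c i) powr w i)" for x
      unfolding prod.distrib[symmetric]
    proof (intro prod.cong refl)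
      fix i assume "i \<in> I"
      then show "f i x powr w i = c i powr w i * (f i x / c i) powr w i"
        using c[of i] f(2)[of i x] by (simp add: powr_divide)
    qed
    have "(LINT x|M. (\<Prod>i\<in>I. f i x powr w i)) \<le> (LINT x|M. (\<Prod>i\<in>I. c i powr w i) * (\<Sum>i\<in>I. w i * (f i x / c i)))"
    proof (rule integral_mono[OF int])
      show "integrable M (\<lambda>x. (\<Prod>i\<in>I. c i powr w i) * (\<Sum>i\<in>I. w i * (f i x / c i)))"
        using f by auto
      show "(\<Prod>i\<in>I. f i x powr w i) \<le> (\<Prod>i\<in>I. c i powr w i) * (\<Sum>i\<in>I. w i * (f i x / c i))" for x
        unfolding eq
        by (intro mult_left_mono weighted_arith_geom_mean prod_nonneg)
          (use assms c in \<open>auto simp: less_imp_le\<close>)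
    qed
    also have "\<dots> = (\<Prod>i\<in>I. c i powr w i) * (\<Sum>i\<in>I. w i * (c i / c i))"
      using f(1) by (auto simp: Bochner_Integration.integral_sum intro!: sum.cong simp flip: c_def)
    also have "(\<Sum>i\<in>I. w i * (c i / c i)) = (\<Sum>i\<in>I. w i)"
      by (intro sum.cong refl) (use c in fastforce)
    finally show ?thesis using w by (simp add: c_def)
  qed
qed

lemma Holder_two:
  fixes f g :: "'b \<Rightarrow> real"
  assumes "0 \<le> a" "0 \<le> b" "a + b = 1"
    and f: "integrable M f" "\<And>x. 0 \<le> f x" and g: "integrable M g" "\<And>x. 0 \<le> g x"
  shows "integrable M (\<lambda>x. f x powr a * g x powr b)"
    and "(LINT x|M. f x powr a * g x powr b) \<le> (LINT x|M. f x) powr a * (LINT x|M. g x) powr b"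
  using Holder_weighted[of UNIV "\<lambda>i. if i then a else b" M "\<lambda>i. if i then f else g"] assms
  by (auto simp: UNIV_bool add.commute mult.commute)

text \<open>The part \<open>Y\<close> of the majorant takes up the critical growth, for which there is only a bound on the
  integrals; it makes the Brezis--Lieb splitting a consequence of pointwise convergence.\<close>

lemma tendsto_L1_split:
  fixes X :: "nat \<Rightarrow> 'b \<Rightarrow> real"
  assumes meas: "\<And>n. X n \<in> borel_measurable M"
    and ae: "AE x in M. (\<lambda>n. X n x) \<longlonglongrightarrow> 0"
    and dom: "\<And>\<eta>. \<eta> > 0 \<Longrightarrow> \<exists>Y W. (\<forall>n. integrable M (Y n)) \<and> integrable M W \<and>
        (\<forall>n. AE x in M. 0 \<le> Y n x \<and> \<bar>X n x\<bar> \<le> Y n x + W x) \<and>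
        (\<forall>\<^sub>F n in sequentially. (LINT x|M. Y n x) \<le> \<eta>)"
  shows "\<And>n. integrable M (X n)" and "(\<lambda>n. LINT x|M. \<bar>X n x\<bar>) \<longlonglongrightarrow> 0"
    and "(\<lambda>n. LINT x|M. X n x) \<longlonglongrightarrow> 0"
proof -
  show int: "integrable M (X n)" for n
  proof -
    from dom[of 1] obtain Y W where YW: "\<forall>n. integrable M (Y n)" "integrable M W"
        "\<forall>n. AE x in M. 0 \<le> Y n x \<and> \<bar>X n x\<bar> \<le> Y n x + W x" by auto
    have "AE x in M. norm (X n x) \<le> norm (Y n x + W x)"
      using YW(3)[rule_format, of n] by eventually_elim auto
    then show ?thesis
      by (rule Bochner_Integration.integrable_bound[rotated 2]) (use YW meas in auto)
  qed
  show lim: "(\<lambda>n. LINT x|M. \<bar>X n x\<bar>) \<longlonglongrightarrow> 0"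
  proof (rule LIMSEQ_I)
    fix e :: real assume "0 < e"
    from dom[of "e/3"] \<open>0 < e\<close> obtain Y W where YW: "\<And>n. integrable M (Y n)" "integrable M W"
        "\<And>n. AE x in M. 0 \<le> Y n x \<and> \<bar>X n x\<bar> \<le> Y n x + W x"
        "\<forall>\<^sub>F n in sequentially. (LINT x|M. Y n x) \<le> e/3" by auto
    \<comment> \<open>\<open>Z n\<close> is the excess of \<open>\<bar>X n\<bar>\<close> over
      \<open>Y n\<close>. It is dominated by the fixed function \<open>W\<close> and still tends to
      0, so dominated convergence applies to it; what remains of \<open>\<bar>X n\<bar>\<close>
      costs at most the integral of \<open>Y n\<close>.\<close>
    define Z where "Z n x = max 0 (\<bar>X n x\<bar> - Y n x)" for n x
    have mY: "Y n \<in> borel_measurable M" for n using YW(1) by auto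
    have aeall: "AE x in M. \<forall>n. 0 \<le> Y n x \<and> \<bar>X n x\<bar> \<le> Y n x + W x"
      using YW(3) by (simp add: AE_all_countable)
    have "(\<lambda>n. LINT x|M. Z n x) \<longlonglongrightarrow> (LINT x|M. 0)"
    proof (rule integral_dominated_convergence[where w = "\<lambda>x. \<bar>W x\<bar>"])
      show "AE x in M. (\<lambda>n. Z n x) \<longlonglongrightarrow> 0"
        using ae aeall
      proof eventually_elim
        case (elim x)
        show ?case
          by (rule Lim_null_comparison[OF _ tendsto_rabs_zero[OF elim(1)]])
            (use elim(2) in \<open>auto simp: Z_def\<close>)
      qed
      show "AE x in M. norm (Z n x) \<le> \<bar>W x\<bar>" for n
        using YW(3)[of n] by eventually_elim (auto simp: Z_def)
    qed (use YW meas mY in \<open>auto simp: Z_def[abs_def]\<close>)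
    then have "\<forall>\<^sub>F n in sequentially. (LINT x|M. Z n x) < e/3"
      using \<open>0 < e\<close> by (intro order_tendstoD) auto
    then have "\<forall>\<^sub>F n in sequentially. (LINT x|M. \<bar>X n x\<bar>) < e"
      using YW(4)
    proof eventually_elim
      case (elim n)
      have "integrable M (Z n)"
        by (rule Bochner_Integration.integrable_bound[where f = "\<lambda>x. \<bar>X n x\<bar> + \<bar>Y n x\<bar>"])
          (use YW(1)[of n] int[of n] meas mY in \<open>auto simp: Z_def[abs_def]\<close>)
      then have "(LINT x|M. \<bar>X n x\<bar>) \<le> (LINT x|M. Z n x + Y n x)"
        using int[of n] YW(1)[of n] by (intro integral_mono) (auto simp: Z_def)
      also have "\<dots> = (LINT x|M. Z n x) + (LINT x|M. Y n x)"
        using \<open>integrable M (Z n)\<close> YW(1)[of n] by simp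
      finally show ?case using elim \<open>0 < e\<close> by linarith
    qed
    then show "\<exists>no. \<forall>n\<ge>no. norm ((LINT x|M. \<bar>X n x\<bar>) - 0) < e"
      unfolding eventually_sequentially by (auto simp: abs_of_nonneg)
  qed
  show "(\<lambda>n. LINT x|M. X n x) \<longlonglongrightarrow> 0"
    by (rule Lim_null_comparison[OF _ lim]) (auto intro!: always_eventually)
qed

section \<open>Square-integrable functions with values in a Euclidean space\<close>

definition sq_int :: "'b measure \<Rightarrow> ('b \<Rightarrow> 'c::euclidean_space) \<Rightarrow> bool" where
  "sq_int M u \<longleftrightarrow> u \<in> borel_measurable M \<and> integrable M (\<lambda>x. (norm (u x))\<^sup>2)"

definition l2norm :: "'b measure \<Rightarrow> ('b \<Rightarrow> 'c::euclidean_space) \<Rightarrow> real" where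
  "l2norm M u = sqrt (LINT x|M. (norm (u x))\<^sup>2)"

lemma L2_iff: "u \<in> L2 \<Omega> \<longleftrightarrow> sq_int (lebesgue_on \<Omega>) u"
  by (auto simp: L2_def sq_int_def)

lemma sq_int_measurable: "sq_int M u \<Longrightarrow> u \<in> borel_measurable M"
  and sq_int_integrable: "sq_int M u \<Longrightarrow> integrable M (\<lambda>x. (norm (u x))\<^sup>2)"
  by (auto simp: sq_int_def)

lemma l2norm_nonneg [simp]: "l2norm M u \<ge> 0"
  by (simp add: l2norm_def)

lemma l2norm_sq: "(l2norm M u)\<^sup>2 = (LINT x|M. (norm (u x))\<^sup>2)"
  by (simp add: l2norm_def)

lemma sq_int_scaleR: "sq_int M u \<Longrightarrow> sq_int M (\<lambda>x. c *\<^sub>R u x)"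
  by (auto simp: sq_int_def power_mult_distrib)

lemma norm_add_sq_le: "(norm (a + b :: 'c::real_inner))\<^sup>2 \<le> 2 * (norm a)\<^sup>2 + 2 * (norm b)\<^sup>2"
proof -
  have "(norm (a + b))\<^sup>2 + (norm (a - b))\<^sup>2 = 2 * (norm a)\<^sup>2 + 2 * (norm b)\<^sup>2"
    by (simp add: power2_norm_eq_inner inner_simps inner_commute)
  then show ?thesis by (smt (verit) zero_le_power2)
qed

lemma sq_int_add:
  assumes "sq_int M u" "sq_int M v"
  shows "sq_int M (\<lambda>x. u x + v x)"
  unfolding sq_int_def
proof
  show m: "(\<lambda>x. u x + v x) \<in> borel_measurable M"
    using assms by (auto simp: sq_int_def)
  show "integrable M (\<lambda>x. (norm (u x + v x))\<^sup>2)"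
    by (rule Bochner_Integration.integrable_bound[where f = "\<lambda>x. 2 * (norm (u x))\<^sup>2 + 2 * (norm (v x))\<^sup>2"])
      (use assms m norm_add_sq_le in \<open>auto simp: sq_int_def intro!: AE_I2\<close>)
qed

lemma sq_int_diff:
  assumes "sq_int M u" "sq_int M v"
  shows "sq_int M (\<lambda>x. u x - v x)"
  using sq_int_add[OF assms(1) sq_int_scaleR[OF assms(2), of "-1"]] by simp

lemma sq_int_lincomb:
  assumes "sq_int M u" "sq_int M v"
  shows "sq_int M (\<lambda>x. a *\<^sub>R u x + b *\<^sub>R v x)"
  using assms by (intro sq_int_add sq_int_scaleR)

lemma sq_int_zero [simp]: "sq_int M (\<lambda>x. 0)"
  by (simp add: sq_int_def)

lemma inner_le_sq: "\<bar>a \<bullet> b\<bar> \<le> (norm a)\<^sup>2 + (norm (b :: 'c::real_inner))\<^sup>2"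
proof -
  have "\<bar>a \<bullet> b\<bar> \<le> norm a * norm b" by (rule Cauchy_Schwarz_ineq2)
  moreover have "0 \<le> (norm a - norm b)\<^sup>2" by simp
  moreover have "0 \<le> norm a * norm b" by simp
  ultimately show ?thesis unfolding power2_diff by linarith
qed

lemma integrable_inner_sq_int:
  assumes "sq_int M u" "sq_int M v"
  shows "integrable M (\<lambda>x. u x \<bullet> v x)"
  by (rule Bochner_Integration.integrable_bound[where f = "\<lambda>x. (norm (u x))\<^sup>2 + (norm (v x))\<^sup>2"])
    (use assms inner_le_sq in \<open>auto simp: sq_int_def intro!: AE_I2 borel_measurable_inner\<close>)

lemma integrable_norm_norm_sq_int:
  assumes "sq_int M u" "sq_int M v"
  shows "integrable M (\<lambda>x. norm (u x) * norm (v x))"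
proof -
  have "sq_int M (\<lambda>x. norm (u x))" "sq_int M (\<lambda>x. norm (v x))"
    using assms by (auto simp: sq_int_def)
  from integrable_inner_sq_int[OF this] show ?thesis by simp
qed

lemma Cauchy_Schwarz_norm_integral:
  assumes u: "sq_int M u" and v: "sq_int M v"
  shows "(LINT x|M. norm (u x) * norm (v x)) \<le> l2norm M u * l2norm M v"
proof -
  have e: "((norm y)\<^sup>2) powr (1/2) = norm y" for y :: "'z::real_normed_vector"
    by (simp add: powr_half_sqrt)
  show ?thesis
    using Holder_two(2)[of "1/2" "1/2" M "\<lambda>x. (norm (u x))\<^sup>2" "\<lambda>x. (norm (v x))\<^sup>2"] u v
    by (simp add: sq_int_def e powr_half_sqrt l2norm_def)
qed

lemma Cauchy_Schwarz_integral:
  assumes u: "sq_int M u" and v: "sq_int M v"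
  shows "\<bar>LINT x|M. u x \<bullet> v x\<bar> \<le> l2norm M u * l2norm M v"
proof -
  have "\<bar>LINT x|M. u x \<bullet> v x\<bar> \<le> (LINT x|M. \<bar>u x \<bullet> v x\<bar>)"
    using integral_abs_bound by blast
  also have "\<dots> \<le> (LINT x|M. norm (u x) * norm (v x))"
    by (intro integral_mono integrable_norm_norm_sq_int u v integrable_abs integrable_inner_sq_int
        Cauchy_Schwarz_ineq2)
  finally show ?thesis using Cauchy_Schwarz_norm_integral[OF u v] by linarith
qed

lemma l2norm_sq_lincomb:
  assumes u: "sq_int M u" and v: "sq_int M v"
  shows "(LINT x|M. (norm (a *\<^sub>R u x + b *\<^sub>R v x))\<^sup>2) =
    a\<^sup>2 * (LINT x|M. (norm (u x))\<^sup>2) + 2 * a * b * (LINT x|M. u x \<bullet> v x) + b\<^sup>2 * (LINT x|M. (norm (v x))\<^sup>2)"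
proof -
  have "(norm (a *\<^sub>R u x + b *\<^sub>R v x))\<^sup>2 = a\<^sup>2 * (norm (u x))\<^sup>2 + 2 * a * b * (u x \<bullet> v x) + b\<^sup>2 * (norm (v x))\<^sup>2" for x
    unfolding power2_norm_eq_inner
    by (simp add: inner_simps inner_commute algebra_simps power2_eq_square)
  then show ?thesis
    using sq_int_integrable[OF u] sq_int_integrable[OF v] integrable_inner_sq_int[OF u v] by simp
qed

lemma l2norm_triangle:
  assumes u: "sq_int M u" and v: "sq_int M v"
  shows "l2norm M (\<lambda>x. u x + v x) \<le> l2norm M u + l2norm M v"
proof (rule power2_le_imp_le)
  have "(l2norm M (\<lambda>x. u x + v x))\<^sup>2 = (l2norm M u)\<^sup>2 + 2 * (LINT x|M. u x \<bullet> v x) + (l2norm M v)\<^sup>2"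
    using l2norm_sq_lincomb[OF u v, of 1 1] by (simp add: l2norm_sq)
  also have "\<dots> \<le> (l2norm M u + l2norm M v)\<^sup>2"
    using Cauchy_Schwarz_integral[OF u v] by (simp add: power2_sum)
  finally show "(l2norm M (\<lambda>x. u x + v x))\<^sup>2 \<le> (l2norm M u + l2norm M v)\<^sup>2" .
qed auto

lemma l2norm_minus: "l2norm M (\<lambda>x. u x - v x) = l2norm M (\<lambda>x. v x - u x)"
  by (simp add: l2norm_def norm_minus_commute)

lemma l2norm_triangle3:
  assumes "sq_int M u" "sq_int M v" "sq_int M w"
  shows "l2norm M (\<lambda>x. u x - w x) \<le> l2norm M (\<lambda>x. u x - v x) + l2norm M (\<lambda>x. v x - w x)"
  using l2norm_triangle[OF sq_int_diff[OF assms(1,2)] sq_int_diff[OF assms(2,3)]] by simp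

lemma l2norm_diff_le:
  assumes "sq_int M u" "sq_int M v"
  shows "\<bar>l2norm M u - l2norm M v\<bar> \<le> l2norm M (\<lambda>x. u x - v x)"
  using l2norm_triangle3[OF assms(1,2) sq_int_zero] l2norm_triangle3[OF assms(2,1) sq_int_zero]
    l2norm_minus[of M u v] by simp

lemma l2norm_tendsto:
  assumes "\<And>n. sq_int M (u n)" "sq_int M v" "(\<lambda>n. l2norm M (\<lambda>x. u n x - v x)) \<longlonglongrightarrow> 0"
  shows "(\<lambda>n. l2norm M (u n)) \<longlonglongrightarrow> l2norm M v"
  by (rule LIM_zero_cancel, rule Lim_null_comparison[OF _ assms(3)])
    (use l2norm_diff_le[OF assms(1,2)] in \<open>auto intro!: always_eventually\<close>)

lemma integral_inner_tendsto:
  assumes "\<And>n. sq_int M (u n)" "sq_int M u0" "(\<lambda>n. l2norm M (\<lambda>x. u n x - u0 x)) \<longlonglongrightarrow> 0"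
    and v: "sq_int M v"
  shows "(\<lambda>n. LINT x|M. u n x \<bullet> v x) \<longlonglongrightarrow> (LINT x|M. u0 x \<bullet> v x)"
proof (rule LIM_zero_cancel, rule Lim_null_comparison)
  show "(\<lambda>n. l2norm M (\<lambda>x. u n x - u0 x) * l2norm M v) \<longlonglongrightarrow> 0"
    using tendsto_mult_right[OF assms(3), of "l2norm M v"] by simp
  show "\<forall>\<^sub>F n in sequentially. norm ((LINT x|M. u n x \<bullet> v x) - (LINT x|M. u0 x \<bullet> v x))
      \<le> l2norm M (\<lambda>x. u n x - u0 x) * l2norm M v"
  proof (intro always_eventually allI)
    fix n
    have "(LINT x|M. u n x \<bullet> v x) - (LINT x|M. u0 x \<bullet> v x) = (LINT x|M. (u n x - u0 x) \<bullet> v x)"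
      using integrable_inner_sq_int[OF assms(1)[of n] v] integrable_inner_sq_int[OF assms(2) v]
      by (simp add: inner_diff_left)
    then show "norm ((LINT x|M. u n x \<bullet> v x) - (LINT x|M. u0 x \<bullet> v x))
      \<le> l2norm M (\<lambda>x. u n x - u0 x) * l2norm M v"
      using Cauchy_Schwarz_integral[OF sq_int_diff[OF assms(1,2)] v] by simp
  qed
qed

lemma (in finite_measure) sq_int_const: "sq_int M (\<lambda>x. c)"
  by (simp add: sq_int_def)

lemma (in finite_measure) sq_int_imp_integrable:
  assumes "sq_int M u"
  shows "integrable M u"
proof -
  have "norm a \<le> 1 + (norm a)\<^sup>2" for a :: 'b
  proof -
    have "0 \<le> (norm a - 1)\<^sup>2" by simp
    then have "2 * norm a \<le> 1 + (norm a)\<^sup>2" by (simp add: power2_diff)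
    then show ?thesis using norm_ge_zero[of a] by linarith
  qed
  then have le: "norm (u x) \<le> norm (1 + (norm (u x))\<^sup>2)" for x
    by (metis abs_of_nonneg add_nonneg_nonneg real_norm_def zero_le_one zero_le_power2)
  have "integrable M (\<lambda>x. 1 + (norm (u x))\<^sup>2)"
    using sq_int_integrable[OF assms] by simp
  then show ?thesis
    by (rule Bochner_Integration.integrable_bound) (use sq_int_measurable[OF assms] le in auto)
qed

lemma (in finite_measure) L1_le_l2norm:
  assumes "sq_int M u"
  shows "(LINT x|M. norm (u x)) \<le> sqrt (measure M (space M)) * l2norm M u"
  using Cauchy_Schwarz_norm_integral[OF sq_int_const[of "1::real"] assms] by (simp add: l2norm_def)

text \<open>Integrability of the limit is a conclusion here. This is how the finiteness of critical
  integrals passes from test functions to their limits.\<close>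

lemma Fatou_real:
  fixes f :: "nat \<Rightarrow> 'b \<Rightarrow> real"
  assumes "\<And>n. integrable M (f n)" "\<And>n x. 0 \<le> f n x" "g \<in> borel_measurable M" "\<And>x. 0 \<le> g x"
    and ae: "AE x in M. (\<lambda>n. f n x) \<longlonglongrightarrow> g x"
    and bnd: "\<forall>\<^sub>F n in sequentially. (LINT x|M. f n x) \<le> C"
  shows "integrable M g" "(LINT x|M. g x) \<le> C"
proof -
  obtain N where "(LINT x|M. f N x) \<le> C"
    using bnd unfolding eventually_sequentially by auto
  moreover have "0 \<le> (LINT x|M. f N x)"
    by (rule Bochner_Integration.integral_nonneg) (use assms(2) in auto)
  ultimately have C: "0 \<le> C" by linarith
  have "(\<integral>\<^sup>+x. g x \<partial>M) = (\<integral>\<^sup>+x. liminf (\<lambda>n. ennreal (f n x)) \<partial>M)"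
  proof (rule nn_integral_cong_AE)
    show "AE x in M. ennreal (g x) = liminf (\<lambda>n. ennreal (f n x))"
      using ae
    proof eventually_elim
      case (elim x)
      then have "(\<lambda>n. ennreal (f n x)) \<longlonglongrightarrow> ennreal (g x)" by (rule tendsto_ennrealI)
      then show ?case by (simp add: lim_imp_Liminf)
    qed
  qed
  also have "\<dots> \<le> liminf (\<lambda>n. \<integral>\<^sup>+x. ennreal (f n x) \<partial>M)"
    by (rule nn_integral_liminf) (use assms(1) in auto)
  also have "\<dots> \<le> liminf (\<lambda>n. ennreal C)"
    by (rule Liminf_mono, rule eventually_mono[OF bnd])
      (use assms in \<open>auto simp: nn_integral_eq_integral ennreal_leI\<close>)
  finally have le: "(\<integral>\<^sup>+x. g x \<partial>M) \<le> ennreal C" by (simp add: Liminf_const)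
  show int: "integrable M g"
    by (rule integrableI_nonneg) (use assms le in \<open>auto simp: le_less_trans\<close>)
  show "(LINT x|M. g x) \<le> C"
    using le C by (subst (asm) nn_integral_eq_integral[OF int]) (use assms in auto)
qed

text \<open>On a finite measure space a mean-square Cauchy sequence is Cauchy in mean, hence has a
  subsequence converging almost everywhere. Fatou's lemma, applied to \<open>g i - g (r n)\<close>
  with \<open>i\<close> fixed, turns this pointwise limit into a mean-square limit of the whole
  sequence.\<close>

lemma (in finite_measure) l2_complete:
  fixes g :: "nat \<Rightarrow> 'a \<Rightarrow> 'c::euclidean_space"
  assumes g: "\<And>n. sq_int M (g n)"
    and cau: "\<And>e. e > 0 \<Longrightarrow> \<exists>N. \<forall>i\<ge>N. \<forall>j\<ge>N. l2norm M (\<lambda>x. g i x - g j x) < e"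
  obtains g0 r where "sq_int M g0" "(\<lambda>n. l2norm M (\<lambda>x. g n x - g0 x)) \<longlonglongrightarrow> 0"
    "strict_mono r" "AE x in M. (\<lambda>n. g (r n) x) \<longlonglongrightarrow> g0 x"
proof -
  let ?m = "sqrt (measure M (space M)) + 1"
  have m: "?m > 0" by (smt (verit) measure_nonneg real_sqrt_ge_zero)
  have L1: "\<exists>N. \<forall>i\<ge>N. \<forall>j\<ge>N. (LINT x|M. norm (g i x - g j x)) < e" if "e > 0" for e
  proof -
    from cau[of "e / ?m"] that m obtain N where N: "\<forall>i\<ge>N. \<forall>j\<ge>N. l2norm M (\<lambda>x. g i x - g j x) < e / ?m"
      by auto
    have "(LINT x|M. norm (g i x - g j x)) < e" if "i \<ge> N" "j \<ge> N" for i j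
    proof -
      have "(LINT x|M. norm (g i x - g j x)) \<le> sqrt (measure M (space M)) * l2norm M (\<lambda>x. g i x - g j x)"
        by (rule L1_le_l2norm[OF sq_int_diff[OF g g]])
      also have "\<dots> \<le> ?m * l2norm M (\<lambda>x. g i x - g j x)"
        by (intro mult_right_mono) auto
      also have "\<dots> < e"
        using N that m by (simp add: pos_less_divide_eq mult.commute)
      finally show ?thesis .
    qed
    then show ?thesis by blast
  qed
  obtain r where r: "strict_mono r" "AE x in M. Cauchy (\<lambda>i. g (r i) x)"
    using cauchy_L1_AE_cauchy_subseq[of M g, OF sq_int_imp_integrable[OF g] L1] by blast
  define g0 where "g0 x = lim (\<lambda>n. g (r n) x)" for x
  have gm: "g n \<in> borel_measurable M" for n using g by (auto simp: sq_int_def)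
  have g0m: "g0 \<in> borel_measurable M"
    unfolding g0_def by (rule borel_measurable_lim_metric) (rule gm)
  have ae: "AE x in M. (\<lambda>n. g (r n) x) \<longlonglongrightarrow> g0 x"
    using r(2) by eventually_elim (simp add: g0_def Cauchy_convergent_iff convergent_LIMSEQ_iff)
  have est: "sq_int M (\<lambda>x. g i x - g0 x) \<and> l2norm M (\<lambda>x. g i x - g0 x) \<le> e"
    if N: "\<forall>i\<ge>N. \<forall>j\<ge>N. l2norm M (\<lambda>x. g i x - g j x) < e" and i: "i \<ge> N" and e: "e > 0" for N e i
  proof -
    have 1: "integrable M (\<lambda>x. (norm (g i x - g (r n) x))\<^sup>2)" for n
      using sq_int_integrable[OF sq_int_diff[OF g g]] .
    have 2: "(\<lambda>x. (norm (g i x - g0 x))\<^sup>2) \<in> borel_measurable M"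
      using gm g0m by auto
    have 3: "AE x in M. (\<lambda>n. (norm (g i x - g (r n) x))\<^sup>2) \<longlonglongrightarrow> (norm (g i x - g0 x))\<^sup>2"
      using ae by eventually_elim (intro tendsto_intros)
    have "(LINT x|M. (norm (g i x - g (r n) x))\<^sup>2) \<le> e\<^sup>2" if "n \<ge> N" for n
    proof -
      have "r n \<ge> N" using that seq_suble[OF r(1), of n] by linarith
      then have "l2norm M (\<lambda>x. g i x - g (r n) x) < e" using N i by blast
      then show ?thesis unfolding l2norm_sq[symmetric] by (intro power_mono) auto
    qed
    then have 4: "\<forall>\<^sub>F n in sequentially. (LINT x|M. (norm (g i x - g (r n) x))\<^sup>2) \<le> e\<^sup>2"
      unfolding eventually_sequentially by blast
    note F = Fatou_real[OF 1 _ 2 _ 3 4, simplified]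
    then have "l2norm M (\<lambda>x. g i x - g0 x) \<le> e"
      unfolding l2norm_def using e F(2) by (simp add: real_le_lsqrt)
    then show ?thesis using F(1) gm g0m by (auto simp: sq_int_def)
  qed
  obtain N1 where N1: "\<forall>i\<ge>N1. \<forall>j\<ge>N1. l2norm M (\<lambda>x. g i x - g j x) < 1"
    using cau[of 1] by auto
  \<comment> \<open>Fatou's lemma controls differences only; \<open>g0\<close> is recovered by
    subtracting such a difference from one member of the sequence.\<close>
  have "sq_int M (\<lambda>x. g N1 x - (g N1 x - g0 x))"
    by (rule sq_int_diff[OF g conjunct1[OF est[OF N1 order_refl zero_less_one]]])
  then have g0: "sq_int M g0" by simp
  have "(\<lambda>n. l2norm M (\<lambda>x. g n x - g0 x)) \<longlonglongrightarrow> 0"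
  proof (rule LIMSEQ_I)
    fix e :: real assume e: "0 < e"
    then obtain N where N: "\<forall>i\<ge>N. \<forall>j\<ge>N. l2norm M (\<lambda>x. g i x - g j x) < e/2"
      using cau[of "e/2"] by auto
    have "norm (l2norm M (\<lambda>x. g i x - g0 x) - 0) < e" if "i \<ge> N" for i
      using est[OF N that] e by simp
    then show "\<exists>no. \<forall>n\<ge>no. norm (l2norm M (\<lambda>x. g n x - g0 x) - 0) < e" by blast
  qed
  with g0 r(1) ae show ?thesis by (intro that)
qed

section \<open>Test functions\<close>

lemma C_k_imp_continuous:
  assumes "C_k k \<phi>"
  shows "continuous_on UNIV \<phi>"
proof (cases k)
  case 0
  with assms show ?thesis by simp
next
  case (Suc m)
  with assms have "\<And>x. \<phi> differentiable (at x)" by simp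
  then show ?thesis
    by (simp add: continuous_at_imp_continuous_on differentiable_imp_continuous_within)
qed

lemma C_k_Suc_imp: "C_k (Suc k) \<phi> \<Longrightarrow> C_k k \<phi>"
proof (induction k arbitrary: \<phi>)
  case 0
  show ?case using C_k_imp_continuous[OF 0] by simp
next
  case (Suc k)
  then show ?case by (metis C_k.simps(2))
qed

lemma C_k_const: "C_k k (\<lambda>x. c)"
  by (induction k arbitrary: c) auto

lemma frechet_derivative_add_real:
  fixes \<phi> \<psi> :: "'a::euclidean_space \<Rightarrow> real"
  assumes "\<phi> differentiable (at x)" "\<psi> differentiable (at x)"
  shows "frechet_derivative (\<lambda>x. \<phi> x + \<psi> x) (at x) i =
     frechet_derivative \<phi> (at x) i + frechet_derivative \<psi> (at x) i"
  using fun_cong[OF frechet_derivative_at[OF has_derivative_add[OF assms[THEN frechet_derivative_works[THEN iffD1]]]], of i]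
  by simp

lemma frechet_derivative_mult_real:
  fixes \<phi> \<psi> :: "'a::euclidean_space \<Rightarrow> real"
  assumes "\<phi> differentiable (at x)" "\<psi> differentiable (at x)"
  shows "frechet_derivative (\<lambda>x. \<phi> x * \<psi> x) (at x) i =
     \<phi> x * frechet_derivative \<psi> (at x) i + frechet_derivative \<phi> (at x) i * \<psi> x"
  using fun_cong[OF frechet_derivative_at[OF has_derivative_mult[OF assms[THEN frechet_derivative_works[THEN iffD1]]]], of i]
  by simp

lemma C_k_add: "C_k k \<phi> \<Longrightarrow> C_k k \<psi> \<Longrightarrow> C_k k (\<lambda>x. \<phi> x + \<psi> x)"
proof (induction k arbitrary: \<phi> \<psi>)
  case (Suc k)
  then show ?case by (simp add: frechet_derivative_add_real)
qed (auto intro: continuous_intros)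

lemma C_k_mult: "C_k k \<phi> \<Longrightarrow> C_k k \<psi> \<Longrightarrow> C_k k (\<lambda>x. \<phi> x * \<psi> x)"
proof (induction k arbitrary: \<phi> \<psi>)
  case (Suc k)
  have "C_k k \<phi>" "C_k k \<psi>" using Suc.prems C_k_Suc_imp by blast+
  with Suc show ?case by (simp add: frechet_derivative_mult_real C_k_add)
qed (auto intro: continuous_intros)

lemma C_k_prod: "finite I \<Longrightarrow> (\<And>i. i \<in> I \<Longrightarrow> C_k k (f i)) \<Longrightarrow> C_k k (\<lambda>x. \<Prod>i\<in>I. f i x)"
  by (induction I rule: finite_induct) (auto intro: C_k_const C_k_mult)

text \<open>The flat functions \<open>p(1/t) exp(-1/t)\<close> form a family closed under differentiation.\<close>

definition flat_fun :: "real poly \<Rightarrow> real \<Rightarrow> real" where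
  "flat_fun p t = (if t > 0 then poly p (inverse t) * exp (- inverse t) else 0)"

lemma poly_exp_tendsto_0: "((\<lambda>s. poly p s * exp (- s)) \<longlongrightarrow> (0::real)) at_top"
proof -
  have "((\<lambda>s. \<Sum>i\<le>degree p. coeff p i * (s ^ i / exp s)) \<longlongrightarrow> (\<Sum>i\<le>degree p. coeff p i * 0)) at_top"
    by (intro tendsto_intros tendsto_power_div_exp_0)
  then show ?thesis
    by (simp add: poly_altdef exp_minus sum_distrib_right divide_inverse mult.assoc)
qed

text \<open>In the variable \<open>s = 1/t\<close>, whose derivative is \<open>-s^2\<close>,
  differentiating \<open>p(s) exp(-s)\<close> gives \<open>s^2 (p(s) - p'(s)) exp(-s)\<close>; the
  polynomial \<open>[:0, 0, 1:]\<close> is \<open>s^2\<close>. At the origin the right difference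
  quotient is again flat, with \<open>s * p\<close> in place of \<open>p\<close>, and tends to 0
  because the exponential wins.\<close>

lemma flat_fun_deriv:
  "(flat_fun p has_real_derivative flat_fun ([:0, 0, 1:] * (p - pderiv p)) t) (at t)"
proof -
  consider "t > 0" | "t < 0" | "t = 0" by linarith
  then show ?thesis
  proof cases
    case 1
    have "((\<lambda>t. poly p (inverse t) * exp (- inverse t)) has_real_derivative
        flat_fun ([:0, 0, 1:] * (p - pderiv p)) t) (at t)"
      using 1 by (auto intro!: derivative_eq_intros DERIV_chain2[OF poly_DERIV] simp: flat_fun_def)
        (simp add: field_simps power2_eq_square)
    then show ?thesis
      by (rule has_field_derivative_transform_within_open[where S = "{0<..}"])
        (use 1 in \<open>auto simp: flat_fun_def\<close>)
  next
    case 2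
    have "((\<lambda>t. 0) has_real_derivative flat_fun ([:0, 0, 1:] * (p - pderiv p)) t) (at t)"
      using 2 by (auto simp: flat_fun_def)
    then show ?thesis
      by (rule has_field_derivative_transform_within_open[where S = "{..<0}"])
        (use 2 in \<open>auto simp: flat_fun_def\<close>)
  next
    case 3
    have "((\<lambda>h. flat_fun p h / h) \<longlongrightarrow> 0) (at 0)"
    proof (rule filterlim_split_at_real)
      show "((\<lambda>h. flat_fun p h / h) \<longlongrightarrow> 0) (at_left 0)"
        by (rule tendsto_eventually) (auto simp: flat_fun_def eventually_at_filter)
      have "((\<lambda>h. poly (pCons 0 p) (inverse h) * exp (- inverse h)) \<longlongrightarrow> 0) (at_right 0)"
        by (rule filterlim_compose[OF poly_exp_tendsto_0 filterlim_inverse_at_top_right])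
      then show "((\<lambda>h. flat_fun p h / h) \<longlongrightarrow> 0) (at_right 0)"
        by (rule Lim_transform_eventually)
          (auto simp: flat_fun_def eventually_at_filter field_simps)
    qed
    then show ?thesis using 3 by (simp add: DERIV_def flat_fun_def)
  qed
qed

lemma has_derivative_flat_fun_affine:
  fixes v :: "'a::euclidean_space"
  shows "((\<lambda>x. flat_fun p (x \<bullet> v + c)) has_derivative
    (\<lambda>h. flat_fun ([:0, 0, 1:] * (p - pderiv p)) (x \<bullet> v + c) * (h \<bullet> v))) (at x)"
proof -
  have "((\<lambda>x. x \<bullet> v + c) has_derivative (\<lambda>h. h \<bullet> v)) (at x)"
    by (auto intro!: derivative_eq_intros)
  from has_derivative_compose[OF this flat_fun_deriv[of p "x \<bullet> v + c", unfolded has_field_derivative_def]]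
  show ?thesis .
qed

lemma C_k_flat_fun_affine:
  fixes v :: "'a::euclidean_space"
  shows "C_k k (\<lambda>x. flat_fun p (x \<bullet> v + c))"
proof (induction k arbitrary: p)
  case 0
  have "(\<lambda>x. flat_fun p (x \<bullet> v + c)) differentiable (at x)" for x
    using has_derivative_flat_fun_affine unfolding differentiable_def by blast
  then show ?case
    by (auto intro!: differentiable_imp_continuous_on simp: differentiable_on_def)
next
  case (Suc k)
  have "frechet_derivative (\<lambda>x. flat_fun p (x \<bullet> v + c)) (at x) i =
      flat_fun ([:0, 0, 1:] * (p - pderiv p)) (x \<bullet> v + c) * (i \<bullet> v)" for x i
    using frechet_derivative_at[OF has_derivative_flat_fun_affine[of p v c x]] by metis
  moreover have "(\<lambda>x. flat_fun p (x \<bullet> v + c)) differentiable (at x)" for x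
    using has_derivative_flat_fun_affine unfolding differentiable_def by blast
  ultimately show ?case
    using Suc C_k_const by (auto intro!: C_k_mult)
qed

text \<open>One flat factor for each face of the box, evaluated at \<open>m\<close> times the signed
  distance to that face. The product is positive exactly on the open box when \<open>m > 0\<close>,
  and each factor tends to 1 there as \<open>m\<close> grows, so the bumps converge to the indicator
  of the box.\<close>

definition box_bump :: "'a::euclidean_space \<Rightarrow> 'a \<Rightarrow> real \<Rightarrow> 'a \<Rightarrow> real" where
  "box_bump a b m x = (\<Prod>i\<in>Basis. flat_fun 1 (x \<bullet> (m *\<^sub>R i) + (- m * (a \<bullet> i))) *
       flat_fun 1 (x \<bullet> (- m *\<^sub>R i) + m * (b \<bullet> i)))"

lemma flat_fun_1_bounds: "0 \<le> flat_fun 1 t" "flat_fun 1 t \<le> 1"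
  by (auto simp: flat_fun_def)

lemma box_bump_bounds: "0 \<le> box_bump a b m x" "box_bump a b m x \<le> 1"
  unfolding box_bump_def
  by (auto intro!: prod_nonneg prod_le_1 mult_le_one flat_fun_1_bounds mult_nonneg_nonneg)

lemma box_bump_eq:
  assumes "m > 0"
  shows "box_bump a b m x = (if x \<in> box a b then
    (\<Prod>i\<in>Basis. exp (- inverse (m * (x \<bullet> i - a \<bullet> i))) * exp (- inverse (m * (b \<bullet> i - x \<bullet> i)))) else 0)"
proof -
  have "flat_fun 1 (x \<bullet> (m *\<^sub>R i) + (- m * (a \<bullet> i))) = (if a \<bullet> i < x \<bullet> i then exp (- inverse (m * (x \<bullet> i - a \<bullet> i))) else 0)"
     "flat_fun 1 (x \<bullet> (- m *\<^sub>R i) + m * (b \<bullet> i)) = (if x \<bullet> i < b \<bullet> i then exp (- inverse (m * (b \<bullet> i - x \<bullet> i))) else 0)" for i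
    using assms by (auto simp: flat_fun_def algebra_simps)
  then show ?thesis
    unfolding box_bump_def by (auto simp: mem_box intro!: prod.cong)
qed

lemma box_bump_tendsto:
  "(\<lambda>n. box_bump a b (real (Suc n)) x) \<longlonglongrightarrow> indicator (box a b) x"
proof (cases "x \<in> box a b")
  case True
  have *: "(\<lambda>n. inverse (real (Suc n) * c)) \<longlonglongrightarrow> 0" for c
    using tendsto_mult_left[OF LIMSEQ_inverse_real_of_nat, of "inverse c"] by (simp add: mult.commute)
  have "(\<lambda>n. (\<Prod>i\<in>Basis. exp (- inverse (real (Suc n) * (x \<bullet> i - a \<bullet> i))) *
      exp (- inverse (real (Suc n) * (b \<bullet> i - x \<bullet> i))))) \<longlonglongrightarrow> (\<Prod>i\<in>(Basis::'a set). exp (- 0) * exp (- 0))"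
    by (intro tendsto_intros *)
  then show ?thesis using True by (subst box_bump_eq) auto
next
  case False
  then show ?thesis by (subst box_bump_eq) auto
qed

lemma box_bump_test_function:
  assumes "cbox a b \<subseteq> \<Omega>" "m > 0"
  shows "box_bump a b m \<in> test_functions \<Omega>"
proof -
  have "C_k k (box_bump a b m)" for k
    unfolding box_bump_def[abs_def] by (intro C_k_prod C_k_mult C_k_flat_fun_affine) auto
  moreover have sub: "closure {x. box_bump a b m x \<noteq> 0} \<subseteq> cbox a b"
    by (rule closure_minimal) (use assms(2) in \<open>auto simp: box_bump_eq box_subset_cbox[THEN subsetD] split: if_splits\<close>)
  moreover have "compact (closure {x. box_bump a b m x \<noteq> 0})"
    using sub compact_cbox[of a b] closed_closure by (meson bounded_subset bounded_cbox compact_eq_bounded_closed)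
  ultimately show ?thesis using assms unfolding test_functions_def by blast
qed

section \<open>Calculus of test functions\<close>

definition grad :: "('a::euclidean_space \<Rightarrow> real) \<Rightarrow> 'a \<Rightarrow> 'a" where
  "grad \<phi> x = (\<Sum>i\<in>Basis. frechet_derivative \<phi> (at x) i *\<^sub>R i)"

lemma grad_inner_Basis: "i \<in> Basis \<Longrightarrow> grad \<phi> x \<bullet> i = frechet_derivative \<phi> (at x) i"
  unfolding grad_def by simp

lemma norm_grad_sq:
  "(norm (grad \<phi> x))\<^sup>2 = (\<Sum>i\<in>Basis. frechet_derivative \<phi> (at x) i * frechet_derivative \<phi> (at x) i)"
  unfolding power2_norm_eq_inner by (subst euclidean_inner) (simp add: grad_inner_Basis)

lemma test_function_C_k: "\<phi> \<in> test_functions \<Omega> \<Longrightarrow> C_k k \<phi>"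
  by (simp add: test_functions_def)

lemma test_function_differentiable: "\<phi> \<in> test_functions \<Omega> \<Longrightarrow> \<phi> differentiable (at x)"
  using test_function_C_k[of \<phi> \<Omega> 1] by simp

lemma test_function_has_derivative:
  assumes "\<phi> \<in> test_functions \<Omega>"
  shows "(\<phi> has_derivative (\<lambda>h. grad \<phi> x \<bullet> h)) (at x)"
proof -
  have d: "(\<phi> has_derivative frechet_derivative \<phi> (at x)) (at x)"
    using test_function_differentiable[OF assms] frechet_derivative_works by blast
  have "frechet_derivative \<phi> (at x) h = grad \<phi> x \<bullet> h" for h
  proof -
    have lin: "linear (frechet_derivative \<phi> (at x))"
      using d has_derivative_linear by blast
    have "frechet_derivative \<phi> (at x) (\<Sum>i\<in>Basis. (h \<bullet> i) *\<^sub>R i) = (\<Sum>i\<in>Basis. (h \<bullet> i) * frechet_derivative \<phi> (at x) i)"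
      by (simp add: linear_sum[OF lin] linear_scale[OF lin])
    also have "\<dots> = grad \<phi> x \<bullet> h"
      by (auto simp: grad_def inner_sum_left inner_commute[of h] intro!: sum.cong)
    finally show ?thesis unfolding euclidean_representation .
  qed
  then show ?thesis using d by presburger
qed

lemma test_function_continuous: "\<phi> \<in> test_functions \<Omega> \<Longrightarrow> continuous_on UNIV \<phi>"
  using test_function_C_k C_k_imp_continuous by blast

lemma test_function_borel: "\<phi> \<in> test_functions \<Omega> \<Longrightarrow> \<phi> \<in> borel_measurable borel"
  using test_function_continuous borel_measurable_continuous_onI by blast

lemma grad_zero_off_support:
  assumes "x \<notin> closure {x. \<phi> x \<noteq> 0}"
  shows "frechet_derivative \<phi> (at x) i = 0"
proof -
  have "((\<lambda>x. 0) has_derivative (\<lambda>h. 0)) (at x)" by simp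
  then have "(\<phi> has_derivative (\<lambda>h. 0)) (at x)"
    by (rule has_derivative_transform_within_open[where s = "- closure {x. \<phi> x \<noteq> 0}"])
      (use assms closure_subset[of "{x. \<phi> x \<noteq> 0}"] in auto)
  then show ?thesis using frechet_derivative_at by metis
qed

text \<open>Serves the closure properties in which the support can only shrink: partial derivatives,
  multiples and products. Sums involve the union of two supports and are handled directly.\<close>

lemma test_function_supportI:
  assumes \<phi>: "\<phi> \<in> test_functions \<Omega>" and \<psi>: "\<And>k. C_k k \<psi>"
    and sub: "\<And>x. x \<notin> closure {x. \<phi> x \<noteq> 0} \<Longrightarrow> \<psi> x = 0"
  shows "\<psi> \<in> test_functions \<Omega>"
proof -
  have sub': "closure {x. \<psi> x \<noteq> 0} \<subseteq> closure {x. \<phi> x \<noteq> 0}"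
    by (rule closure_minimal) (use sub in auto)
  have c: "compact (closure {x. \<phi> x \<noteq> 0})" and s: "closure {x. \<phi> x \<noteq> 0} \<subseteq> \<Omega>"
    using \<phi> by (auto simp: test_functions_def)
  have "bounded (closure {x. \<psi> x \<noteq> 0})"
    by (rule bounded_subset[OF compact_imp_bounded[OF c] sub'])
  then have "compact (closure {x. \<psi> x \<noteq> 0})" by (simp only: compact_eq_bounded_closed closed_closure simp_thms)
  with \<psi> subset_trans[OF sub' s] show ?thesis unfolding test_functions_def by blast
qed

lemma not_in_closure_support: "x \<notin> closure {x. \<phi> x \<noteq> 0} \<Longrightarrow> \<phi> x = 0"
  using closure_subset[of "{x. \<phi> x \<noteq> 0}"] by auto

lemma test_function_partial:
  assumes "\<phi> \<in> test_functions \<Omega>" "i \<in> Basis"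
  shows "(\<lambda>x. frechet_derivative \<phi> (at x) i) \<in> test_functions \<Omega>"
proof (rule test_function_supportI[OF assms(1)])
  show "C_k k (\<lambda>x. frechet_derivative \<phi> (at x) i)" for k
    using test_function_C_k[OF assms(1), of "Suc k"] assms(2) by simp
qed (rule grad_zero_off_support)

lemma grad_continuous:
  assumes "\<phi> \<in> test_functions \<Omega>"
  shows "continuous_on UNIV (grad \<phi>)"
  unfolding grad_def[abs_def]
  by (intro continuous_intros test_function_continuous[OF test_function_partial[OF assms]])

lemma grad_borel: "\<phi> \<in> test_functions \<Omega> \<Longrightarrow> grad \<phi> \<in> borel_measurable borel"
  using grad_continuous borel_measurable_continuous_onI by blast

lemma test_function_add:
  assumes "\<phi> \<in> test_functions \<Omega>" "\<psi> \<in> test_functions \<Omega>"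
  shows "(\<lambda>x. \<phi> x + \<psi> x) \<in> test_functions \<Omega>"
proof -
  have "closure {x. \<phi> x + \<psi> x \<noteq> 0} \<subseteq> closure ({x. \<phi> x \<noteq> 0} \<union> {x. \<psi> x \<noteq> 0})"
    by (rule closure_mono) auto
  then have sub: "closure {x. \<phi> x + \<psi> x \<noteq> 0} \<subseteq> closure {x. \<phi> x \<noteq> 0} \<union> closure {x. \<psi> x \<noteq> 0}"
    by simp
  moreover have "compact (closure {x. \<phi> x + \<psi> x \<noteq> 0})"
    using sub assms unfolding test_functions_def
    by (metis (no_types, lifting) bounded_subset closed_closure compact_eq_bounded_closed mem_Collect_eq bounded_Un)
  ultimately show ?thesis using assms C_k_add unfolding test_functions_def by blast
qed

lemma test_function_scale:
  assumes "\<phi> \<in> test_functions \<Omega>"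
  shows "(\<lambda>x. c * \<phi> x) \<in> test_functions \<Omega>"
  by (rule test_function_supportI[OF assms])
    (auto intro: C_k_mult C_k_const test_function_C_k[OF assms] not_in_closure_support)

lemma test_function_lincomb:
  "\<phi> \<in> test_functions \<Omega> \<Longrightarrow> \<psi> \<in> test_functions \<Omega> \<Longrightarrow> (\<lambda>x. a * \<phi> x + b * \<psi> x) \<in> test_functions \<Omega>"
  by (intro test_function_add test_function_scale)

lemma grad_unique:
  assumes "(\<phi> has_derivative (\<lambda>h. v \<bullet> h)) (at x)"
  shows "grad \<phi> x = v"
proof (rule euclidean_eqI)
  fix i :: 'a assume "i \<in> Basis"
  then show "grad \<phi> x \<bullet> i = v \<bullet> i"
    using frechet_derivative_at[OF assms] by (metis grad_inner_Basis)
qed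

lemma grad_lincomb:
  assumes "\<phi> \<in> test_functions \<Omega>" "\<psi> \<in> test_functions \<Omega>"
  shows "grad (\<lambda>x. a * \<phi> x + b * \<psi> x) x = a *\<^sub>R grad \<phi> x + b *\<^sub>R grad \<psi> x"
  by (rule grad_unique)
    (auto intro!: derivative_eq_intros test_function_has_derivative assms simp: inner_simps)

lemma test_function_bounded:
  assumes "\<phi> \<in> test_functions \<Omega>"
  obtains B R where "\<And>x. \<bar>\<phi> x\<bar> \<le> B" "B \<ge> 0" "R > 0" "\<And>x. norm x > R \<Longrightarrow> \<phi> x = 0"
proof -
  let ?S = "closure {x. \<phi> x \<noteq> 0}"
  have c: "compact ?S" using assms by (auto simp: test_functions_def)
  from compact_imp_bounded[OF c] obtain R where R: "R > 0" "\<And>x. x \<in> ?S \<Longrightarrow> norm x \<le> R"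
    unfolding bounded_pos by auto
  have "bounded (\<phi> ` ?S)"
    by (rule compact_imp_bounded[OF compact_continuous_image[OF _ c]])
      (use test_function_continuous[OF assms] continuous_on_subset in blast)
  then obtain B where B: "\<And>x. x \<in> ?S \<Longrightarrow> \<bar>\<phi> x\<bar> \<le> B" "B > 0" unfolding bounded_pos by auto
  have z: "\<phi> x = 0" if "x \<notin> ?S" for x
    using that closure_subset[of "{x. \<phi> x \<noteq> 0}"] by auto
  show thesis
  proof (rule that[of B R])
    show "\<bar>\<phi> x\<bar> \<le> B" for x using B(1)[of x] B(2) z[of x] by fastforce
    show "\<phi> x = 0" if "norm x > R" for x using R(2)[of x] z[of x] that by force
  qed (use B R in auto)
qed

lemma integrable_bounded_support:
  fixes f :: "'a::euclidean_space \<Rightarrow> 'b::{banach, second_countable_topology}"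
  assumes "f \<in> borel_measurable borel" "\<And>x. norm (f x) \<le> B" "\<And>x. norm x > R \<Longrightarrow> f x = 0"
  shows "integrable lborel f"
proof (rule Bochner_Integration.integrable_bound[where f = "\<lambda>x. indicator (cball (0::'a) R) x *\<^sub>R B"])
  show "integrable lborel (\<lambda>x. indicator (cball (0::'a) R) x *\<^sub>R B)"
    using emeasure_bounded_finite[OF bounded_cball[of "0::'a" R]]
    by (intro integrable_scaleR_left integrable_real_indicator) auto
  show "AE x in lborel. norm (f x) \<le> norm (indicator (cball (0::'a) R) x *\<^sub>R B)"
  proof (intro AE_I2)
    fix x :: 'a
    show "norm (f x) \<le> norm (indicator (cball (0::'a) R) x *\<^sub>R B)"
      using assms(2)[of x] assms(3)[of x] by (cases "norm x > R") (auto simp: indicator_def)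
  qed
qed (use assms in auto)

lemma test_function_integrable: "\<phi> \<in> test_functions \<Omega> \<Longrightarrow> integrable lborel \<phi>"
  by (rule test_function_bounded[of \<phi> \<Omega>], assumption, rule integrable_bounded_support)
    (auto intro: test_function_borel)

lemma test_function_mult:
  assumes "\<phi> \<in> test_functions \<Omega>" "\<psi> \<in> test_functions \<Omega>"
  shows "(\<lambda>x. \<phi> x * \<psi> x) \<in> test_functions \<Omega>"
  by (rule test_function_supportI[OF assms(1)])
    (auto intro: C_k_mult test_function_C_k[OF assms(1)] test_function_C_k[OF assms(2)] not_in_closure_support)

lemma lborel_integral_translate:
  fixes f :: "'a::euclidean_space \<Rightarrow> 'b::{banach, second_countable_topology}"
  assumes "f \<in> borel_measurable borel"
  shows "(LINT x|lborel. f (x + v)) = (LINT x|lborel. f x)"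
    and "integrable lborel (\<lambda>x. f (x + v)) \<longleftrightarrow> integrable lborel f"
proof -
  have e: "lborel = distr lborel borel (\<lambda>x. v + x)" by (rule lborel_distr_plus[symmetric])
  show "(LINT x|lborel. f (x + v)) = (LINT x|lborel. f x)"
    using assms by (subst (2) e) (simp add: integral_distr add.commute)
  show "integrable lborel (\<lambda>x. f (x + v)) \<longleftrightarrow> integrable lborel f"
    using assms by (subst (2) e) (simp add: integrable_distr_eq add.commute)
qed

lemma nn_integral_lborel_translate:
  fixes f :: "'a::euclidean_space \<Rightarrow> ennreal"
  assumes "f \<in> borel_measurable borel"
  shows "(\<integral>\<^sup>+x. f (x + v) \<partial>lborel) = (\<integral>\<^sup>+x. f x \<partial>lborel)"
proof -
  have e: "lborel = distr lborel borel (\<lambda>x. v + x)" by (rule lborel_distr_plus[symmetric])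
  show ?thesis
    using assms by (subst (2) e) (simp add: nn_integral_distr add.commute)
qed

text \<open>Difference quotients have integral zero by translation invariance. The mean value
  theorem bounds them by the supremum of the partial derivative, and steps of length at most 1 keep
  their supports in the ball of radius \<open>R + 1\<close>, so dominated convergence passes to the
  derivative.\<close>

lemma integral_partial_test_function:
  assumes \<phi>: "\<phi> \<in> test_functions \<Omega>" and i: "i \<in> Basis"
  shows "(LINT x|lborel. frechet_derivative \<phi> (at x) i) = 0"
proof -
  let ?D = "\<lambda>x. frechet_derivative \<phi> (at x) i"
  obtain B R where B: "\<And>x. \<bar>?D x\<bar> \<le> B" "B \<ge> 0" using test_function_bounded[OF test_function_partial[OF \<phi> i]] by metis
  obtain B' R where R: "R > 0" "\<And>x. norm x > R \<Longrightarrow> \<phi> x = 0" using test_function_bounded[OF \<phi>] by metis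
  define t where "t n = inverse (real (Suc n))" for n
  have t: "t n > 0" "t n \<le> 1" for n by (auto simp: t_def field_simps)
  define q where "q n x = (\<phi> (x + t n *\<^sub>R i) - \<phi> x) / t n" for n x
  have dt: "((\<lambda>s. \<phi> (x + s *\<^sub>R i)) has_real_derivative ?D (x + s *\<^sub>R i)) (at s)" for x s
  proof -
    have "((\<lambda>s. x + s *\<^sub>R i) has_derivative (\<lambda>h. h *\<^sub>R i)) (at s)"
      by (auto intro!: derivative_eq_intros)
    from has_derivative_compose[OF this test_function_has_derivative[OF \<phi>, of "x + s *\<^sub>R i"]]
    show ?thesis by (simp add: has_field_derivative_def grad_inner_Basis i mult_commute_abs)
  qed
  have qb: "\<bar>q n x\<bar> \<le> B" for n x
  proof -
    obtain z where "0 < z" "z < t n" "\<phi> (x + t n *\<^sub>R i) - \<phi> (x + 0 *\<^sub>R i) = (t n - 0) * ?D (x + z *\<^sub>R i)"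
      using MVT2[of 0 "t n" "\<lambda>s. \<phi> (x + s *\<^sub>R i)" "\<lambda>s. ?D (x + s *\<^sub>R i)"] t[of n] dt by blast
    then have "q n x = ?D (x + z *\<^sub>R i)" using t[of n] by (simp add: q_def)
    then show ?thesis using B by simp
  qed
  have int: "integrable lborel (\<lambda>x. \<phi> (x + v))" for v
    using lborel_integral_translate(2) test_function_borel[OF \<phi>] test_function_integrable[OF \<phi>] by blast
  have q0: "(LINT x|lborel. q n x) = 0" for n
    unfolding q_def using int[of "t n *\<^sub>R i"] test_function_integrable[OF \<phi>]
      lborel_integral_translate(1)[OF test_function_borel[OF \<phi>], of "t n *\<^sub>R i"]
    by simp
  have "(\<lambda>n. LINT x|lborel. q n x) \<longlonglongrightarrow> (LINT x|lborel. ?D x)"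
  proof (rule integral_dominated_convergence[where w = "\<lambda>x. indicator (cball 0 (R + 1)) x *\<^sub>R B"])
    show "?D \<in> borel_measurable lborel"
      using test_function_borel[OF test_function_partial[OF \<phi> i]] by simp
    show "q n \<in> borel_measurable lborel" for n
      using test_function_borel[OF \<phi>] unfolding q_def[abs_def] by measurable
    show "integrable lborel (\<lambda>x. indicator (cball (0::'a) (R + 1)) x *\<^sub>R B)"
      using emeasure_bounded_finite[OF bounded_cball[of "0::'a" "R + 1"]]
      by (intro integrable_scaleR_left integrable_real_indicator) auto
    show "AE x in lborel. (\<lambda>n. q n x) \<longlonglongrightarrow> ?D x"
    proof (intro AE_I2)
      fix x
      have "((\<lambda>h. (\<phi> (x + h *\<^sub>R i) - \<phi> x) / h) \<longlongrightarrow> ?D x) (at 0)"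
        using dt[of x 0] by (simp add: DERIV_def)
      moreover have "filterlim t (at 0) sequentially"
        unfolding filterlim_at t_def
        using LIMSEQ_inverse_real_of_nat by (auto intro!: always_eventually)
      ultimately show "(\<lambda>n. q n x) \<longlonglongrightarrow> ?D x"
        unfolding q_def by (rule filterlim_compose)
    qed
    show "AE x in lborel. norm (q n x) \<le> indicator (cball 0 (R + 1)) x *\<^sub>R B" for n
    proof (intro AE_I2)
      fix x
      show "norm (q n x) \<le> indicator (cball 0 (R + 1)) x *\<^sub>R B"
      proof (cases "norm x \<le> R + 1")
        case True then show ?thesis using qb by simp
      next
        case False
        have "norm x \<le> norm (x + t n *\<^sub>R i) + norm (t n *\<^sub>R i)"
          by (metis add_diff_cancel norm_triangle_ineq4)
        also have "norm (t n *\<^sub>R i) \<le> 1" using t[of n] i by simp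
        finally have "norm (x + t n *\<^sub>R i) > R" using False by linarith
        then have "q n x = 0" using R(2) False by (simp add: q_def)
        then show ?thesis using False by simp
      qed
    qed
  qed
  then have "(\<lambda>n::nat. 0) \<longlonglongrightarrow> (LINT x|lborel. ?D x)" by (simp only: q0)
  from LIMSEQ_unique[OF this tendsto_const] show ?thesis .
qed

lemma integration_by_parts:
  assumes "\<phi> \<in> test_functions \<Omega>" "\<psi> \<in> test_functions \<Omega>" "i \<in> Basis"
  shows "(LINT x|lborel. \<phi> x * frechet_derivative \<psi> (at x) i) = - (LINT x|lborel. frechet_derivative \<phi> (at x) i * \<psi> x)"
proof -
  have "(LINT x|lborel. \<phi> x * frechet_derivative \<psi> (at x) i + frechet_derivative \<phi> (at x) i * \<psi> x) = 0"
    using integral_partial_test_function[OF test_function_mult[OF assms(1,2)] assms(3)]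
    by (simp add: frechet_derivative_mult_real test_function_differentiable[OF assms(1)] test_function_differentiable[OF assms(2)])
  moreover have "integrable lborel (\<lambda>x. \<phi> x * frechet_derivative \<psi> (at x) i)"
    "integrable lborel (\<lambda>x. frechet_derivative \<phi> (at x) i * \<psi> x)"
    using assms by (auto intro!: test_function_integrable test_function_mult test_function_partial)
  ultimately show ?thesis by simp
qed

section \<open>Weak gradients\<close>

locale bounded_open_set =
  fixes \<Omega> :: "'a::euclidean_space set"
  assumes open_\<Omega>: "open \<Omega>" and bounded_\<Omega>: "bounded \<Omega>"
begin

abbreviation "M \<equiv> lebesgue_on \<Omega>"
abbreviation "wg \<equiv> weak_gradient \<Omega>"

lemma \<Omega>_lebesgue [simp]: "\<Omega> \<in> sets lebesgue" "\<Omega> \<inter> space lebesgue \<in> sets lebesgue"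
  using open_\<Omega> by (auto intro: borel_open)

lemma \<Omega>_borel [measurable]: "\<Omega> \<in> sets borel"
  using open_\<Omega> by simp

lemma finite_measure_M: "finite_measure M"
  by (rule finite_measure_lebesgue_on)
    (use bounded_\<Omega> open_\<Omega> in \<open>simp add: bounded_set_imp_lmeasurable\<close>)

sublocale finite_measure M
  by (rule finite_measure_M)

lemma borel_imp_M:
  assumes "f \<in> borel_measurable borel"
  shows "f \<in> borel_measurable M"
  using assms by (intro measurable_restrict_space1 measurable_completion) simp

text \<open>Weak derivatives live on the complete measure \<open>M\<close>, while translations and
  coordinatewise integration use \<open>lborel\<close>; this is the passage between the two.\<close>

lemma M_integral_eq:
  fixes f :: "'a \<Rightarrow> 'b::{banach, second_countable_topology}"
  assumes "f \<in> borel_measurable borel" "\<And>x. x \<notin> \<Omega> \<Longrightarrow> f x = 0"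
  shows "(LINT x|M. f x) = (LINT x|lborel. f x)" "integrable M f \<longleftrightarrow> integrable lborel f"
proof -
  have e: "(\<lambda>x. indicator \<Omega> x *\<^sub>R f x) = f"
    using assms(2) by (auto simp: indicator_def fun_eq_iff)
  show "(LINT x|M. f x) = (LINT x|lborel. f x)"
    using assms(1) by (simp add: integral_restrict_space e integral_completion)
  show "integrable M f \<longleftrightarrow> integrable lborel f"
    using assms(1) by (simp add: integrable_restrict_space e integrable_completion)
qed

lemma test_function_zero_outside:
  assumes "\<phi> \<in> test_functions \<Omega>" "x \<notin> \<Omega>"
  shows "\<phi> x = 0"
  using assms closure_subset[of "{x. \<phi> x \<noteq> 0}"] unfolding test_functions_def by blast

lemma grad_zero_outside:
  assumes "\<phi> \<in> test_functions \<Omega>" "x \<notin> \<Omega>"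
  shows "grad \<phi> x = 0"
proof -
  have "x \<notin> closure {x. \<phi> x \<noteq> 0}" using assms by (auto simp: test_functions_def)
  then show ?thesis by (simp add: grad_def grad_zero_off_support)
qed

lemma test_function_M:
  assumes "\<phi> \<in> test_functions \<Omega>"
  shows "\<phi> \<in> borel_measurable M" "integrable M \<phi>"
    "(LINT x|M. \<phi> x) = (LINT x|lborel. \<phi> x)"
  using M_integral_eq[of \<phi>] test_function_borel[OF assms] test_function_integrable[OF assms]
    test_function_zero_outside[OF assms] borel_imp_M by auto

lemma sq_int_test_function:
  assumes "\<phi> \<in> test_functions \<Omega>"
  shows "sq_int M \<phi>"
  using test_function_M(1)[OF assms] test_function_M(2)[OF test_function_mult[OF assms assms]]
  by (simp add: sq_int_def power2_eq_square)

lemma sq_int_grad: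
  assumes "\<phi> \<in> test_functions \<Omega>"
  shows "sq_int M (grad \<phi>)"
proof -
  have "integrable M (\<lambda>x. \<Sum>i\<in>Basis. frechet_derivative \<phi> (at x) i * frechet_derivative \<phi> (at x) i)"
    by (intro Bochner_Integration.integrable_sum test_function_M(2) test_function_mult
        test_function_partial[OF assms])
  then show ?thesis
    using borel_imp_M[OF grad_borel[OF assms]] by (simp add: sq_int_def norm_grad_sq)
qed

lemma sq_int_partial:
  assumes "\<phi> \<in> test_functions \<Omega>" "i \<in> Basis"
  shows "sq_int M (\<lambda>x. frechet_derivative \<phi> (at x) i)"
  by (rule sq_int_test_function[OF test_function_partial[OF assms]])

lemma sq_int_component:
  assumes "sq_int M g" "i \<in> Basis"
  shows "sq_int M (\<lambda>x. g x \<bullet> i)"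
  unfolding sq_int_def
proof
  show m: "(\<lambda>x. g x \<bullet> i) \<in> borel_measurable M"
    using assms by (auto simp: sq_int_def)
  have le: "(norm (g x \<bullet> i))\<^sup>2 \<le> (norm (g x))\<^sup>2" for x
    using power_mono[OF Basis_le_norm[OF assms(2), of "g x"], of 2] by simp
  have "norm ((norm (g x \<bullet> i))\<^sup>2) \<le> norm ((norm (g x))\<^sup>2)" for x
    using le[of x] by (simp only: real_norm_def abs_power2)
  then show "integrable M (\<lambda>x. (norm (g x \<bullet> i))\<^sup>2)"
    by (intro Bochner_Integration.integrable_bound[OF sq_int_integrable[OF assms(1)]] AE_I2)
      (use m in simp_all)
qed

text \<open>Testing with bumps that fill up a box shows that \<open>g\<close> has integral zero over
  every box whose closure lies in \<open>\<Omega>\<close>. Lebesgue differentiation along shrinking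
  cubes then gives \<open>g = 0\<close> almost everywhere.\<close>

lemma fundamental_lemma:
  assumes g: "integrable M g"
    and zero: "\<And>\<phi>. \<phi> \<in> test_functions \<Omega> \<Longrightarrow> (LINT x|M. g x * \<phi> x) = (0::real)"
  shows "AE x in M. g x = 0"
proof -
  define G where "G x = indicator \<Omega> x *\<^sub>R g x" for x
  have G: "integrable lebesgue G"
    using g unfolding G_def by (simp add: integrable_restrict_space)
  have Gon: "G integrable_on S" if "S \<in> sets lebesgue" for S
  proof -
    have "set_integrable lebesgue S G"
      unfolding set_integrable_def using integrable_mult_indicator[OF that G] .
    then show ?thesis by (rule set_lebesgue_integral_eq_integral(1))
  qed
  have box0: "integral (cbox a b) G = 0" if sub: "cbox a b \<subseteq> \<Omega>" for a b
  proof -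
    have "(\<lambda>n. LINT x|M. g x * box_bump a b (real (Suc n)) x) \<longlonglongrightarrow> (LINT x|M. g x * indicator (box a b) x)"
    proof (rule integral_dominated_convergence[where w = "\<lambda>x. \<bar>g x\<bar>"])
      have gm: "g \<in> borel_measurable M" using g by auto
      show "(\<lambda>x. g x * indicator (box a b) x) \<in> borel_measurable M"
        by (intro borel_measurable_times gm borel_imp_M) auto
      show "(\<lambda>x. g x * box_bump a b (real (Suc n)) x) \<in> borel_measurable M" for n
        by (intro borel_measurable_times gm test_function_M(1) box_bump_test_function sub) auto
      show "AE x in M. (\<lambda>n. g x * box_bump a b (real (Suc n)) x) \<longlonglongrightarrow> g x * indicator (box a b) x"
        by (intro AE_I2 tendsto_intros box_bump_tendsto)
      show "AE x in M. norm (g x * box_bump a b (real (Suc n)) x) \<le> \<bar>g x\<bar>" for n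
        using box_bump_bounds[of a b "real (Suc n)"]
        by (intro AE_I2) (auto simp: abs_mult intro!: mult_left_le)
    qed (use g in auto)
    moreover have "(LINT x|M. g x * box_bump a b (real (Suc n)) x) = 0" for n
      by (intro zero box_bump_test_function sub) auto
    ultimately have "(\<lambda>n::nat. 0) \<longlonglongrightarrow> (LINT x|M. g x * indicator (box a b) x)" by simp
    from LIMSEQ_unique[OF this tendsto_const]
    have "(LINT x|M. g x * indicator (box a b) x) = 0" .
    then have "(LINT x|lebesgue. indicator \<Omega> x *\<^sub>R (g x * indicator (box a b) x)) = 0"
      by (simp add: integral_restrict_space)
    also have "(\<lambda>x. indicator \<Omega> x *\<^sub>R (g x * indicator (box a b) x)) = (\<lambda>x. indicator (box a b) x *\<^sub>R G x)"
      by (auto simp: G_def)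
    finally have "set_lebesgue_integral lebesgue (box a b) G = 0"
      by (simp add: set_lebesgue_integral_def)
    moreover have "set_integrable lebesgue (box a b) G"
      unfolding set_integrable_def by (rule integrable_mult_indicator[OF _ G]) auto
    ultimately have "integral (box a b) G = 0"
      using set_lebesgue_integral_eq_integral(2) by metis
    then show ?thesis by (simp add: integral_open_interval)
  qed
  \<comment> \<open>Lebesgue differentiation for the extension of \<open>g\<close> by zero, along
    cubes having \<open>x\<close> as their lower corner.\<close>
  obtain N where N: "negligible N"
    "\<And>x e. \<lbrakk>x \<notin> N; 0 < e\<rbrakk> \<Longrightarrow> \<exists>d>0. \<forall>h. 0 < h \<and> h < d \<longrightarrow>
         norm (integral (cbox x (x + h *\<^sub>R One)) G /\<^sub>R h ^ DIM('a) - G x) < e"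
    using integrable_ccontinuous_explicit[of G] Gon by (metis lborelD sets_completionI_sets sets_lborel lmeasurable_cbox fmeasurableD)
  have G0: "G x = 0" if x: "x \<in> \<Omega>" "x \<notin> N" for x
  proof (rule ccontr)
    assume "G x \<noteq> 0"
    then obtain d where d: "d > 0" "\<forall>h. 0 < h \<and> h < d \<longrightarrow>
         norm (integral (cbox x (x + h *\<^sub>R One)) G /\<^sub>R h ^ DIM('a) - G x) < norm (G x)"
      using N(2)[OF x(2), of "norm (G x)"] by auto
    obtain r where r: "r > 0" "ball x r \<subseteq> \<Omega>" using open_\<Omega> x(1) open_contains_ball by blast
    \<comment> \<open>Points of the cube differ from its corner by at most
      \<open>DIM('a) * h\<close> in the \<open>l1\<close> norm, so the second bound keeps the cube
      inside the ball of radius \<open>r\<close>.\<close>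
    define h where "h = min (d / 2) (r / (2 * DIM('a)))"
    have h: "0 < h" "h < d" "h \<le> r / (2 * DIM('a))" using d r by (auto simp: h_def)
    have "cbox x (x + h *\<^sub>R One) \<subseteq> ball x r"
    proof
      fix y assume y: "y \<in> cbox x (x + h *\<^sub>R One)"
      have "norm (y - x) \<le> (\<Sum>i\<in>Basis. \<bar>(y - x) \<bullet> i\<bar>)" by (rule norm_le_l1)
      also have "\<dots> \<le> (\<Sum>i\<in>(Basis::'a set). h)"
        by (rule sum_mono) (use y in \<open>auto simp: mem_box inner_simps abs_le_iff\<close>)
      also have "\<dots> < r" using h r by (simp add: field_simps)
      finally show "y \<in> ball x r" by (simp add: dist_norm norm_minus_commute)
    qed
    then have "integral (cbox x (x + h *\<^sub>R One)) G = 0" using box0 r by blast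
    then show False using d(2) h by auto
  qed
  have "AE x in lebesgue. x \<notin> N"
    using N(1) by (simp add: negligible_iff_null_sets AE_not_in)
  then have "AE x in lebesgue. x \<in> \<Omega> \<longrightarrow> g x = 0"
  proof eventually_elim
    case (elim x)
    then show ?case using G0[of x] by (auto simp: G_def)
  qed
  then show ?thesis by (simp add: AE_restrict_space_iff)
qed

lemma H1_sq_int: "u \<in> H1 \<Omega> \<Longrightarrow> sq_int M u"
  by (auto simp: H1_def L2_iff)

lemma H1_weak_gradient:
  assumes "u \<in> H1 \<Omega>"
  shows "sq_int M (wg u)" "is_weak_gradient \<Omega> u (wg u)"
proof -
  have "\<exists>g. g \<in> L2 \<Omega> \<and> is_weak_gradient \<Omega> u g" using assms by (auto simp: H1_def)
  from someI_ex[OF this] show "sq_int M (wg u)" "is_weak_gradient \<Omega> u (wg u)"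
    unfolding weak_gradient_def[symmetric] by (auto simp: L2_iff)
qed

lemma weak_gradientD:
  assumes "is_weak_gradient \<Omega> u g" "\<phi> \<in> test_functions \<Omega>" "i \<in> Basis"
  shows "(LINT x|M. u x * frechet_derivative \<phi> (at x) i) = - (LINT x|M. (g x \<bullet> i) * \<phi> x)"
  using assms by (auto simp: is_weak_gradient_def)

text \<open>The fundamental lemma is applied to each component of the difference. It makes the
  choice hidden in \<open>wg\<close> harmless, at the price that identities for \<open>wg\<close>
  hold only almost everywhere.\<close>

lemma weak_gradient_unique:
  assumes g: "sq_int M g" "is_weak_gradient \<Omega> u g" and g': "sq_int M g'" "is_weak_gradient \<Omega> u g'"
  shows "AE x in M. g x = g' x"
proof -
  have "AE x in M. g x \<bullet> i - g' x \<bullet> i = 0" if i: "i \<in> Basis" for i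
  proof (rule fundamental_lemma)
    show "integrable M (\<lambda>x. g x \<bullet> i - g' x \<bullet> i)"
      by (intro sq_int_imp_integrable sq_int_diff sq_int_component g g' i)
    fix \<phi> assume \<phi>: "\<phi> \<in> test_functions \<Omega>"
    have "(LINT x|M. (g x \<bullet> i) * \<phi> x) = (LINT x|M. (g' x \<bullet> i) * \<phi> x)"
      using weak_gradientD[OF g(2) \<phi> i] weak_gradientD[OF g'(2) \<phi> i] by simp
    moreover have "integrable M (\<lambda>x. (g x \<bullet> i) * \<phi> x)" "integrable M (\<lambda>x. (g' x \<bullet> i) * \<phi> x)"
      using integrable_inner_sq_int[OF sq_int_component[OF g(1) i] sq_int_test_function[OF \<phi>]]
        integrable_inner_sq_int[OF sq_int_component[OF g'(1) i] sq_int_test_function[OF \<phi>]] by simp_all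
    ultimately show "(LINT x|M. (g x \<bullet> i - g' x \<bullet> i) * \<phi> x) = 0"
      by (simp add: left_diff_distrib)
  qed
  then have "AE x in M. \<forall>i\<in>Basis. g x \<bullet> i - g' x \<bullet> i = 0"
    by (intro AE_finite_allI) auto
  then show ?thesis
    by eventually_elim (auto intro: euclidean_eqI)
qed

lemma sq_int_cong_AE_integral:
  assumes "AE x in M. g x = g' x" "sq_int M g" "sq_int M g'"
  shows "(LINT x|M. (norm (g x))\<^sup>2) = (LINT x|M. (norm (g' x))\<^sup>2)"
  by (rule integral_cong_AE) (use assms in \<open>auto simp: sq_int_def elim!: eventually_mono\<close>)

lemma l2norm_cong_AE:
  assumes "AE x in M. g x = g' x" "sq_int M g" "sq_int M g'"
  shows "l2norm M g = l2norm M g'"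
  unfolding l2norm_def using sq_int_cong_AE_integral[OF assms] by simp

lemma H1_I:
  assumes "sq_int M u" "sq_int M g" "is_weak_gradient \<Omega> u g"
  shows "u \<in> H1 \<Omega>" "AE x in M. wg u x = g x"
proof -
  show u: "u \<in> H1 \<Omega>" using assms by (auto simp: H1_def L2_iff)
  show "AE x in M. wg u x = g x"
    by (rule weak_gradient_unique[OF H1_weak_gradient[OF u] assms(2,3)])
qed

lemma H1_lincomb:
  assumes u: "u \<in> H1 \<Omega>" and v: "v \<in> H1 \<Omega>"
  shows "(\<lambda>x. a * u x + b * v x) \<in> H1 \<Omega>"
    and "AE x in M. wg (\<lambda>x. a * u x + b * v x) x = a *\<^sub>R wg u x + b *\<^sub>R wg v x"
proof -
  have s: "sq_int M (\<lambda>x. a * u x + b * v x)"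
    using sq_int_lincomb[OF H1_sq_int[OF u] H1_sq_int[OF v], of a b] by simp
  have s': "sq_int M (\<lambda>x. a *\<^sub>R wg u x + b *\<^sub>R wg v x)"
    by (intro sq_int_lincomb H1_weak_gradient u v)
  have w: "is_weak_gradient \<Omega> (\<lambda>x. a * u x + b * v x) (\<lambda>x. a *\<^sub>R wg u x + b *\<^sub>R wg v x)"
    unfolding is_weak_gradient_def
  proof (intro ballI)
    fix \<phi> and i :: 'a assume \<phi>: "\<phi> \<in> test_functions \<Omega>" and i: "i \<in> Basis"
    have I: "integrable M (\<lambda>x. w x * frechet_derivative \<phi> (at x) i)" if "w \<in> H1 \<Omega>" for w
      using integrable_inner_sq_int[OF H1_sq_int[OF that] sq_int_partial[OF \<phi> i]] by simp
    have J: "integrable M (\<lambda>x. (wg w x \<bullet> i) * \<phi> x)" if "w \<in> H1 \<Omega>" for w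
      using integrable_inner_sq_int[OF sq_int_component[OF H1_weak_gradient(1)[OF that] i] sq_int_test_function[OF \<phi>]] by simp
    have "(LINT x|M. (a * u x + b * v x) * frechet_derivative \<phi> (at x) i) =
        (LINT x|M. a * (u x * frechet_derivative \<phi> (at x) i) + b * (v x * frechet_derivative \<phi> (at x) i))"
      by (simp add: algebra_simps)
    also have "\<dots> = a * (LINT x|M. u x * frechet_derivative \<phi> (at x) i) + b * (LINT x|M. v x * frechet_derivative \<phi> (at x) i)"
      using I[OF u] I[OF v] by simp
    also have "\<dots> = - (a * (LINT x|M. (wg u x \<bullet> i) * \<phi> x) + b * (LINT x|M. (wg v x \<bullet> i) * \<phi> x))"
      using weak_gradientD[OF H1_weak_gradient(2)[OF u] \<phi> i] weak_gradientD[OF H1_weak_gradient(2)[OF v] \<phi> i]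
      by simp
    also have "\<dots> = - (LINT x|M. a * ((wg u x \<bullet> i) * \<phi> x) + b * ((wg v x \<bullet> i) * \<phi> x))"
      using J[OF u] J[OF v] by simp
    also have "\<dots> = - (LINT x|M. ((a *\<^sub>R wg u x + b *\<^sub>R wg v x) \<bullet> i) * \<phi> x)"
      by (simp add: algebra_simps inner_simps)
    finally show "(LINT x|M. (a * u x + b * v x) * frechet_derivative \<phi> (at x) i) =
      - (LINT x|M. ((a *\<^sub>R wg u x + b *\<^sub>R wg v x) \<bullet> i) * \<phi> x)" .
  qed
  show "(\<lambda>x. a * u x + b * v x) \<in> H1 \<Omega>"
    "AE x in M. wg (\<lambda>x. a * u x + b * v x) x = a *\<^sub>R wg u x + b *\<^sub>R wg v x"
    using H1_I[OF s s' w] by auto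
qed

lemma test_function_H1:
  assumes \<phi>: "\<phi> \<in> test_functions \<Omega>"
  shows "\<phi> \<in> H1 \<Omega>" "AE x in M. wg \<phi> x = grad \<phi> x"
proof -
  have "is_weak_gradient \<Omega> \<phi> (grad \<phi>)"
    unfolding is_weak_gradient_def
  proof (intro ballI)
    fix \<psi> and i :: 'a assume \<psi>: "\<psi> \<in> test_functions \<Omega>" and i: "i \<in> Basis"
    show "(LINT x|M. \<phi> x * frechet_derivative \<psi> (at x) i) = - (LINT x|M. (grad \<phi> x \<bullet> i) * \<psi> x)"
      using integration_by_parts[OF \<phi> \<psi> i]
        test_function_M(3)[OF test_function_mult[OF \<phi> test_function_partial[OF \<psi> i]]]
        test_function_M(3)[OF test_function_mult[OF test_function_partial[OF \<phi> i] \<psi>]]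
      by (simp add: grad_inner_Basis i)
  qed
  then show "\<phi> \<in> H1 \<Omega>" "AE x in M. wg \<phi> x = grad \<phi> x"
    using H1_I[OF sq_int_test_function[OF \<phi>] sq_int_grad[OF \<phi>]] by auto
qed

lemma dirichlet_eq: "dirichlet \<Omega> u = (l2norm M (wg u))\<^sup>2"
  by (simp add: dirichlet_def l2norm_sq)

lemma dirichlet_nonneg [simp]: "dirichlet \<Omega> u \<ge> 0"
  by (simp add: dirichlet_eq)

lemma H10_norm_eq: "H10_norm \<Omega> u = l2norm M (wg u)"
  by (simp add: H10_norm_def dirichlet_eq)

lemma H10_norm_sq: "(H10_norm \<Omega> u)\<^sup>2 = dirichlet \<Omega> u"
  by (simp add: H10_norm_def)

lemma H10_norm_nonneg [simp]: "H10_norm \<Omega> u \<ge> 0"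
  by (simp add: H10_norm_eq)

lemma H1_norm_eq: "H1_norm \<Omega> u = sqrt ((l2norm M u)\<^sup>2 + (l2norm M (wg u))\<^sup>2)"
  by (simp add: H1_norm_def dirichlet_eq l2norm_sq)

lemma l2norm_wg_test:
  assumes u: "u \<in> H1 \<Omega>" and \<phi>: "\<phi> \<in> test_functions \<Omega>"
  shows "l2norm M (wg (\<lambda>x. \<phi> x - u x)) = l2norm M (\<lambda>x. grad \<phi> x - wg u x)"
proof -
  have "AE x in M. wg (\<lambda>x. 1 * \<phi> x + (-1) * u x) x = grad \<phi> x - wg u x"
    using H1_lincomb(2)[OF test_function_H1(1)[OF \<phi>] u, of 1 "-1"] test_function_H1(2)[OF \<phi>]
    by eventually_elim simp
  then have "l2norm M (wg (\<lambda>x. 1 * \<phi> x + (-1) * u x)) = l2norm M (\<lambda>x. grad \<phi> x - wg u x)"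
    by (intro l2norm_cong_AE H1_weak_gradient sq_int_diff sq_int_grad \<phi> u H1_lincomb test_function_H1)
  then show ?thesis by simp
qed

lemma sqrt_sum_squares_tendsto_iff:
  fixes a b :: "nat \<Rightarrow> real"
  assumes "\<And>n. a n \<ge> 0" "\<And>n. b n \<ge> 0"
  shows "(\<lambda>n. sqrt ((a n)\<^sup>2 + (b n)\<^sup>2)) \<longlonglongrightarrow> 0 \<longleftrightarrow> a \<longlonglongrightarrow> 0 \<and> b \<longlonglongrightarrow> 0"
proof
  assume L: "(\<lambda>n. sqrt ((a n)\<^sup>2 + (b n)\<^sup>2)) \<longlonglongrightarrow> 0"
  show "a \<longlonglongrightarrow> 0 \<and> b \<longlonglongrightarrow> 0"
    by (intro conjI; rule Lim_null_comparison[OF _ L])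
      (use assms in \<open>auto intro!: always_eventually real_le_rsqrt\<close>)
next
  assume "a \<longlonglongrightarrow> 0 \<and> b \<longlonglongrightarrow> 0"
  then have "(\<lambda>n. sqrt ((a n)\<^sup>2 + (b n)\<^sup>2)) \<longlonglongrightarrow> sqrt (0\<^sup>2 + 0\<^sup>2)"
    by (intro tendsto_intros) auto
  then show "(\<lambda>n. sqrt ((a n)\<^sup>2 + (b n)\<^sup>2)) \<longlonglongrightarrow> 0" by simp
qed

section \<open>The space \<open>H10\<close> and its Dirichlet form\<close>

lemma H10_iff:
  "u \<in> H10 \<Omega> \<longleftrightarrow> u \<in> H1 \<Omega> \<and> (\<exists>\<phi>. (\<forall>n. \<phi> n \<in> test_functions \<Omega>) \<and>
     (\<lambda>n. l2norm M (\<lambda>x. \<phi> n x - u x)) \<longlonglongrightarrow> 0 \<and> (\<lambda>n. l2norm M (\<lambda>x. grad (\<phi> n) x - wg u x)) \<longlonglongrightarrow> 0)"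
proof -
  have "(\<lambda>n. H1_norm \<Omega> (\<lambda>x. \<phi> n x - u x)) \<longlonglongrightarrow> 0 \<longleftrightarrow>
      (\<lambda>n. l2norm M (\<lambda>x. \<phi> n x - u x)) \<longlonglongrightarrow> 0 \<and> (\<lambda>n. l2norm M (\<lambda>x. grad (\<phi> n) x - wg u x)) \<longlonglongrightarrow> 0"
    if "u \<in> H1 \<Omega>" "\<forall>n. \<phi> n \<in> test_functions \<Omega>" for \<phi> :: "nat \<Rightarrow> 'a \<Rightarrow> real"
    unfolding H1_norm_eq using that
    by (subst sqrt_sum_squares_tendsto_iff) (auto simp: l2norm_wg_test)
  then show ?thesis unfolding H10_def by blast
qed

lemma H10_H1: "u \<in> H10 \<Omega> \<Longrightarrow> u \<in> H1 \<Omega>"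
  by (simp add: H10_iff)

lemma H10_sq_int: "u \<in> H10 \<Omega> \<Longrightarrow> sq_int M u"
  by (simp add: H10_H1 H1_sq_int)

lemma H10_wg: "u \<in> H10 \<Omega> \<Longrightarrow> sq_int M (wg u)"
  by (simp add: H10_H1 H1_weak_gradient)

text \<open>The integration by parts formula for test functions survives the two mean-square limits,
  so the limit of the gradients is the weak gradient. Membership in \<open>H10\<close> is always
  established through this lemma.\<close>

lemma H10_I_limit:
  assumes \<phi>: "\<And>n. \<phi> n \<in> test_functions \<Omega>" and u: "sq_int M u" and g: "sq_int M g"
    and lim: "(\<lambda>n. l2norm M (\<lambda>x. \<phi> n x - u x)) \<longlonglongrightarrow> 0" "(\<lambda>n. l2norm M (\<lambda>x. grad (\<phi> n) x - g x)) \<longlonglongrightarrow> 0"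
  shows "u \<in> H10 \<Omega>" "AE x in M. wg u x = g x"
proof -
  have w: "is_weak_gradient \<Omega> u g"
    unfolding is_weak_gradient_def
  proof (intro ballI)
    fix \<psi> and i :: 'a assume \<psi>: "\<psi> \<in> test_functions \<Omega>" and i: "i \<in> Basis"
    have "(\<lambda>n. LINT x|M. \<phi> n x \<bullet> frechet_derivative \<psi> (at x) i) \<longlonglongrightarrow> (LINT x|M. u x \<bullet> frechet_derivative \<psi> (at x) i)"
      by (rule integral_inner_tendsto[OF sq_int_test_function[OF \<phi>] u lim(1) sq_int_partial[OF \<psi> i]])
    \<comment> \<open>Writing a component of the gradient as the inner product with the field
      \<open>\<psi> x *\<^sub>R i\<close> allows convergence of vector-valued functions to be used
      directly.\<close>
    moreover have s: "sq_int M (\<lambda>x. \<psi> x *\<^sub>R i)"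
      using sq_int_test_function[OF \<psi>] i unfolding sq_int_def
      by (auto intro!: borel_measurable_scaleR)
    have "(\<lambda>n. - (LINT x|M. grad (\<phi> n) x \<bullet> (\<psi> x *\<^sub>R i))) \<longlonglongrightarrow> - (LINT x|M. g x \<bullet> (\<psi> x *\<^sub>R i))"
      by (rule tendsto_minus[OF integral_inner_tendsto[OF sq_int_grad[OF \<phi>] g lim(2) s]])
    moreover have "(LINT x|M. \<phi> n x \<bullet> frechet_derivative \<psi> (at x) i) = - (LINT x|M. grad (\<phi> n) x \<bullet> (\<psi> x *\<^sub>R i))" for n
      using integration_by_parts[OF \<phi>[of n] \<psi> i]
        test_function_M(3)[OF test_function_mult[OF \<phi>[of n] test_function_partial[OF \<psi> i]]]
        test_function_M(3)[OF test_function_mult[OF test_function_partial[OF \<phi>[of n] i] \<psi>]]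
      by (simp add: grad_inner_Basis i mult.commute)
    ultimately have "(LINT x|M. u x \<bullet> frechet_derivative \<psi> (at x) i) = - (LINT x|M. g x \<bullet> (\<psi> x *\<^sub>R i))"
      using LIMSEQ_unique by simp
    then show "(LINT x|M. u x * frechet_derivative \<psi> (at x) i) = - (LINT x|M. (g x \<bullet> i) * \<psi> x)"
      by (simp add: mult.commute)
  qed
  show ae: "AE x in M. wg u x = g x" by (rule H1_I[OF u g w])
  have u1: "u \<in> H1 \<Omega>" by (rule H1_I[OF u g w])
  have "l2norm M (\<lambda>x. grad (\<phi> n) x - wg u x) = l2norm M (\<lambda>x. grad (\<phi> n) x - g x)" for n
    by (rule l2norm_cong_AE) (use ae in \<open>auto intro!: sq_int_diff sq_int_grad \<phi> g H1_weak_gradient u1 elim!: eventually_mono\<close>)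
  then show "u \<in> H10 \<Omega>" using u1 \<phi> lim by (auto simp: H10_iff intro!: exI[of _ \<phi>])
qed

lemma H10_approx:
  assumes "u \<in> H10 \<Omega>"
  obtains \<phi> where "\<And>n. \<phi> n \<in> test_functions \<Omega>" "(\<lambda>n. l2norm M (\<lambda>x. \<phi> n x - u x)) \<longlonglongrightarrow> 0"
    "(\<lambda>n. l2norm M (\<lambda>x. grad (\<phi> n) x - wg u x)) \<longlonglongrightarrow> 0"
proof -
  from assms obtain \<phi> where "(\<forall>n. \<phi> n \<in> test_functions \<Omega>) \<and>
     (\<lambda>n. l2norm M (\<lambda>x. \<phi> n x - u x)) \<longlonglongrightarrow> 0 \<and> (\<lambda>n. l2norm M (\<lambda>x. grad (\<phi> n) x - wg u x)) \<longlonglongrightarrow> 0"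
    unfolding H10_iff by auto
  then show thesis by (intro that[of \<phi>]) auto
qed

lemma test_function_H10:
  assumes "\<phi> \<in> test_functions \<Omega>"
  shows "\<phi> \<in> H10 \<Omega>"
  by (rule H10_I_limit[where \<phi> = "\<lambda>_. \<phi>" and g = "grad \<phi>"])
    (use assms in \<open>auto intro: sq_int_test_function sq_int_grad simp: l2norm_def\<close>)

lemma l2norm_lincomb_tendsto:
  assumes "\<And>n. sq_int M (p n)" "\<And>n. sq_int M (q n)" "sq_int M p0" "sq_int M q0"
    and "(\<lambda>n. l2norm M (\<lambda>x. p n x - p0 x)) \<longlonglongrightarrow> 0" "(\<lambda>n. l2norm M (\<lambda>x. q n x - q0 x)) \<longlonglongrightarrow> 0"
  shows "(\<lambda>n. l2norm M (\<lambda>x. (a *\<^sub>R p n x + b *\<^sub>R q n x) - (a *\<^sub>R p0 x + b *\<^sub>R q0 x))) \<longlonglongrightarrow> 0"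
proof (rule Lim_null_comparison)
  have sc: "l2norm M (\<lambda>x. c *\<^sub>R w x) = \<bar>c\<bar> * l2norm M w" for c and w :: "'a \<Rightarrow> 'd::euclidean_space"
    by (simp add: l2norm_def power_mult_distrib real_sqrt_mult)
  show "(\<lambda>n. \<bar>a\<bar> * l2norm M (\<lambda>x. p n x - p0 x) + \<bar>b\<bar> * l2norm M (\<lambda>x. q n x - q0 x)) \<longlonglongrightarrow> 0"
    using tendsto_add[OF tendsto_mult_left[OF assms(5)] tendsto_mult_left[OF assms(6)], of "\<bar>a\<bar>" "\<bar>b\<bar>"] by simp
  show "\<forall>\<^sub>F n in sequentially. norm (l2norm M (\<lambda>x. (a *\<^sub>R p n x + b *\<^sub>R q n x) - (a *\<^sub>R p0 x + b *\<^sub>R q0 x)))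
      \<le> \<bar>a\<bar> * l2norm M (\<lambda>x. p n x - p0 x) + \<bar>b\<bar> * l2norm M (\<lambda>x. q n x - q0 x)"
  proof (intro always_eventually allI)
    fix n
    have "(\<lambda>x. (a *\<^sub>R p n x + b *\<^sub>R q n x) - (a *\<^sub>R p0 x + b *\<^sub>R q0 x)) =
        (\<lambda>x. a *\<^sub>R (p n x - p0 x) + b *\<^sub>R (q n x - q0 x))"
      by (auto simp: algebra_simps)
    then show "norm (l2norm M (\<lambda>x. (a *\<^sub>R p n x + b *\<^sub>R q n x) - (a *\<^sub>R p0 x + b *\<^sub>R q0 x)))
      \<le> \<bar>a\<bar> * l2norm M (\<lambda>x. p n x - p0 x) + \<bar>b\<bar> * l2norm M (\<lambda>x. q n x - q0 x)"
      using l2norm_triangle[OF sq_int_scaleR[OF sq_int_diff[OF assms(1,3)], of a n] sq_int_scaleR[OF sq_int_diff[OF assms(2,4)], of b n]]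
      by (simp add: sc)
  qed
qed

lemma H10_lincomb:
  assumes u: "u \<in> H10 \<Omega>" and v: "v \<in> H10 \<Omega>"
  shows "(\<lambda>x. a * u x + b * v x) \<in> H10 \<Omega>"
proof -
  obtain \<phi> where \<phi>: "\<And>n. \<phi> n \<in> test_functions \<Omega>" "(\<lambda>n. l2norm M (\<lambda>x. \<phi> n x - u x)) \<longlonglongrightarrow> 0"
    "(\<lambda>n. l2norm M (\<lambda>x. grad (\<phi> n) x - wg u x)) \<longlonglongrightarrow> 0" by (rule H10_approx[OF u]) (rule that)
  obtain \<psi> where \<psi>: "\<And>n. \<psi> n \<in> test_functions \<Omega>" "(\<lambda>n. l2norm M (\<lambda>x. \<psi> n x - v x)) \<longlonglongrightarrow> 0"
    "(\<lambda>n. l2norm M (\<lambda>x. grad (\<psi> n) x - wg v x)) \<longlonglongrightarrow> 0" by (rule H10_approx[OF v]) (rule that)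
  show ?thesis
  proof (rule H10_I_limit[where \<phi> = "\<lambda>n x. a * \<phi> n x + b * \<psi> n x" and g = "\<lambda>x. a *\<^sub>R wg u x + b *\<^sub>R wg v x"])
    show "(\<lambda>n. l2norm M (\<lambda>x. (a * \<phi> n x + b * \<psi> n x) - (a * u x + b * v x))) \<longlonglongrightarrow> 0"
      using l2norm_lincomb_tendsto[OF sq_int_test_function[OF \<phi>(1)] sq_int_test_function[OF \<psi>(1)]
          H10_sq_int[OF u] H10_sq_int[OF v] \<phi>(2) \<psi>(2), of a b] by simp
    show "(\<lambda>n. l2norm M (\<lambda>x. grad (\<lambda>x. a * \<phi> n x + b * \<psi> n x) x - (a *\<^sub>R wg u x + b *\<^sub>R wg v x))) \<longlonglongrightarrow> 0"
      using l2norm_lincomb_tendsto[OF sq_int_grad[OF \<phi>(1)] sq_int_grad[OF \<psi>(1)]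
          H10_wg[OF u] H10_wg[OF v] \<phi>(3) \<psi>(3), of a b] by (simp only: grad_lincomb[OF \<phi>(1) \<psi>(1)])
    show "sq_int M (\<lambda>x. a * u x + b * v x)"
      using sq_int_lincomb[OF H10_sq_int[OF u] H10_sq_int[OF v], of a b] by simp
  qed (auto intro!: test_function_lincomb \<phi> \<psi> sq_int_lincomb H10_wg u v)
qed

lemma H10_add: "u \<in> H10 \<Omega> \<Longrightarrow> v \<in> H10 \<Omega> \<Longrightarrow> (\<lambda>x. u x + v x) \<in> H10 \<Omega>"
  using H10_lincomb[of u v 1 1] by simp

lemma H10_diff: "u \<in> H10 \<Omega> \<Longrightarrow> v \<in> H10 \<Omega> \<Longrightarrow> (\<lambda>x. u x - v x) \<in> H10 \<Omega>"
  using H10_lincomb[of u v 1 "-1"] by simp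

lemma H10_zero: "(\<lambda>x. 0) \<in> H10 \<Omega>"
proof -
  have "(\<lambda>x::'a. 0::real) \<in> test_functions \<Omega>"
    by (simp add: test_functions_def C_k_const)
  then show ?thesis by (rule test_function_H10)
qed

lemma H10_scale: "u \<in> H10 \<Omega> \<Longrightarrow> (\<lambda>x. a * u x) \<in> H10 \<Omega>"
  using H10_lincomb[OF _ H10_zero, of u a 0] by simp

definition dform :: "('a \<Rightarrow> real) \<Rightarrow> ('a \<Rightarrow> real) \<Rightarrow> real" where
  "dform u v = (LINT x|M. wg u x \<bullet> wg v x)"

lemma dform_lincomb_right:
  assumes u: "u \<in> H10 \<Omega>" and v: "v \<in> H10 \<Omega>" and w: "w \<in> H10 \<Omega>"
  shows "dform u (\<lambda>x. a * v x + b * w x) = a * dform u v + b * dform u w"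
proof -
  have "dform u (\<lambda>x. a * v x + b * w x) = (LINT x|M. wg u x \<bullet> (a *\<^sub>R wg v x + b *\<^sub>R wg w x))"
    unfolding dform_def
    by (rule integral_cong_AE)
      (use H1_lincomb(2)[OF H10_H1[OF v] H10_H1[OF w], of a b] sq_int_measurable[OF H10_wg[OF u]]
        sq_int_measurable[OF H10_wg[OF v]] sq_int_measurable[OF H10_wg[OF w]]
        sq_int_measurable[OF H10_wg[OF H10_lincomb[OF v w, of a b]]] in \<open>auto elim!: eventually_mono\<close>)
  also have "\<dots> = (LINT x|M. a * (wg u x \<bullet> wg v x) + b * (wg u x \<bullet> wg w x))"
    by (simp add: inner_simps)
  also have "\<dots> = a * dform u v + b * dform u w"
    unfolding dform_def
    using integrable_inner_sq_int[OF H10_wg[OF u] H10_wg[OF v]] integrable_inner_sq_int[OF H10_wg[OF u] H10_wg[OF w]]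
    by simp
  finally show ?thesis .
qed

lemma dform_self: "dform u u = dirichlet \<Omega> u"
  by (simp add: dform_def dirichlet_def power2_norm_eq_inner)

lemma dform_commute: "dform u v = dform v u"
  by (simp add: dform_def inner_commute)

lemma dirichlet_lincomb:
  assumes u: "u \<in> H10 \<Omega>" and v: "v \<in> H10 \<Omega>"
  shows "dirichlet \<Omega> (\<lambda>x. a * u x + b * v x) = a\<^sup>2 * dirichlet \<Omega> u + 2 * a * b * dform u v + b\<^sup>2 * dirichlet \<Omega> v"
proof -
  have uv: "(\<lambda>x. a * u x + b * v x) \<in> H10 \<Omega>" by (rule H10_lincomb[OF u v])
  have "dirichlet \<Omega> (\<lambda>x. a * u x + b * v x) =
      a * dform u (\<lambda>x. a * u x + b * v x) + b * dform v (\<lambda>x. a * u x + b * v x)"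
    using dform_lincomb_right[OF uv u v, of a b] dform_commute[of _ u] dform_commute[of _ v] dform_self by metis
  then show ?thesis
    using dform_lincomb_right[OF u u v, of a b] dform_lincomb_right[OF v u v, of a b] dform_commute[of v u]
    by (simp add: dform_self algebra_simps power2_eq_square)
qed

lemma dform_bound:
  assumes "u \<in> H10 \<Omega>" "v \<in> H10 \<Omega>"
  shows "\<bar>dform u v\<bar> \<le> H10_norm \<Omega> u * H10_norm \<Omega> v"
  unfolding dform_def H10_norm_eq by (intro Cauchy_Schwarz_integral H10_wg assms)

lemma H10_norm_scale:
  assumes "u \<in> H10 \<Omega>"
  shows "H10_norm \<Omega> (\<lambda>x. a * u x) = \<bar>a\<bar> * H10_norm \<Omega> u"
  using dirichlet_lincomb[OF assms assms, of a 0] by (simp add: H10_norm_def real_sqrt_mult)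

end

section \<open>The Sobolev inequality\<close>

text \<open>Against a finite measure on the line such functions are always integrable, and the class
  is stable under products, nonnegative powers and integration along lines. Iterated integrals
  therefore carry no integrability conditions.\<close>

definition bdd_meas :: "('a::euclidean_space \<Rightarrow> real) \<Rightarrow> bool" where
  "bdd_meas f \<longleftrightarrow> f \<in> borel_measurable borel \<and> (\<forall>x. 0 \<le> f x) \<and> (\<exists>B. \<forall>x. f x \<le> B)"

lemma bdd_measD: "bdd_meas f \<Longrightarrow> f \<in> borel_measurable borel" "bdd_meas f \<Longrightarrow> 0 \<le> f x"
  by (auto simp: bdd_meas_def)

lemma bdd_meas_bound:
  assumes "bdd_meas f"
  obtains B where "B \<ge> 0" "\<And>x. f x \<le> B"
  using assms unfolding bdd_meas_def by (meson order_trans)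

lemma bdd_meas_powr: "bdd_meas f \<Longrightarrow> 0 \<le> a \<Longrightarrow> bdd_meas (\<lambda>x. f x powr a)"
  unfolding bdd_meas_def by (auto intro!: exI powr_mono2)

lemma bdd_meas_mult:
  assumes f: "bdd_meas f" and g: "bdd_meas g"
  shows "bdd_meas (\<lambda>x. f x * g x)"
proof -
  obtain A where A: "A \<ge> 0" "\<And>x. f x \<le> A" by (rule bdd_meas_bound[OF f]) (blast intro: that)
  obtain B where B: "B \<ge> 0" "\<And>x. g x \<le> B" by (rule bdd_meas_bound[OF g]) (blast intro: that)
  have "f x * g x \<le> A * B" for x
    by (rule mult_mono) (use A B bdd_measD(2)[OF f] bdd_measD(2)[OF g] in auto)
  then show ?thesis using f g unfolding bdd_meas_def by auto
qed

lemma bdd_meas_const: "0 \<le> c \<Longrightarrow> bdd_meas (\<lambda>x. c)"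
  unfolding bdd_meas_def by auto

lemma bdd_meas_prod: "finite I \<Longrightarrow> (\<And>i. i \<in> I \<Longrightarrow> bdd_meas (f i)) \<Longrightarrow> bdd_meas (\<lambda>x. \<Prod>i\<in>I. f i x)"
  by (induction I rule: finite_induct) (auto intro: bdd_meas_const bdd_meas_mult)

definition slice :: "'a::euclidean_space \<Rightarrow> 'a \<Rightarrow> real \<Rightarrow> 'a" where
  "slice i x t = x + (t - x \<bullet> i) *\<^sub>R i"

lemma slice_slice: "i \<in> Basis \<Longrightarrow> slice i (slice i x s) t = slice i x t"
  by (simp add: slice_def inner_simps algebra_simps)

lemma slice_commute:
  "i \<in> Basis \<Longrightarrow> j \<in> Basis \<Longrightarrow> i \<noteq> j \<Longrightarrow> slice i (slice j x s) t = slice j (slice i x t) s"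
  by (simp add: slice_def inner_simps inner_not_same_Basis)

text \<open>Integrating out a coordinate leaves a function on the whole space that is constant in
  that direction. All marginals thus keep the same type, and spaces of lower dimension do not
  appear.\<close>

definition marg :: "real measure \<Rightarrow> 'a::euclidean_space \<Rightarrow> ('a \<Rightarrow> real) \<Rightarrow> 'a \<Rightarrow> real" where
  "marg \<mu> i f x = (LINT t|\<mu>. f (slice i x t))"

locale finite_borel = finite_measure \<mu> for \<mu> :: "real measure" +
  assumes sets_\<mu> [measurable_cong]: "sets \<mu> = sets borel"
    and nonzero: "measure \<mu> (space \<mu>) > 0"
begin

lemma slice_measurable [measurable]: "slice i x \<in> measurable \<mu> borel"
  unfolding slice_def[abs_def] by measurable

lemma integrable_slice:
  assumes "bdd_meas f"
  shows "integrable \<mu> (\<lambda>t. f (slice i x t))"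
proof -
  obtain B where B: "\<And>x. f x \<le> B" by (rule bdd_meas_bound[OF assms]) (blast intro: that)
  show ?thesis
    by (rule integrable_const_bound[where B = B])
      (use B bdd_measD[OF assms] in \<open>auto intro: measurable_compose[OF slice_measurable]\<close>)
qed

lemma bdd_meas_marg:
  assumes "bdd_meas f"
  shows "bdd_meas (marg \<mu> i f)"
proof -
  obtain B where B: "B \<ge> 0" "\<And>x. f x \<le> B" by (rule bdd_meas_bound[OF assms]) (blast intro: that)
  have [measurable]: "f \<in> borel_measurable borel" using bdd_measD(1)[OF assms] .
  have "(\<lambda>(x, t). f (slice i x t)) \<in> borel_measurable (borel \<Otimes>\<^sub>M \<mu>)"
    unfolding slice_def by measurable
  then have "marg \<mu> i f \<in> borel_measurable borel"
    unfolding marg_def[abs_def] by (rule borel_measurable_lebesgue_integral)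
  moreover have "0 \<le> marg \<mu> i f x" for x
    unfolding marg_def by (rule Bochner_Integration.integral_nonneg) (use bdd_measD(2)[OF assms] in auto)
  moreover have "marg \<mu> i f x \<le> B * measure \<mu> (space \<mu>)" for x
  proof -
    have "marg \<mu> i f x \<le> (LINT t|\<mu>. B)"
      unfolding marg_def by (rule integral_mono[OF integrable_slice[OF assms]]) (use B in auto)
    then show ?thesis by (simp add: mult.commute)
  qed
  ultimately show ?thesis unfolding bdd_meas_def by blast
qed

lemma marg_mono:
  assumes "bdd_meas f" "bdd_meas g" "\<And>x. f x \<le> g x"
  shows "marg \<mu> i f x \<le> marg \<mu> i g x"
  unfolding marg_def by (intro integral_mono integrable_slice assms)

lemma marg_slice: "i \<in> Basis \<Longrightarrow> marg \<mu> i f (slice i x t) = marg \<mu> i f x"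
  by (simp add: marg_def slice_slice)

lemma marg_commute:
  assumes f: "bdd_meas f" and ij: "i \<in> Basis" "j \<in> Basis" "i \<noteq> j"
  shows "marg \<mu> i (marg \<mu> j f) x = marg \<mu> j (marg \<mu> i f) x"
proof -
  obtain B where B: "B \<ge> 0" "\<And>x. f x \<le> B" by (rule bdd_meas_bound[OF f]) (blast intro: that)
  have [measurable]: "f \<in> borel_measurable borel" using bdd_measD(1)[OF f] .
  interpret pair_sigma_finite \<mu> \<mu> by unfold_locales
  interpret P: finite_measure "\<mu> \<Otimes>\<^sub>M \<mu>"
    by (rule finite_measure_pair_measure) unfold_locales
  have "integrable (\<mu> \<Otimes>\<^sub>M \<mu>) (\<lambda>(t, s). f (slice j (slice i x t) s))"
  proof (rule P.integrable_const_bound[where B = B])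
    show "(\<lambda>(t, s). f (slice j (slice i x t) s)) \<in> borel_measurable (\<mu> \<Otimes>\<^sub>M \<mu>)"
      unfolding slice_def by measurable
  qed (use B bdd_measD(2)[OF f] in auto)
  from Fubini_integral[OF this] show ?thesis
    unfolding marg_def by (simp add: slice_commute[OF ij(2,1) ij(3)[symmetric]])
qed

fun margs :: "'a::euclidean_space list \<Rightarrow> ('a \<Rightarrow> real) \<Rightarrow> 'a \<Rightarrow> real" where
  "margs [] f = f"
| "margs (k # js) f = marg \<mu> k (margs js f)"

lemma bdd_meas_margs: "bdd_meas f \<Longrightarrow> bdd_meas (margs js f)"
  by (induction js) (auto intro: bdd_meas_marg)

lemma margs_mono:
  assumes "bdd_meas f" "bdd_meas g" "\<And>x. f x \<le> g x"
  shows "margs js f x \<le> margs js g x"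
  by (induction js arbitrary: x) (auto intro!: marg_mono bdd_meas_margs assms)

text \<open>In the factor with index \<open>k\<close> the integral in direction \<open>k\<close> is
  the innermost one. Moved outermost, it makes this factor constant along the slices in direction
  \<open>k\<close>.\<close>

lemma margs_marg:
  assumes f: "bdd_meas f"
  shows "set js \<subseteq> Basis \<Longrightarrow> k \<in> Basis \<Longrightarrow> k \<notin> set js \<Longrightarrow> margs js (marg \<mu> k f) = marg \<mu> k (margs js f)"
proof (induction js)
  case (Cons j js)
  then have IH: "margs js (marg \<mu> k f) = marg \<mu> k (margs js f)" by auto
  show ?case
    unfolding margs.simps IH
    by (rule ext, rule marg_commute[OF bdd_meas_margs[OF f]]) (use Cons.prems in auto)
qed simp

text \<open>Coordinates are integrated out one at a time. When the coordinate \<open>k\<close> is integrated, the factor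
  with index \<open>k\<close> no longer depends on it and the weights of the remaining factors sum to \<open>1\<close>, so
  that Hoelder's inequality applies.\<close>

lemma margs_prod_le:
  fixes f :: "'a::euclidean_space \<Rightarrow> real"
  assumes f: "bdd_meas f" and p: "p * (real DIM('a) - 1) = 1"
  shows "distinct js \<Longrightarrow> set js \<subseteq> Basis \<Longrightarrow>
    margs js (\<lambda>x. \<Prod>i\<in>Basis. marg \<mu> i f x powr p) x \<le>
      (if js = [] then 1 else margs js f x powr (real (length js) * p)) *
      (\<Prod>i\<in>Basis - set js. margs js (marg \<mu> i f) x powr p)"
proof (induction js arbitrary: x)
  case Nil
  then show ?case by simp
next
  case (Cons k js)
  have p0: "p > 0"
    using p DIM_positive[where 'a='a] by (smt (verit) zero_less_mult_iff of_nat_less_imp_less of_nat_1 One_nat_def Suc_leI of_nat_mono)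
  have k: "k \<in> Basis" "k \<notin> set js" and js: "distinct js" "set js \<subseteq> Basis" using Cons.prems by auto
  let ?I = "Basis - set (k # js)"
  \<comment> \<open>The factors for Hoelder's inequality: \<open>None\<close> indexes the power of
    \<open>margs js f\<close> accumulated so far, \<open>Some j\<close> a coordinate still to be
    integrated. Before the first integration nothing has been accumulated, and the constant 1 with
    weight 0 takes its place.\<close>
  define h where "h = (if js = [] then (\<lambda>x. 1) else margs js f)"
  define g where "g i = (case i of None \<Rightarrow> h | Some j \<Rightarrow> margs js (marg \<mu> j f))" for i
  define w where "w i = (case i of None \<Rightarrow> real (length js) * p | Some (j::'a) \<Rightarrow> p)" for i
  let ?J = "insert None (Some ` ?I)"
  have hb: "bdd_meas h" unfolding h_def by (auto intro: bdd_meas_const bdd_meas_margs f)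
  have gb: "bdd_meas (g i)" for i
    unfolding g_def by (cases i) (auto intro: hb bdd_meas_margs bdd_meas_marg f)
  let ?P = "\<lambda>x. \<Prod>i\<in>Basis. marg \<mu> i f x powr p"
  let ?H = "\<lambda>x. \<Prod>i\<in>?J. g i x powr w i"
  have Pb: "bdd_meas ?P" using p0 by (auto intro!: bdd_meas_prod bdd_meas_powr bdd_meas_marg f)
  have w0: "0 \<le> w i" for i using p0 by (cases i) (auto simp: w_def)
  have Hb: "bdd_meas ?H" by (intro bdd_meas_prod bdd_meas_powr gb w0) auto
  have wsum: "sum w ?J = 1"
  proof -
    have "card ?I = DIM('a) - (length js + 1)"
      using k js Cons.prems by (subst card_Diff_subset) (auto simp: distinct_card)
    moreover have "length js + 1 \<le> DIM('a)"
      using card_mono[OF finite_Basis Cons.prems(2)] distinct_card[OF Cons.prems(1)] by simp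
    ultimately have c: "real (card ?I) = real DIM('a) - (real (length js) + 1)" by (simp add: of_nat_diff)
    have "sum w ?J = real (length js) * p + real (card ?I) * p"
      by (subst sum.insert) (auto simp: w_def sum.reindex)
    also have "\<dots> = p * (real DIM('a) - 1)" unfolding c by (simp add: algebra_simps)
    finally show ?thesis using p by simp
  qed
  have Hprod: "?H y = h y powr (real (length js) * p) * (\<Prod>i\<in>?I. margs js (marg \<mu> i f) y powr p)" for y
    by (subst prod.insert) (auto simp: g_def w_def prod.reindex)
  have le: "margs js ?P y \<le> margs (k # js) f x powr p * ?H y" if y: "y = slice k x t" for y t
  proof -
    have "margs js ?P y \<le> (if js = [] then 1 else margs js f y powr (real (length js) * p)) *
        (\<Prod>i\<in>Basis - set js. margs js (marg \<mu> i f) y powr p)"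
      by (rule Cons.IH[OF js])
    also have "(if js = [] then 1 else margs js f y powr (real (length js) * p)) = h y powr (real (length js) * p)"
      by (simp add: h_def)
    also have "(\<Prod>i\<in>Basis - set js. margs js (marg \<mu> i f) y powr p) =
        margs js (marg \<mu> k f) y powr p * (\<Prod>i\<in>?I. margs js (marg \<mu> i f) y powr p)"
      using k by (subst prod.remove[of _ k]) (auto intro!: prod.cong)
    also have "margs js (marg \<mu> k f) y = margs (k # js) f x"
      unfolding margs_marg[OF f js(2) k] y by (simp add: marg_slice k)
    finally show ?thesis unfolding Hprod by (simp add: mult_ac)
  qed
  have "margs (k # js) ?P x = (LINT t|\<mu>. margs js ?P (slice k x t))"
    by (simp add: marg_def)
  also have "\<dots> \<le> (LINT t|\<mu>. margs (k # js) f x powr p * ?H (slice k x t))"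
    by (intro integral_mono integrable_slice bdd_meas_margs Pb integrable_mult_right Hb le) auto
  also have "\<dots> = margs (k # js) f x powr p * (LINT t|\<mu>. ?H (slice k x t))" by simp
  also have "\<dots> \<le> margs (k # js) f x powr p * (\<Prod>i\<in>?J. (LINT t|\<mu>. g i (slice k x t)) powr w i)"
    by (intro mult_left_mono Holder_weighted(2) integrable_slice gb w0 wsum bdd_measD(2)[OF gb]) auto
  also have "(\<Prod>i\<in>?J. (LINT t|\<mu>. g i (slice k x t)) powr w i) =
      marg \<mu> k h x powr (real (length js) * p) * (\<Prod>i\<in>?I. margs (k # js) (marg \<mu> i f) x powr p)"
    by (subst prod.insert) (auto simp: g_def w_def prod.reindex marg_def)
  also have "margs (k # js) f x powr p * (marg \<mu> k h x powr (real (length js) * p) * (\<Prod>i\<in>?I. margs (k # js) (marg \<mu> i f) x powr p))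
     = (margs (k # js) f x powr p * marg \<mu> k h x powr (real (length js) * p)) * (\<Prod>i\<in>?I. margs (k # js) (marg \<mu> i f) x powr p)"
    by simp
  also have "margs (k # js) f x powr p * marg \<mu> k h x powr (real (length js) * p) = margs (k # js) f x powr (real (length (k # js)) * p)"
  proof (cases "js = []")
    case True
    \<comment> \<open>The exponent is 0 here, and \<open>0 powr 0 = 0\<close>; positive total mass
      makes the power equal to 1.\<close>
    then show ?thesis using nonzero by (simp add: h_def marg_def)
  next
    case False
    then show ?thesis by (simp add: h_def powr_add[symmetric] algebra_simps)
  qed
  finally show ?case by simp
qed

end

definition interval_meas :: "real \<Rightarrow> real measure" where
  "interval_meas R = density lborel (indicator {-R..R})"

lemma finite_borel_interval_meas:
  assumes "R > 0"
  shows "finite_borel (interval_meas R)"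
proof -
  have e: "emeasure (interval_meas R) UNIV = ennreal (2 * R)"
    using assms by (simp add: interval_meas_def emeasure_density)
  have sp: "space (interval_meas R) = UNIV" by (simp add: interval_meas_def)
  show ?thesis
  proof (intro finite_borel.intro finite_measureI finite_borel_axioms.intro)
    show "sets (interval_meas R) = sets borel" by (simp add: interval_meas_def)
    show "emeasure (interval_meas R) (space (interval_meas R)) \<noteq> \<infinity>" unfolding sp e by simp
    show "0 < measure (interval_meas R) (space (interval_meas R))"
      unfolding sp measure_def e using assms by simp
  qed
qed

lemma nn_integral_interval_meas:
  assumes "f \<in> borel_measurable borel"
  shows "(\<integral>\<^sup>+t. f t \<partial>interval_meas R) = (\<integral>\<^sup>+t. f t * indicator {-R..R} t \<partial>lborel)"
  using assms unfolding interval_meas_def by (subst nn_integral_density) (auto simp: mult.commute)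

lemma (in finite_borel) ennreal_marg:
  assumes "bdd_meas f"
  shows "ennreal (marg \<mu> i f x) = (\<integral>\<^sup>+t. ennreal (f (slice i x t)) \<partial>\<mu>)"
  unfolding marg_def
  by (rule nn_integral_eq_integral[symmetric, OF integrable_slice[OF assms]]) (use bdd_measD(2)[OF assms] in auto)

text \<open>Peeling off the head of the list turns the iterated integral into one over a finite
  product of lines. For a list of all basis vectors this product is Lebesgue measure in
  coordinates.\<close>

lemma margs_eq_PiM:
  fixes f :: "'a::euclidean_space \<Rightarrow> real"
  assumes R: "R > 0" and f: "bdd_meas f"
  shows "distinct js \<Longrightarrow> set js \<subseteq> Basis \<Longrightarrow>
    ennreal (finite_borel.margs (interval_meas R) js f x) =
    (\<integral>\<^sup>+y. ennreal (f (x + (\<Sum>j\<in>set js. (y j - x \<bullet> j) *\<^sub>R j))) * (\<Prod>j\<in>set js. indicator {-R..R} (y j))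
        \<partial>(PiM (set js) (\<lambda>_. lborel)))"
proof (induction js arbitrary: x)
  case Nil
  interpret finite_borel "interval_meas R" by (rule finite_borel_interval_meas[OF R])
  interpret product_sigma_finite "\<lambda>_::'a. lborel :: real measure" by unfold_locales
  show ?case by (simp add: PiM_empty nn_integral_count_space_finite)
next
  case (Cons k js)
  interpret finite_borel "interval_meas R" by (rule finite_borel_interval_meas[OF R])
  interpret product_sigma_finite "\<lambda>_::'a. lborel :: real measure" by unfold_locales
  have [measurable]: "f \<in> borel_measurable borel" by (rule bdd_measD(1)[OF f])
  have k: "k \<in> Basis" "k \<notin> set js" and js: "distinct js" "set js \<subseteq> Basis" using Cons.prems by auto
  let ?F = "\<lambda>y. ennreal (f (x + (\<Sum>j\<in>set (k # js). (y j - x \<bullet> j) *\<^sub>R j))) * (\<Prod>j\<in>set (k # js). indicator {-R..R} (y j))"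
  have F: "?F \<in> borel_measurable (PiM (insert k (set js)) (\<lambda>_. lborel))"
  proof -
    have c: "(\<lambda>y. y j) \<in> borel_measurable (PiM (insert k (set js)) (\<lambda>_. lborel :: real measure))" if "j \<in> set (k # js)" for j
      using measurable_component_singleton[of j "insert k (set js)" "\<lambda>_. lborel :: real measure"] that by simp
    have "(\<lambda>y. x + (\<Sum>j\<in>set (k # js). (y j - x \<bullet> j) *\<^sub>R j)) \<in> borel_measurable (PiM (insert k (set js)) (\<lambda>_. lborel))"
      using c by (intro borel_measurable_add borel_measurable_const borel_measurable_sum borel_measurable_scaleR
          borel_measurable_diff) auto
    from measurable_compose[OF this, of f borel]
    have 1: "(\<lambda>y. ennreal (f (x + (\<Sum>j\<in>set (k # js). (y j - x \<bullet> j) *\<^sub>R j)))) \<in> borel_measurable (PiM (insert k (set js)) (\<lambda>_. lborel))"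
      by simp
    have ind: "(indicator {-R..R} :: real \<Rightarrow> ennreal) \<in> borel_measurable borel" by simp
    have 2: "(\<lambda>y. \<Prod>j\<in>set (k # js). indicator {-R..R} (y j) :: ennreal) \<in> borel_measurable (PiM (insert k (set js)) (\<lambda>_. lborel))"
      by (intro borel_measurable_prod_ennreal measurable_compose[OF c ind])
    from 1 2 show ?thesis by (rule borel_measurable_times_ennreal)
  qed
  have mm: "margs js f \<in> borel_measurable borel" by (rule bdd_measD(1)[OF bdd_meas_margs[OF f]])
  have "ennreal (margs (k # js) f x) = (\<integral>\<^sup>+t. ennreal (margs js f (slice k x t)) * indicator {-R..R} t \<partial>lborel)"
    unfolding margs.simps
    by (subst ennreal_marg[OF bdd_meas_margs[OF f]], rule nn_integral_interval_meas)
      (use mm in \<open>simp add: slice_def\<close>)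
  also have "\<dots> = (\<integral>\<^sup>+t. \<integral>\<^sup>+y. ?F (y(k := t)) \<partial>(PiM (set js) (\<lambda>_. lborel)) \<partial>lborel)"
  proof (rule nn_integral_cong)
    fix t
    have e: "?F (y(k := t)) = (ennreal (f (slice k x t + (\<Sum>j\<in>set js. (y j - slice k x t \<bullet> j) *\<^sub>R j))) * (\<Prod>j\<in>set js. indicator {-R..R} (y j))) * indicator {-R..R} t" for y
    proof -
      have "(\<Prod>j\<in>set js. indicator {-R..R} ((y(k := t)) j) :: ennreal) = (\<Prod>j\<in>set js. indicator {-R..R} (y j))"
        by (rule prod.cong) (use k in auto)
      moreover have "(\<Sum>j\<in>set js. ((y(k := t)) j - x \<bullet> j) *\<^sub>R j) = (\<Sum>j\<in>set js. (y j - slice k x t \<bullet> j) *\<^sub>R j)"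
        by (rule sum.cong) (use k js in \<open>auto simp: slice_def inner_simps inner_Basis\<close>)
      ultimately show ?thesis
        using k by (simp add: slice_def add.assoc mult_ac)
    qed
    have "(\<integral>\<^sup>+y. ?F (y(k := t)) \<partial>(PiM (set js) (\<lambda>_. lborel))) = ennreal (margs js f (slice k x t)) * indicator {-R..R} t"
      unfolding e Cons.IH[OF js] by (cases "t \<in> {-R..R}") auto
    then show "ennreal (margs js f (slice k x t)) * indicator {-R..R} t = (\<integral>\<^sup>+y. ?F (y(k := t)) \<partial>(PiM (set js) (\<lambda>_. lborel)))" ..
  qed
  also have "\<dots> = (\<integral>\<^sup>+y. ?F y \<partial>(PiM (insert k (set js)) (\<lambda>_. lborel)))"
    by (rule product_nn_integral_insert_rev[symmetric, OF _ k(2) F]) simp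
  finally show ?case by simp
qed

text \<open>With every coordinate integrated the base point \<open>x\<close> drops out. The
  restriction to intervals is invisible, since a point with a coordinate outside
  \<open>{-R..R}\<close> has norm above \<open>R\<close>, where \<open>f\<close> vanishes.\<close>

lemma margs_full:
  fixes f :: "'a::euclidean_space \<Rightarrow> real"
  assumes R: "R > 0" and f: "bdd_meas f" and supp: "\<And>x. norm x > R \<Longrightarrow> f x = 0"
    and js: "distinct js" "set js = Basis"
  shows "finite_borel.margs (interval_meas R) js f x = (LINT y|lborel. f y)"
proof -
  interpret finite_borel "interval_meas R" by (rule finite_borel_interval_meas[OF R])
  have [measurable]: "f \<in> borel_measurable borel" by (rule bdd_measD(1)[OF f])
  obtain B where B: "\<And>x. f x \<le> B" by (rule bdd_meas_bound[OF f]) (blast intro: that)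
  have int: "integrable lborel f"
    by (rule integrable_bounded_support[where B = B and R = R]) (use B bdd_measD(2)[OF f] supp in auto)
  let ?s = "\<lambda>y::'a \<Rightarrow> real. \<Sum>b\<in>Basis. y b *\<^sub>R b"
  have e: "f (x + (\<Sum>j\<in>Basis. (y j - x \<bullet> j) *\<^sub>R j)) = f (?s y)" for y
    by (simp add: scaleR_diff_left sum_subtractf euclidean_representation)
  have i: "ennreal (f (?s y)) * (\<Prod>j\<in>Basis. indicator {-R..R} (y j)) = ennreal (f (?s y))" for y
  proof (cases "\<forall>j\<in>Basis. y j \<in> {-R..R}")
    case False
    then obtain j where j: "j \<in> Basis" "y j \<notin> {-R..R}" by auto
    have "?s y \<bullet> j = y j" using j(1) by simp
    then have "\<bar>y j\<bar> \<le> norm (?s y)" using Basis_le_norm[OF j(1), of "?s y"] by simp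
    then have "norm (?s y) > R" using j(2) by auto
    then show ?thesis using supp by simp
  qed simp
  have "ennreal (margs js f x) = (\<integral>\<^sup>+y. ennreal (f (?s y)) \<partial>(PiM Basis (\<lambda>_. lborel)))"
    using margs_eq_PiM[OF R f js(1), of x] js(2) by (simp add: e i)
  also have "\<dots> = (\<integral>\<^sup>+y. ennreal (f y) \<partial>lborel)"
    by (subst lborel_eq, subst nn_integral_distr) auto
  also have "\<dots> = ennreal (LINT y|lborel. f y)"
    by (rule nn_integral_eq_integral[OF int]) (use bdd_measD(2)[OF f] in auto)
  finally show ?thesis
    using bdd_measD(2)[OF bdd_meas_margs[OF f]] bdd_measD(2)[OF f]
    by (subst (asm) ennreal_inj) (auto intro: Bochner_Integration.integral_nonneg)
qed

lemma abs_powr_deriv: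
  fixes s :: real
  assumes "\<gamma> > 1"
  shows "((\<lambda>s. \<bar>s\<bar> powr \<gamma>) has_real_derivative \<gamma> * (sgn s * \<bar>s\<bar> powr (\<gamma> - 1))) (at s)"
proof -
  consider "s > 0" | "s < 0" | "s = 0" by linarith
  then show ?thesis
  proof cases
    case 1
    have "((\<lambda>s. s powr \<gamma>) has_real_derivative \<gamma> * (sgn s * \<bar>s\<bar> powr (\<gamma> - 1))) (at s)"
      using 1 by (auto intro!: derivative_eq_intros)
    then show ?thesis
      by (rule has_field_derivative_transform_within_open[where S = "{0<..}"]) (use 1 in auto)
  next
    case 2
    have "((\<lambda>s. (- s) powr \<gamma>) has_real_derivative \<gamma> * (sgn s * \<bar>s\<bar> powr (\<gamma> - 1))) (at s)"
      using 2 by (auto intro!: derivative_eq_intros)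
    then show ?thesis
      by (rule has_field_derivative_transform_within_open[where S = "{..<0}"]) (use 2 in auto)
  next
    case 3
    have "((\<lambda>h::real. \<bar>h\<bar> powr (\<gamma> - 1)) \<longlongrightarrow> \<bar>0\<bar> powr (\<gamma> - 1)) (at 0)"
      by (rule tendsto_powr'[OF tendsto_rabs[OF tendsto_ident_at] tendsto_const])
        (use assms in \<open>auto intro!: always_eventually\<close>)
    then have l: "((\<lambda>h::real. \<bar>h\<bar> powr (\<gamma> - 1)) \<longlongrightarrow> 0) (at 0)" by simp
    have "((\<lambda>h::real. \<bar>h\<bar> powr \<gamma> / h) \<longlongrightarrow> 0) (at 0)"
    proof (rule Lim_null_comparison[OF _ l], rule always_eventually, rule allI)
      fix h :: real
      show "norm (\<bar>h\<bar> powr \<gamma> / h) \<le> \<bar>h\<bar> powr (\<gamma> - 1)"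
        by (cases "h = 0") (auto simp: powr_diff abs_mult)
    qed
    then show ?thesis using 3 by (simp add: DERIV_def)
  qed
qed

text \<open>The jump of \<open>sgn\<close> is avoided by writing the function as a difference of
  powers of the positive and the negative part.\<close>

lemma continuous_sgn_powr:
  assumes "a > 0"
  shows "continuous_on UNIV (\<lambda>s::real. sgn s * \<bar>s\<bar> powr a)"
proof -
  have "(\<lambda>s::real. sgn s * \<bar>s\<bar> powr a) = (\<lambda>s. (max 0 s) powr a - (max 0 (- s)) powr a)"
    by (auto simp: fun_eq_iff sgn_if max_def)
  moreover have "continuous_on UNIV (\<lambda>s. (max 0 s) powr a - (max 0 (- s)) powr a)"
    using assms by (intro continuous_intros continuous_on_powr') auto
  ultimately show ?thesis by (simp only:)
qed

text \<open>The fundamental theorem of calculus on the line through \<open>x\<close> in direction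
  \<open>i\<close>, started at coordinate \<open>-R\<close>, where \<open>\<phi>\<close> vanishes.
  Extending the integral of the absolute value to all of \<open>{-R..R}\<close> makes the bound
  independent of the coordinate \<open>x \<bullet> i\<close>.\<close>

lemma abs_powr_le_marg:
  fixes \<phi> :: "'a::euclidean_space \<Rightarrow> real"
  assumes \<phi>: "\<phi> \<in> test_functions \<Omega>" and R: "R > 0" "\<And>x. norm x \<ge> R \<Longrightarrow> \<phi> x = 0"
    and i: "i \<in> Basis" and \<gamma>: "\<gamma> > 1"
  shows "\<bar>\<phi> x\<bar> powr \<gamma> \<le> \<gamma> * marg (interval_meas R) i (\<lambda>x. \<bar>\<phi> x\<bar> powr (\<gamma> - 1) * norm (grad \<phi> x)) x"
proof -
  let ?f = "\<lambda>x. \<bar>\<phi> x\<bar> powr (\<gamma> - 1) * norm (grad \<phi> x)"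
  define D where "D t = \<gamma> * (sgn (\<phi> (slice i x t)) * \<bar>\<phi> (slice i x t)\<bar> powr (\<gamma> - 1)) * (grad \<phi> (slice i x t) \<bullet> i)" for t
  have cs: "continuous_on UNIV (slice i x)" unfolding slice_def[abs_def] by (intro continuous_intros)
  have c\<phi>: "continuous_on UNIV (\<lambda>t. \<phi> (slice i x t))"
    by (rule continuous_on_compose2[OF test_function_continuous[OF \<phi>] cs]) auto
  have cg: "continuous_on UNIV (\<lambda>t. grad \<phi> (slice i x t))"
    by (rule continuous_on_compose2[OF grad_continuous[OF \<phi>] cs]) auto
  have cD: "continuous_on UNIV D"
    unfolding D_def using \<gamma>
    by (intro continuous_intros continuous_on_compose2[OF continuous_sgn_powr c\<phi>] cg) auto
  have cf: "continuous_on UNIV (\<lambda>t. ?f (slice i x t))"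
    using \<gamma> by (intro continuous_intros continuous_on_powr' c\<phi> cg) auto
  have der: "((\<lambda>t. \<bar>\<phi> (slice i x t)\<bar> powr \<gamma>) has_real_derivative D t) (at t)" for t
  proof -
    have "((\<lambda>t. slice i x t) has_derivative (\<lambda>h. h *\<^sub>R i)) (at t)"
      unfolding slice_def by (auto intro!: derivative_eq_intros)
    from has_derivative_compose[OF this test_function_has_derivative[OF \<phi>, of "slice i x t"]]
    have "((\<lambda>t. \<phi> (slice i x t)) has_real_derivative (grad \<phi> (slice i x t) \<bullet> i)) (at t)"
      by (simp add: has_field_derivative_def mult_commute_abs)
    from DERIV_chain2[OF abs_powr_deriv[OF \<gamma>] this] show ?thesis unfolding D_def by simp
  qed
  have im: "interval_meas R = density lborel (\<lambda>t. ennreal (indicat_real {-R..R} t))"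
    by (simp add: interval_meas_def ennreal_indicator)
  have marg_eq: "marg (interval_meas R) i ?f x = (LINT t|lborel. indicator {-R..R} t *\<^sub>R ?f (slice i x t))"
    unfolding marg_def im
    using borel_measurable_continuous_onI[OF cf] by (intro integral_density) auto
  have fint: "integrable lborel (\<lambda>t. indicator {-R..R} t *\<^sub>R ?f (slice i x t))"
    by (rule borel_integrable_compact) (use cf continuous_on_subset in auto)
  show ?thesis
  proof (cases "\<bar>x \<bullet> i\<bar> < R")
    case False
    then have "norm x \<ge> R" using Basis_le_norm[OF i, of x] by linarith
    then have "\<phi> x = 0" by (rule R(2))
    moreover have "0 \<le> marg (interval_meas R) i ?f x"
      unfolding marg_def by (rule Bochner_Integration.integral_nonneg) auto
    ultimately show ?thesis using \<gamma> by simp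
  next
    case True
    have "norm (slice i x (-R)) \<ge> R"
      using Basis_le_norm[OF i, of "slice i x (-R)"] R(1) i by (simp add: slice_def inner_simps)
    then have z: "\<phi> (slice i x (-R)) = 0" by (rule R(2))
    have "(LINT t|lborel. indicator {-R..x \<bullet> i} t *\<^sub>R D t) = \<bar>\<phi> (slice i x (x \<bullet> i))\<bar> powr \<gamma> - \<bar>\<phi> (slice i x (-R))\<bar> powr \<gamma>"
    proof (rule integral_FTC_atLeastAtMost)
      show "((\<lambda>t. \<bar>\<phi> (slice i x t)\<bar> powr \<gamma>) has_vector_derivative D t) (at t within {-R..x \<bullet> i})" for t
        using der[of t] unfolding has_real_derivative_iff_has_vector_derivative
        by (rule has_vector_derivative_at_within)
    qed (use True cD continuous_on_subset in auto)
    then have "\<bar>\<phi> x\<bar> powr \<gamma> = (LINT t|lborel. indicator {-R..x \<bullet> i} t *\<^sub>R D t)"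
      using z \<gamma> by (simp add: slice_def)
    also have "\<dots> \<le> (LINT t|lborel. \<gamma> * (indicator {-R..R} t *\<^sub>R ?f (slice i x t)))"
    proof (rule integral_mono)
      show "integrable lborel (\<lambda>t. indicator {-R..x \<bullet> i} t *\<^sub>R D t)"
        by (rule borel_integrable_compact) (use cD continuous_on_subset in auto)
      show "integrable lborel (\<lambda>t. \<gamma> * (indicator {-R..R} t *\<^sub>R ?f (slice i x t)))"
        by (intro integrable_mult_right fint)
      fix t
      have "\<bar>grad \<phi> (slice i x t) \<bullet> i\<bar> \<le> norm (grad \<phi> (slice i x t))" by (rule Basis_le_norm[OF i])
      moreover have "\<bar>sgn (\<phi> (slice i x t)) * \<bar>\<phi> (slice i x t)\<bar> powr (\<gamma> - 1)\<bar> \<le> \<bar>\<phi> (slice i x t)\<bar> powr (\<gamma> - 1)"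
        by (simp add: abs_mult abs_sgn_eq)
      ultimately have "\<bar>sgn (\<phi> (slice i x t)) * \<bar>\<phi> (slice i x t)\<bar> powr (\<gamma> - 1)\<bar> * \<bar>grad \<phi> (slice i x t) \<bullet> i\<bar> \<le> ?f (slice i x t)"
        by (intro mult_mono) auto
      then have "\<gamma> * (\<bar>sgn (\<phi> (slice i x t)) * \<bar>\<phi> (slice i x t)\<bar> powr (\<gamma> - 1)\<bar> * \<bar>grad \<phi> (slice i x t) \<bullet> i\<bar>) \<le> \<gamma> * ?f (slice i x t)"
        using \<gamma> by (intro mult_left_mono) auto
      moreover have "\<bar>D t\<bar> = \<gamma> * (\<bar>sgn (\<phi> (slice i x t)) * \<bar>\<phi> (slice i x t)\<bar> powr (\<gamma> - 1)\<bar> * \<bar>grad \<phi> (slice i x t) \<bullet> i\<bar>)"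
        using \<gamma> unfolding D_def by (simp only: abs_mult abs_of_pos mult.assoc)
      ultimately have "\<bar>D t\<bar> \<le> \<gamma> * ?f (slice i x t)" by simp
      then have "D t \<le> \<gamma> * ?f (slice i x t)" "0 \<le> \<gamma> * ?f (slice i x t)" by linarith+
      then show "indicator {-R..x \<bullet> i} t *\<^sub>R D t \<le> \<gamma> * (indicator {-R..R} t *\<^sub>R ?f (slice i x t))"
        using True by (auto simp: indicator_def)
    qed
    also have "\<dots> = \<gamma> * marg (interval_meas R) i ?f x" unfolding marg_eq by simp
    finally show ?thesis .
  qed
qed

text \<open>Gagliardo--Nirenberg--Sobolev: the \<open>L\<^sup>1\<close> inequality is applied to \<open>\<bar>\<phi>\<bar> powr \<gamma>\<close>, with \<open>\<gamma>\<close> chosen so that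
  the exponents on both sides agree.\<close>

lemma sobolev_test_function:
  fixes \<phi> :: "'a::euclidean_space \<Rightarrow> real"
  assumes \<phi>: "\<phi> \<in> test_functions \<Omega>" and N: "DIM('a) \<ge> 3"
  defines "q \<equiv> crit_exp DIM('a)"
  defines "\<gamma> \<equiv> 2 * (real DIM('a) - 1) / (real DIM('a) - 2)"
  shows "(LINT x|lborel. \<bar>\<phi> x\<bar> powr q) \<le> \<gamma> powr q * (LINT x|lborel. (norm (grad \<phi> x))\<^sup>2) powr (q / 2)"
proof -
  define n where "n = real DIM('a)"
  have n: "n \<ge> 3" using N by (simp add: n_def)
  define p where "p = 1 / (n - 1)"
  have p: "p * (real DIM('a) - 1) = 1" "p > 0" using n by (auto simp: p_def n_def)
  have q: "q = 2 * n / (n - 2)" by (simp add: q_def crit_exp_def n_def)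
  have \<gamma>: "\<gamma> = 2 * (n - 1) / (n - 2)" by (simp add: \<gamma>_def n_def)
  have \<gamma>1: "\<gamma> > 1" using n by (simp add: \<gamma> field_simps)
  have q2: "q > 2" using n by (simp add: q field_simps)
  have "2 * a / b * (n * (1 / a)) = 2 * n / b" if "a \<noteq> 0" "b \<noteq> 0" for a b :: real
    using that by (simp add: field_simps)
  from this[of "n - 1" "n - 2"] have e1: "\<gamma> * (n * p) = q" using n by (simp add: \<gamma> p_def q)
  \<comment> \<open>Together with \<open>e1\<close> this fixes \<open>\<gamma>\<close>: the product
    over all directions reaches the power \<open>q\<close> on the left, and Cauchy--Schwarz applied
    to \<open>\<bar>\<phi>\<bar> powr (\<gamma> - 1) * norm (grad \<phi>)\<close> returns the same
    power \<open>q\<close> on the right.\<close>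
  have e2: "(\<gamma> - 1) * 2 = q" using n by (simp add: \<gamma> q field_simps)
  obtain B where B: "\<And>x. \<bar>\<phi> x\<bar> \<le> B" using test_function_bounded[OF \<phi>] by metis
  obtain R0 where R0: "R0 > 0" "\<And>x. norm x > R0 \<Longrightarrow> \<phi> x = 0" using test_function_bounded[OF \<phi>] by metis
  \<comment> \<open>The margin makes \<open>\<phi>\<close> vanish on the sphere of radius
    \<open>R\<close> as well, as required at the starting points of the line integrals.\<close>
  define R where "R = R0 + 1"
  have R: "R > 0" "\<And>x. norm x \<ge> R \<Longrightarrow> \<phi> x = 0" using R0 by (auto simp: R_def)
  interpret finite_borel "interval_meas R" by (rule finite_borel_interval_meas[OF R(1)])
  have gB: "bdd_meas (\<lambda>x. norm (grad \<phi> x))"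
  proof -
    have "\<exists>C. \<forall>x. \<bar>frechet_derivative \<phi> (at x) i\<bar> \<le> C" if "i \<in> Basis" for i
      using test_function_bounded[OF test_function_partial[OF \<phi> that]] by metis
    then obtain C where C: "\<And>i x. i \<in> Basis \<Longrightarrow> \<bar>frechet_derivative \<phi> (at x) i\<bar> \<le> C i" by metis
    have "norm (grad \<phi> x) \<le> (\<Sum>i\<in>Basis. C i)" for x
    proof -
      have "norm (grad \<phi> x) \<le> (\<Sum>i\<in>Basis. \<bar>grad \<phi> x \<bullet> i\<bar>)" by (rule norm_le_l1)
      also have "\<dots> \<le> (\<Sum>i\<in>Basis. C i)" by (rule sum_mono) (simp add: grad_inner_Basis C)
      finally show ?thesis .
    qed
    then show ?thesis using grad_borel[OF \<phi>] unfolding bdd_meas_def by auto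
  qed
  have \<phi>B: "bdd_meas (\<lambda>x. \<bar>\<phi> x\<bar>)"
    using test_function_borel[OF \<phi>] B unfolding bdd_meas_def by auto
  define f where "f x = \<bar>\<phi> x\<bar> powr (\<gamma> - 1) * norm (grad \<phi> x)" for x
  have fB: "bdd_meas f" unfolding f_def[abs_def] using \<gamma>1 by (intro bdd_meas_mult bdd_meas_powr \<phi>B gB) auto
  have fs: "f x = 0" if "norm x > R" for x using R(2)[of x] that by (simp add: f_def)
  obtain js :: "'a list" where js: "set js = Basis" "distinct js"
    using finite_distinct_list[OF finite_Basis] by blast
  have jsn: "js \<noteq> []" "real (length js) = n" using js distinct_card[OF js(2)] by (auto simp: n_def)
  let ?A = "LINT x|lborel. \<bar>\<phi> x\<bar> powr q"
  let ?E = "LINT x|lborel. (norm (grad \<phi> x))\<^sup>2"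
  have qB: "bdd_meas (\<lambda>x. \<bar>\<phi> x\<bar> powr q)" using q2 by (intro bdd_meas_powr \<phi>B) auto
  have prodB: "bdd_meas (\<lambda>x. \<Prod>i\<in>Basis. marg (interval_meas R) i f x powr p)"
    using p by (intro bdd_meas_prod bdd_meas_powr bdd_meas_marg fB) auto
  have pt: "\<bar>\<phi> x\<bar> powr q \<le> \<gamma> powr (n * p) * (\<Prod>i\<in>Basis. marg (interval_meas R) i f x powr p)" for x
  proof -
    have "\<bar>\<phi> x\<bar> powr q = (\<Prod>i\<in>(Basis::'a set). (\<bar>\<phi> x\<bar> powr \<gamma>) powr p)"
      by (cases "\<phi> x = 0") (simp_all add: powr_power powr_powr n_def[symmetric] e1[symmetric] mult_ac)
    also have "\<dots> \<le> (\<Prod>i\<in>Basis. (\<gamma> * marg (interval_meas R) i f x) powr p)"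
      unfolding f_def using p \<gamma>1
      by (intro prod_mono conjI powr_mono2 abs_powr_le_marg[OF \<phi> R]) auto
    also have "\<dots> = (\<Prod>i\<in>(Basis::'a set). \<gamma> powr p) * (\<Prod>i\<in>Basis. marg (interval_meas R) i f x powr p)"
      using \<gamma>1 bdd_measD(2)[OF bdd_meas_marg[OF fB]] unfolding prod.distrib[symmetric]
      by (intro prod.cong refl) (auto simp: powr_mult)
    also have "(\<Prod>i\<in>(Basis::'a set). \<gamma> powr p) = \<gamma> powr (n * p)"
      using \<gamma>1 by (simp add: powr_power n_def mult.commute)
    finally show ?thesis .
  qed
  have scale: "margs js (\<lambda>x. c * g x) x = c * margs js g x" for c g x and js :: "'a list"
    by (induction js arbitrary: x) (auto simp: marg_def)
  let ?P = "\<lambda>x. \<Prod>i\<in>Basis. marg (interval_meas R) i f x powr p"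
  have "?A = margs js (\<lambda>x. \<bar>\<phi> x\<bar> powr q) 0"
    by (rule margs_full[symmetric, OF R(1) qB _ js(2,1)]) (use R(2) in auto)
  also have "\<dots> \<le> margs js (\<lambda>x. \<gamma> powr (n * p) * ?P x) 0"
    by (intro margs_mono qB bdd_meas_mult bdd_meas_const prodB pt) auto
  also have "\<dots> = \<gamma> powr (n * p) * margs js ?P 0" by (rule scale)
  \<comment> \<open>When all coordinates have been integrated, the product over
    \<open>Basis - set js\<close> is empty and only a power of the full integral of \<open>f\<close>
    remains.\<close>
  also have "\<dots> \<le> \<gamma> powr (n * p) * (LINT x|lborel. f x) powr (n * p)"
    using margs_prod_le[OF fB p(1) js(2) eq_refl[OF js(1)], of 0] jsn js(1)
      margs_full[OF R(1) fB fs js(2,1), of 0]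
    by (intro mult_left_mono) auto
  finally have A1: "?A \<le> \<gamma> powr (n * p) * (LINT x|lborel. f x) powr (n * p)" .
  have iq: "integrable lborel (\<lambda>x. \<bar>\<phi> x\<bar> powr q)"
    by (rule integrable_bounded_support[where R = R and B = "B powr q"])
      (use bdd_measD(1)[OF qB] R(2) B q2 in \<open>auto intro!: powr_mono2\<close>)
  have ig: "integrable lborel (\<lambda>x. (norm (grad \<phi> x))\<^sup>2)"
    unfolding norm_grad_sq
    by (intro Bochner_Integration.integrable_sum test_function_integrable[where \<Omega> = \<Omega>] test_function_mult
        test_function_partial[OF \<phi>])
  have A0: "?A \<ge> 0" by (rule Bochner_Integration.integral_nonneg) auto
  have E0: "?E \<ge> 0" by (rule Bochner_Integration.integral_nonneg) auto
  have f0: "(LINT x|lborel. f x) \<ge> 0" by (rule Bochner_Integration.integral_nonneg) (use bdd_measD(2)[OF fB] in auto)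
  have e3: "q * (1 / 2) = \<gamma> - 1" using e2 by simp
  have "f x = (\<bar>\<phi> x\<bar> powr q) powr (1/2) * ((norm (grad \<phi> x))\<^sup>2) powr (1/2)" for x
    unfolding f_def powr_powr e3 by (simp add: powr_half_sqrt)
  then have fle: "(LINT x|lborel. f x) \<le> ?A powr (1/2) * ?E powr (1/2)"
    using Holder_two(2)[of "1/2" "1/2" lborel "\<lambda>x. \<bar>\<phi> x\<bar> powr q" "\<lambda>x. (norm (grad \<phi> x))\<^sup>2"] iq ig by simp
  have np: "n * p > 0" using n p by simp
  have "(LINT x|lborel. f x) powr (n * p) \<le> (?A powr (1/2) * ?E powr (1/2)) powr (n * p)"
    by (rule powr_mono2) (use fle f0 np in auto)
  then have A2: "?A \<le> \<gamma> powr (n * p) * (?A powr (n * p / 2) * ?E powr (n * p / 2))"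
    using order_trans[OF A1 mult_left_mono[OF _ powr_ge_zero, of _ _ \<gamma> "n * p"]] A0 E0
    by (simp add: powr_mult powr_powr)
  show ?thesis
  proof (cases "?A = 0")
    case True
    then show ?thesis by simp
  next
    case False
    then have Apos: "?A > 0" using A0 by linarith
    let ?r = "n * p / 2"
    \<comment> \<open>The power \<open>?r\<close> of the unknown integral is cancelled against the
      left-hand side. This leaves a positive exponent
      \<open>1 - ?r = (n - 2) / (2 * (n - 1))\<close> because \<open>n > 2\<close>, and raising to
      its reciprocal gives the claimed exponents.\<close>
    have "?A powr (1 - ?r) * ?A powr ?r \<le> (\<gamma> powr (n * p) * ?E powr ?r) * ?A powr ?r"
      using A2 Apos by (simp add: powr_add[symmetric] mult_ac)
    then have A3: "?A powr (1 - ?r) \<le> \<gamma> powr (n * p) * ?E powr ?r"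
      using Apos by (simp add: mult_le_cancel_right)
    have r0: "1 - ?r = (n - 2) / (2 * (n - 1))" using n by (simp add: p_def field_simps)
    have "n * (1 / a) / (b / (2 * a)) = 2 * n / b" if "a \<noteq> 0" "b \<noteq> 0" for a b :: real
      using that by (simp add: field_simps)
    from this[of "n - 1" "n - 2"] n have "n * (1 / (n - 1)) / ((n - 2) / (2 * (n - 1))) = 2 * n / (n - 2)"
      by linarith
    then have r1: "n * p / (1 - ?r) = q" unfolding r0 unfolding p_def q .
    have "?r / (1 - ?r) = (n * p / (1 - ?r)) / 2" by (simp only: divide_divide_eq_left mult.commute)
    then have r2: "?r / (1 - ?r) = q / 2" unfolding r1 .
    have "1 - ?r > 0" unfolding r0 using n by simp
    note r = this r1 r2
    have "?A = (?A powr (1 - ?r)) powr (1 / (1 - ?r))" using Apos r(1) by (simp add: powr_powr)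
    also have "\<dots> \<le> (\<gamma> powr (n * p) * ?E powr ?r) powr (1 / (1 - ?r))"
      by (rule powr_mono2) (use A3 r(1) in auto)
    also have "\<dots> = \<gamma> powr (n * p / (1 - ?r)) * ?E powr (?r / (1 - ?r))"
      by (simp add: powr_mult powr_powr)
    finally show ?thesis unfolding r .
  qed
qed

text \<open>At the threshold \<open>T\<close>, chosen so that
  \<open>\<delta> * T powr (q - a) = 1\<close>, the higher power takes over; below it the lower
  power is at most \<open>T powr a\<close>.\<close>

lemma powr_absorb:
  fixes a q \<delta> :: real
  assumes "0 \<le> a" "a < q" "\<delta> > 0"
  obtains C where "C \<ge> 0" "\<And>t. t \<ge> 0 \<Longrightarrow> t powr a \<le> \<delta> * t powr q + C"
proof -
  define T where "T = (1 / \<delta>) powr (1 / (q - a))"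
  have T: "T > 0" "T powr (q - a) = 1 / \<delta>" using assms by (auto simp: T_def powr_powr)
  show thesis
  proof (rule that[of "T powr a"])
    fix t :: real assume t: "t \<ge> 0"
    show "t powr a \<le> \<delta> * t powr q + T powr a"
    proof (cases "t \<le> T")
      case True
      then have "t powr a \<le> T powr a" using t assms by (intro powr_mono2) auto
      then show ?thesis using assms by (smt (verit) powr_ge_zero mult_nonneg_nonneg)
    next
      case False
      then have "1 / \<delta> \<le> t powr (q - a)"
        unfolding T(2)[symmetric] using T assms by (intro powr_mono2) auto
      then have "1 \<le> \<delta> * t powr (q - a)" using assms by (simp add: field_simps)
      then have "t powr a * 1 \<le> t powr a * (\<delta> * t powr (q - a))" by (intro mult_left_mono) auto
      also have "\<dots> = \<delta> * t powr q"
        using False T by (simp add: powr_add[symmetric])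
      finally show ?thesis by (smt (verit) powr_ge_zero)
    qed
  qed auto
qed

text \<open>The interpolation behind the step from convergence in mean to convergence in mean
  square: the critical integrals stay bounded and get a small factor, while the large constant falls
  on the first power.\<close>

lemma sq_absorb:
  fixes q \<delta> :: real
  assumes "q > 2" "\<delta> > 0"
  obtains C where "C \<ge> 0" "\<And>t. t\<^sup>2 \<le> \<delta> * \<bar>t\<bar> powr q + C * \<bar>t\<bar>"
proof -
  obtain C where C: "C \<ge> 0" "\<And>t. t \<ge> 0 \<Longrightarrow> t powr 1 \<le> \<delta> * t powr (q - 1) + C"
    using powr_absorb[of 1 "q - 1" \<delta>] assms by auto
  show thesis
  proof (rule that[OF C(1)])
    fix t :: real
    have "\<bar>t\<bar> * \<bar>t\<bar> \<le> (\<delta> * \<bar>t\<bar> powr (q - 1) + C) * \<bar>t\<bar>"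
      using C(2)[of "\<bar>t\<bar>"] by (intro mult_right_mono) (auto split: if_splits)
    also have "\<dots> = \<delta> * (\<bar>t\<bar> powr (q - 1) * \<bar>t\<bar> powr 1) + C * \<bar>t\<bar>"
      by (simp add: algebra_simps)
    also have "\<bar>t\<bar> powr (q - 1) * \<bar>t\<bar> powr 1 = \<bar>t\<bar> powr q"
      unfolding powr_add[symmetric] by simp
    finally show "t\<^sup>2 \<le> \<delta> * \<bar>t\<bar> powr q + C * \<bar>t\<bar>" by (simp add: power2_eq_square)
  qed
qed

section \<open>The Sobolev embedding of \<open>H10\<close> and its best constant\<close>

locale sobolev_domain = bounded_open_set \<Omega> for \<Omega> :: "'a::euclidean_space set" +
  assumes dim: "DIM('a) \<ge> 3"
begin

definition q :: real where "q = crit_exp DIM('a)"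

lemma q_gt_2: "q > 2"
proof -
  have "real DIM('a) \<ge> 3" using dim by simp
  then show ?thesis by (simp add: q_def crit_exp_def field_simps)
qed

text \<open>The constant of \<open>sobolev_test_function\<close>. It depends on the dimension only
  and need not be the best one.\<close>

definition C0 :: real where "C0 = (2 * (real DIM('a) - 1) / (real DIM('a) - 2)) powr q"

lemma C0_pos: "C0 > 0"
proof -
  have "real DIM('a) \<ge> 3" using dim by simp
  then show ?thesis by (simp add: C0_def)
qed

lemma sobolev_test:
  assumes \<phi>: "\<phi> \<in> test_functions \<Omega>"
  shows "integrable M (\<lambda>x. \<bar>\<phi> x\<bar> powr q)"
    "(LINT x|M. \<bar>\<phi> x\<bar> powr q) \<le> C0 * l2norm M (grad \<phi>) powr q"
proof -
  have m: "(\<lambda>x. \<bar>\<phi> x\<bar> powr q) \<in> borel_measurable borel"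
    using test_function_borel[OF \<phi>] by simp
  have z: "\<bar>\<phi> x\<bar> powr q = 0" if "x \<notin> \<Omega>" for x using test_function_zero_outside[OF \<phi> that] by simp
  obtain B R where B: "\<And>x. \<bar>\<phi> x\<bar> \<le> B" "\<And>x. norm x > R \<Longrightarrow> \<phi> x = 0" using test_function_bounded[OF \<phi>] by metis
  have "integrable lborel (\<lambda>x. \<bar>\<phi> x\<bar> powr q)"
    by (rule integrable_bounded_support[where R = R and B = "B powr q"])
      (use m B q_gt_2 in \<open>auto intro!: powr_mono2\<close>)
  then show "integrable M (\<lambda>x. \<bar>\<phi> x\<bar> powr q)" using M_integral_eq(2)[OF m z] by blast
  have g: "(\<lambda>x. (norm (grad \<phi> x))\<^sup>2) \<in> borel_measurable borel"
    using grad_borel[OF \<phi>] by simp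
  have gz: "(norm (grad \<phi> x))\<^sup>2 = 0" if "x \<notin> \<Omega>" for x using grad_zero_outside[OF \<phi> that] by simp
  have "(LINT x|lborel. (norm (grad \<phi> x))\<^sup>2) = (l2norm M (grad \<phi>))\<^sup>2"
    using M_integral_eq(1)[OF g gz] by (simp add: l2norm_sq)
  then have "(LINT x|lborel. (norm (grad \<phi> x))\<^sup>2) powr (q / 2) = l2norm M (grad \<phi>) powr q"
    by (cases "l2norm M (grad \<phi>) = 0") (auto simp: powr_powr order_less_le simp flip: powr_numeral)
  then show "(LINT x|M. \<bar>\<phi> x\<bar> powr q) \<le> C0 * l2norm M (grad \<phi>) powr q"
    using sobolev_test_function[OF \<phi> dim] M_integral_eq(1)[OF m z] by (simp add: q_def C0_def)
qed

lemma l2norm_tendsto_AE_subseq: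
  assumes u: "\<And>n. sq_int M (u n)" "sq_int M u0" and lim: "(\<lambda>n. l2norm M (\<lambda>x. u n x - u0 x)) \<longlonglongrightarrow> 0"
  obtains r where "strict_mono r" "AE x in M. (\<lambda>n. u (r n) x) \<longlonglongrightarrow> u0 x"
proof -
  have "(\<lambda>n. LINT x|M. norm (u n x - u0 x)) \<longlonglongrightarrow> 0"
  proof (rule Lim_null_comparison)
    show "(\<lambda>n. sqrt (measure M (space M)) * l2norm M (\<lambda>x. u n x - u0 x)) \<longlonglongrightarrow> 0"
      using tendsto_mult_left[OF lim] by simp
    show "\<forall>\<^sub>F n in sequentially. norm (LINT x|M. norm (u n x - u0 x)) \<le> sqrt (measure M (space M)) * l2norm M (\<lambda>x. u n x - u0 x)"
      using L1_le_l2norm[OF sq_int_diff[OF u]] by (intro always_eventually) (auto simp: abs_of_nonneg)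
  qed
  from tendsto_L1_AE_subseq[OF _ this] sq_int_imp_integrable[OF sq_int_diff[OF u]]
  obtain r where r: "strict_mono r" "AE x in M. (\<lambda>n. u (r n) x - u0 x) \<longlonglongrightarrow> 0" by auto
  from r(2) have "AE x in M. (\<lambda>n. u (r n) x) \<longlonglongrightarrow> u0 x"
    by eventually_elim (simp add: LIM_zero_iff)
  with r(1) show thesis by (rule that)
qed

text \<open>Fatou's lemma along approximating test functions that converge almost everywhere. Their
  gradient norms merely converge to that of \<open>u\<close>, so the bound is first obtained up to
  an arbitrary \<open>e > 0\<close>.\<close>

lemma sobolev_H10:
  assumes u: "u \<in> H10 \<Omega>"
  shows "integrable M (\<lambda>x. \<bar>u x\<bar> powr q)" "(LINT x|M. \<bar>u x\<bar> powr q) \<le> C0 * H10_norm \<Omega> u powr q"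
proof -
  obtain \<phi> where \<phi>: "\<And>n. \<phi> n \<in> test_functions \<Omega>" "(\<lambda>n. l2norm M (\<lambda>x. \<phi> n x - u x)) \<longlonglongrightarrow> 0"
    "(\<lambda>n. l2norm M (\<lambda>x. grad (\<phi> n) x - wg u x)) \<longlonglongrightarrow> 0" by (rule H10_approx[OF u]) (rule that)
  obtain r where r: "strict_mono r" "AE x in M. (\<lambda>n. \<phi> (r n) x) \<longlonglongrightarrow> u x"
    by (rule l2norm_tendsto_AE_subseq[OF sq_int_test_function[OF \<phi>(1)] H10_sq_int[OF u] \<phi>(2)]) (rule that)
  have "(\<lambda>n. l2norm M (grad (\<phi> n))) \<longlonglongrightarrow> l2norm M (wg u)"
    by (rule l2norm_tendsto[OF sq_int_grad[OF \<phi>(1)] H10_wg[OF u] \<phi>(3)])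
  then have "(\<lambda>n. l2norm M (grad (\<phi> (r n)))) \<longlonglongrightarrow> l2norm M (wg u)"
    using LIMSEQ_subseq_LIMSEQ[OF _ r(1)] unfolding o_def by blast
  then have lim: "(\<lambda>n. C0 * l2norm M (grad (\<phi> (r n))) powr q) \<longlonglongrightarrow> C0 * l2norm M (wg u) powr q"
    using q_gt_2 by (intro tendsto_mult tendsto_const tendsto_powr') auto
  have um: "u \<in> borel_measurable M" using H10_sq_int[OF u] by (rule sq_int_measurable)
  have F: "integrable M (\<lambda>x. \<bar>u x\<bar> powr q) \<and> (LINT x|M. \<bar>u x\<bar> powr q) \<le> C0 * H10_norm \<Omega> u powr q + e" if e: "e > 0" for e
  proof -
    have 1: "AE x in M. (\<lambda>n. \<bar>\<phi> (r n) x\<bar> powr q) \<longlonglongrightarrow> \<bar>u x\<bar> powr q"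
      using r(2) by eventually_elim (use q_gt_2 in \<open>intro tendsto_powr' tendsto_rabs tendsto_const; auto\<close>)
    have "\<forall>\<^sub>F n in sequentially. C0 * l2norm M (grad (\<phi> (r n))) powr q < C0 * l2norm M (wg u) powr q + e"
      using order_tendstoD(2)[OF lim] e by simp
    then have 2: "\<forall>\<^sub>F n in sequentially. (LINT x|M. \<bar>\<phi> (r n) x\<bar> powr q) \<le> C0 * l2norm M (wg u) powr q + e"
      by eventually_elim (rule order_trans[OF sobolev_test(2)[OF \<phi>(1)] less_imp_le])
    show ?thesis
      using Fatou_real[OF sobolev_test(1)[OF \<phi>(1)] _ _ _ 1 2] um by (simp add: H10_norm_eq)
  qed
  show "integrable M (\<lambda>x. \<bar>u x\<bar> powr q)" using F[of 1] by simp
  show "(LINT x|M. \<bar>u x\<bar> powr q) \<le> C0 * H10_norm \<Omega> u powr q"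
    by (rule field_le_epsilon) (use F in auto)
qed

definition K :: real where "K = sobolev_const \<Omega> powr (- q / 2)"

lemma K_nonneg: "K \<ge> 0" by (simp add: K_def)

text \<open>The infimum is taken over real numbers, so a lower bound for the quotients has to be
  exhibited before it can be compared with any of them. The constant \<open>C0\<close> supplies that
  bound and makes the infimum positive, after which the defining inequality for \<open>u\<close> can
  be solved for the critical integral.\<close>

lemma sobolev_K:
  assumes u: "u \<in> H10 \<Omega>"
  shows "(LINT x|M. \<bar>u x\<bar> powr q) \<le> K * dirichlet \<Omega> u powr (q / 2)"
proof (cases "AE x in M. u x = 0")
  case True
  then have "AE x in M. \<bar>u x\<bar> powr q = 0" by eventually_elim simp
  then have "(LINT x|M. \<bar>u x\<bar> powr q) = 0"
    by (rule integral_eq_zero_AE)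
  then show ?thesis by (simp add: K_nonneg)
next
  case False
  let ?A = "\<lambda>w. LINT x|M. \<bar>w x\<bar> powr q"
  let ?W = "{w \<in> H10 \<Omega>. \<not> (AE x in M. w x = 0)}"
  let ?r = "\<lambda>w. dirichlet \<Omega> w / ?A w powr (2 / q)"
  have S: "sobolev_const \<Omega> = (INF w\<in>?W. ?r w)"
    by (simp add: sobolev_const_def q_def)
  have uW: "u \<in> ?W" using u False by simp
  have Apos: "?A w > 0" if "w \<in> ?W" for w
  proof (rule ccontr)
    assume "\<not> ?A w > 0"
    moreover have "?A w \<ge> 0" by (rule Bochner_Integration.integral_nonneg) auto
    ultimately have "?A w = 0" by simp
    then have "AE x in M. \<bar>w x\<bar> powr q = 0"
      using integral_nonneg_eq_0_iff_AE[OF sobolev_H10(1)[of w]] that by auto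
    then have "AE x in M. w x = 0" by eventually_elim simp
    then show False using that by simp
  qed
  have dn: "dirichlet \<Omega> w powr (q/2) = H10_norm \<Omega> w powr q" for w
    unfolding H10_norm_sq[symmetric]
    by (cases "H10_norm \<Omega> w = 0") (auto simp: powr_powr order_less_le simp flip: powr_numeral)
  have low: "C0 powr (- 2 / q) \<le> ?r w" if w: "w \<in> ?W" for w
  proof -
    have "?A w \<le> C0 * dirichlet \<Omega> w powr (q / 2)"
      unfolding dn using sobolev_H10(2)[of w] w by simp
    then have "?A w powr (2 / q) \<le> (C0 * dirichlet \<Omega> w powr (q / 2)) powr (2 / q)"
      using Apos[OF w] q_gt_2 by (intro powr_mono2) auto
    also have "\<dots> = C0 powr (2 / q) * dirichlet \<Omega> w"
      using C0_pos q_gt_2 by (simp add: powr_mult powr_powr)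
    finally have "?A w powr (2 / q) * C0 powr (- 2 / q) \<le> (C0 powr (2 / q) * dirichlet \<Omega> w) * C0 powr (- 2 / q)"
      by (rule mult_right_mono) simp
    also have "\<dots> = dirichlet \<Omega> w * (C0 powr (2 / q) * C0 powr (- 2 / q))" by simp
    also have "C0 powr (2 / q) * C0 powr (- 2 / q) = 1"
      using C0_pos by (simp add: powr_add[symmetric])
    finally show ?thesis using Apos[OF w] by (simp add: pos_le_divide_eq mult.commute)
  qed
  have Sge: "sobolev_const \<Omega> \<ge> C0 powr (- 2 / q)"
    unfolding S by (rule cINF_greatest) (use uW low in auto)
  have "C0 powr (- 2 / q) > 0" using C0_pos by simp
  with Sge have Spos: "sobolev_const \<Omega> > 0" by linarith
  have "sobolev_const \<Omega> \<le> ?r u"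
    unfolding S by (rule cINF_lower[OF _ uW]) (use low in \<open>auto intro!: bdd_belowI2\<close>)
  then have "?A u powr (2 / q) \<le> dirichlet \<Omega> u / sobolev_const \<Omega>"
    using Apos[OF uW] Spos by (simp add: field_simps)
  then have "(?A u powr (2 / q)) powr (q / 2) \<le> (dirichlet \<Omega> u / sobolev_const \<Omega>) powr (q / 2)"
    using q_gt_2 by (intro powr_mono2) auto
  then show ?thesis
    using Apos[OF uW] Spos q_gt_2 by (simp add: powr_powr powr_divide K_def powr_minus_divide)
qed

end

section \<open>Compactness\<close>

text \<open>Averages over small balls are uniformly Lipschitz and \<open>L\<^sup>1\<close>-close to the function.\<close>

lemma translation_L1:
  fixes \<phi> :: "'a::euclidean_space \<Rightarrow> real"
  assumes \<phi>: "\<phi> \<in> test_functions \<Omega>"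
  shows "(\<integral>\<^sup>+x. ennreal \<bar>\<phi> (x + z) - \<phi> x\<bar> \<partial>lborel) \<le> ennreal (norm z * (LINT x|lborel. norm (grad \<phi> x)))"
proof -
  have cg: "continuous_on UNIV (\<lambda>s. grad \<phi> (x + s *\<^sub>R z))" for x
    by (rule continuous_on_compose2[OF grad_continuous[OF \<phi>]]) (auto intro!: continuous_intros)
  let ?h = "\<lambda>x s. ennreal (indicator {0..1} s * (norm (grad \<phi> (x + s *\<^sub>R z)) * norm z))"
  have pt: "ennreal \<bar>\<phi> (x + z) - \<phi> x\<bar> \<le> (\<integral>\<^sup>+s. ?h x s \<partial>lborel)" for x
  proof -
    have der: "((\<lambda>s. \<phi> (x + s *\<^sub>R z)) has_vector_derivative (grad \<phi> (x + s *\<^sub>R z) \<bullet> z)) (at s within {0..1})" for s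
    proof -
      have "((\<lambda>s. x + s *\<^sub>R z) has_derivative (\<lambda>h. h *\<^sub>R z)) (at s)"
        by (auto intro!: derivative_eq_intros)
      from has_derivative_compose[OF this test_function_has_derivative[OF \<phi>, of "x + s *\<^sub>R z"]]
      have "((\<lambda>s. \<phi> (x + s *\<^sub>R z)) has_vector_derivative (grad \<phi> (x + s *\<^sub>R z) \<bullet> z)) (at s)"
        by (simp add: has_vector_derivative_def)
      then show ?thesis by (rule has_vector_derivative_at_within)
    qed
    have i1: "integrable lborel (\<lambda>s. indicator {0..1} s *\<^sub>R (grad \<phi> (x + s *\<^sub>R z) \<bullet> z))"
      by (rule borel_integrable_compact) (auto intro!: continuous_intros continuous_on_subset[OF cg])
    have i2: "integrable lborel (\<lambda>s. indicator {0..1} s *\<^sub>R (norm (grad \<phi> (x + s *\<^sub>R z)) * norm z))"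
      by (rule borel_integrable_compact) (auto intro!: continuous_intros continuous_on_subset[OF cg])
    have "(LINT s|lborel. indicator {0..1} s *\<^sub>R (grad \<phi> (x + s *\<^sub>R z) \<bullet> z)) = \<phi> (x + 1 *\<^sub>R z) - \<phi> (x + 0 *\<^sub>R z)"
      by (rule integral_FTC_atLeastAtMost[OF _ der]) (auto intro!: continuous_intros continuous_on_subset[OF cg])
    then have "\<phi> (x + z) - \<phi> x = (LINT s|lborel. indicator {0..1} s *\<^sub>R (grad \<phi> (x + s *\<^sub>R z) \<bullet> z))"
      by simp
    also have "\<bar>\<dots>\<bar> \<le> (LINT s|lborel. \<bar>indicator {0..1} s *\<^sub>R (grad \<phi> (x + s *\<^sub>R z) \<bullet> z)\<bar>)"
      using integral_abs_bound by blast
    also have "\<dots> \<le> (LINT s|lborel. indicator {0..1} s *\<^sub>R (norm (grad \<phi> (x + s *\<^sub>R z)) * norm z))"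
      by (rule integral_mono[OF integrable_abs[OF i1] i2]) (auto simp: indicator_def Cauchy_Schwarz_ineq2)
    finally have "ennreal \<bar>\<phi> (x + z) - \<phi> x\<bar> \<le> ennreal (LINT s|lborel. indicator {0..1} s *\<^sub>R (norm (grad \<phi> (x + s *\<^sub>R z)) * norm z))"
      by (rule ennreal_leI)
    also have "\<dots> = (\<integral>\<^sup>+s. ?h x s \<partial>lborel)"
      using nn_integral_eq_integral[OF i2] by simp
    finally show ?thesis .
  qed
  have [measurable]: "grad \<phi> \<in> borel_measurable borel" by (rule grad_borel[OF \<phi>])
  have gi: "integrable lborel (\<lambda>x. norm (grad \<phi> x))"
    using integrable_norm[OF Bochner_Integration.integrable_sum[of Basis lborel "\<lambda>i x. frechet_derivative \<phi> (at x) i *\<^sub>R i"]]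
      test_function_integrable[OF test_function_partial[OF \<phi>]] unfolding grad_def by auto
  have "(\<integral>\<^sup>+x. ennreal \<bar>\<phi> (x + z) - \<phi> x\<bar> \<partial>lborel) \<le> (\<integral>\<^sup>+x. \<integral>\<^sup>+s. ?h x s \<partial>lborel \<partial>lborel)"
    by (intro nn_integral_mono pt)
  \<comment> \<open>After the integrals are exchanged, each inner one is the integral of a translate
    of \<open>norm (grad \<phi>)\<close> and does not depend on \<open>s\<close>; the interval for
    \<open>s\<close> has length 1.\<close>
  also have "\<dots> = (\<integral>\<^sup>+s. \<integral>\<^sup>+x. ?h x s \<partial>lborel \<partial>lborel)"
    by (rule lborel_pair.Fubini'[symmetric]) measurable
  also have "\<dots> = (\<integral>\<^sup>+s. ennreal (norm z * (LINT x|lborel. norm (grad \<phi> x))) * indicator {0..1::real} s \<partial>lborel)"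
  proof (rule nn_integral_cong)
    fix s :: real
    have "(\<integral>\<^sup>+x. ?h x s \<partial>lborel) = (\<integral>\<^sup>+x. ennreal (indicator {0..1} s * norm z) * ennreal (norm (grad \<phi> (x + s *\<^sub>R z))) \<partial>lborel)"
      by (intro nn_integral_cong) (simp add: ennreal_mult'[symmetric] mult_ac)
    also have "\<dots> = ennreal (indicator {0..1} s * norm z) * (\<integral>\<^sup>+x. ennreal (norm (grad \<phi> x)) \<partial>lborel)"
      by (subst nn_integral_cmult, measurable, subst nn_integral_lborel_translate) auto
    also have "(\<integral>\<^sup>+x. ennreal (norm (grad \<phi> x)) \<partial>lborel) = ennreal (LINT x|lborel. norm (grad \<phi> x))"
      by (rule nn_integral_eq_integral[OF gi]) auto
    also have "ennreal (indicator {0..1} s * norm z) * \<dots> = ennreal (norm z * (LINT x|lborel. norm (grad \<phi> x))) * indicator {0..1::real} s"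
      by (cases "s \<in> {0..1}") (auto simp: ennreal_mult')
    finally show "(\<integral>\<^sup>+x. ?h x s \<partial>lborel) = ennreal (norm z * (LINT x|lborel. norm (grad \<phi> x))) * indicator {0..1::real} s" .
  qed
  also have "\<dots> = ennreal (norm z * (LINT x|lborel. norm (grad \<phi> x)))"
    by (subst nn_integral_cmult_indicator) auto
  finally show ?thesis .
qed

text \<open>The volume of the ball is not divided out, so that the supremum and Lipschitz bounds are
  the same for all radii; the division is made only when the average is compared with
  \<open>\<phi>\<close>.\<close>

definition ball_int :: "real \<Rightarrow> ('a::euclidean_space \<Rightarrow> real) \<Rightarrow> 'a \<Rightarrow> real" where
  "ball_int \<epsilon> \<phi> x = (LINT z|lborel. indicator (ball 0 \<epsilon>) z * \<phi> (x + z))"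

context
  fixes \<phi> :: "'a::euclidean_space \<Rightarrow> real" and \<Omega> :: "'a set" and L :: real
  assumes \<phi>: "\<phi> \<in> test_functions \<Omega>" and gL: "(LINT x|lborel. norm (grad \<phi> x)) \<le> L"
begin

lemma integrable_ball_shift: "integrable lborel (\<lambda>z. indicator (ball 0 \<epsilon>) z * \<phi> (x + z))"
proof -
  have "integrable lborel (\<lambda>z. \<phi> (z + x))"
    using lborel_integral_translate(2) test_function_borel[OF \<phi>] test_function_integrable[OF \<phi>] by blast
  from integrable_mult_indicator[OF _ this, of "ball 0 \<epsilon>"] show ?thesis by (simp add: add.commute)
qed

lemma ball_int_bound: "\<bar>ball_int \<epsilon> \<phi> x\<bar> \<le> (LINT x|lborel. \<bar>\<phi> x\<bar>)"
proof -
  have m: "(\<lambda>x. \<bar>\<phi> x\<bar>) \<in> borel_measurable borel" using test_function_borel[OF \<phi>] by simp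
  have i: "integrable lborel (\<lambda>z. \<bar>\<phi> (z + x)\<bar>)"
    using lborel_integral_translate(2)[OF m] integrable_abs[OF test_function_integrable[OF \<phi>]] by blast
  have "\<bar>ball_int \<epsilon> \<phi> x\<bar> \<le> (LINT z|lborel. \<bar>indicator (ball 0 \<epsilon>) z * \<phi> (x + z)\<bar>)"
    unfolding ball_int_def using integral_abs_bound by blast
  also have "\<dots> \<le> (LINT z|lborel. \<bar>\<phi> (z + x)\<bar>)"
    by (rule integral_mono[OF integrable_abs[OF integrable_ball_shift] i]) (auto simp: indicator_def add.commute)
  also have "\<dots> = (LINT x|lborel. \<bar>\<phi> x\<bar>)" by (rule lborel_integral_translate(1)[OF m])
  finally show ?thesis .
qed

lemma L_nonneg: "L \<ge> 0"
proof -
  have "0 \<le> (LINT x|lborel. norm (grad \<phi> x))" by (rule Bochner_Integration.integral_nonneg) auto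
  with gL show ?thesis by linarith
qed

lemma translation_L1_L: "(\<integral>\<^sup>+x. ennreal \<bar>\<phi> (x + z) - \<phi> x\<bar> \<partial>lborel) \<le> ennreal (norm z * L)"
  by (rule order_trans[OF translation_L1[OF \<phi>]]) (auto intro!: ennreal_leI mult_left_mono gL)

text \<open>Moving the centre of the ball amounts to translating \<open>\<phi>\<close> by
  \<open>x - y\<close>. Dropping the indicator only enlarges the integral, and
  \<open>translation_L1\<close> gives its size.\<close>

lemma ball_int_Lipschitz: "\<bar>ball_int \<epsilon> \<phi> x - ball_int \<epsilon> \<phi> y\<bar> \<le> norm (x - y) * L"
proof -
  have [measurable]: "\<phi> \<in> borel_measurable borel" by (rule test_function_borel[OF \<phi>])
  have "ennreal \<bar>ball_int \<epsilon> \<phi> x - ball_int \<epsilon> \<phi> y\<bar> =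
      ennreal (norm (LINT z|lborel. indicator (ball 0 \<epsilon>) z * \<phi> (x + z) - indicator (ball 0 \<epsilon>) z * \<phi> (y + z)))"
    unfolding ball_int_def by (simp add: integrable_ball_shift)
  also have "\<dots> \<le> (\<integral>\<^sup>+z. ennreal (norm (indicator (ball 0 \<epsilon>) z * \<phi> (x + z) - indicator (ball 0 \<epsilon>) z * \<phi> (y + z))) \<partial>lborel)"
    by (rule integral_norm_bound_ennreal) (intro Bochner_Integration.integrable_diff integrable_ball_shift)
  also have "\<dots> \<le> (\<integral>\<^sup>+z. ennreal \<bar>\<phi> ((z + y) + (x - y)) - \<phi> (z + y)\<bar> \<partial>lborel)"
    by (intro nn_integral_mono ennreal_leI) (auto simp: indicator_def add.commute)
  also have "\<dots> = (\<integral>\<^sup>+z. ennreal \<bar>\<phi> (z + (x - y)) - \<phi> z\<bar> \<partial>lborel)"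
    by (rule nn_integral_lborel_translate) measurable
  also have "\<dots> \<le> ennreal (norm (x - y) * L)" by (rule translation_L1_L)
  finally show ?thesis using L_nonneg by (simp add: ennreal_le_iff)
qed

lemma ball_int_measurable: "ball_int \<epsilon> \<phi> \<in> borel_measurable borel"
proof (rule borel_measurable_continuous_onI)
  have "L-lipschitz_on UNIV (ball_int \<epsilon> \<phi>)"
    by (rule lipschitz_onI) (use ball_int_Lipschitz L_nonneg in \<open>auto simp: dist_norm mult.commute\<close>)
  then show "continuous_on UNIV (ball_int \<epsilon> \<phi>)" by (rule lipschitz_on_continuous_on)
qed

text \<open>The error is an average of the differences \<open>\<phi> (x + z) - \<phi> x\<close> over
  shifts of length below \<open>\<epsilon>\<close>. After Tonelli's theorem each shift contributes
  at most \<open>\<epsilon> * L\<close>.\<close>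

lemma ball_int_close:
  assumes "\<epsilon> > 0"
  shows "(\<integral>\<^sup>+x. ennreal \<bar>ball_int \<epsilon> \<phi> x / measure lborel (ball 0 \<epsilon> :: 'a set) - \<phi> x\<bar> \<partial>lborel) \<le> ennreal (\<epsilon> * L)"
proof -
  have [measurable]: "\<phi> \<in> borel_measurable borel" by (rule test_function_borel[OF \<phi>])
  let ?B = "ball 0 \<epsilon> :: 'a set"
  have [measurable]: "?B \<in> sets borel" by simp
  define c where "c = measure lborel ?B"
  have fin: "emeasure lborel ?B < \<infinity>" by (rule emeasure_bounded_finite) simp
  have c: "c > 0"
    unfolding c_def using content_ball_pos[OF assms, of 0] by simp
  have ec: "emeasure lborel ?B = ennreal c" using fin by (simp add: c_def emeasure_eq_ennreal_measure)
  have iB: "integrable lborel (\<lambda>z. indicator ?B z * \<phi> x)" for x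
    using fin by (intro integrable_mult_left integrable_real_indicator) auto
  have pt: "ennreal \<bar>ball_int \<epsilon> \<phi> x / c - \<phi> x\<bar> \<le> ennreal (1 / c) * (\<integral>\<^sup>+z. indicator ?B z * ennreal \<bar>\<phi> (x + z) - \<phi> x\<bar> \<partial>lborel)" for x
  proof -
    have "(LINT z|lborel. indicator ?B z * \<phi> x) = c * \<phi> x" by (simp add: c_def)
    then have "ball_int \<epsilon> \<phi> x / c - \<phi> x = (1 / c) * (LINT z|lborel. indicator ?B z * \<phi> (x + z) - indicator ?B z * \<phi> x)"
      using c iB[of x] by (subst Bochner_Integration.integral_diff[OF integrable_ball_shift]) (auto simp: ball_int_def field_simps)
    then have "ennreal \<bar>ball_int \<epsilon> \<phi> x / c - \<phi> x\<bar> = ennreal (1 / c) * ennreal (norm (LINT z|lborel. indicator ?B z * \<phi> (x + z) - indicator ?B z * \<phi> x))"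
      using c by (simp add: abs_mult ennreal_mult'[symmetric])
    also have "ennreal (norm (LINT z|lborel. indicator ?B z * \<phi> (x + z) - indicator ?B z * \<phi> x)) \<le>
       (\<integral>\<^sup>+z. ennreal (norm (indicator ?B z * \<phi> (x + z) - indicator ?B z * \<phi> x)) \<partial>lborel)"
      by (rule integral_norm_bound_ennreal) (intro Bochner_Integration.integrable_diff integrable_ball_shift iB)
    also have "\<dots> = (\<integral>\<^sup>+z. indicator ?B z * ennreal \<bar>\<phi> (x + z) - \<phi> x\<bar> \<partial>lborel)"
      by (intro nn_integral_cong) (auto simp: indicator_def)
    finally show ?thesis by (simp add: mult_left_mono)
  qed
  have "(\<integral>\<^sup>+x. ennreal \<bar>ball_int \<epsilon> \<phi> x / c - \<phi> x\<bar> \<partial>lborel) \<le>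
     (\<integral>\<^sup>+x. ennreal (1 / c) * (\<integral>\<^sup>+z. indicator ?B z * ennreal \<bar>\<phi> (x + z) - \<phi> x\<bar> \<partial>lborel) \<partial>lborel)"
    by (intro nn_integral_mono pt)
  also have "\<dots> = ennreal (1 / c) * (\<integral>\<^sup>+x. \<integral>\<^sup>+z. indicator ?B z * ennreal \<bar>\<phi> (x + z) - \<phi> x\<bar> \<partial>lborel \<partial>lborel)"
    by (rule nn_integral_cmult) measurable
  also have "(\<integral>\<^sup>+x. \<integral>\<^sup>+z. indicator ?B z * ennreal \<bar>\<phi> (x + z) - \<phi> x\<bar> \<partial>lborel \<partial>lborel) =
      (\<integral>\<^sup>+z. \<integral>\<^sup>+x. indicator ?B z * ennreal \<bar>\<phi> (x + z) - \<phi> x\<bar> \<partial>lborel \<partial>lborel)"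
    by (rule lborel_pair.Fubini'[symmetric]) measurable
  also have "\<dots> \<le> (\<integral>\<^sup>+z. ennreal (\<epsilon> * L) * indicator ?B z \<partial>lborel)"
  proof (rule nn_integral_mono)
    fix z
    have "(\<integral>\<^sup>+x. indicator ?B z * ennreal \<bar>\<phi> (x + z) - \<phi> x\<bar> \<partial>lborel) =
      indicator ?B z * (\<integral>\<^sup>+x. ennreal \<bar>\<phi> (x + z) - \<phi> x\<bar> \<partial>lborel)"
      by (rule nn_integral_cmult) measurable
    also have "\<dots> \<le> indicator ?B z * ennreal (norm z * L)"
      by (intro mult_left_mono translation_L1_L) auto
    also have "\<dots> \<le> ennreal (\<epsilon> * L) * indicator ?B z"
      using L_nonneg by (auto simp: indicator_def intro!: ennreal_leI mult_right_mono)
    finally show "(\<integral>\<^sup>+x. indicator ?B z * ennreal \<bar>\<phi> (x + z) - \<phi> x\<bar> \<partial>lborel) \<le> ennreal (\<epsilon> * L) * indicator ?B z" .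
  qed
  also have "(\<integral>\<^sup>+z. ennreal (\<epsilon> * L) * indicator ?B z \<partial>lborel) = ennreal (\<epsilon> * L) * ennreal c"
    by (subst nn_integral_cmult_indicator) (auto simp: ec)
  also have "ennreal (1 / c) * (ennreal (\<epsilon> * L) * ennreal c) = ennreal (\<epsilon> * L)"
    using c L_nonneg assms by (simp add: ennreal_mult'[symmetric] ennreal_mult[symmetric])
  finally show ?thesis unfolding c_def by (simp add: mult_left_mono)
qed

end

section \<open>Rellich's theorem and weak limits\<close>

context sobolev_domain
begin

lemma M_nn_integral_le:
  assumes w: "w \<in> borel_measurable borel" "\<And>x. 0 \<le> w x" and le: "(\<integral>\<^sup>+x. ennreal (w x) \<partial>lborel) \<le> ennreal C" "C \<ge> 0"
  shows "integrable M w" "(LINT x|M. w x) \<le> C"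
proof -
  have wM: "w \<in> borel_measurable M" by (rule borel_imp_M[OF w(1)])
  have "(\<integral>\<^sup>+x. ennreal (w x) \<partial>M) = (\<integral>\<^sup>+x. ennreal (w x) * indicator \<Omega> x \<partial>lebesgue)"
    by (rule nn_integral_restrict_space) simp
  also have "\<dots> \<le> (\<integral>\<^sup>+x. ennreal (w x) \<partial>lebesgue)"
    by (intro nn_integral_mono) (auto simp: indicator_def)
  also have "\<dots> = (\<integral>\<^sup>+x. ennreal (w x) \<partial>lborel)"
    by (rule nn_integral_completion)
  finally have 1: "(\<integral>\<^sup>+x. ennreal (w x) \<partial>M) \<le> ennreal C" using le by simp
  show i: "integrable M w"
    by (rule integrableI_nonneg[OF wM]) (use w 1 in \<open>auto simp: le_less_trans\<close>)
  show "(LINT x|M. w x) \<le> C"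
    using 1 le(2) by (subst (asm) nn_integral_eq_integral[OF i]) (use w in auto)
qed

text \<open>For each radius the averages are bounded and uniformly Lipschitz. One subsequence makes
  them converge on a countable dense set for all radii, the Lipschitz bound extends this to every
  point, and dominated convergence makes it convergence in mean. Since the averages approximate the
  functions uniformly in the index, the functions themselves form a Cauchy sequence in mean.\<close>

lemma rellich_test:
  fixes \<phi> :: "nat \<Rightarrow> 'a \<Rightarrow> real"
  assumes \<phi>: "\<And>j. \<phi> j \<in> test_functions \<Omega>"
    and L: "\<And>j. (LINT x|lborel. norm (grad (\<phi> j) x)) \<le> L" "\<And>j. (LINT x|lborel. \<bar>\<phi> j x\<bar>) \<le> L"
  shows "\<exists>r::nat \<Rightarrow> nat. strict_mono r \<and>
    (\<forall>e>0. \<exists>N. \<forall>i\<ge>N. \<forall>j\<ge>N. (LINT x|M. \<bar>\<phi> (r i) x - \<phi> (r j) x\<bar>) < e)"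
proof -
  obtain D :: "'a set" where D: "countable D" "\<And>X. open X \<Longrightarrow> X \<noteq> {} \<Longrightarrow> \<exists>d\<in>D. d \<in> X"
    using countable_dense_exists by blast
  define eps where "eps k = inverse (real (Suc k))" for k
  have eps: "eps k > 0" for k by (simp add: eps_def)
  define b where "b k j x = ball_int (eps k) (\<phi> j) x" for k j x
  have L0: "L \<ge> 0" by (rule L_nonneg[OF \<phi> L(1)])
  have bL: "\<bar>b k j x\<bar> \<le> L" for k j x
    unfolding b_def using ball_int_bound[OF \<phi> L(1)] L(2) by (rule order_trans)
  have lip: "\<bar>b k j x - b k j y\<bar> \<le> norm (x - y) * L" for k j x y
    unfolding b_def by (rule ball_int_Lipschitz[OF \<phi> L(1)])
  have bm: "b k j \<in> borel_measurable borel" for k j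
    unfolding b_def by (rule ball_int_measurable[OF \<phi> L(1)])
  \<comment> \<open>The index set of pairs of a point and a radius is countable, so the diagonal
    argument is needed only once.\<close>
  obtain r where r: "strict_mono r" "\<And>y. y \<in> D \<times> (UNIV :: nat set) \<Longrightarrow> \<exists>l. (\<lambda>j. b (snd y) (r j) (fst y)) \<longlonglongrightarrow> l"
    by (rule function_convergent_subsequence[of "D \<times> (UNIV :: nat set)" "\<lambda>j y. b (snd y) j (fst y)" L])
      (use D(1) bL in auto)
  have conv: "convergent (\<lambda>j. b k (r j) x)" for k x
  proof -
    have "Cauchy (\<lambda>j. b k (r j) x)"
    proof (rule metric_CauchyI)
      fix e :: real assume e: "e > 0"
      \<comment> \<open>The summand 1 covers \<open>L = 0\<close>; the point \<open>d\<close> is so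
        close that the Lipschitz bound costs at most a third of \<open>e\<close> at each
        end.\<close>
      then have pos: "0 < e / (3 * (L + 1))" using L0 by simp
      then have "ball x (e / (3 * (L + 1))) \<noteq> {}" by simp
      from D(2)[OF open_ball this] obtain d where d: "d \<in> D" "d \<in> ball x (e / (3 * (L + 1)))" by blast
      have "norm (x - d) * L \<le> e / (3 * (L + 1)) * (L + 1)"
        using d(2) L0 less_imp_le[OF pos] by (intro mult_mono) (simp_all add: dist_norm)
      also have "\<dots> = e / 3" using L0 by (simp add: field_simps)
      finally have xd: "norm (x - d) * L \<le> e / 3" .
      have "Cauchy (\<lambda>j. b k (r j) d)"
        using r(2)[of "(d, k)"] d(1) by (auto intro: LIMSEQ_imp_Cauchy)
      then obtain N where N: "\<And>i j. i \<ge> N \<Longrightarrow> j \<ge> N \<Longrightarrow> dist (b k (r i) d) (b k (r j) d) < e / 3"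
        using e metric_CauchyD[of _ "e / 3"] by (metis zero_less_divide_iff zero_less_numeral)
      have "dist (b k (r i) x) (b k (r j) x) < e" if "i \<ge> N" "j \<ge> N" for i j
        using N[OF that] lip[of k "r i" x d] lip[of k "r j" x d] xd unfolding dist_real_def by linarith
      then show "\<exists>N. \<forall>i\<ge>N. \<forall>j\<ge>N. dist (b k (r i) x) (b k (r j) x) < e" by blast
    qed
    then show ?thesis by (rule Cauchy_convergent)
  qed
  define g where "g k x = lim (\<lambda>j. b k (r j) x)" for k x
  have lim: "(\<lambda>j. b k (r j) x) \<longlonglongrightarrow> g k x" for k x
    using conv unfolding g_def by (simp add: convergent_LIMSEQ_iff)
  have gm: "g k \<in> borel_measurable borel" for k
    by (rule borel_measurable_LIMSEQ_real[OF lim bm])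
  have gL: "\<bar>g k x\<bar> \<le> L" for k x
    by (rule LIMSEQ_le_const2[OF tendsto_rabs[OF lim]]) (use bL in auto)
  have bgL: "\<bar>b k j x - g k x\<bar> \<le> 2 * L" for k j x using bL[of k j x] gL[of k x] by linarith
  have bgm: "(\<lambda>x. \<bar>b k j x - g k x\<bar>) \<in> borel_measurable M" for k j
    by (rule borel_imp_M) (use bm gm in measurable)
  have bgi: "integrable M (\<lambda>x. \<bar>b k j x - g k x\<bar>)" for k j
    by (rule integrable_const_bound[of _ "2 * L"]) (use bgm bgL in auto)
  have dct: "(\<lambda>j. LINT x|M. \<bar>b k (r j) x - g k x\<bar>) \<longlonglongrightarrow> 0" for k
  proof -
    have "(\<lambda>j. LINT x|M. \<bar>b k (r j) x - g k x\<bar>) \<longlonglongrightarrow> (LINT x|M. 0)"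
    proof (rule integral_dominated_convergence[where w = "\<lambda>_. 2 * L"])
      show "AE x in M. (\<lambda>j. \<bar>b k (r j) x - g k x\<bar>) \<longlonglongrightarrow> 0"
        using tendsto_rabs_zero[OF LIM_zero[OF lim]] by (intro AE_I2) simp
    qed (use bgm bgL in auto)
    then show ?thesis by simp
  qed
  show ?thesis
  proof (intro exI[of _ r] conjI allI impI r(1))
    fix e :: real assume e: "e > 0"
    have "(\<lambda>k. eps k * L) \<longlonglongrightarrow> 0"
      unfolding eps_def using tendsto_mult_right[OF LIMSEQ_inverse_real_of_nat, of L] by simp
    then have "\<forall>\<^sub>F k in sequentially. eps k * L < e / 4" using e by (intro order_tendstoD) auto
    then obtain k where k: "eps k * L < e / 4" unfolding eventually_sequentially by auto
    define c where "c = measure lborel (ball 0 (eps k) :: 'a set)"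
    have c: "c > 0" unfolding c_def using content_ball_pos[OF eps[of k], of 0] by simp
    \<comment> \<open>The factor \<open>c\<close> prepares for the later division of the
      unnormalised averages by the volume \<open>c\<close> of the ball. Each of the four errors in
      the comparison then stays below a quarter of \<open>e\<close>.\<close>
    have "\<forall>\<^sub>F j in sequentially. (LINT x|M. \<bar>b k (r j) x - g k x\<bar>) < c * e / 4"
      using dct[of k] e c by (intro order_tendstoD) auto
    then obtain N where N: "\<And>j. j \<ge> N \<Longrightarrow> (LINT x|M. \<bar>b k (r j) x - g k x\<bar>) < c * e / 4"
      unfolding eventually_sequentially by auto
    have m: "(\<lambda>x. \<bar>b k j x / c - \<phi> j x\<bar>) \<in> borel_measurable borel" for j
      using bm test_function_borel[OF \<phi>] by measurable
    have nn: "(\<integral>\<^sup>+x. ennreal \<bar>b k j x / c - \<phi> j x\<bar> \<partial>lborel) \<le> ennreal (eps k * L)" for j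
      unfolding b_def c_def by (rule ball_int_close[OF \<phi> L(1) eps])
    have ce: "integrable M (\<lambda>x. \<bar>b k j x / c - \<phi> j x\<bar>)" "(LINT x|M. \<bar>b k j x / c - \<phi> j x\<bar>) \<le> eps k * L" for j
      using M_nn_integral_le[OF m _ nn] eps[of k] L0 by auto
    have "(LINT x|M. \<bar>\<phi> (r i) x - \<phi> (r j) x\<bar>) < e" if ij: "i \<ge> N" "j \<ge> N" for i j
    proof -
      let ?F = "\<lambda>x. (\<bar>b k (r i) x / c - \<phi> (r i) x\<bar> + \<bar>b k (r j) x / c - \<phi> (r j) x\<bar>) + (\<bar>b k (r i) x - g k x\<bar> / c + \<bar>b k (r j) x - g k x\<bar> / c)"
      have "(LINT x|M. \<bar>\<phi> (r i) x - \<phi> (r j) x\<bar>) \<le> (LINT x|M. ?F x)"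
      proof (rule integral_mono)
        show "integrable M (\<lambda>x. \<bar>\<phi> (r i) x - \<phi> (r j) x\<bar>)"
          by (intro integrable_abs Bochner_Integration.integrable_diff test_function_M \<phi>)
        show "integrable M ?F"
          by (intro Bochner_Integration.integrable_add ce(1) integrable_divide bgi)
        fix x
        have "b k (r i) x / c - b k (r j) x / c = ((b k (r i) x - g k x) - (b k (r j) x - g k x)) / c"
          by (simp add: diff_divide_distrib)
        also have "\<bar>\<dots>\<bar> \<le> (\<bar>b k (r i) x - g k x\<bar> + \<bar>b k (r j) x - g k x\<bar>) / c"
          using c by (simp add: divide_right_mono)
        finally show "\<bar>\<phi> (r i) x - \<phi> (r j) x\<bar> \<le> ?F x"
          unfolding add_divide_distrib by linarith
      qed
      also have "\<dots> = ((LINT x|M. \<bar>b k (r i) x / c - \<phi> (r i) x\<bar>) + (LINT x|M. \<bar>b k (r j) x / c - \<phi> (r j) x\<bar>)) +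
          ((LINT x|M. \<bar>b k (r i) x - g k x\<bar>) / c + (LINT x|M. \<bar>b k (r j) x - g k x\<bar>) / c)"
        using ce(1) bgi by simp
      also have "\<dots> < (e / 4 + e / 4) + (e / 4 + e / 4)"
      proof -
        have "(LINT x|M. \<bar>b k (r l) x - g k x\<bar>) / c < e / 4" if "l \<ge> N" for l
          using N[OF that] c by (simp add: field_simps)
        from this[OF ij(1)] this[OF ij(2)] ce(2)[of "r i"] ce(2)[of "r j"] k show ?thesis by linarith
      qed
      finally show ?thesis by simp
    qed
    then show "\<exists>N. \<forall>i\<ge>N. \<forall>j\<ge>N. (LINT x|M. \<bar>\<phi> (r i) x - \<phi> (r j) x\<bar>) < e" by blast
  qed
qed

text \<open>Weak closedness: among the test functions which are \<open>1/n\<close>-close in \<open>L\<^sup>2\<close>, almost minimisers of the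
  Dirichlet integral form a Cauchy sequence by the parallelogram law.\<close>

lemma H10_closed_bounded:
  assumes \<phi>: "\<And>n. \<phi> n \<in> test_functions \<Omega>" and B: "\<And>n. l2norm M (grad (\<phi> n)) \<le> B"
    and w: "sq_int M w" and lim: "(\<lambda>n. l2norm M (\<lambda>x. \<phi> n x - w x)) \<longlonglongrightarrow> 0"
  shows "w \<in> H10 \<Omega>"
proof -
  define e where "e n = inverse (real (Suc n))" for n
  have e: "e n > 0" "e \<longlonglongrightarrow> 0" for n
    unfolding e_def using LIMSEQ_inverse_real_of_nat by auto
  have e_mono: "m \<ge> n \<Longrightarrow> e m \<le> e n" for m n by (simp add: e_def)
  define A where "A n = {\<psi> \<in> test_functions \<Omega>. l2norm M (\<lambda>x. \<psi> x - w x) \<le> e n}" for n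
  define E where "E \<psi> = (l2norm M (grad \<psi>))\<^sup>2" for \<psi>
  define d where "d n = (INF \<psi>\<in>A n. E \<psi>)" for n
  have bb: "bdd_below (E ` A n)" for n by (rule bdd_belowI2[of _ 0]) (simp add: E_def)
  have mem: "\<exists>j. \<phi> j \<in> A n" for n
  proof -
    have "\<forall>\<^sub>F j in sequentially. l2norm M (\<lambda>x. \<phi> j x - w x) < e n"
      using e(1)[of n] by (intro order_tendstoD(2)[OF lim])
    then obtain j where "l2norm M (\<lambda>x. \<phi> j x - w x) < e n" unfolding eventually_sequentially by auto
    then show ?thesis using \<phi> by (auto simp: A_def intro!: exI[of _ j])
  qed
  have sub: "A m \<subseteq> A n" if "m \<ge> n" for m n using e_mono[OF that] by (auto simp: A_def)
  have dle: "d n \<le> E \<psi>" if "\<psi> \<in> A n" for n \<psi> unfolding d_def by (rule cINF_lower[OF bb that])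
  \<comment> \<open>Smaller tolerances leave fewer competitors, so the infima increase; by
    \<open>mem\<close> and \<open>B\<close> they stay below the square of \<open>B\<close>.\<close>
  have dinc: "incseq d"
    unfolding incseq_def d_def
  proof (intro allI impI)
    fix m n :: nat assume "m \<le> n"
    then show "(INF \<psi>\<in>A m. E \<psi>) \<le> (INF \<psi>\<in>A n. E \<psi>)"
      using mem[of n] sub[of m n] bb by (intro cINF_superset_mono) auto
  qed
  have dB: "d n \<le> B\<^sup>2" for n
  proof -
    from mem[of n] obtain j where "\<phi> j \<in> A n" ..
    then have "d n \<le> E (\<phi> j)" by (rule dle)
    also have "\<dots> \<le> B\<^sup>2" unfolding E_def by (intro power_mono B) simp
    finally show ?thesis .
  qed
  obtain dl where "d \<longlonglongrightarrow> dl" using incseq_convergent[OF dinc] dB by blast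
  then have dC: "Cauchy d" by (rule LIMSEQ_imp_Cauchy)
  have "\<exists>\<psi>. \<psi> \<in> A n \<and> E \<psi> < d n + e n" for n
  proof -
    have "\<exists>\<psi>\<in>A n. E \<psi> < d n + e n"
      using cINF_less_iff[OF _ bb, of n "d n + e n"] mem[of n] e(1)[of n] unfolding d_def by auto
    then show ?thesis by blast
  qed
  then obtain \<psi> where \<psi>: "\<And>n. \<psi> n \<in> A n" "\<And>n. E (\<psi> n) < d n + e n" by metis
  have \<psi>t: "\<psi> n \<in> test_functions \<Omega>" and \<psi>w: "l2norm M (\<lambda>x. \<psi> n x - w x) \<le> e n" for n
    using \<psi>(1)[of n] by (auto simp: A_def)
  have est: "(l2norm M (\<lambda>x. grad (\<psi> n) x - grad (\<psi> m) x))\<^sup>2 \<le> 2 * (d m - d n) + 4 * e n" if mn: "m \<ge> n" for m n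
  proof -
    \<comment> \<open>The set \<open>A n\<close> is convex, so the midpoint competes for the infimum
      \<open>d n\<close>.\<close>
    have mid: "(\<lambda>x. 1/2 * \<psi> n x + 1/2 * \<psi> m x) \<in> A n"
    proof -
      have "l2norm M (\<lambda>x. (1/2) *\<^sub>R (\<psi> n x - w x) + (1/2) *\<^sub>R (\<psi> m x - w x)) \<le>
          l2norm M (\<lambda>x. (1/2) *\<^sub>R (\<psi> n x - w x)) + l2norm M (\<lambda>x. (1/2) *\<^sub>R (\<psi> m x - w x))"
        by (intro l2norm_triangle sq_int_scaleR sq_int_diff sq_int_test_function \<psi>t w)
      also have "\<dots> = 1/2 * l2norm M (\<lambda>x. \<psi> n x - w x) + 1/2 * l2norm M (\<lambda>x. \<psi> m x - w x)"
        by (simp add: l2norm_def power_divide real_sqrt_divide)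
      also have "\<dots> \<le> e n" using \<psi>w[of n] \<psi>w[of m] e_mono[OF mn] by linarith
      also have "(\<lambda>x. (1/2) *\<^sub>R (\<psi> n x - w x) + (1/2) *\<^sub>R (\<psi> m x - w x)) = (\<lambda>x. (1/2 * \<psi> n x + 1/2 * \<psi> m x) - w x)"
        by (auto simp: algebra_simps)
      finally show ?thesis
        using test_function_lincomb[OF \<psi>t \<psi>t, of "1/2" n "1/2" m] unfolding A_def by blast
    qed
    have g: "sq_int M (grad (\<psi> n))" for n by (rule sq_int_grad[OF \<psi>t])
    have "grad (\<lambda>x. 1/2 * \<psi> n x + 1/2 * \<psi> m x) = (\<lambda>x. (1/2) *\<^sub>R grad (\<psi> n) x + (1/2) *\<^sub>R grad (\<psi> m) x)"
      by (rule ext) (rule grad_lincomb[OF \<psi>t \<psi>t])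
    then have "E (\<lambda>x. 1/2 * \<psi> n x + 1/2 * \<psi> m x) = (1/4) * E (\<psi> n) + (1/2) * (LINT x|M. grad (\<psi> n) x \<bullet> grad (\<psi> m) x) + (1/4) * E (\<psi> m)"
      using l2norm_sq_lincomb[OF g g, of "1/2" n "1/2" m] by (simp add: E_def l2norm_sq power_divide)
    then have 1: "d n \<le> (1/4) * E (\<psi> n) + (1/2) * (LINT x|M. grad (\<psi> n) x \<bullet> grad (\<psi> m) x) + (1/4) * E (\<psi> m)"
      using dle[OF mid] by simp
    have 2: "(l2norm M (\<lambda>x. grad (\<psi> n) x - grad (\<psi> m) x))\<^sup>2 =
        E (\<psi> n) - 2 * (LINT x|M. grad (\<psi> n) x \<bullet> grad (\<psi> m) x) + E (\<psi> m)"
      using l2norm_sq_lincomb[OF g g, of 1 n "-1" m] by (simp add: E_def l2norm_sq)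
    \<comment> \<open>The midpoint bound gives \<open>- 2 * i \<le> a + b - 4 * dn\<close>, hence at
      most \<open>2 * a + 2 * b - 4 * dn\<close> on the left, and \<open>a\<close>, \<open>b\<close>
      exceed their infima by less than \<open>en\<close>, \<open>em\<close>.\<close>
    have "a - 2 * i + b \<le> 2 * (dm - dn) + 4 * en"
      if "dn \<le> (1/4) * a + (1/2) * i + (1/4) * b" "a < dn + en" "b < dm + em" "em \<le> en" for a b i dm dn en em :: real
      using that by (simp add: field_simps)
    from this[OF 1 \<psi>(2) \<psi>(2) e_mono[OF mn]] show ?thesis unfolding 2 .
  qed
  have cau: "\<exists>N. \<forall>i\<ge>N. \<forall>j\<ge>N. l2norm M (\<lambda>x. grad (\<psi> i) x - grad (\<psi> j) x) < \<epsilon>" if \<epsilon>: "\<epsilon> > 0" for \<epsilon>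
  proof -
    obtain N1 where N1: "\<And>i j. i \<ge> N1 \<Longrightarrow> j \<ge> N1 \<Longrightarrow> dist (d i) (d j) < \<epsilon>\<^sup>2 / 4"
      using metric_CauchyD[OF dC, of "\<epsilon>\<^sup>2 / 4"] \<epsilon> by auto
    have "\<forall>\<^sub>F n in sequentially. e n < \<epsilon>\<^sup>2 / 8" using \<epsilon> by (intro order_tendstoD(2)[OF e(2)]) auto
    then obtain N2 where N2: "\<And>n. n \<ge> N2 \<Longrightarrow> e n < \<epsilon>\<^sup>2 / 8" unfolding eventually_sequentially by auto
    have le: "l2norm M (\<lambda>x. grad (\<psi> i) x - grad (\<psi> j) x) < \<epsilon>" if "i \<ge> max N1 N2" "j \<ge> i" for i j
    proof -
      have "(l2norm M (\<lambda>x. grad (\<psi> i) x - grad (\<psi> j) x))\<^sup>2 \<le> 2 * (d j - d i) + 4 * e i" by (rule est[OF that(2)])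
      also have "\<dots> < \<epsilon>\<^sup>2"
      proof -
        have "a < E / 4 \<Longrightarrow> b < E / 8 \<Longrightarrow> x \<le> a \<Longrightarrow> 2 * x + 4 * b < E" for a b x E :: real by simp
        moreover have "dist (d i) (d j) < \<epsilon>\<^sup>2 / 4" "e i < \<epsilon>\<^sup>2 / 8" "d j - d i \<le> dist (d i) (d j)"
          using N1[of i j] N2[of i] that by (auto simp: dist_real_def)
        ultimately show ?thesis by blast
      qed
      finally show ?thesis using \<epsilon> by (simp add: power_less_imp_less_base)
    qed
    have "l2norm M (\<lambda>x. grad (\<psi> i) x - grad (\<psi> j) x) < \<epsilon>" if "i \<ge> max N1 N2" "j \<ge> max N1 N2" for i j
      using le[of i j] le[of j i] that l2norm_minus[of M "grad (\<psi> i)" "grad (\<psi> j)"] by (cases "i \<le> j") auto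
    then show ?thesis by blast
  qed
  obtain G where G: "sq_int M G" "(\<lambda>n. l2norm M (\<lambda>x. grad (\<psi> n) x - G x)) \<longlonglongrightarrow> 0"
    by (rule l2_complete[of "\<lambda>n. grad (\<psi> n)", OF sq_int_grad[OF \<psi>t]], erule cau, rule that)
  have "(\<lambda>n. l2norm M (\<lambda>x. \<psi> n x - w x)) \<longlonglongrightarrow> 0"
    by (rule Lim_null_comparison[OF _ e(2)]) (use \<psi>w in auto)
  from H10_I_limit(1)[OF \<psi>t w G(1) this G(2)] show ?thesis .
qed

lemma dform_test:
  assumes u: "u \<in> H10 \<Omega>" and \<psi>: "\<psi> \<in> test_functions \<Omega>"
  shows "dform u \<psi> = - (\<Sum>i\<in>Basis. LINT x|M. u x * frechet_derivative (\<lambda>x. frechet_derivative \<psi> (at x) i) (at x) i)"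
proof -
  have "dform u \<psi> = (LINT x|M. wg u x \<bullet> grad \<psi> x)"
    unfolding dform_def
    by (rule integral_cong_AE)
      (use test_function_H1(2)[OF \<psi>] sq_int_measurable[OF H10_wg[OF u]] sq_int_measurable[OF sq_int_grad[OF \<psi>]]
        sq_int_measurable[OF H10_wg[OF test_function_H10[OF \<psi>]]] in \<open>auto elim!: eventually_mono\<close>)
  also have "\<dots> = (LINT x|M. (\<Sum>i\<in>Basis. (wg u x \<bullet> i) * frechet_derivative \<psi> (at x) i))"
    by (subst euclidean_inner) (simp add: grad_inner_Basis)
  also have "\<dots> = (\<Sum>i\<in>Basis. LINT x|M. (wg u x \<bullet> i) * frechet_derivative \<psi> (at x) i)"
  proof (rule Bochner_Integration.integral_sum)
    fix i :: 'a assume i: "i \<in> Basis"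
    show "integrable M (\<lambda>x. (wg u x \<bullet> i) * frechet_derivative \<psi> (at x) i)"
      using integrable_inner_sq_int[OF sq_int_component[OF H10_wg[OF u] i] sq_int_partial[OF \<psi> i]] by simp
  qed
  also have "\<dots> = (\<Sum>i\<in>Basis. - (LINT x|M. u x * frechet_derivative (\<lambda>x. frechet_derivative \<psi> (at x) i) (at x) i))"
  proof (rule sum.cong[OF refl])
    fix i :: 'a assume i: "i \<in> Basis"
    show "(LINT x|M. (wg u x \<bullet> i) * frechet_derivative \<psi> (at x) i) =
      - (LINT x|M. u x * frechet_derivative (\<lambda>x. frechet_derivative \<psi> (at x) i) (at x) i)"
      using weak_gradientD[OF H1_weak_gradient(2)[OF H10_H1[OF u]] test_function_partial[OF \<psi> i] i] by simp
  qed
  finally show ?thesis by (simp add: sum_negf)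
qed

text \<open>For a test function in the second argument both derivatives have been removed from
  \<open>u n\<close> by \<open>dform_test\<close>, and mean-square convergence suffices. The bound
  \<open>B\<close> makes the forms equicontinuous in the second argument, so density extends the
  limit to all of \<open>H10\<close>.\<close>

lemma dform_weak_limit:
  assumes u: "\<And>n. u n \<in> H10 \<Omega>" and w: "w \<in> H10 \<Omega>" and B: "\<And>n. H10_norm \<Omega> (u n) \<le> B"
    and lim: "(\<lambda>n. l2norm M (\<lambda>x. u n x - w x)) \<longlonglongrightarrow> 0" and v: "v \<in> H10 \<Omega>"
  shows "(\<lambda>n. dform (u n) v) \<longlonglongrightarrow> dform w v"
proof -
  have test: "(\<lambda>n. dform (u n) \<psi>) \<longlonglongrightarrow> dform w \<psi>" if \<psi>: "\<psi> \<in> test_functions \<Omega>" for \<psi>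
    unfolding dform_test[OF u \<psi>] dform_test[OF w \<psi>]
  proof (intro tendsto_minus tendsto_sum)
    fix i :: 'a assume i: "i \<in> Basis"
    show "(\<lambda>n. LINT x|M. u n x * frechet_derivative (\<lambda>x. frechet_derivative \<psi> (at x) i) (at x) i)
      \<longlonglongrightarrow> (LINT x|M. w x * frechet_derivative (\<lambda>x. frechet_derivative \<psi> (at x) i) (at x) i)"
      using integral_inner_tendsto[OF H10_sq_int[OF u] H10_sq_int[OF w] lim
          sq_int_partial[OF test_function_partial[OF \<psi> i] i]] by simp
  qed
  \<comment> \<open>Bounds the errors for \<open>u n\<close> and for \<open>w\<close> together; the
    summand 1 makes it a legitimate divisor.\<close>
  define B' where "B' = B + H10_norm \<Omega> w + 1"
  have B'pos: "B' > 0"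
    unfolding B'_def using B[of 0] H10_norm_nonneg[of "u 0"] H10_norm_nonneg[of w] by linarith
  show ?thesis
  proof (rule LIMSEQ_I)
    fix e :: real assume e: "e > 0"
    obtain \<phi> where \<phi>: "\<And>n. \<phi> n \<in> test_functions \<Omega>" "(\<lambda>n. l2norm M (\<lambda>x. \<phi> n x - v x)) \<longlonglongrightarrow> 0"
      "(\<lambda>n. l2norm M (\<lambda>x. grad (\<phi> n) x - wg v x)) \<longlonglongrightarrow> 0" by (rule H10_approx[OF v]) (rule that)
    have "\<forall>\<^sub>F n in sequentially. l2norm M (\<lambda>x. grad (\<phi> n) x - wg v x) < e / (2 * B')"
      using e B'pos by (intro order_tendstoD(2)[OF \<phi>(3)]) auto
    then obtain k where k: "l2norm M (\<lambda>x. grad (\<phi> k) x - wg v x) < e / (2 * B')"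
      unfolding eventually_sequentially by auto
    define \<psi> where "\<psi> = \<phi> k"
    have \<psi>: "\<psi> \<in> test_functions \<Omega>" and \<psi>10: "\<psi> \<in> H10 \<Omega>" using \<phi>(1) test_function_H10 by (auto simp: \<psi>_def)
    have near: "H10_norm \<Omega> (\<lambda>x. \<psi> x - v x) < e / (2 * B')"
      using k l2norm_wg_test[OF H10_H1[OF v] \<psi>] by (simp add: H10_norm_eq \<psi>_def)
    have near0: "H10_norm \<Omega> (\<lambda>x. \<psi> x - v x) * B' \<le> e / 2"
      using mult_right_mono[OF less_imp_le[OF near] less_imp_le[OF B'pos]] B'pos by (simp add: field_simps)
    obtain N where N: "\<And>n. n \<ge> N \<Longrightarrow> \<bar>dform (u n) \<psi> - dform w \<psi>\<bar> < e / 2"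
      using LIMSEQ_D[OF test[OF \<psi>], of "e/2"] e by auto
    have split: "dform z v = dform z \<psi> - dform z (\<lambda>x. \<psi> x - v x)" if "z \<in> H10 \<Omega>" for z
      using dform_lincomb_right[OF that \<psi>10 v, of 1 "-1"] by simp
    have "norm (dform (u n) v - dform w v) < e" if "n \<ge> N" for n
    proof -
      have dv: "(\<lambda>x. \<psi> x - v x) \<in> H10 \<Omega>" by (rule H10_diff[OF \<psi>10 v])
      have b1: "\<bar>dform (u n) (\<lambda>x. \<psi> x - v x)\<bar> \<le> B * H10_norm \<Omega> (\<lambda>x. \<psi> x - v x)"
        using order_trans[OF dform_bound[OF u dv] mult_right_mono[OF B]] by simp
      have b2: "\<bar>dform w (\<lambda>x. \<psi> x - v x)\<bar> \<le> H10_norm \<Omega> w * H10_norm \<Omega> (\<lambda>x. \<psi> x - v x)"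
        by (rule dform_bound[OF w dv])
      have "B * H10_norm \<Omega> (\<lambda>x. \<psi> x - v x) + H10_norm \<Omega> w * H10_norm \<Omega> (\<lambda>x. \<psi> x - v x) \<le> H10_norm \<Omega> (\<lambda>x. \<psi> x - v x) * B'"
        by (simp add: B'_def algebra_simps)
      then show ?thesis
        unfolding split[OF u[of n]] split[OF w] real_norm_def using b1 b2 N[OF that] near0 by linarith
    qed
    then show "\<exists>no. \<forall>n\<ge>no. norm (dform (u n) v - dform w v) < e" by blast
  qed
qed

lemma lborel_M_test_abs:
  assumes "\<phi> \<in> test_functions \<Omega>"
  shows "(LINT x|lborel. \<bar>\<phi> x\<bar>) = (LINT x|M. \<bar>\<phi> x\<bar>)"
    "(LINT x|lborel. norm (grad \<phi> x)) = (LINT x|M. norm (grad \<phi> x))"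
  by (rule M_integral_eq(1)[symmetric];
      use test_function_borel[OF assms] test_function_zero_outside[OF assms] grad_borel[OF assms]
        grad_zero_outside[OF assms] in auto)+

text \<open>Each \<open>u n\<close> is replaced by a test function at distance below
  \<open>1/(n+1)\<close> in both norms, which changes no limit and makes the results on test
  functions applicable. Compactness in mean is upgraded to mean square by interpolation with the
  bounded critical integrals.\<close>

lemma H10_compact:
  fixes u :: "nat \<Rightarrow> 'a \<Rightarrow> real"
  assumes u: "\<And>n. u n \<in> H10 \<Omega>" and B: "\<And>n. H10_norm \<Omega> (u n) \<le> B"
  obtains r w where "strict_mono (r :: nat \<Rightarrow> nat)" "w \<in> H10 \<Omega>" "AE x in M. (\<lambda>n. u (r n) x) \<longlonglongrightarrow> w x"
    "\<And>v. v \<in> H10 \<Omega> \<Longrightarrow> (\<lambda>n. dform (u (r n)) v) \<longlonglongrightarrow> dform w v"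
proof -
  define e where "e n = inverse (real (Suc n))" for n
  have e: "e n > 0" "e n \<le> 1" "e \<longlonglongrightarrow> 0" for n
    unfolding e_def using LIMSEQ_inverse_real_of_nat by (auto simp: field_simps)
  have "\<exists>\<phi>. \<phi> \<in> test_functions \<Omega> \<and> l2norm M (\<lambda>x. \<phi> x - u n x) < e n \<and> l2norm M (\<lambda>x. grad \<phi> x - wg (u n) x) < e n" for n
  proof -
    obtain \<phi> where \<phi>: "\<And>k. \<phi> k \<in> test_functions \<Omega>" "(\<lambda>k. l2norm M (\<lambda>x. \<phi> k x - u n x)) \<longlonglongrightarrow> 0"
      "(\<lambda>k. l2norm M (\<lambda>x. grad (\<phi> k) x - wg (u n) x)) \<longlonglongrightarrow> 0" by (rule H10_approx[OF u]) (rule that)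
    have "\<forall>\<^sub>F k in sequentially. l2norm M (\<lambda>x. \<phi> k x - u n x) < e n \<and> l2norm M (\<lambda>x. grad (\<phi> k) x - wg (u n) x) < e n"
      using e(1)[of n] by (intro eventually_conj order_tendstoD(2)[OF \<phi>(2)] order_tendstoD(2)[OF \<phi>(3)])
    then obtain k where "l2norm M (\<lambda>x. \<phi> k x - u n x) < e n \<and> l2norm M (\<lambda>x. grad (\<phi> k) x - wg (u n) x) < e n"
      unfolding eventually_sequentially by auto
    with \<phi>(1) show ?thesis by blast
  qed
  then obtain \<phi> where \<phi>: "\<And>n. \<phi> n \<in> test_functions \<Omega>" "\<And>n. l2norm M (\<lambda>x. \<phi> n x - u n x) < e n"
    "\<And>n. l2norm M (\<lambda>x. grad (\<phi> n) x - wg (u n) x) < e n" by metis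
  have gB: "l2norm M (grad (\<phi> n)) \<le> B + 1" for n
    using l2norm_diff_le[OF sq_int_grad[OF \<phi>(1)[of n]] H10_wg[OF u[of n]]] \<phi>(3)[of n] e(2)[of n] B[of n]
    unfolding H10_norm_eq by linarith
  have B1: "B + 1 \<ge> 0" using gB[of 0] l2norm_nonneg[of M "grad (\<phi> 0)"] by linarith
  \<comment> \<open>The first entry bounds the gradients in mean by Cauchy--Schwarz. The second
    bounds the functions themselves through
    \<open>\<bar>t\<bar> \<le> 1 + \<bar>t\<bar> powr q\<close> and the Sobolev inequality, which
    here takes the place of a Poincare inequality.\<close>
  define L where "L = max (sqrt (measure M (space M)) * (B + 1)) (measure M (space M) + C0 * (B + 1) powr q)"
  have L1: "(LINT x|lborel. norm (grad (\<phi> n) x)) \<le> L" for n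
  proof -
    have "(LINT x|M. norm (grad (\<phi> n) x)) \<le> sqrt (measure M (space M)) * l2norm M (grad (\<phi> n))"
      by (rule L1_le_l2norm[OF sq_int_grad[OF \<phi>(1)]])
    also have "\<dots> \<le> sqrt (measure M (space M)) * (B + 1)" by (intro mult_left_mono gB) simp
    finally show ?thesis unfolding lborel_M_test_abs[OF \<phi>(1)] L_def by simp
  qed
  have L2: "(LINT x|lborel. \<bar>\<phi> n x\<bar>) \<le> L" for n
  proof -
    have pw: "\<bar>t\<bar> \<le> 1 + \<bar>t\<bar> powr q" for t :: real
    proof (cases "\<bar>t\<bar> \<le> 1")
      case False
      then have "\<bar>t\<bar> powr 1 \<le> \<bar>t\<bar> powr q" using q_gt_2 by (intro powr_mono) auto
      then show ?thesis by (auto split: if_splits)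
    qed (simp add: add_increasing2)
    have "(LINT x|M. \<bar>\<phi> n x\<bar>) \<le> (LINT x|M. 1 + \<bar>\<phi> n x\<bar> powr q)"
      by (rule integral_mono) (use sobolev_test(1)[OF \<phi>(1)] test_function_M(2)[OF \<phi>(1)] pw in auto)
    also have "\<dots> = measure M (space M) + (LINT x|M. \<bar>\<phi> n x\<bar> powr q)"
      using sobolev_test(1)[OF \<phi>(1)[of n]] by simp
    also have "(LINT x|M. \<bar>\<phi> n x\<bar> powr q) \<le> C0 * l2norm M (grad (\<phi> n)) powr q" by (rule sobolev_test(2)[OF \<phi>(1)])
    also have "\<dots> \<le> C0 * (B + 1) powr q"
      using C0_pos gB[of n] q_gt_2 by (intro mult_left_mono powr_mono2) auto
    finally show ?thesis unfolding lborel_M_test_abs[OF \<phi>(1)] L_def by simp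
  qed
  obtain r :: "nat \<Rightarrow> nat" where r: "strict_mono r"
    "\<And>e. e > 0 \<Longrightarrow> \<exists>N. \<forall>i\<ge>N. \<forall>j\<ge>N. (LINT x|M. \<bar>\<phi> (r i) x - \<phi> (r j) x\<bar>) < e"
    using rellich_test[of \<phi> L, OF \<phi>(1) L1 L2] by blast
  have cau: "\<exists>N. \<forall>i\<ge>N. \<forall>j\<ge>N. l2norm M (\<lambda>x. \<phi> (r i) x - \<phi> (r j) x) < \<epsilon>" if \<epsilon>: "\<epsilon> > 0" for \<epsilon>
  proof -
    \<comment> \<open>Bounds the critical integrals of all differences. The weights are chosen so
      that the critical part contributes at most a quarter and the integral of the absolute value at
      most half of the square of \<open>\<epsilon>\<close>.\<close>
    define Q where "Q = C0 * (2 * (B + 1)) powr q + 1"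
    have Q: "Q > 0" using C0_pos by (simp add: Q_def add_nonneg_pos)
    obtain C where C: "C \<ge> 0" "\<And>t. t\<^sup>2 \<le> (\<epsilon>\<^sup>2 / (4 * Q)) * \<bar>t\<bar> powr q + C * \<bar>t\<bar>"
      by (rule sq_absorb[OF q_gt_2, of "\<epsilon>\<^sup>2 / (4 * Q)"]) (use \<epsilon> Q in auto)
    have "\<epsilon>\<^sup>2 / (2 * (C + 1)) > 0" using \<epsilon> C(1) by simp
    from r(2)[OF this] obtain N where N: "\<forall>i\<ge>N. \<forall>j\<ge>N. (LINT x|M. \<bar>\<phi> (r i) x - \<phi> (r j) x\<bar>) < \<epsilon>\<^sup>2 / (2 * (C + 1))" by blast
    have "l2norm M (\<lambda>x. \<phi> (r i) x - \<phi> (r j) x) < \<epsilon>" if ij: "i \<ge> N" "j \<ge> N" for i j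
    proof -
      define \<psi> where "\<psi> x = \<phi> (r i) x - \<phi> (r j) x" for x
      have \<psi>: "\<psi> \<in> test_functions \<Omega>"
        using test_function_lincomb[OF \<phi>(1) \<phi>(1), of 1 "r i" "-1" "r j"] by (simp add: \<psi>_def[abs_def])
      have "grad \<psi> = (\<lambda>x. grad (\<phi> (r i)) x - grad (\<phi> (r j)) x)"
        using grad_lincomb[OF \<phi>(1) \<phi>(1), of 1 "r i" "-1" "r j"] by (simp add: \<psi>_def[abs_def] fun_eq_iff)
      then have "l2norm M (grad \<psi>) \<le> l2norm M (grad (\<phi> (r i))) + l2norm M (grad (\<phi> (r j)))"
        using l2norm_triangle3[OF sq_int_grad[OF \<phi>(1)] sq_int_zero sq_int_grad[OF \<phi>(1)], of "r i" "r j"]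
        by (simp add: l2norm_def)
      also have "\<dots> \<le> (B + 1) + (B + 1)" by (rule add_mono[OF gB gB])
      finally have g2: "l2norm M (grad \<psi>) \<le> 2 * (B + 1)" by simp
      have "(LINT x|M. \<bar>\<psi> x\<bar> powr q) \<le> C0 * l2norm M (grad \<psi>) powr q" by (rule sobolev_test(2)[OF \<psi>])
      also have "\<dots> \<le> C0 * (2 * (B + 1)) powr q"
        using C0_pos g2 q_gt_2 by (intro mult_left_mono powr_mono2) auto
      also have "\<dots> \<le> Q" by (simp add: Q_def)
      finally have Qle: "(LINT x|M. \<bar>\<psi> x\<bar> powr q) \<le> Q" .
      have "(l2norm M \<psi>)\<^sup>2 = (LINT x|M. (\<psi> x)\<^sup>2)" by (simp add: l2norm_sq)
      also have "\<dots> \<le> (LINT x|M. (\<epsilon>\<^sup>2 / (4 * Q)) * \<bar>\<psi> x\<bar> powr q + C * \<bar>\<psi> x\<bar>)"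
        by (rule integral_mono)
          (use sq_int_integrable[OF sq_int_test_function[OF \<psi>]] sobolev_test(1)[OF \<psi>] test_function_M(2)[OF \<psi>] C(2) in auto)
      also have "\<dots> = (\<epsilon>\<^sup>2 / (4 * Q)) * (LINT x|M. \<bar>\<psi> x\<bar> powr q) + C * (LINT x|M. \<bar>\<psi> x\<bar>)"
        using sobolev_test(1)[OF \<psi>] test_function_M(2)[OF \<psi>] by simp
      also have "\<dots> \<le> (\<epsilon>\<^sup>2 / (4 * Q)) * Q + C * (\<epsilon>\<^sup>2 / (2 * (C + 1)))"
        using Qle N ij C(1) \<epsilon> Q unfolding \<psi>_def by (intro add_mono mult_left_mono) (auto simp: less_imp_le)
      also have "(\<epsilon>\<^sup>2 / (4 * Q)) * Q = \<epsilon>\<^sup>2 / 4" using Q by simp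
      also have "C * (\<epsilon>\<^sup>2 / (2 * (C + 1))) \<le> \<epsilon>\<^sup>2 / 2"
        using C(1) \<epsilon> by (simp add: field_simps)
      also have "\<epsilon>\<^sup>2 / 4 + \<epsilon>\<^sup>2 / 2 < \<epsilon>\<^sup>2" using \<epsilon> by simp
      finally have "(l2norm M \<psi>)\<^sup>2 < \<epsilon>\<^sup>2" by simp
      then have "l2norm M \<psi> < \<epsilon>" using \<epsilon> by (simp add: power_less_imp_less_base)
      then show ?thesis unfolding \<psi>_def[abs_def] .
    qed
    then show ?thesis by blast
  qed
  obtain w where w: "sq_int M w" "(\<lambda>n. l2norm M (\<lambda>x. \<phi> (r n) x - w x)) \<longlonglongrightarrow> 0"
    by (rule l2_complete[of "\<lambda>n. \<phi> (r n)", OF sq_int_test_function[OF \<phi>(1)]], erule cau, rule that)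
  have wH: "w \<in> H10 \<Omega>"
    by (rule H10_closed_bounded[OF \<phi>(1) gB w])
  have ulim: "(\<lambda>n. l2norm M (\<lambda>x. u (r n) x - w x)) \<longlonglongrightarrow> 0"
  proof (rule Lim_null_comparison)
    have "(\<lambda>n. e (r n)) \<longlonglongrightarrow> 0" using LIMSEQ_subseq_LIMSEQ[OF e(3) r(1)] by (simp add: o_def)
    then show "(\<lambda>n. e (r n) + l2norm M (\<lambda>x. \<phi> (r n) x - w x)) \<longlonglongrightarrow> 0"
      using tendsto_add[OF _ w(2)] by fastforce
    show "\<forall>\<^sub>F n in sequentially. norm (l2norm M (\<lambda>x. u (r n) x - w x)) \<le> e (r n) + l2norm M (\<lambda>x. \<phi> (r n) x - w x)"
    proof (intro always_eventually allI)
      fix n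
      have "l2norm M (\<lambda>x. u (r n) x - w x) \<le> l2norm M (\<lambda>x. u (r n) x - \<phi> (r n) x) + l2norm M (\<lambda>x. \<phi> (r n) x - w x)"
        by (rule l2norm_triangle3[OF H10_sq_int[OF u] sq_int_test_function[OF \<phi>(1)] w(1)])
      then show "norm (l2norm M (\<lambda>x. u (r n) x - w x)) \<le> e (r n) + l2norm M (\<lambda>x. \<phi> (r n) x - w x)"
        using \<phi>(2)[of "r n"] l2norm_minus[of M "u (r n)" "\<phi> (r n)"] by simp
    qed
  qed
  obtain s where s: "strict_mono s" "AE x in M. (\<lambda>n. u (r (s n)) x) \<longlonglongrightarrow> w x"
    by (rule l2norm_tendsto_AE_subseq[of "\<lambda>n. u (r n)" w, OF H10_sq_int[OF u] w(1) ulim]) (rule that)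
  have ulim': "(\<lambda>n. l2norm M (\<lambda>x. u (r (s n)) x - w x)) \<longlonglongrightarrow> 0"
    using LIMSEQ_subseq_LIMSEQ[OF ulim s(1)] by (simp add: o_def)
  show thesis
  proof (rule that[of "r \<circ> s" w])
    show "strict_mono (r \<circ> s)" by (rule strict_mono_o[OF r(1) s(1)])
    show "AE x in M. (\<lambda>n. u ((r \<circ> s) n) x) \<longlonglongrightarrow> w x" using s(2) by simp
    show "(\<lambda>n. dform (u ((r \<circ> s) n)) v) \<longlonglongrightarrow> dform w v" if "v \<in> H10 \<Omega>" for v
      using dform_weak_limit[OF u wH B ulim' that] by simp
  qed (rule wH)
qed

end

section \<open>The energy functional\<close>

text \<open>Rounding \<open>u\<close> down to multiples of \<open>1/(n+1)\<close> leaves countably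
  many values, and for those measurability at fixed \<open>t\<close> is enough. Continuity in
  \<open>t\<close> then carries measurability to the limit.\<close>

lemma caratheodory_compose:
  fixes g :: "'x \<Rightarrow> real \<Rightarrow> real"
  assumes g: "\<And>t. (\<lambda>x. g x t) \<in> borel_measurable N"
    and c: "\<And>x. x \<in> space N \<Longrightarrow> continuous_on UNIV (g x)"
    and u: "u \<in> borel_measurable N"
  shows "(\<lambda>x. g x (u x)) \<in> borel_measurable N"
proof (rule borel_measurable_LIMSEQ_real)
  let ?u = "\<lambda>n x. real_of_int \<lfloor>real (Suc n) * u x\<rfloor> / real (Suc n)"
  show "(\<lambda>x. g x (?u n x)) \<in> borel_measurable N" for n
  proof -
    have "(\<lambda>x. \<lfloor>real (Suc n) * u x\<rfloor>) \<in> measurable N (count_space UNIV)"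
      using u by measurable
    then show ?thesis
      by (rule measurable_compose_countable[where f = "\<lambda>i x. g x (real_of_int i / real (Suc n))", rotated]) (rule g)
  qed
  show "(\<lambda>n. g x (?u n x)) \<longlonglongrightarrow> g x (u x)" if "x \<in> space N" for x
  proof -
    have "(\<lambda>n. ?u n x) \<longlonglongrightarrow> u x"
    proof (rule LIM_zero_cancel, rule Lim_null_comparison[OF _ LIMSEQ_inverse_real_of_nat], intro always_eventually allI)
      fix n
      let ?m = "real (Suc n)"
      have "?u n x - u x = (real_of_int \<lfloor>?m * u x\<rfloor> - ?m * u x) / ?m"
        by (simp add: diff_divide_distrib)
      also have "\<bar>\<dots>\<bar> \<le> 1 / ?m"
        unfolding abs_divide by (rule divide_mono) (auto simp: abs_le_iff, linarith+)
      finally show "norm (?u n x - u x) \<le> inverse ?m" by (simp add: inverse_eq_divide)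
    qed
    moreover have "isCont (g x) (u x)"
      using c[OF that] by (simp add: continuous_on_eq_continuous_at)
    ultimately show ?thesis by (rule isCont_tendsto_compose[rotated])
  qed
qed

lemma primitive_deriv:
  assumes "continuous_on UNIV g"
  shows "(primitive g has_real_derivative g t) (at t)"
proof -
  \<comment> \<open>The interval \<open>{-a..a}\<close> contains the base point 0 and has
    \<open>t\<close> in its interior, whatever the sign of \<open>t\<close>.\<close>
  define a where "a = \<bar>t\<bar> + 1"
  have t: "- a < t" "t < a" "-a \<le> 0" "0 \<le> a" by (auto simp: a_def)
  have "((\<lambda>u. LBINT y=ereal 0..ereal u. g y) has_vector_derivative g t) (at t within {-a..a})"
    by (rule interval_integral_FTC2) (use t assms continuous_on_subset in auto)
  then have "(primitive g has_vector_derivative g t) (at t)"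
    unfolding primitive_def[abs_def] using t
    by (simp add: at_within_Icc_at)
  then show ?thesis by (simp add: has_real_derivative_iff_has_vector_derivative)
qed

lemma primitive_0 [simp]: "primitive g 0 = 0"
  by (simp add: primitive_def interval_lebesgue_integral_def set_lebesgue_integral_def)

lemma primitive_continuous:
  assumes "continuous_on UNIV g"
  shows "continuous_on UNIV (primitive g)"
  using DERIV_isCont[OF primitive_deriv[OF assms]] by (simp add: continuous_at_imp_continuous_on)

lemma mvt_bound:
  fixes \<Phi> :: "real \<Rightarrow> real"
  assumes d: "\<And>t. (\<Phi> has_real_derivative \<phi> t) (at t)"
    and b: "\<And>t. \<bar>t\<bar> \<le> \<bar>a\<bar> + \<bar>b\<bar> \<Longrightarrow> \<bar>\<phi> t\<bar> \<le> B"
  shows "\<bar>\<Phi> (a + b) - \<Phi> a\<bar> \<le> B * \<bar>b\<bar>"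
proof -
  consider "b > 0" | "b < 0" | "b = 0" by linarith
  then show ?thesis
  proof cases
    case 1
    then obtain z where z: "z > a" "z < a + b" "\<Phi> (a + b) - \<Phi> a = (a + b - a) * \<phi> z"
      using MVT2[of a "a + b" \<Phi> \<phi>] d by auto
    then show ?thesis using b[of z] 1 by (auto simp: abs_mult mult.commute intro!: mult_left_mono)
  next
    case 2
    then obtain z where z: "z > a + b" "z < a" "\<Phi> a - \<Phi> (a + b) = (a - (a + b)) * \<phi> z"
      using MVT2[of "a + b" a \<Phi> \<phi>] d by auto
    then have "\<bar>\<Phi> a - \<Phi> (a + b)\<bar> = \<bar>b\<bar> * \<bar>\<phi> z\<bar>" by (simp add: abs_mult)
    then show ?thesis using b[of z] z 2
      by (subst abs_minus_commute) (auto simp: mult.commute intro!: mult_left_mono)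
  qed simp
qed

section \<open>Elementary inequalities for powers\<close>

lemma add_powr_le:
  fixes x y a :: real
  assumes "0 \<le> x" "0 \<le> y" "0 \<le> a"
  shows "(x + y) powr a \<le> 2 powr a * (x powr a + y powr a)"
proof -
  have "(x + y) powr a \<le> (2 * max x y) powr a" using assms by (intro powr_mono2) auto
  also have "\<dots> = 2 powr a * max x y powr a" using assms by (simp add: powr_mult)
  also have "max x y powr a \<le> x powr a + y powr a" by (auto simp: max_def)
  finally show ?thesis by simp
qed

lemma powr_le_1_plus:
  fixes t a b :: real
  assumes "0 \<le> t" "0 \<le> a" "a \<le> b"
  shows "t powr a \<le> 1 + t powr b"
proof (cases "t \<le> 1")
  case True
  then have "t powr a \<le> 1 powr a" using assms by (intro powr_mono2) auto
  then show ?thesis by (simp add: add_increasing2)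
next
  case False
  then have "t powr a \<le> t powr b" using assms by (intro powr_mono) auto
  then show ?thesis by simp
qed

lemma powr_mult_le:
  fixes a b q :: real
  assumes "0 \<le> a" "0 \<le> b" "q > 1"
  shows "a powr (q - 1) * b \<le> a powr q + b powr q"
proof -
  have "a powr (q - 1) * b \<le> max a b powr (q - 1) * max a b"
    using assms by (intro mult_mono powr_mono2) auto
  also have "\<dots> = max a b powr q"
    using assms by (cases "max a b = 0") (auto simp: powr_diff)
  also have "\<dots> \<le> a powr q + b powr q" by (auto simp: max_def)
  finally show ?thesis .
qed

text \<open>Two regimes are separated by the ratio of \<open>b\<close> to \<open>v\<close>. If
  \<open>\<bar>b\<bar> \<ge> \<delta> * \<bar>v\<bar>\<close>, both powers are controlled by that of
  \<open>\<bar>b\<bar>\<close>. Otherwise \<open>s = \<bar>v + b\<bar> / \<bar>v\<bar>\<close> is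
  close to 1, and continuity of \<open>s powr q\<close> there yields the small factor
  \<open>\<eta>\<close>.\<close>

lemma brezis_lieb_ineq:
  fixes q \<eta> :: real
  assumes q: "q > 1" and \<eta>: "\<eta> > 0"
  obtains C where "C \<ge> 0" "\<And>v b :: real. \<bar>\<bar>v + b\<bar> powr q - \<bar>v\<bar> powr q\<bar> \<le> \<eta> * \<bar>v\<bar> powr q + C * \<bar>b\<bar> powr q"
proof -
  have "isCont (\<lambda>s::real. s powr q) 1" by (intro continuous_intros) auto
  then obtain d where d: "d > 0" "\<And>s. \<bar>s - 1\<bar> < d \<Longrightarrow> \<bar>s powr q - 1\<bar> < \<eta>"
    using \<eta> unfolding continuous_at_eps_delta by (auto simp: dist_real_def)
  define \<delta> where "\<delta> = d / 2"
  have \<delta>: "\<delta> > 0" "\<And>s. \<bar>s - 1\<bar> \<le> \<delta> \<Longrightarrow> \<bar>s powr q - 1\<bar> \<le> \<eta>"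
    using d by (auto simp: \<delta>_def intro!: less_imp_le)
  define C where "C = (1 / \<delta> + 1) powr q"
  show thesis
  proof (rule that[of "C + C"])
    show "C + C \<ge> 0" by (simp add: C_def)
    fix v b :: real
    show "\<bar>\<bar>v + b\<bar> powr q - \<bar>v\<bar> powr q\<bar> \<le> \<eta> * \<bar>v\<bar> powr q + (C + C) * \<bar>b\<bar> powr q"
    proof (cases "\<bar>v\<bar> \<le> \<bar>b\<bar> / \<delta>")
      case True
      have C: "((1 / \<delta> + 1) * \<bar>b\<bar>) powr q = C * \<bar>b\<bar> powr q"
        using \<delta> by (simp add: C_def powr_mult)
      have "\<bar>v + b\<bar> \<le> (1 / \<delta> + 1) * \<bar>b\<bar>" "\<bar>v\<bar> \<le> (1 / \<delta> + 1) * \<bar>b\<bar>"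
        using True by (auto simp: algebra_simps)
      then have "\<bar>v + b\<bar> powr q \<le> C * \<bar>b\<bar> powr q" "\<bar>v\<bar> powr q \<le> C * \<bar>b\<bar> powr q"
        unfolding C[symmetric] using q by (auto intro!: powr_mono2)
      moreover have "0 \<le> \<eta> * \<bar>v\<bar> powr q" "0 \<le> \<bar>v + b\<bar> powr q" "0 \<le> \<bar>v\<bar> powr q" using \<eta> by auto
      ultimately show ?thesis unfolding abs_le_iff distrib_right by linarith
    next
      case False
      then have v: "\<bar>v\<bar> > 0" using \<delta> by (smt (verit) divide_nonneg_pos)
      have b: "\<bar>b\<bar> \<le> \<delta> * \<bar>v\<bar>" using False \<delta> by (simp add: field_simps)
      define s where "s = \<bar>v + b\<bar> / \<bar>v\<bar>"
      have "s - 1 = (\<bar>v + b\<bar> - \<bar>v\<bar>) / \<bar>v\<bar>" using v by (simp add: s_def diff_divide_distrib)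
      also have "\<bar>\<dots>\<bar> \<le> \<bar>b\<bar> / \<bar>v\<bar>" unfolding abs_divide abs_abs by (intro divide_right_mono) auto
      also have "\<dots> \<le> \<delta>" using b v by (simp add: pos_divide_le_eq)
      finally have "\<bar>s powr q - 1\<bar> \<le> \<eta>" by (rule \<delta>(2))
      then have "\<bar>v\<bar> powr q * \<bar>s powr q - 1\<bar> \<le> \<bar>v\<bar> powr q * \<eta>" by (intro mult_left_mono) auto
      moreover have "\<bar>v + b\<bar> powr q - \<bar>v\<bar> powr q = \<bar>v\<bar> powr q * (s powr q - 1)"
        using v by (simp add: s_def powr_divide algebra_simps)
      then have "\<bar>\<bar>v + b\<bar> powr q - \<bar>v\<bar> powr q\<bar> = \<bar>v\<bar> powr q * \<bar>s powr q - 1\<bar>"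
        by (simp add: abs_mult)
      moreover have "0 \<le> (C + C) * \<bar>b\<bar> powr q" by (simp add: C_def)
      ultimately show ?thesis unfolding mult.commute[of "\<bar>v\<bar> powr q" \<eta>] by linarith
    qed
  qed
qed

text \<open>Young's inequality reduces the mixed product to the powers
  \<open>\<bar>v + b\<bar> powr q\<close> and \<open>\<bar>v\<bar> powr q\<close>, to which the
  preceding estimate applies. Only the excess over \<open>\<bar>v\<bar> powr q\<close> is estimated,
  because the Palais--Smale argument needs the critical term from above only.\<close>

lemma powr_mult_brezis_lieb:
  fixes q \<eta> :: real
  assumes q: "q > 1" and \<eta>: "\<eta> > 0"
  obtains C where "C \<ge> 0"
    "\<And>v b :: real. max 0 (\<bar>v + b\<bar> powr (q - 1) * \<bar>v\<bar> - \<bar>v\<bar> powr q) \<le> \<eta> * \<bar>v\<bar> powr q + C * \<bar>b\<bar> powr q"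
proof -
  obtain C where C: "C \<ge> 0" "\<And>v b :: real. \<bar>\<bar>v + b\<bar> powr q - \<bar>v\<bar> powr q\<bar> \<le> \<eta> * \<bar>v\<bar> powr q + C * \<bar>b\<bar> powr q"
    by (rule brezis_lieb_ineq[OF assms]) (blast intro: that)
  show thesis
  proof (rule that[OF C(1)])
    fix v b :: real
    let ?r = "(q - 1) / q"
    have r: "0 \<le> ?r" "?r \<le> 1" "?r + 1 / q = 1" using q by (auto simp: field_simps)
    have "(\<bar>v + b\<bar> powr q) powr ?r * (\<bar>v\<bar> powr q) powr (1 / q) \<le> ?r * \<bar>v + b\<bar> powr q + (1 / q) * \<bar>v\<bar> powr q"
      using weighted_arith_geom_mean[of UNIV "\<lambda>i. if i then ?r else 1 / q" "\<lambda>i. if i then \<bar>v + b\<bar> powr q else \<bar>v\<bar> powr q"] q r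
      by (simp add: UNIV_bool add.commute mult.commute)
    then have "\<bar>v + b\<bar> powr (q - 1) * \<bar>v\<bar> \<le> ?r * \<bar>v + b\<bar> powr q + (1 / q) * \<bar>v\<bar> powr q"
      using q by (simp add: powr_powr)
    also have "\<dots> \<le> ?r * (\<bar>v\<bar> powr q + (\<eta> * \<bar>v\<bar> powr q + C * \<bar>b\<bar> powr q)) + (1 / q) * \<bar>v\<bar> powr q"
      using C(2)[of v b] r by (intro add_right_mono mult_left_mono) (auto simp: abs_le_iff)
    also have "\<dots> = (?r + 1 / q) * \<bar>v\<bar> powr q + ?r * (\<eta> * \<bar>v\<bar> powr q + C * \<bar>b\<bar> powr q)"
      by (simp add: algebra_simps)
    also have "\<dots> \<le> \<bar>v\<bar> powr q + (\<eta> * \<bar>v\<bar> powr q + C * \<bar>b\<bar> powr q)"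
      unfolding r(3) using mult_right_mono[OF r(2), of "\<eta> * \<bar>v\<bar> powr q + C * \<bar>b\<bar> powr q"] \<eta> C(1) by simp
    finally show "max 0 (\<bar>v + b\<bar> powr (q - 1) * \<bar>v\<bar> - \<bar>v\<bar> powr q) \<le> \<eta> * \<bar>v\<bar> powr q + C * \<bar>b\<bar> powr q"
      using \<eta> C(1) by simp
  qed
qed

text \<open>Continuity and growth are assumed at every point of \<open>\<Omega>\<close>, although
  they are given only almost everywhere; the gap is closed at the end by changing \<open>f\<close>
  on a null set.\<close>

locale nonlinearity = sobolev_domain \<Omega> for \<Omega> :: "'a::euclidean_space set" +
  fixes f :: "'a \<Rightarrow> real \<Rightarrow> real" and c1 c2 p :: real
  assumes f_meas: "\<And>t. (\<lambda>x. f x t) \<in> borel_measurable (lebesgue_on \<Omega>)"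
    and f_cont: "\<And>x. x \<in> \<Omega> \<Longrightarrow> continuous_on UNIV (f x)"
    and c12: "c1 > 0" "c2 > 0" and p: "1 < p" "p < crit_exp DIM('a)"
    and growth: "\<And>x t. x \<in> \<Omega> \<Longrightarrow> \<bar>f x t\<bar> \<le> c1 * \<bar>t\<bar> powr (p - 1) + c2"
begin

lemma p_less_q: "p < q" using p by (simp add: q_def)

lemma q_gt_1: "q > 1" using q_gt_2 by simp

definition F :: "'a \<Rightarrow> real \<Rightarrow> real" where "F x = primitive (f x)"

lemma F_deriv: "x \<in> \<Omega> \<Longrightarrow> (F x has_real_derivative f x t) (at t)"
  unfolding F_def by (rule primitive_deriv[OF f_cont])

lemma F_0 [simp]: "F x 0 = 0" by (simp add: F_def)

lemma F_cont: "x \<in> \<Omega> \<Longrightarrow> continuous_on UNIV (F x)"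
  unfolding F_def by (rule primitive_continuous[OF f_cont])

lemma f_compose: "u \<in> borel_measurable M \<Longrightarrow> (\<lambda>x. f x (u x)) \<in> borel_measurable M"
  by (rule caratheodory_compose[OF f_meas]) (auto intro: f_cont)

text \<open>Composing with the second projection on a product space shows that \<open>f\<close> is
  jointly measurable, so its primitive is a measurable parametric integral. The two signs of
  \<open>t\<close> correspond to the two orientations of the interval.\<close>

lemma F_meas: "(\<lambda>x. F x t) \<in> borel_measurable M"
proof -
  have j: "(\<lambda>y. f (fst y) (snd y)) \<in> borel_measurable (M \<Otimes>\<^sub>M lborel)"
  proof (rule caratheodory_compose[of "\<lambda>y t. f (fst y) t" "M \<Otimes>\<^sub>M lborel" snd])
    show "(\<lambda>y. f (fst y) t) \<in> borel_measurable (M \<Otimes>\<^sub>M lborel)" for t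
      by (rule measurable_compose[OF measurable_fst f_meas])
    show "snd \<in> borel_measurable (M \<Otimes>\<^sub>M lborel)"
      using measurable_snd[of M "lborel :: real measure"] by simp
  qed (auto simp: space_pair_measure intro: f_cont)
  have I: "(\<lambda>x. LINT s|lborel. indicator A s * f x s) \<in> borel_measurable M" if "A \<in> sets borel" for A
  proof (rule sigma_finite_measure.borel_measurable_lebesgue_integral[OF sigma_finite_lborel])
    have "(\<lambda>y. indicator A (snd y) :: real) \<in> borel_measurable (M \<Otimes>\<^sub>M lborel)"
      by (rule measurable_compose[OF measurable_snd]) (use that in simp)
    with j show "(\<lambda>(x, s). indicator A s * f x s) \<in> borel_measurable (M \<Otimes>\<^sub>M lborel)"
      by (simp add: case_prod_beta')
  qed
  show ?thesis
  proof (cases "0 \<le> t")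
    case True
    then show ?thesis
      using I[of "{0<..<t}"]
      by (simp add: F_def primitive_def interval_lebesgue_integral_def set_lebesgue_integral_def)
  next
    case False
    then show ?thesis
      using I[of "{t<..<0}"]
      by (simp add: F_def primitive_def interval_lebesgue_integral_def set_lebesgue_integral_def)
  qed
qed

lemma F_compose: "u \<in> borel_measurable M \<Longrightarrow> (\<lambda>x. F x (u x)) \<in> borel_measurable M"
  by (rule caratheodory_compose[OF F_meas]) (auto intro: F_cont)

lemma F_bound:
  assumes "x \<in> \<Omega>"
  shows "\<bar>F x t\<bar> \<le> c1 * \<bar>t\<bar> powr p + c2 * \<bar>t\<bar>"
proof -
  have "\<bar>F x (0 + t) - F x 0\<bar> \<le> (c1 * \<bar>t\<bar> powr (p - 1) + c2) * \<bar>t\<bar>"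
  proof (rule mvt_bound[OF F_deriv[OF assms]])
    fix s assume "\<bar>s\<bar> \<le> \<bar>0\<bar> + \<bar>t\<bar>"
    then have "c1 * \<bar>s\<bar> powr (p - 1) \<le> c1 * \<bar>t\<bar> powr (p - 1)"
      using c12 p by (intro mult_left_mono powr_mono2) auto
    then show "\<bar>f x s\<bar> \<le> c1 * \<bar>t\<bar> powr (p - 1) + c2" using growth[OF assms, of s] by linarith
  qed
  also have "\<bar>t\<bar> powr (p - 1) * \<bar>t\<bar> = \<bar>t\<bar> powr p"
    by (cases "t = 0") (auto simp: powr_diff)
  then have "(c1 * \<bar>t\<bar> powr (p - 1) + c2) * \<bar>t\<bar> = c1 * \<bar>t\<bar> powr p + c2 * \<bar>t\<bar>"
    by (simp add: algebra_simps)
  finally show ?thesis by simp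
qed

text \<open>\<open>P\<close> is the derivative of \<open>\<bar>t\<bar> powr q / q\<close>, so that
  \<open>g\<close> is the derivative of \<open>G\<close> in \<open>t\<close>. The subcritical and
  critical terms are bundled because the differentiability proof uses nothing but the common bound
  of growth \<open>q - 1\<close>.\<close>

definition P :: "real \<Rightarrow> real" where "P t = sgn t * \<bar>t\<bar> powr (q - 1)"
definition g :: "'a \<Rightarrow> real \<Rightarrow> real" where "g x t = f x t + P t"
definition G :: "'a \<Rightarrow> real \<Rightarrow> real" where "G x t = F x t + \<bar>t\<bar> powr q / q"
definition Cg :: real where "Cg = c1 + c2 + 1"

lemma abs_P: "\<bar>P t\<bar> = \<bar>t\<bar> powr (q - 1)"
  by (simp add: P_def abs_mult abs_sgn_eq)

lemma P_cont: "continuous_on UNIV P"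
  unfolding P_def[abs_def] by (rule continuous_sgn_powr) (use q_gt_1 in simp)

lemma Cg_pos: "Cg > 0" using c12 by (simp add: Cg_def)

lemma g_bound:
  assumes "x \<in> \<Omega>"
  shows "\<bar>g x t\<bar> \<le> Cg * (1 + \<bar>t\<bar> powr (q - 1))"
proof -
  have "\<bar>t\<bar> powr (p - 1) \<le> 1 + \<bar>t\<bar> powr (q - 1)"
    using p p_less_q by (intro powr_le_1_plus) auto
  then have "c1 * \<bar>t\<bar> powr (p - 1) \<le> c1 * (1 + \<bar>t\<bar> powr (q - 1))" using c12 by simp
  moreover have "c2 \<le> c2 * (1 + \<bar>t\<bar> powr (q - 1))" using c12 by simp
  moreover have "\<bar>g x t\<bar> \<le> \<bar>f x t\<bar> + \<bar>t\<bar> powr (q - 1)"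
    unfolding g_def abs_P[symmetric] by (rule abs_triangle_ineq)
  moreover have "Cg * (1 + \<bar>t\<bar> powr (q - 1)) = c1 * (1 + \<bar>t\<bar> powr (q - 1)) + c2 * (1 + \<bar>t\<bar> powr (q - 1)) + (1 + \<bar>t\<bar> powr (q - 1))"
    by (simp add: Cg_def algebra_simps)
  ultimately show ?thesis using growth[OF assms, of t] by linarith
qed

lemma G_deriv:
  assumes "x \<in> \<Omega>"
  shows "(G x has_real_derivative g x t) (at t)"
proof -
  have "((\<lambda>t. F x t + \<bar>t\<bar> powr q / q) has_real_derivative f x t + q * (sgn t * \<bar>t\<bar> powr (q - 1)) / q) (at t)"
    by (intro DERIV_add F_deriv assms DERIV_cdivide abs_powr_deriv q_gt_1)
  then show ?thesis using q_gt_1 by (simp add: G_def[abs_def] g_def P_def)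
qed

lemma g_compose:
  assumes u: "u \<in> borel_measurable M"
  shows "(\<lambda>x. g x (u x)) \<in> borel_measurable M"
proof -
  have "(\<lambda>x. P (u x)) \<in> borel_measurable M"
    by (rule measurable_compose[OF u borel_measurable_continuous_onI[OF P_cont]])
  then show ?thesis unfolding g_def using f_compose[OF u] by simp
qed

lemma G_compose: "u \<in> borel_measurable M \<Longrightarrow> (\<lambda>x. G x (u x)) \<in> borel_measurable M"
  unfolding G_def by (intro borel_measurable_add F_compose) simp_all

lemma G_diff_bound:
  assumes "x \<in> \<Omega>"
  shows "\<bar>G x (a + b) - G x a\<bar> \<le> Cg * (1 + (\<bar>a\<bar> + \<bar>b\<bar>) powr (q - 1)) * \<bar>b\<bar>"
proof (rule mvt_bound[OF G_deriv[OF assms]])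
  fix t assume t: "\<bar>t\<bar> \<le> \<bar>a\<bar> + \<bar>b\<bar>"
  have "\<bar>t\<bar> powr (q - 1) \<le> (\<bar>a\<bar> + \<bar>b\<bar>) powr (q - 1)" using t q_gt_1 by (intro powr_mono2) auto
  then have "Cg * (1 + \<bar>t\<bar> powr (q - 1)) \<le> Cg * (1 + (\<bar>a\<bar> + \<bar>b\<bar>) powr (q - 1))"
    using Cg_pos by simp
  then show "\<bar>g x t\<bar> \<le> Cg * (1 + (\<bar>a\<bar> + \<bar>b\<bar>) powr (q - 1))" using g_bound[OF assms, of t] by linarith
qed

lemma H10_measurable: "u \<in> H10 \<Omega> \<Longrightarrow> u \<in> borel_measurable M"
  by (rule sq_int_measurable[OF H10_sq_int])

lemma H10_integrable: "u \<in> H10 \<Omega> \<Longrightarrow> integrable M u"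
  by (rule sq_int_imp_integrable[OF H10_sq_int])

lemma F_integrable:
  assumes u: "u \<in> H10 \<Omega>"
  shows "integrable M (\<lambda>x. F x (u x))"
proof (rule Bochner_Integration.integrable_bound[where f = "\<lambda>x. c1 * (1 + \<bar>u x\<bar> powr q) + c2 * \<bar>u x\<bar>"])
  show "integrable M (\<lambda>x. c1 * (1 + \<bar>u x\<bar> powr q) + c2 * \<bar>u x\<bar>)"
    using sobolev_H10(1)[OF u] H10_integrable[OF u] by simp
  show "(\<lambda>x. F x (u x)) \<in> borel_measurable M" by (rule F_compose[OF H10_measurable[OF u]])
  show "AE x in M. norm (F x (u x)) \<le> norm (c1 * (1 + \<bar>u x\<bar> powr q) + c2 * \<bar>u x\<bar>)"
  proof (intro AE_I2)
    fix x assume "x \<in> space M"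
    then have x: "x \<in> \<Omega>" by simp
    have "c1 * \<bar>u x\<bar> powr p \<le> c1 * (1 + \<bar>u x\<bar> powr q)"
      using c12 p p_less_q by (intro mult_left_mono powr_le_1_plus) auto
    then show "norm (F x (u x)) \<le> norm (c1 * (1 + \<bar>u x\<bar> powr q) + c2 * \<bar>u x\<bar>)"
      unfolding real_norm_def using F_bound[OF x, of "u x"] by linarith
  qed
qed

lemma g_mult_integrable:
  assumes u: "u \<in> H10 \<Omega>" and v: "v \<in> H10 \<Omega>"
  shows "integrable M (\<lambda>x. g x (u x) * v x)"
proof (rule Bochner_Integration.integrable_bound[where f = "\<lambda>x. Cg * (\<bar>v x\<bar> + \<bar>u x\<bar> powr q + \<bar>v x\<bar> powr q)"])
  show "integrable M (\<lambda>x. Cg * (\<bar>v x\<bar> + \<bar>u x\<bar> powr q + \<bar>v x\<bar> powr q))"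
    using sobolev_H10(1)[OF u] sobolev_H10(1)[OF v] H10_integrable[OF v] by simp
  show "(\<lambda>x. g x (u x) * v x) \<in> borel_measurable M"
    using g_compose[OF H10_measurable[OF u]] H10_measurable[OF v] by simp
  show "AE x in M. norm (g x (u x) * v x) \<le> norm (Cg * (\<bar>v x\<bar> + \<bar>u x\<bar> powr q + \<bar>v x\<bar> powr q))"
  proof (intro AE_I2)
    fix x assume "x \<in> space M"
    then have x: "x \<in> \<Omega>" by simp
    have "\<bar>g x (u x)\<bar> * \<bar>v x\<bar> \<le> Cg * (1 + \<bar>u x\<bar> powr (q - 1)) * \<bar>v x\<bar>"
      by (intro mult_right_mono g_bound[OF x]) simp
    also have "\<dots> = Cg * (\<bar>v x\<bar> + \<bar>u x\<bar> powr (q - 1) * \<bar>v x\<bar>)" by (simp add: algebra_simps)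
    also have "\<dots> \<le> Cg * (\<bar>v x\<bar> + (\<bar>u x\<bar> powr q + \<bar>v x\<bar> powr q))"
      using Cg_pos q_gt_1 by (intro mult_left_mono add_left_mono powr_mult_le) auto
    finally show "norm (g x (u x) * v x) \<le> norm (Cg * (\<bar>v x\<bar> + \<bar>u x\<bar> powr q + \<bar>v x\<bar> powr q))"
      using Cg_pos by (simp add: abs_mult add.assoc)
  qed
qed

definition NG :: "('a \<Rightarrow> real) \<Rightarrow> real" where "NG u = (LINT x|M. G x (u x))"

lemma NG_eq:
  assumes u: "u \<in> H10 \<Omega>"
  shows "integrable M (\<lambda>x. G x (u x))"
    "NG u = (LINT x|M. F x (u x)) + 1 / q * (LINT x|M. \<bar>u x\<bar> powr q)"
  unfolding NG_def G_def using F_integrable[OF u] sobolev_H10(1)[OF u] by auto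

text \<open>Hoelder's inequality with the conjugate exponent \<open>q / (q - 1)\<close>, combined
  with the Sobolev inequality: functions in the dual Lebesgue space act as bounded functionals on
  \<open>H10\<close>.\<close>

lemma Holder_q:
  assumes R: "integrable M (\<lambda>x. R x powr (q / (q - 1)))" "\<And>x. 0 \<le> R x" and v: "v \<in> H10 \<Omega>"
  shows "integrable M (\<lambda>x. R x * \<bar>v x\<bar>)"
    "(LINT x|M. R x * \<bar>v x\<bar>) \<le> (LINT x|M. R x powr (q / (q - 1))) powr (1 - 1 / q) * (C0 powr (1 / q) * H10_norm \<Omega> v)"
proof -
  have e: "(R x powr (q / (q - 1))) powr (1 - 1 / q) = R x" "(\<bar>v x\<bar> powr q) powr (1 / q) = \<bar>v x\<bar>" for x
  proof -
    have "q / (q - 1) * (1 - 1 / q) = 1" using q_gt_1 by (simp add: field_simps)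
    then show "(R x powr (q / (q - 1))) powr (1 - 1 / q) = R x" using R(2)[of x] by (simp only: powr_powr) simp
    show "(\<bar>v x\<bar> powr q) powr (1 / q) = \<bar>v x\<bar>" using q_gt_1 by (simp add: powr_powr)
  qed
  note H = Holder_two[of "1 - 1 / q" "1 / q" M "\<lambda>x. R x powr (q / (q - 1))" "\<lambda>x. \<bar>v x\<bar> powr q", unfolded e]
  show "integrable M (\<lambda>x. R x * \<bar>v x\<bar>)"
    using H(1) R(1) sobolev_H10(1)[OF v] q_gt_1 by simp
  have "(LINT x|M. \<bar>v x\<bar> powr q) powr (1 / q) \<le> (C0 * H10_norm \<Omega> v powr q) powr (1 / q)"
    by (rule powr_mono2) (use sobolev_H10(2)[OF v] q_gt_1 in \<open>auto intro: Bochner_Integration.integral_nonneg\<close>)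
  also have "\<dots> = C0 powr (1 / q) * H10_norm \<Omega> v"
    using C0_pos q_gt_1 by (simp add: powr_mult powr_powr)
  finally have le: "(LINT x|M. \<bar>v x\<bar> powr q) powr (1 / q) \<le> C0 powr (1 / q) * H10_norm \<Omega> v" .
  have "(LINT x|M. R x * \<bar>v x\<bar>) \<le> (LINT x|M. R x powr (q / (q - 1))) powr (1 - 1 / q) * (LINT x|M. \<bar>v x\<bar> powr q) powr (1 / q)"
    using H(2) R(1) sobolev_H10(1)[OF v] q_gt_1 by simp
  also have "\<dots> \<le> (LINT x|M. R x powr (q / (q - 1))) powr (1 - 1 / q) * (C0 powr (1 / q) * H10_norm \<Omega> v)"
    by (intro mult_left_mono le) simp
  finally show "(LINT x|M. R x * \<bar>v x\<bar>) \<le> (LINT x|M. R x powr (q / (q - 1))) powr (1 - 1 / q) * (C0 powr (1 / q) * H10_norm \<Omega> v)" .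
qed

text \<open>The conjugate exponent turns growth of order \<open>q - 1\<close> into growth of order
  exactly \<open>q\<close>, which the Sobolev inequality controls.\<close>

lemma conj_power_bound:
  assumes "0 \<le> R" "R \<le> B * (1 + (a + b) powr (q - 1))" "0 \<le> B" "0 \<le> a" "0 \<le> b"
  shows "R powr (q / (q - 1)) \<le> (B powr (q / (q - 1)) * 2 powr (q / (q - 1)) * 2 powr q) * (1 + a powr q + b powr q)"
proof -
  let ?k = "q / (q - 1)"
  have k: "?k > 0" "(q - 1) * ?k = q" using q_gt_1 by auto
  have "R powr ?k \<le> (B * (1 + (a + b) powr (q - 1))) powr ?k"
    using assms k by (intro powr_mono2) auto
  also have "\<dots> = B powr ?k * (1 + (a + b) powr (q - 1)) powr ?k"
    using assms by (simp add: powr_mult)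
  also have "(1 + (a + b) powr (q - 1)) powr ?k \<le> 2 powr ?k * (1 powr ?k + ((a + b) powr (q - 1)) powr ?k)"
    by (rule add_powr_le) (use k in auto)
  also have "((a + b) powr (q - 1)) powr ?k = (a + b) powr q" unfolding powr_powr k ..
  also have "(a + b) powr q \<le> 2 powr q * (a powr q + b powr q)"
    using assms q_gt_1 by (intro add_powr_le) auto
  also have "1 powr ?k + 2 powr q * (a powr q + b powr q) \<le> 2 powr q * (1 + a powr q + b powr q)"
  proof -
    have "(1::real) \<le> 2 powr q" using q_gt_1 by (simp add: ge_one_powr_ge_zero)
    then show ?thesis by (simp add: algebra_simps)
  qed
  finally show ?thesis using k by (simp add: mult_left_mono mult.assoc)
qed

lemma NG_deriv_bounded:
  assumes u: "u \<in> H10 \<Omega>"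
  shows "\<exists>C. \<forall>v\<in>H10 \<Omega>. \<bar>LINT x|M. g x (u x) * v x\<bar> \<le> C * H10_norm \<Omega> v"
proof -
  define R where "R x = (if x \<in> \<Omega> then \<bar>g x (u x)\<bar> else 0)" for x
  let ?D = "Cg powr (q / (q - 1)) * 2 powr (q / (q - 1)) * 2 powr q"
  have m: "(\<lambda>x. R x powr (q / (q - 1))) \<in> borel_measurable M"
  proof -
    have "(\<lambda>x. \<bar>g x (u x)\<bar> powr (q / (q - 1))) \<in> borel_measurable M"
      using g_compose[OF H10_measurable[OF u]] by simp
    then show ?thesis by (rule measurable_cong[THEN iffD1, rotated]) (simp add: R_def)
  qed
  have "integrable M (\<lambda>x. R x powr (q / (q - 1)))"
  proof (rule Bochner_Integration.integrable_bound[where f = "\<lambda>x. ?D * (1 + \<bar>u x\<bar> powr q)"])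
    show "integrable M (\<lambda>x. ?D * (1 + \<bar>u x\<bar> powr q))" using sobolev_H10(1)[OF u] by simp
    show "AE x in M. norm (R x powr (q / (q - 1))) \<le> norm (?D * (1 + \<bar>u x\<bar> powr q))"
    proof (intro AE_I2)
      fix x assume "x \<in> space M"
      then have x: "x \<in> \<Omega>" by simp
      have "R x powr (q / (q - 1)) \<le> ?D * (1 + \<bar>u x\<bar> powr q + 0 powr q)"
        by (rule conj_power_bound) (use g_bound[OF x, of "u x"] x Cg_pos in \<open>auto simp: R_def\<close>)
      then show "norm (R x powr (q / (q - 1))) \<le> norm (?D * (1 + \<bar>u x\<bar> powr q))" by simp
    qed
  qed (rule m)
  note H = Holder_q[OF this, unfolded R_def]
  show ?thesis
  proof (intro exI ballI)
    fix v assume v: "v \<in> H10 \<Omega>"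
    have "\<bar>LINT x|M. g x (u x) * v x\<bar> \<le> (LINT x|M. \<bar>g x (u x) * v x\<bar>)" using integral_abs_bound by blast
    also have "\<dots> = (LINT x|M. R x * \<bar>v x\<bar>)"
      by (rule Bochner_Integration.integral_cong) (auto simp: R_def abs_mult)
    also have "\<dots> \<le> (LINT x|M. R x powr (q / (q - 1))) powr (1 - 1 / q) * (C0 powr (1 / q) * H10_norm \<Omega> v)"
      unfolding R_def by (rule H(2)) (use v in auto)
    finally show "\<bar>LINT x|M. g x (u x) * v x\<bar> \<le> ((LINT x|M. R x powr (q / (q - 1))) powr (1 - 1 / q) * C0 powr (1 / q)) * H10_norm \<Omega> v"
      by (simp add: mult.assoc)
  qed
qed

text \<open>Argued by contradiction along a sequence \<open>v n\<close> tending to 0. The remainder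
  divided by \<open>\<bar>v n\<bar>\<close> tends to 0 almost everywhere along a subsequence, and
  its conjugate power is at most a fixed integrable function plus a multiple of
  \<open>\<bar>v n\<bar> powr q\<close>, whose integral vanishes in the limit. It thus tends to 0 in
  the dual Lebesgue space, and Hoelder's inequality makes the remainder small relative to
  \<open>H10_norm \<Omega> (v n)\<close>.\<close>

lemma NG_frechet:
  assumes u: "u \<in> H10 \<Omega>" and \<epsilon>: "\<epsilon> > 0"
  shows "\<exists>\<delta>>0. \<forall>v\<in>H10 \<Omega>. H10_norm \<Omega> v < \<delta> \<longrightarrow>
    \<bar>NG (\<lambda>x. u x + v x) - NG u - (LINT x|M. g x (u x) * v x)\<bar> \<le> \<epsilon> * H10_norm \<Omega> v"
proof (rule ccontr)
  assume neg: "\<not> ?thesis"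
  let ?E = "\<lambda>v. \<bar>NG (\<lambda>x. u x + v x) - NG u - (LINT x|M. g x (u x) * v x)\<bar>"
  have "\<exists>v. v \<in> H10 \<Omega> \<and> H10_norm \<Omega> v < inverse (real (Suc n)) \<and> ?E v > \<epsilon> * H10_norm \<Omega> v" for n
  proof -
    have "inverse (real (Suc n)) > 0" by simp
    with neg show ?thesis by (metis not_le)
  qed
  then have "\<forall>n. \<exists>v. v \<in> H10 \<Omega> \<and> H10_norm \<Omega> v < inverse (real (Suc n)) \<and> ?E v > \<epsilon> * H10_norm \<Omega> v" ..
  from choice[OF this] obtain v where V: "\<forall>n. v n \<in> H10 \<Omega> \<and> H10_norm \<Omega> (v n) < inverse (real (Suc n)) \<and>
    ?E (v n) > \<epsilon> * H10_norm \<Omega> (v n)" ..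
  have v: "v n \<in> H10 \<Omega>" "H10_norm \<Omega> (v n) < inverse (real (Suc n))" "?E (v n) > \<epsilon> * H10_norm \<Omega> (v n)" for n
    using spec[OF V, of n] by (simp_all only:)
  have n0: "(\<lambda>n. H10_norm \<Omega> (v n)) \<longlonglongrightarrow> 0"
    by (rule Lim_null_comparison[OF _ LIMSEQ_inverse_real_of_nat]) (use v(2) in \<open>auto intro!: always_eventually less_imp_le\<close>)
  have C0n: "(\<lambda>n. C0 * H10_norm \<Omega> (v n) powr q) \<longlonglongrightarrow> 0"
  proof -
    have "(\<lambda>n. C0 * H10_norm \<Omega> (v n) powr q) \<longlonglongrightarrow> C0 * 0 powr q"
      using q_gt_1 by (intro tendsto_mult tendsto_const tendsto_powr' n0) auto
    then show ?thesis by simp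
  qed
  have vq: "(\<lambda>n. LINT x|M. norm (\<bar>v n x\<bar> powr q)) \<longlonglongrightarrow> 0"
    by (rule Lim_null_comparison[OF _ C0n])
      (use sobolev_H10(2)[OF v(1)] in \<open>auto intro!: always_eventually simp: abs_of_nonneg Bochner_Integration.integral_nonneg\<close>)
  obtain r where r: "strict_mono (r :: nat \<Rightarrow> nat)" "AE x in M. (\<lambda>n. \<bar>v (r n) x\<bar> powr q) \<longlonglongrightarrow> 0"
    using tendsto_L1_AE_subseq[OF sobolev_H10(1)[OF v(1)] vq] by auto
  have v0: "AE x in M. (\<lambda>n. v (r n) x) \<longlonglongrightarrow> 0"
    using r(2)
  proof eventually_elim
    case (elim x)
    have "(\<lambda>n. (\<bar>v (r n) x\<bar> powr q) powr (1 / q)) \<longlonglongrightarrow> 0 powr (1 / q)"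
      using q_gt_1 by (intro tendsto_powr' elim tendsto_const) auto
    then have "(\<lambda>n. \<bar>v (r n) x\<bar>) \<longlonglongrightarrow> 0" using q_gt_1 by (simp add: powr_powr)
    then show ?case by (simp add: tendsto_rabs_zero_iff)
  qed
  have um: "u \<in> borel_measurable M" and vm: "v n \<in> borel_measurable M" for n
    using u v(1) H10_measurable by auto
  define R where "R n x = (if x \<in> \<Omega> then \<bar>G x (u x + v (r n) x) - G x (u x) - g x (u x) * v (r n) x\<bar> / \<bar>v (r n) x\<bar> else 0)" for n x
  have R0: "0 \<le> R n x" for n x by (simp add: R_def)
  let ?k = "q / (q - 1)"
  have k: "?k > 0" using q_gt_1 by simp
  define D where "D = (2 * Cg) powr ?k * 2 powr ?k * 2 powr q"
  have D0: "D \<ge> 0" by (simp add: D_def)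
  have Rb: "R n x \<le> 2 * Cg * (1 + (\<bar>u x\<bar> + \<bar>v (r n) x\<bar>) powr (q - 1))" if x: "x \<in> \<Omega>" for n x
  proof (cases "v (r n) x = 0")
    case True
    then show ?thesis using Cg_pos x by (simp add: R_def)
  next
    case False
    let ?a = "u x" and ?b = "v (r n) x"
    let ?B = "Cg * (1 + (\<bar>?a\<bar> + \<bar>?b\<bar>) powr (q - 1))"
    have "\<bar>?a\<bar> powr (q - 1) \<le> (\<bar>?a\<bar> + \<bar>?b\<bar>) powr (q - 1)" using q_gt_1 by (intro powr_mono2) auto
    then have "Cg * (1 + \<bar>?a\<bar> powr (q - 1)) \<le> ?B" using Cg_pos by simp
    then have "\<bar>g x ?a\<bar> \<le> ?B" using g_bound[OF x, of ?a] by linarith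
    then have "\<bar>g x ?a * ?b\<bar> \<le> ?B * \<bar>?b\<bar>" unfolding abs_mult by (intro mult_right_mono) auto
    with G_diff_bound[OF x, of ?a ?b]
    have "\<bar>G x (?a + ?b) - G x ?a - g x ?a * ?b\<bar> \<le> ?B * \<bar>?b\<bar> + ?B * \<bar>?b\<bar>" by linarith
    then have "\<bar>G x (?a + ?b) - G x ?a - g x ?a * ?b\<bar> \<le> (2 * ?B) * \<bar>?b\<bar>" by (simp add: algebra_simps)
    then show ?thesis using False x by (simp add: R_def pos_divide_le_eq mult.assoc)
  qed
  have Rk: "R n x powr ?k \<le> D * (1 + \<bar>u x\<bar> powr q + \<bar>v (r n) x\<bar> powr q)" if "x \<in> \<Omega>" for n x
    unfolding D_def by (rule conj_power_bound[OF R0 Rb[OF that]]) (use Cg_pos in auto)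
  have Rm: "(\<lambda>x. R n x powr ?k) \<in> borel_measurable M" for n
  proof -
    have "(\<lambda>x. (\<bar>G x (u x + v (r n) x) - G x (u x) - g x (u x) * v (r n) x\<bar> / \<bar>v (r n) x\<bar>) powr ?k) \<in> borel_measurable M"
      using G_compose[OF borel_measurable_add[OF um vm[of "r n"]]] G_compose[OF um] g_compose[OF um] vm[of "r n"] by simp
    then show ?thesis by (rule measurable_cong[THEN iffD1, rotated]) (simp add: R_def)
  qed
  have Rlim: "AE x in M. (\<lambda>n. R n x powr ?k) \<longlonglongrightarrow> 0"
    using v0 AE_space
  proof eventually_elim
    case (elim x)
    then have x: "x \<in> \<Omega>" by simp
    have "((\<lambda>h. (G x (u x + h) - G x (u x)) / h) \<longlongrightarrow> g x (u x)) (at 0)"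
      using G_deriv[OF x, of "u x"] by (simp add: DERIV_def)
    then have l: "((\<lambda>h. \<bar>(G x (u x + h) - G x (u x)) / h - g x (u x)\<bar>) \<longlongrightarrow> 0) (at 0)"
      by (intro tendsto_rabs_zero LIM_zero)
    \<comment> \<open>Division by zero gives \<open>Q 0 = 0\<close>, which is also the limit of
      \<open>Q\<close> at 0. Hence \<open>Q\<close> is continuous there, and indices with
      \<open>v (r n) x = 0\<close> are covered as well.\<close>
    define Q where "Q h = \<bar>G x (u x + h) - G x (u x) - g x (u x) * h\<bar> / \<bar>h\<bar>" for h
    have "(Q \<longlongrightarrow> 0) (at 0)"
      by (rule Lim_transform_eventually[OF l])
        (auto simp: eventually_at_filter Q_def field_simps intro!: always_eventually simp flip: abs_divide)
    then have "isCont Q 0" by (simp add: isCont_def Q_def)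
    from isCont_tendsto_compose[OF this elim(1)] have "(\<lambda>n. Q (v (r n) x)) \<longlonglongrightarrow> 0" by (simp add: Q_def)
    then have "(\<lambda>n. R n x) \<longlonglongrightarrow> 0" using x by (simp add: R_def Q_def)
    then have "(\<lambda>n. R n x powr ?k) \<longlonglongrightarrow> 0 powr ?k"
      using R0 k by (intro tendsto_powr' tendsto_const) auto
    then show ?case by simp
  qed
  have vq': "(\<lambda>n. LINT x|M. \<bar>v (r n) x\<bar> powr q) \<longlonglongrightarrow> 0"
    using LIMSEQ_subseq_LIMSEQ[OF vq r(1)] by (simp add: o_def)
  have split: "\<exists>Y W. (\<forall>n. integrable M (Y n)) \<and> integrable M W \<and>
        (\<forall>n. AE x in M. 0 \<le> Y n x \<and> \<bar>R n x powr ?k\<bar> \<le> Y n x + W x) \<and>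
        (\<forall>\<^sub>F n in sequentially. (LINT x|M. Y n x) \<le> \<eta>)" if \<eta>: "\<eta> > 0" for \<eta>
  proof (intro exI conjI allI)
    show "integrable M (\<lambda>x. D * \<bar>v (r n) x\<bar> powr q)" for n
      using sobolev_H10(1)[OF v(1)] by simp
    show "integrable M (\<lambda>x. D * (1 + \<bar>u x\<bar> powr q))"
      using sobolev_H10(1)[OF u] by simp
    show "AE x in M. 0 \<le> D * \<bar>v (r n) x\<bar> powr q \<and> \<bar>R n x powr ?k\<bar> \<le> D * \<bar>v (r n) x\<bar> powr q + D * (1 + \<bar>u x\<bar> powr q)" for n
      using Rk D0 by (intro AE_I2) (auto simp: algebra_simps)
    have "(\<lambda>n. LINT x|M. D * \<bar>v (r n) x\<bar> powr q) \<longlonglongrightarrow> 0"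
      using tendsto_mult_right_zero[OF vq', of D] by simp
    from order_tendstoD(2)[OF this \<eta>]
    show "\<forall>\<^sub>F n in sequentially. (LINT x|M. D * \<bar>v (r n) x\<bar> powr q) \<le> \<eta>"
      by eventually_elim simp
  qed
  note T = tendsto_L1_split[of "\<lambda>n x. R n x powr ?k", OF Rm Rlim split]
  have Ri: "integrable M (\<lambda>x. R n x powr ?k)" for n by (rule T(1))
  define A where "A n = (LINT x|M. R n x powr ?k) powr (1 - 1 / q) * C0 powr (1 / q)" for n
  have "(\<lambda>n. (LINT x|M. R n x powr ?k) powr (1 - 1 / q) * C0 powr (1 / q)) \<longlonglongrightarrow> 0 powr (1 - 1 / q) * C0 powr (1 / q)"
    using q_gt_1 by (intro tendsto_mult tendsto_powr' T(3) tendsto_const)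
      (auto intro!: always_eventually Bochner_Integration.integral_nonneg)
  then have "A \<longlonglongrightarrow> 0" by (simp add: A_def[abs_def])
  then have "\<forall>\<^sub>F n in sequentially. A n < \<epsilon>" using \<epsilon> by (intro order_tendstoD(2))
  then obtain n where n: "A n < \<epsilon>" unfolding eventually_sequentially by auto
  let ?v = "v (r n)"
  have uv: "(\<lambda>x. u x + ?v x) \<in> H10 \<Omega>" by (rule H10_add[OF u v(1)])
  have "NG (\<lambda>x. u x + ?v x) - NG u - (LINT x|M. g x (u x) * ?v x) = (LINT x|M. G x (u x + ?v x) - G x (u x) - g x (u x) * ?v x)"
    unfolding NG_def using NG_eq(1)[OF uv] NG_eq(1)[OF u] g_mult_integrable[OF u v(1)[of "r n"]] by simp
  then have "?E ?v \<le> (LINT x|M. \<bar>G x (u x + ?v x) - G x (u x) - g x (u x) * ?v x\<bar>)"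
    by (simp only: integral_abs_bound)
  also have "\<dots> = (LINT x|M. R n x * \<bar>?v x\<bar>)"
    by (rule Bochner_Integration.integral_cong) (auto simp: R_def)
  also have "\<dots> \<le> A n * H10_norm \<Omega> ?v"
    unfolding A_def using Holder_q(2)[OF Ri R0 v(1)[of "r n"], of n] by (simp add: mult.assoc)
  also have "\<dots> \<le> \<epsilon> * H10_norm \<Omega> ?v" using n by (intro mult_right_mono) auto
  finally show False using v(3)[of "r n"] by linarith
qed

end

lemma primitive_cong_nonneg:
  assumes "\<And>s. 0 \<le> s \<Longrightarrow> h s = h' s" "0 \<le> t"
  shows "primitive h t = primitive h' t"
proof -
  have "(\<lambda>s. indicator {0<..<t} s * h s) = (\<lambda>s. indicator {0<..<t} s * h' s)"
    using assms(1) by (auto simp: fun_eq_iff indicator_def)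
  then show ?thesis
    using assms(2) by (simp add: primitive_def interval_lebesgue_integral_def set_lebesgue_integral_def)
qed

text \<open>Differentiability of the comparison function is asked for on the open half-line only,
  because the powers to which it is applied may fail to be differentiable at 0.\<close>

lemma primitive_ge:
  fixes \<Phi> \<phi> :: "real \<Rightarrow> real"
  assumes h: "continuous_on UNIV h" and \<Phi>: "continuous_on {0..} \<Phi>" "\<Phi> 0 = 0"
    and d: "\<And>s. s > 0 \<Longrightarrow> (\<Phi> has_real_derivative \<phi> s) (at s)"
    and le: "\<And>s. s > 0 \<Longrightarrow> \<phi> s \<le> h s" and t: "0 \<le> t"
  shows "\<Phi> t \<le> primitive h t"
proof -
  have "primitive h 0 - \<Phi> 0 \<le> primitive h t - \<Phi> t"
  proof (rule DERIV_nonneg_imp_increasing_open[OF t, of "\<lambda>x. primitive h x - \<Phi> x"])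
    fix s :: real assume "0 < s" "s < t"
    then show "\<exists>y. ((\<lambda>x. primitive h x - \<Phi> x) has_real_derivative y) (at s) \<and> 0 \<le> y"
      using DERIV_diff[OF primitive_deriv[OF h] d] le by force
  next
    show "continuous_on {0..t} (\<lambda>x. primitive h x - \<Phi> x)"
      by (intro continuous_intros continuous_on_subset[OF primitive_continuous[OF h]] continuous_on_subset[OF \<Phi>(1)]) auto
  qed
  then show ?thesis using \<Phi>(2) by simp
qed

lemma powr_continuous_nonneg: "r > 0 \<Longrightarrow> continuous_on {0..} (\<lambda>t::real. t powr r)"
  by (intro continuous_on_powr' continuous_intros) auto

text \<open>The three conditions enter only through \<open>h_gt\<close>, which prevents loss of
  compactness, and \<open>H_ge\<close>, which gives coercivity. \<open>J\<close> is a separate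
  parameter tied to the energy on \<open>H10\<close> alone, so that the functional of the original
  nonlinearity can be supplied after \<open>f\<close> has been changed on a null set.\<close>

locale kirchhoff_problem = nonlinearity \<Omega> f c1 c2 p
  for \<Omega> :: "'a::euclidean_space set" and f c1 c2 p +
  fixes h :: "real \<Rightarrow> real" and J :: "('a \<Rightarrow> real) \<Rightarrow> real" and a \<rho> Cb :: real
  assumes h_cont: "continuous_on {0..} h" and h_mono: "mono_on {0..} h" and h_nonneg: "\<And>t. 0 \<le> t \<Longrightarrow> 0 \<le> h t"
    and J_energy: "\<And>u. u \<in> H10 \<Omega> \<Longrightarrow> J u = energy \<Omega> h f u"
    and h_gt: "\<And>t. t > 0 \<Longrightarrow> h t > K * t powr (q / 2 - 1)"
    and a: "a > 0" and \<rho>: "p < \<rho>"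
    and H_ge: "\<And>t. 0 \<le> t \<Longrightarrow> 1 / 2 * primitive h t \<ge> K / q * t powr (q / 2) + a * t powr (\<rho> / 2) - Cb"
begin

text \<open>The constant continuation to negative arguments makes the primitive differentiable on
  the whole line, in particular at 0, which is the Dirichlet integral of the zero function.\<close>

definition hh :: "real \<Rightarrow> real" where "hh t = h (max 0 t)"
definition H :: "real \<Rightarrow> real" where "H = primitive hh"

lemma hh_cont: "continuous_on UNIV hh"
  unfolding hh_def[abs_def]
  by (rule continuous_on_compose2[OF h_cont]) (auto intro!: continuous_intros)

lemma hh_eq: "0 \<le> t \<Longrightarrow> hh t = h t" by (simp add: hh_def)

lemma H_deriv: "(H has_real_derivative hh t) (at t)"
  unfolding H_def by (rule primitive_deriv[OF hh_cont])

lemma H_eq: "0 \<le> t \<Longrightarrow> primitive h t = H t"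
  unfolding H_def by (rule primitive_cong_nonneg) (simp add: hh_eq)

lemma J_eq: "u \<in> H10 \<Omega> \<Longrightarrow> J u = 1 / 2 * H (dirichlet \<Omega> u) - NG u"
  by (simp add: J_energy energy_def NG_eq H_eq F_def q_def)

lemma J_eq2: "u \<in> H10 \<Omega> \<Longrightarrow>
    J u = 1 / 2 * H (dirichlet \<Omega> u) - (LINT x|M. F x (u x)) - 1 / q * (LINT x|M. \<bar>u x\<bar> powr q)"
  by (simp add: J_eq NG_eq)

text \<open>Unlike \<open>H_ge\<close> this bound has no additive error. It is applied to the lost
  amount \<open>s\<close>, where an error would spoil the comparison of infima.\<close>

lemma H_lower:
  assumes "0 \<le> t"
  shows "K / q * t powr (q / 2) \<le> 1 / 2 * H t"
proof -
  have "2 * K / q * t powr (q / 2) \<le> primitive hh t"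
  proof (rule primitive_ge[OF hh_cont, where \<phi> = "\<lambda>s. K * s powr (q / 2 - 1)"])
    show "continuous_on {0..} (\<lambda>t. 2 * K / q * t powr (q / 2))"
      using q_gt_1 by (intro continuous_intros powr_continuous_nonneg) auto
    show "((\<lambda>t. 2 * K / q * t powr (q / 2)) has_real_derivative K * s powr (q / 2 - 1)) (at s)" if "s > 0" for s
      using that q_gt_1 by (auto intro!: derivative_eq_intros)
    show "K * s powr (q / 2 - 1) \<le> hh s" if "s > 0" for s
      using h_gt[OF that] that by (simp add: hh_eq)
  qed (use assms in auto)
  moreover have "2 * K / q * t powr (q / 2) = 2 * (K / q * t powr (q / 2))" by simp
  ultimately show ?thesis unfolding H_def by linarith
qed

text \<open>Monotonicity of \<open>h\<close> enters only here; it yields the weak lower semicontinuity of the energy.\<close>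

lemma H_superadd:
  assumes "0 \<le> s" "0 \<le> t"
  shows "H s + H t \<le> H (t + s)"
proof -
  have "H (0 + s) - H 0 \<le> H (t + s) - H t"
  proof (rule DERIV_nonneg_imp_nondecreasing[OF assms(2), of "\<lambda>x. H (x + s) - H x"])
    fix x :: real assume x: "0 \<le> x" "x \<le> t"
    have "hh x \<le> hh (x + s)"
      using x assms(1) mono_onD[OF h_mono, of x "x + s"] by (simp add: hh_eq)
    moreover have "((\<lambda>x. H (x + s)) has_real_derivative hh (x + s)) (at x)"
      by (rule DERIV_shift[THEN iffD1]) (rule H_deriv)
    then have "((\<lambda>x. H (x + s) - H x) has_real_derivative hh (x + s) - hh x) (at x)"
      by (rule DERIV_diff[OF _ H_deriv])
    ultimately show "\<exists>y. ((\<lambda>x. H (x + s) - H x) has_real_derivative y) (at x) \<and> 0 \<le> y"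
      by (intro exI conjI) auto
  qed
  then show ?thesis by (simp add: H_def)
qed

text \<open>Hoelder's inequality against the constant 1 on the finite measure space, followed by
  \<open>sobolev_K\<close>.\<close>

lemma p_norm_bound:
  obtains C where "C \<ge> 0" "\<And>u. u \<in> H10 \<Omega> \<Longrightarrow>
    integrable M (\<lambda>x. \<bar>u x\<bar> powr p) \<and> (LINT x|M. \<bar>u x\<bar> powr p) \<le> C * dirichlet \<Omega> u powr (p / 2)"
proof (rule that[of "K powr (p / q) * measure M (space M) powr (1 - p / q)"])
  fix u assume u: "u \<in> H10 \<Omega>"
  have pq: "0 \<le> p / q" "p / q \<le> 1" using p p_less_q by auto
  have e: "(\<bar>u x\<bar> powr q) powr (p / q) = \<bar>u x\<bar> powr p" for x using q_gt_1 by (simp add: powr_powr)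
  note HH = Holder_two[of "p / q" "1 - p / q" M "\<lambda>x. \<bar>u x\<bar> powr q" "\<lambda>x. 1", unfolded e, simplified]
  have i: "integrable M (\<lambda>x. \<bar>u x\<bar> powr p)" using HH(1) pq sobolev_H10(1)[OF u] by simp
  have "(LINT x|M. \<bar>u x\<bar> powr p) \<le> (LINT x|M. \<bar>u x\<bar> powr q) powr (p / q) * measure M (space M) powr (1 - p / q)"
    using HH(2) pq sobolev_H10(1)[OF u] by simp
  also have "\<dots> \<le> (K * dirichlet \<Omega> u powr (q / 2)) powr (p / q) * measure M (space M) powr (1 - p / q)"
    using sobolev_K[OF u] pq by (intro mult_right_mono powr_mono2) (auto intro: Bochner_Integration.integral_nonneg)
  also have "\<dots> = K powr (p / q) * measure M (space M) powr (1 - p / q) * dirichlet \<Omega> u powr (p / 2)"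
    using K_nonneg q_gt_1 by (simp add: powr_mult powr_powr)
  finally show "integrable M (\<lambda>x. \<bar>u x\<bar> powr p) \<and> (LINT x|M. \<bar>u x\<bar> powr p) \<le>
      K powr (p / q) * measure M (space M) powr (1 - p / q) * dirichlet \<Omega> u powr (p / 2)"
    using i by simp
qed simp

text \<open>The critical term cancels against \<open>K / q * D powr (q / 2)\<close> in
  \<open>H_ge\<close>. The subcritical integral grows at most like the power \<open>p / 2\<close> of
  the Dirichlet integral, and since \<open>p < \<rho>\<close> half of the surplus absorbs
  it.\<close>

lemma J_lower:
  obtains C where "\<And>u. u \<in> H10 \<Omega> \<Longrightarrow> J u \<ge> a / 2 * dirichlet \<Omega> u powr (\<rho> / 2) - C"
proof -
  obtain B where B: "B \<ge> 0" "\<And>u. u \<in> H10 \<Omega> \<Longrightarrow>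
    integrable M (\<lambda>x. \<bar>u x\<bar> powr p) \<and> (LINT x|M. \<bar>u x\<bar> powr p) \<le> B * dirichlet \<Omega> u powr (p / 2)"
    by (rule p_norm_bound) (blast intro: that)
  define c where "c = (c1 + c2) * B + 1"
  have c: "c > 0" using B(1) c12 by (simp add: c_def add_nonneg_pos)
  obtain E where E: "E \<ge> 0" "\<And>t. t \<ge> 0 \<Longrightarrow> t powr (p / 2) \<le> a / (2 * c) * t powr (\<rho> / 2) + E"
    by (rule powr_absorb[of "p / 2" "\<rho> / 2" "a / (2 * c)"]) (use p \<rho> a c in auto)
  let ?m = "measure M (space M)"
  show thesis
  proof (rule that[of "c * E + c2 * ?m + Cb"])
    fix u assume u: "u \<in> H10 \<Omega>"
    let ?D = "dirichlet \<Omega> u"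
    have i: "integrable M (\<lambda>x. \<bar>u x\<bar> powr p)" using B(2)[OF u] by simp
    have "(LINT x|M. F x (u x)) \<le> (LINT x|M. (c1 + c2) * \<bar>u x\<bar> powr p + c2)"
    proof (rule integral_mono[OF F_integrable[OF u]])
      show "integrable M (\<lambda>x. (c1 + c2) * \<bar>u x\<bar> powr p + c2)" using i by simp
      fix x assume "x \<in> space M"
      then have "\<bar>F x (u x)\<bar> \<le> c1 * \<bar>u x\<bar> powr p + c2 * \<bar>u x\<bar>" by (intro F_bound) simp
      moreover have "\<bar>u x\<bar> powr 1 \<le> 1 + \<bar>u x\<bar> powr p" using p by (intro powr_le_1_plus) auto
      then have "c2 * \<bar>u x\<bar> \<le> c2 * (1 + \<bar>u x\<bar> powr p)" using c12 by (intro mult_left_mono) auto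
      ultimately show "F x (u x) \<le> (c1 + c2) * \<bar>u x\<bar> powr p + c2" by (simp add: algebra_simps)
    qed
    also have "\<dots> = (c1 + c2) * (LINT x|M. \<bar>u x\<bar> powr p) + c2 * ?m" using i by (simp add: mult.commute)
    also have "\<dots> \<le> (c1 + c2) * (B * ?D powr (p / 2)) + c2 * ?m"
      using B(2)[OF u] c12 by (intro add_right_mono mult_left_mono) auto
    also have "\<dots> \<le> c * ?D powr (p / 2) + c2 * ?m"
      by (simp add: c_def algebra_simps)
    also have "c * ?D powr (p / 2) \<le> c * (a / (2 * c) * ?D powr (\<rho> / 2) + E)"
      using E(2)[of ?D] c by (intro mult_left_mono) auto
    also have "\<dots> = a / 2 * ?D powr (\<rho> / 2) + c * E" using c by (simp add: algebra_simps)
    finally have F: "(LINT x|M. F x (u x)) \<le> a / 2 * ?D powr (\<rho> / 2) + c * E + c2 * ?m" by simp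
    have "1 / q * (LINT x|M. \<bar>u x\<bar> powr q) \<le> 1 / q * (K * ?D powr (q / 2))"
      using sobolev_K[OF u] q_gt_1 by (intro mult_left_mono) auto
    then have S: "1 / q * (LINT x|M. \<bar>u x\<bar> powr q) \<le> K / q * ?D powr (q / 2)" by simp
    have "K / q * ?D powr (q / 2) + a * ?D powr (\<rho> / 2) - Cb \<le> 1 / 2 * H ?D"
      using H_ge[of ?D] by (simp add: H_eq)
    then show "J u \<ge> a / 2 * ?D powr (\<rho> / 2) - (c * E + c2 * ?m + Cb)"
      unfolding J_eq2[OF u] using F S by linarith
  qed
qed

lemma J_bdd_below: "bdd_below (J ` H10 \<Omega>)"
proof -
  obtain C where C: "\<And>u. u \<in> H10 \<Omega> \<Longrightarrow> J u \<ge> a / 2 * dirichlet \<Omega> u powr (\<rho> / 2) - C"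
    by (rule J_lower) (blast intro: that)
  show ?thesis
  proof (rule bdd_belowI2[of _ "- C"])
    fix u assume "u \<in> H10 \<Omega>"
    moreover have "0 \<le> a / 2 * dirichlet \<Omega> u powr (\<rho> / 2)" using a by simp
    ultimately show "- C \<le> J u" using C[of u] by linarith
  qed
qed

lemma J_coercive: "coercive \<Omega> J"
  unfolding coercive_def
proof
  fix m :: real
  obtain C where C: "\<And>u. u \<in> H10 \<Omega> \<Longrightarrow> J u \<ge> a / 2 * dirichlet \<Omega> u powr (\<rho> / 2) - C"
    by (rule J_lower) (blast intro: that)
  have \<rho>0: "\<rho> > 0" using p \<rho> by simp
  \<comment> \<open>The value of \<open>dirichlet \<Omega> u powr (\<rho> / 2)\<close> from which on
    the lower bound exceeds \<open>m\<close>.\<close>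
  define T where "T = max 0 ((m + C) / (a / 2))"
  have T: "T \<ge> 0" "a / 2 * T \<ge> m + C" using a by (auto simp: T_def max_def field_simps)
  show "\<exists>R. \<forall>u\<in>H10 \<Omega>. R \<le> H10_norm \<Omega> u \<longrightarrow> m \<le> J u"
  proof (intro exI ballI impI)
    fix u assume u: "u \<in> H10 \<Omega>" and R: "T powr (1 / \<rho>) \<le> H10_norm \<Omega> u"
    have "T = (T powr (1 / \<rho>)) powr \<rho>" using \<rho>0 T(1) by (simp add: powr_powr)
    also have "\<dots> \<le> H10_norm \<Omega> u powr \<rho>" using R \<rho>0 by (intro powr_mono2) auto
    also have "\<dots> = dirichlet \<Omega> u powr (\<rho> / 2)"
      by (simp add: H10_norm_def powr_half_sqrt[symmetric] powr_powr)
    finally have "a / 2 * T \<le> a / 2 * dirichlet \<Omega> u powr (\<rho> / 2)" using a by (intro mult_left_mono) auto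
    then show "m \<le> J u" using C[OF u] T(2) by linarith
  qed
qed

lemma J_sublevel_bounded:
  obtains B where "\<And>u. u \<in> H10 \<Omega> \<Longrightarrow> J u \<le> c \<Longrightarrow> H10_norm \<Omega> u \<le> B"
proof -
  \<comment> \<open>The level \<open>c + 1\<close> turns the weak inequality in
    \<open>coercive\<close> into a contradiction with \<open>J u \<le> c\<close>.\<close>
  obtain R where "\<forall>u\<in>H10 \<Omega>. R \<le> H10_norm \<Omega> u \<longrightarrow> c + 1 \<le> J u"
    using J_coercive unfolding coercive_def by blast
  then show thesis by (intro that[of R]) (meson add_le_same_cancel1 linear not_one_le_zero order_trans)
qed

text \<open>The common form of all limits below: pointwise convergence to 0 and a majorant
  consisting of an arbitrarily small multiple of critical powers with bounded integrals plus one
  fixed integrable function. The sequence \<open>v\<close> is present because the bounds involve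
  \<open>u n\<close> and \<open>u n - w\<close> alike.\<close>

lemma vanishing:
  fixes u v X :: "nat \<Rightarrow> 'a \<Rightarrow> real"
  assumes u: "\<And>n. u n \<in> H10 \<Omega>" "\<And>n. (LINT x|M. \<bar>u n x\<bar> powr q) \<le> Q"
    and v: "\<And>n. v n \<in> H10 \<Omega>" "\<And>n. (LINT x|M. \<bar>v n x\<bar> powr q) \<le> Q"
    and X: "\<And>n. X n \<in> borel_measurable M" "AE x in M. (\<lambda>n. X n x) \<longlonglongrightarrow> 0"
    and b: "\<And>\<delta>. \<delta> > 0 \<Longrightarrow> \<exists>W. integrable M W \<and> (\<forall>n. \<forall>x\<in>\<Omega>. \<bar>X n x\<bar> \<le> \<delta> * (\<bar>u n x\<bar> powr q + \<bar>v n x\<bar> powr q) + W x)"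
  shows "\<And>n. integrable M (X n)" "(\<lambda>n. LINT x|M. X n x) \<longlonglongrightarrow> 0"
proof -
  have "0 \<le> (LINT x|M. \<bar>u 0 x\<bar> powr q)" by (rule Bochner_Integration.integral_nonneg) simp
  then have Q0: "Q \<ge> 0" using u(2)[of 0] by linarith
  have "\<exists>Y W. (\<forall>n. integrable M (Y n)) \<and> integrable M W \<and>
        (\<forall>n. AE x in M. 0 \<le> Y n x \<and> \<bar>X n x\<bar> \<le> Y n x + W x) \<and>
        (\<forall>\<^sub>F n in sequentially. (LINT x|M. Y n x) \<le> \<eta>)" if \<eta>: "\<eta> > 0" for \<eta>
  proof -
    define \<delta> where "\<delta> = \<eta> / (2 * Q + 1)"
    have \<delta>: "\<delta> > 0" using \<eta> Q0 by (simp add: \<delta>_def)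
    obtain W where W: "integrable M W" "\<And>n x. x \<in> \<Omega> \<Longrightarrow> \<bar>X n x\<bar> \<le> \<delta> * (\<bar>u n x\<bar> powr q + \<bar>v n x\<bar> powr q) + W x"
      using b[OF \<delta>] by blast
    show ?thesis
    proof (intro exI conjI allI)
      show "integrable M (\<lambda>x. \<delta> * (\<bar>u n x\<bar> powr q + \<bar>v n x\<bar> powr q))" for n
        using sobolev_H10(1)[OF u(1)] sobolev_H10(1)[OF v(1)] by simp
      show "AE x in M. 0 \<le> \<delta> * (\<bar>u n x\<bar> powr q + \<bar>v n x\<bar> powr q) \<and>
          \<bar>X n x\<bar> \<le> \<delta> * (\<bar>u n x\<bar> powr q + \<bar>v n x\<bar> powr q) + W x" for n
        using W(2) \<delta> by (intro AE_I2) auto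
      show "\<forall>\<^sub>F n in sequentially. (LINT x|M. \<delta> * (\<bar>u n x\<bar> powr q + \<bar>v n x\<bar> powr q)) \<le> \<eta>"
      proof (intro always_eventually allI)
        fix n
        have "(LINT x|M. \<delta> * (\<bar>u n x\<bar> powr q + \<bar>v n x\<bar> powr q)) = \<delta> * ((LINT x|M. \<bar>u n x\<bar> powr q) + (LINT x|M. \<bar>v n x\<bar> powr q))"
          using sobolev_H10(1)[OF u(1)[of n]] sobolev_H10(1)[OF v(1)[of n]] by simp
        also have "\<dots> \<le> \<delta> * (2 * Q + 1)"
          using u(2)[of n] v(2)[of n] \<delta> by (intro mult_left_mono) auto
        also have "\<dots> = \<eta>" using Q0 by (simp add: \<delta>_def)
        finally show "(LINT x|M. \<delta> * (\<bar>u n x\<bar> powr q + \<bar>v n x\<bar> powr q)) \<le> \<eta>" .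
      qed
    qed (rule W(1))
  qed
  note T = tendsto_L1_split[OF X this]
  show "integrable M (X n)" for n by (rule T(1))
  show "(\<lambda>n. LINT x|M. X n x) \<longlonglongrightarrow> 0" by (rule T(3))
qed

lemma H10_norm_diff_le:
  assumes "u \<in> H10 \<Omega>" "v \<in> H10 \<Omega>"
  shows "H10_norm \<Omega> (\<lambda>x. u x - v x) \<le> H10_norm \<Omega> u + H10_norm \<Omega> v"
proof (rule power2_le_imp_le)
  have "(H10_norm \<Omega> (\<lambda>x. u x - v x))\<^sup>2 = (H10_norm \<Omega> u)\<^sup>2 - 2 * dform u v + (H10_norm \<Omega> v)\<^sup>2"
    unfolding H10_norm_sq using dirichlet_lincomb[OF assms, of 1 "-1"] by simp
  also have "\<dots> \<le> (H10_norm \<Omega> u + H10_norm \<Omega> v)\<^sup>2"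
    using dform_bound[OF assms] by (simp add: power2_sum abs_le_iff)
  finally show "(H10_norm \<Omega> (\<lambda>x. u x - v x))\<^sup>2 \<le> (H10_norm \<Omega> u + H10_norm \<Omega> v)\<^sup>2" .
qed simp

text \<open>The number \<open>s\<close> measures the loss of compactness: it vanishes iff the subsequence converges strongly.\<close>

lemma bounded_sequence_limits:
  fixes u :: "nat \<Rightarrow> 'a \<Rightarrow> real"
  assumes u: "\<And>n. u n \<in> H10 \<Omega>" and B: "\<And>n. H10_norm \<Omega> (u n) \<le> B"
  obtains r w s where "strict_mono (r :: nat \<Rightarrow> nat)" "w \<in> H10 \<Omega>" "0 \<le> s"
    "(\<lambda>n. dirichlet \<Omega> (u (r n))) \<longlonglongrightarrow> dirichlet \<Omega> w + s"
    "(\<lambda>n. dirichlet \<Omega> (\<lambda>x. u (r n) x - w x)) \<longlonglongrightarrow> s"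
    "(\<lambda>n. dform (u (r n)) (\<lambda>x. u (r n) x - w x)) \<longlonglongrightarrow> s"
    "(\<lambda>n. LINT x|M. F x (u (r n) x)) \<longlonglongrightarrow> (LINT x|M. F x (w x))"
    "(\<lambda>n. LINT x|M. f x (u (r n) x) * (u (r n) x - w x)) \<longlonglongrightarrow> 0"
    "\<And>n. integrable M (\<lambda>x. f x (u (r n) x) * (u (r n) x - w x))"
    "(\<lambda>n. (LINT x|M. \<bar>u (r n) x\<bar> powr q) - (LINT x|M. \<bar>u (r n) x - w x\<bar> powr q)) \<longlonglongrightarrow> (LINT x|M. \<bar>w x\<bar> powr q)"
    "(\<lambda>n. LINT x|M. max 0 (\<bar>u (r n) x\<bar> powr (q - 1) * \<bar>u (r n) x - w x\<bar> - \<bar>u (r n) x - w x\<bar> powr q)) \<longlonglongrightarrow> 0"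
    "\<And>n. integrable M (\<lambda>x. max 0 (\<bar>u (r n) x\<bar> powr (q - 1) * \<bar>u (r n) x - w x\<bar> - \<bar>u (r n) x - w x\<bar> powr q))"
proof -
  obtain r1 w where r1: "strict_mono (r1 :: nat \<Rightarrow> nat)" and w: "w \<in> H10 \<Omega>"
    and ae1: "AE x in M. (\<lambda>n. u (r1 n) x) \<longlonglongrightarrow> w x"
    and weak1: "\<And>v. v \<in> H10 \<Omega> \<Longrightarrow> (\<lambda>n. dform (u (r1 n)) v) \<longlonglongrightarrow> dform w v"
    using H10_compact[of u B, OF u B] by blast
  have "bounded (range (\<lambda>n. dirichlet \<Omega> (u (r1 n))))"
  proof (rule boundedI)
    fix y assume "y \<in> range (\<lambda>n. dirichlet \<Omega> (u (r1 n)))"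
    then obtain n where y: "y = (H10_norm \<Omega> (u (r1 n)))\<^sup>2" by (auto simp: H10_norm_sq)
    then show "norm y \<le> B\<^sup>2" using power_mono[OF B H10_norm_nonneg, of "r1 n" 2] by simp
  qed
  then obtain t r2 where r2: "strict_mono (r2 :: nat \<Rightarrow> nat)" and t: "((\<lambda>n. dirichlet \<Omega> (u (r1 n))) \<circ> r2) \<longlonglongrightarrow> t"
    using bounded_imp_convergent_subsequence by blast
  define r where "r = r1 \<circ> r2"
  have r: "strict_mono r" unfolding r_def by (rule strict_mono_o[OF r1 r2])
  have ae: "AE x in M. (\<lambda>n. u (r n) x) \<longlonglongrightarrow> w x"
    using ae1 by eventually_elim (use LIMSEQ_subseq_LIMSEQ[OF _ r2] in \<open>auto simp: r_def o_def\<close>)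
  have weak: "(\<lambda>n. dform (u (r n)) v) \<longlonglongrightarrow> dform w v" if "v \<in> H10 \<Omega>" for v
    using LIMSEQ_subseq_LIMSEQ[OF weak1[OF that] r2] by (simp add: r_def o_def)
  have tl: "(\<lambda>n. dirichlet \<Omega> (u (r n))) \<longlonglongrightarrow> t" using t by (simp add: r_def o_def)
  define U where "U n = u (r n)" for n
  define v where "v n x = U n x - w x" for n x
  have UH: "U n \<in> H10 \<Omega>" for n by (simp add: U_def u)
  have vH: "v n \<in> H10 \<Omega>" for n unfolding v_def by (rule H10_diff[OF UH w])
  have Um: "U n \<in> borel_measurable M" and vm: "v n \<in> borel_measurable M" and wm: "w \<in> borel_measurable M" for n
    using H10_measurable UH vH w by auto
  have Uae: "AE x in M. (\<lambda>n. U n x) \<longlonglongrightarrow> w x" using ae by (simp add: U_def)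
  have vae: "AE x in M. (\<lambda>n. v n x) \<longlonglongrightarrow> 0"
    using Uae by eventually_elim (auto simp: v_def intro: LIM_zero)
  \<comment> \<open>Weak convergence tested with \<open>w\<close> itself gives the limit
    \<open>t - 2 * dirichlet \<Omega> w + dirichlet \<Omega> w\<close> in the expansion of the
    Dirichlet integral of \<open>u - w\<close>. Nonnegativity of \<open>s\<close> is inherited from
    these integrals.\<close>
  define s where "s = t - dirichlet \<Omega> w"
  have vD: "dirichlet \<Omega> (v n) = dirichlet \<Omega> (U n) - 2 * dform (U n) w + dirichlet \<Omega> w" for n
    using dirichlet_lincomb[OF UH w, of 1 n "-1"] by (simp add: v_def[abs_def])
  have "(\<lambda>n. dirichlet \<Omega> (U n) - 2 * dform (U n) w + dirichlet \<Omega> w) \<longlonglongrightarrow> t - 2 * dform w w + dirichlet \<Omega> w"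
    unfolding U_def by (intro tendsto_intros tl weak w)
  then have sl: "(\<lambda>n. dirichlet \<Omega> (v n)) \<longlonglongrightarrow> s"
    unfolding vD s_def by (simp add: dform_self)
  have s0: "0 \<le> s" by (rule LIMSEQ_le_const[OF sl]) auto
  have fl: "(\<lambda>n. dform (U n) (v n)) \<longlonglongrightarrow> s"
  proof -
    have e: "dform (U n) (v n) = dirichlet \<Omega> (U n) - dform (U n) w" for n
      using dform_lincomb_right[OF UH UH w, of n 1 n "-1"] by (simp add: v_def[abs_def] dform_self)
    have "(\<lambda>n. dirichlet \<Omega> (U n) - dform (U n) w) \<longlonglongrightarrow> t - dform w w"
      unfolding U_def by (intro tendsto_intros tl weak w)
    then show ?thesis unfolding e s_def by (simp add: dform_self)
  qed
  \<comment> \<open>A common bound for the critical integrals of the sequence and of its differences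
    from \<open>w\<close>, as \<open>vanishing\<close> expects.\<close>
  define Q where "Q = C0 * (B + H10_norm \<Omega> w) powr q"
  have UQ: "(LINT x|M. \<bar>U n x\<bar> powr q) \<le> Q" for n
  proof -
    have "H10_norm \<Omega> (U n) \<le> B + H10_norm \<Omega> w" using B[of "r n"] H10_norm_nonneg[of w] unfolding U_def by linarith
    then have "C0 * H10_norm \<Omega> (U n) powr q \<le> Q"
      unfolding Q_def using C0_pos q_gt_1 by (intro mult_left_mono powr_mono2) auto
    then show ?thesis using sobolev_H10(2)[OF UH[of n]] by linarith
  qed
  have vQ: "(LINT x|M. \<bar>v n x\<bar> powr q) \<le> Q" for n
  proof -
    have "H10_norm \<Omega> (v n) \<le> B + H10_norm \<Omega> w"
      using H10_norm_diff_le[OF UH[of n] w] B[of "r n"] unfolding v_def[abs_def] U_def by linarith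
    then have "C0 * H10_norm \<Omega> (v n) powr q \<le> Q"
      unfolding Q_def using C0_pos q_gt_1 by (intro mult_left_mono powr_mono2) auto
    then show ?thesis using sobolev_H10(2)[OF vH[of n]] by linarith
  qed
  note van = vanishing[OF UH UQ vH vQ]
  have wq: "integrable M (\<lambda>x. \<bar>w x\<bar> powr q)" by (rule sobolev_H10(1)[OF w])
  have one: "\<bar>y\<bar> \<le> 1 + \<bar>y\<bar> powr p" for y :: real
    using powr_le_1_plus[of "\<bar>y\<bar>" 1 p] p by (auto split: if_splits)
  have absorb: "\<exists>C\<ge>0. \<forall>y. (c1 + c2) * \<bar>y\<bar> powr p \<le> \<delta> * \<bar>y\<bar> powr q + C" if \<delta>: "\<delta> > 0" for \<delta>
  proof -
    obtain C where C: "C \<ge> 0" "\<And>t. t \<ge> 0 \<Longrightarrow> t powr p \<le> \<delta> / (c1 + c2) * t powr q + C"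
      by (rule powr_absorb[of p q "\<delta> / (c1 + c2)"]) (use p p_less_q \<delta> c12 in auto)
    have "(c1 + c2) * \<bar>y\<bar> powr p \<le> \<delta> * \<bar>y\<bar> powr q + (c1 + c2) * C" for y
    proof -
      have "(c1 + c2) * \<bar>y\<bar> powr p \<le> (c1 + c2) * (\<delta> / (c1 + c2) * \<bar>y\<bar> powr q + C)"
        using C(2)[of "\<bar>y\<bar>"] c12 by (intro mult_left_mono) auto
      also have "\<dots> = \<delta> * \<bar>y\<bar> powr q + (c1 + c2) * C"
      proof -
        have "c1 + c2 \<noteq> 0" using c12 by simp
        then show ?thesis by (simp add: distrib_left)
      qed
      finally show ?thesis .
    qed
    then show ?thesis using C(1) c12 by (intro exI[of _ "(c1 + c2) * C"]) auto
  qed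
  have Fl: "(\<lambda>n. LINT x|M. F x (U n x)) \<longlonglongrightarrow> (LINT x|M. F x (w x))"
  proof -
    have "(\<lambda>n. LINT x|M. F x (U n x) - F x (w x)) \<longlonglongrightarrow> 0"
    proof (rule van(2))
      show "(\<lambda>x. F x (U n x) - F x (w x)) \<in> borel_measurable M" for n
        using F_compose[OF Um] F_compose[OF wm] by simp
      show "AE x in M. (\<lambda>n. F x (U n x) - F x (w x)) \<longlonglongrightarrow> 0"
        using Uae AE_space
      proof eventually_elim
        case (elim x)
        then have "isCont (F x) (w x)" using DERIV_isCont[OF F_deriv] by simp
        then show ?case using isCont_tendsto_compose elim(1) LIM_zero by blast
      qed
      fix \<delta> :: real assume "\<delta> > 0"
      then obtain C where C: "C \<ge> 0" "\<And>y. (c1 + c2) * \<bar>y\<bar> powr p \<le> \<delta> * \<bar>y\<bar> powr q + C" using absorb by blast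
      show "\<exists>W. integrable M W \<and> (\<forall>n. \<forall>x\<in>\<Omega>. \<bar>F x (U n x) - F x (w x)\<bar> \<le> \<delta> * (\<bar>U n x\<bar> powr q + \<bar>v n x\<bar> powr q) + W x)"
      proof (intro exI conjI allI ballI)
        show "integrable M (\<lambda>x. C + c2 + \<bar>F x (w x)\<bar>)" using F_integrable[OF w] by simp
        fix n x assume x: "x \<in> \<Omega>"
        have "c2 * \<bar>U n x\<bar> \<le> c2 * (1 + \<bar>U n x\<bar> powr p)" using one[of "U n x"] c12 by (intro mult_left_mono) auto
        then have "\<bar>F x (U n x)\<bar> \<le> (c1 + c2) * \<bar>U n x\<bar> powr p + c2"
          using F_bound[OF x, of "U n x"] by (simp add: algebra_simps)
        moreover have "0 \<le> \<delta> * \<bar>v n x\<bar> powr q" using \<open>\<delta> > 0\<close> by simp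
        ultimately show "\<bar>F x (U n x) - F x (w x)\<bar> \<le> \<delta> * (\<bar>U n x\<bar> powr q + \<bar>v n x\<bar> powr q) + (C + c2 + \<bar>F x (w x)\<bar>)"
          using C(2)[of "U n x"] unfolding distrib_left by linarith
      qed
    qed
    then have "(\<lambda>n. (LINT x|M. F x (U n x)) - (LINT x|M. F x (w x))) \<longlonglongrightarrow> 0"
      using F_integrable[OF UH] F_integrable[OF w] by simp
    then show ?thesis by (rule LIM_zero_cancel)
  qed
  have fv: "(\<lambda>n. LINT x|M. f x (U n x) * v n x) \<longlonglongrightarrow> 0" "integrable M (\<lambda>x. f x (U n x) * v n x)" for n
  proof -
    have m: "(\<lambda>x. f x (U n x) * v n x) \<in> borel_measurable M" for n
      using f_compose[OF Um] vm by simp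
    have l: "AE x in M. (\<lambda>n. f x (U n x) * v n x) \<longlonglongrightarrow> 0"
      using Uae vae AE_space
    proof eventually_elim
      case (elim x)
      then have "isCont (f x) (w x)" using f_cont[of x] by (simp add: continuous_on_eq_continuous_at)
      then have "(\<lambda>n. f x (U n x)) \<longlonglongrightarrow> f x (w x)" using isCont_tendsto_compose elim(1) by blast
      from tendsto_mult[OF this elim(2)] show ?case by simp
    qed
    have b: "\<exists>W. integrable M W \<and> (\<forall>n. \<forall>x\<in>\<Omega>. \<bar>f x (U n x) * v n x\<bar> \<le> \<delta> * (\<bar>U n x\<bar> powr q + \<bar>v n x\<bar> powr q) + W x)"
      if "\<delta> > 0" for \<delta>
    proof -
      obtain C where C: "C \<ge> 0" "\<And>y. (c1 + c2) * \<bar>y\<bar> powr p \<le> \<delta> * \<bar>y\<bar> powr q + C" using absorb[OF \<open>\<delta> > 0\<close>] by blast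
      show ?thesis
      proof (intro exI conjI allI ballI)
        show "integrable M (\<lambda>x. 2 * C + c2)" by simp
        fix n x assume x: "x \<in> \<Omega>"
        have "\<bar>f x (U n x) * v n x\<bar> \<le> (c1 * \<bar>U n x\<bar> powr (p - 1) + c2) * \<bar>v n x\<bar>"
          unfolding abs_mult by (intro mult_right_mono growth x) simp
        also have "\<dots> = c1 * (\<bar>U n x\<bar> powr (p - 1) * \<bar>v n x\<bar>) + c2 * \<bar>v n x\<bar>" by (simp add: algebra_simps)
        also have "\<dots> \<le> c1 * (\<bar>U n x\<bar> powr p + \<bar>v n x\<bar> powr p) + c2 * (1 + \<bar>v n x\<bar> powr p)"
          using c12 p one by (intro add_mono mult_left_mono powr_mult_le) auto
        also have "\<dots> \<le> (c1 + c2) * \<bar>U n x\<bar> powr p + (c1 + c2) * \<bar>v n x\<bar> powr p + c2"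
          using c12 by (simp add: algebra_simps)
        also have "\<dots> \<le> \<delta> * (\<bar>U n x\<bar> powr q + \<bar>v n x\<bar> powr q) + (2 * C + c2)"
          using C(2)[of "U n x"] C(2)[of "v n x"] unfolding distrib_left by linarith
        finally show "\<bar>f x (U n x) * v n x\<bar> \<le> \<delta> * (\<bar>U n x\<bar> powr q + \<bar>v n x\<bar> powr q) + (2 * C + c2)" .
      qed
    qed
    show "(\<lambda>n. LINT x|M. f x (U n x) * v n x) \<longlonglongrightarrow> 0" "integrable M (\<lambda>x. f x (U n x) * v n x)"
      using van[of "\<lambda>n x. f x (U n x) * v n x", OF m l b] by auto
  qed
  \<comment> \<open>In both Brezis--Lieb estimates \<open>v n\<close> is the moving part and
    \<open>w\<close> the fixed one: the small factor falls on the bounded integrals of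
    \<open>\<bar>v n\<bar> powr q\<close>, the large constant on the single integrable function
    \<open>\<bar>w\<bar> powr q\<close>.\<close>
  have Ueq: "U n x = v n x + w x" for n x by (simp add: v_def)
  have BL: "(\<lambda>n. (LINT x|M. \<bar>U n x\<bar> powr q) - (LINT x|M. \<bar>v n x\<bar> powr q)) \<longlonglongrightarrow> (LINT x|M. \<bar>w x\<bar> powr q)"
  proof -
    have "(\<lambda>n. LINT x|M. \<bar>U n x\<bar> powr q - \<bar>v n x\<bar> powr q - \<bar>w x\<bar> powr q) \<longlonglongrightarrow> 0"
    proof (rule van(2))
      show "(\<lambda>x. \<bar>U n x\<bar> powr q - \<bar>v n x\<bar> powr q - \<bar>w x\<bar> powr q) \<in> borel_measurable M" for n
        using Um vm wm by simp
      show "AE x in M. (\<lambda>n. \<bar>U n x\<bar> powr q - \<bar>v n x\<bar> powr q - \<bar>w x\<bar> powr q) \<longlonglongrightarrow> 0"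
        using Uae vae
      proof eventually_elim
        case (elim x)
        have "(\<lambda>n. \<bar>U n x\<bar> powr q - \<bar>v n x\<bar> powr q - \<bar>w x\<bar> powr q) \<longlonglongrightarrow> \<bar>w x\<bar> powr q - \<bar>0\<bar> powr q - \<bar>w x\<bar> powr q"
          using q_gt_1 by (intro tendsto_diff tendsto_powr' tendsto_rabs tendsto_const elim) auto
        then show ?case by simp
      qed
      fix \<delta> :: real assume "\<delta> > 0"
      obtain C where C: "C \<ge> 0" "\<And>y b :: real. \<bar>\<bar>y + b\<bar> powr q - \<bar>y\<bar> powr q\<bar> \<le> \<delta> * \<bar>y\<bar> powr q + C * \<bar>b\<bar> powr q"
        by (rule brezis_lieb_ineq[OF q_gt_1 \<open>\<delta> > 0\<close>]) (blast intro: that)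
      show "\<exists>W. integrable M W \<and> (\<forall>n. \<forall>x\<in>\<Omega>. \<bar>\<bar>U n x\<bar> powr q - \<bar>v n x\<bar> powr q - \<bar>w x\<bar> powr q\<bar> \<le> \<delta> * (\<bar>U n x\<bar> powr q + \<bar>v n x\<bar> powr q) + W x)"
      proof (intro exI conjI allI ballI)
        show "integrable M (\<lambda>x. C * \<bar>w x\<bar> powr q + \<bar>w x\<bar> powr q)" using wq by simp
        fix n x
        have "\<bar>\<bar>U n x\<bar> powr q - \<bar>v n x\<bar> powr q\<bar> \<le> \<delta> * \<bar>v n x\<bar> powr q + C * \<bar>w x\<bar> powr q"
          unfolding Ueq by (rule C(2))
        moreover have "0 \<le> \<delta> * \<bar>U n x\<bar> powr q" "0 \<le> \<bar>w x\<bar> powr q" using \<open>\<delta> > 0\<close> by auto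
        moreover have "\<bar>y - z\<bar> \<le> d * (k + l) + (c + z)" if "\<bar>y\<bar> \<le> d * l + c" "0 \<le> d * k" "0 \<le> z" for y z d k l c :: real
          using that unfolding distrib_left by linarith
        ultimately show "\<bar>\<bar>U n x\<bar> powr q - \<bar>v n x\<bar> powr q - \<bar>w x\<bar> powr q\<bar> \<le> \<delta> * (\<bar>U n x\<bar> powr q + \<bar>v n x\<bar> powr q) + (C * \<bar>w x\<bar> powr q + \<bar>w x\<bar> powr q)"
          by blast
      qed
    qed
    then have "(\<lambda>n. ((LINT x|M. \<bar>U n x\<bar> powr q) - (LINT x|M. \<bar>v n x\<bar> powr q)) - (LINT x|M. \<bar>w x\<bar> powr q)) \<longlonglongrightarrow> 0"
      using sobolev_H10(1)[OF UH] sobolev_H10(1)[OF vH] wq by simp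
    then show ?thesis by (rule LIM_zero_cancel)
  qed
  have X: "(\<lambda>n. LINT x|M. max 0 (\<bar>U n x\<bar> powr (q - 1) * \<bar>v n x\<bar> - \<bar>v n x\<bar> powr q)) \<longlonglongrightarrow> 0"
    "integrable M (\<lambda>x. max 0 (\<bar>U n x\<bar> powr (q - 1) * \<bar>v n x\<bar> - \<bar>v n x\<bar> powr q))" for n
  proof -
    let ?X = "\<lambda>n x. max 0 (\<bar>U n x\<bar> powr (q - 1) * \<bar>v n x\<bar> - \<bar>v n x\<bar> powr q)"
    have m: "?X n \<in> borel_measurable M" for n using Um vm by simp
    have l: "AE x in M. (\<lambda>n. ?X n x) \<longlonglongrightarrow> 0"
      using Uae vae
    proof eventually_elim
      case (elim x)
      have "(\<lambda>n. ?X n x) \<longlonglongrightarrow> max 0 (\<bar>w x\<bar> powr (q - 1) * \<bar>0\<bar> - \<bar>0\<bar> powr q)"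
        using q_gt_1 by (intro tendsto_max tendsto_diff tendsto_mult tendsto_powr' tendsto_rabs tendsto_const elim) auto
      then show ?case by simp
    qed
    have b: "\<exists>W. integrable M W \<and> (\<forall>n. \<forall>x\<in>\<Omega>. \<bar>?X n x\<bar> \<le> \<delta> * (\<bar>U n x\<bar> powr q + \<bar>v n x\<bar> powr q) + W x)"
      if "\<delta> > 0" for \<delta>
    proof -
      obtain C where C: "C \<ge> 0" "\<And>y b :: real. max 0 (\<bar>y + b\<bar> powr (q - 1) * \<bar>y\<bar> - \<bar>y\<bar> powr q) \<le> \<delta> * \<bar>y\<bar> powr q + C * \<bar>b\<bar> powr q"
        by (rule powr_mult_brezis_lieb[OF q_gt_1 \<open>\<delta> > 0\<close>]) (blast intro: that)
      show ?thesis
      proof (intro exI conjI allI ballI)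
        show "integrable M (\<lambda>x. C * \<bar>w x\<bar> powr q)" using wq by simp
        fix n x
        have "?X n x \<le> \<delta> * \<bar>v n x\<bar> powr q + C * \<bar>w x\<bar> powr q" unfolding Ueq by (rule C(2))
        moreover have "0 \<le> \<delta> * \<bar>U n x\<bar> powr q" using \<open>\<delta> > 0\<close> by auto
        ultimately show "\<bar>?X n x\<bar> \<le> \<delta> * (\<bar>U n x\<bar> powr q + \<bar>v n x\<bar> powr q) + C * \<bar>w x\<bar> powr q"
          unfolding distrib_left by linarith
      qed
    qed
    show "(\<lambda>n. LINT x|M. ?X n x) \<longlonglongrightarrow> 0" "integrable M (?X n)"
      using van[of ?X, OF m l b] by auto
  qed
  show thesis
  proof (rule that[of r w s, folded U_def, folded v_def])
    show "(\<lambda>n. dirichlet \<Omega> (U n)) \<longlonglongrightarrow> dirichlet \<Omega> w + s" using tl by (simp add: U_def s_def)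
    show "(\<lambda>n. dirichlet \<Omega> (\<lambda>x. v n x)) \<longlonglongrightarrow> s" by (rule sl)
    show "(\<lambda>n. dform (U n) (\<lambda>x. v n x)) \<longlonglongrightarrow> s" by (rule fl)
  qed (rule r w s0 Fl fv BL X)+
qed

lemma J_has_minimizer: "\<exists>u\<in>H10 \<Omega>. \<forall>v\<in>H10 \<Omega>. J u \<le> J v"
proof -
  define I where "I = (INF u\<in>H10 \<Omega>. J u)"
  have I: "I \<le> J v" if "v \<in> H10 \<Omega>" for v
    unfolding I_def by (rule cINF_lower[OF J_bdd_below that])
  have "\<exists>u. u \<in> H10 \<Omega> \<and> J u < I + inverse (real (Suc n))" for n
  proof -
    have "\<exists>u\<in>H10 \<Omega>. J u < I + inverse (real (Suc n))"
      using cINF_less_iff[OF _ J_bdd_below, of "I + inverse (real (Suc n))"] H10_zero unfolding I_def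
      by fastforce
    then show ?thesis by blast
  qed
  then obtain u where u: "\<And>n. u n \<in> H10 \<Omega>" "\<And>n. J (u n) < I + inverse (real (Suc n))" by metis
  obtain B where B: "\<And>v. v \<in> H10 \<Omega> \<Longrightarrow> J v \<le> I + 1 \<Longrightarrow> H10_norm \<Omega> v \<le> B"
    using J_sublevel_bounded[of "I + 1"] by blast
  have uB: "H10_norm \<Omega> (u n) \<le> B" for n
  proof (rule B[OF u(1)])
    have "inverse (real (Suc n)) \<le> 1" by (simp add: field_simps)
    then show "J (u n) \<le> I + 1" using u(2)[of n] by linarith
  qed
  obtain r w s where r: "strict_mono (r :: nat \<Rightarrow> nat)" and w: "w \<in> H10 \<Omega>" and s: "0 \<le> s"
    and D: "(\<lambda>n. dirichlet \<Omega> (u (r n))) \<longlonglongrightarrow> dirichlet \<Omega> w + s"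
    and Dv: "(\<lambda>n. dirichlet \<Omega> (\<lambda>x. u (r n) x - w x)) \<longlonglongrightarrow> s"
    and Fl: "(\<lambda>n. LINT x|M. F x (u (r n) x)) \<longlonglongrightarrow> (LINT x|M. F x (w x))"
    and BL: "(\<lambda>n. (LINT x|M. \<bar>u (r n) x\<bar> powr q) - (LINT x|M. \<bar>u (r n) x - w x\<bar> powr q)) \<longlonglongrightarrow> (LINT x|M. \<bar>w x\<bar> powr q)"
    by (rule bounded_sequence_limits[of u B, OF u(1) uB]) (rule that)
  \<comment> \<open>The critical integral of \<open>u (r n) - w\<close> is not known to converge.
    Replacing it by its Sobolev bound lowers the energy and leaves only terms with known
    limits.\<close>
  let ?A = "\<lambda>n. 1 / 2 * H (dirichlet \<Omega> (u (r n))) - (LINT x|M. F x (u (r n) x)) -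
     1 / q * (((LINT x|M. \<bar>u (r n) x\<bar> powr q) - (LINT x|M. \<bar>u (r n) x - w x\<bar> powr q)) +
       K * dirichlet \<Omega> (\<lambda>x. u (r n) x - w x) powr (q / 2))"
  have Hl: "(\<lambda>n. H (dirichlet \<Omega> (u (r n)))) \<longlonglongrightarrow> H (dirichlet \<Omega> w + s)"
    by (rule isCont_tendsto_compose[OF DERIV_isCont[OF H_deriv] D])
  have "?A \<longlonglongrightarrow> 1 / 2 * H (dirichlet \<Omega> w + s) - (LINT x|M. F x (w x)) -
      1 / q * ((LINT x|M. \<bar>w x\<bar> powr q) + K * s powr (q / 2))"
    using q_gt_1 by (intro tendsto_diff tendsto_mult tendsto_add tendsto_const tendsto_powr' Hl Fl BL Dv) auto
  moreover have "?A n \<le> I + inverse (real (Suc n))" for n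
  proof -
    have "(LINT x|M. \<bar>u (r n) x - w x\<bar> powr q) \<le> K * dirichlet \<Omega> (\<lambda>x. u (r n) x - w x) powr (q / 2)"
      by (rule sobolev_K[OF H10_diff[OF u(1) w]])
    then have "1 / q * (LINT x|M. \<bar>u (r n) x\<bar> powr q) \<le> 1 / q * (((LINT x|M. \<bar>u (r n) x\<bar> powr q) - (LINT x|M. \<bar>u (r n) x - w x\<bar> powr q)) +
       K * dirichlet \<Omega> (\<lambda>x. u (r n) x - w x) powr (q / 2))"
      using q_gt_1 by (intro mult_left_mono) auto
    then have "?A n \<le> J (u (r n))" unfolding J_eq2[OF u(1)] by linarith
    also have "\<dots> \<le> I + inverse (real (Suc (r n)))" using u(2)[of "r n"] by simp
    also have "\<dots> \<le> I + inverse (real (Suc n))"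
      using seq_suble[OF r, of n] by (simp add: le_imp_inverse_le)
    finally show ?thesis .
  qed
  moreover have "(\<lambda>n. I + inverse (real (Suc n))) \<longlonglongrightarrow> I + 0"
    by (intro tendsto_add tendsto_const LIMSEQ_inverse_real_of_nat)
  ultimately have le: "1 / 2 * H (dirichlet \<Omega> w + s) - (LINT x|M. F x (w x)) -
      1 / q * ((LINT x|M. \<bar>w x\<bar> powr q) + K * s powr (q / 2)) \<le> I + 0"
    by (intro LIMSEQ_le[of ?A]) auto
  \<comment> \<open>The lost part contributes at least \<open>1 / 2 * H s\<close> to the Kirchhoff
    term and removes at most \<open>K / q * s powr (q / 2)\<close> through the critical one; the
    balance is nonnegative, so dropping it leaves \<open>J w\<close>.\<close>
  have "1 / 2 * (H s + H (dirichlet \<Omega> w)) \<le> 1 / 2 * H (dirichlet \<Omega> w + s)"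
    using H_superadd[OF s dirichlet_nonneg[of w]] by simp
  moreover have "K / q * s powr (q / 2) \<le> 1 / 2 * H s" by (rule H_lower[OF s])
  ultimately have "J w \<le> I"
    using le unfolding J_eq2[OF w] distrib_left by simp
  then show ?thesis using w I by (meson order_trans)
qed

text \<open>The factor \<open>1 / 2\<close> in the energy has cancelled the 2 that arises from
  differentiating the quadratic form \<open>dirichlet\<close>.\<close>

definition dJ :: "('a \<Rightarrow> real) \<Rightarrow> ('a \<Rightarrow> real) \<Rightarrow> real" where
  "dJ u v = hh (dirichlet \<Omega> u) * dform u v - (LINT x|M. g x (u x) * v x)"

text \<open>The chain rule by hand: the increment of the Dirichlet integral is
  \<open>d = 2 * dform u v + ?N\<^sup>2\<close>. Differentiability of \<open>H\<close> controls the
  error linearly in \<open>d\<close>, which is at most \<open>n * ?N\<close>, and the quadratic part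
  of \<open>d\<close> is negligible for small \<open>?N\<close>.\<close>

lemma J_has_derivative:
  assumes u: "u \<in> H10 \<Omega>"
  shows "has_H10_derivative \<Omega> J (dJ u) u"
  unfolding has_H10_derivative_def
proof (intro conjI ballI allI impI)
  fix v w and b c :: real assume v: "v \<in> H10 \<Omega>" and w: "w \<in> H10 \<Omega>"
  have "(LINT x|M. g x (u x) * (b * v x + c * w x)) = (LINT x|M. b * (g x (u x) * v x) + c * (g x (u x) * w x))"
    by (simp add: algebra_simps)
  also have "\<dots> = b * (LINT x|M. g x (u x) * v x) + c * (LINT x|M. g x (u x) * w x)"
    using g_mult_integrable[OF u v] g_mult_integrable[OF u w] by simp
  finally show "dJ u (\<lambda>x. b * v x + c * w x) = b * dJ u v + c * dJ u w"
    unfolding dJ_def dform_lincomb_right[OF u v w] by (simp add: algebra_simps)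
next
  obtain C where C: "\<And>v. v \<in> H10 \<Omega> \<Longrightarrow> \<bar>LINT x|M. g x (u x) * v x\<bar> \<le> C * H10_norm \<Omega> v"
    using NG_deriv_bounded[OF u] by blast
  show "\<exists>C. \<forall>v\<in>H10 \<Omega>. \<bar>dJ u v\<bar> \<le> C * H10_norm \<Omega> v"
  proof (intro exI ballI)
    fix v assume v: "v \<in> H10 \<Omega>"
    have "\<bar>hh (dirichlet \<Omega> u) * dform u v\<bar> \<le> \<bar>hh (dirichlet \<Omega> u)\<bar> * (H10_norm \<Omega> u * H10_norm \<Omega> v)"
      unfolding abs_mult by (intro mult_left_mono dform_bound u v) auto
    moreover have "(\<bar>hh (dirichlet \<Omega> u)\<bar> * H10_norm \<Omega> u + C) * H10_norm \<Omega> v =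
        \<bar>hh (dirichlet \<Omega> u)\<bar> * (H10_norm \<Omega> u * H10_norm \<Omega> v) + C * H10_norm \<Omega> v"
      by (simp add: algebra_simps)
    ultimately show "\<bar>dJ u v\<bar> \<le> (\<bar>hh (dirichlet \<Omega> u)\<bar> * H10_norm \<Omega> u + C) * H10_norm \<Omega> v"
      unfolding dJ_def using C[OF v] by linarith
  qed
next
  fix \<epsilon> :: real assume \<epsilon>: "\<epsilon> > 0"
  let ?a = "dirichlet \<Omega> u"
  define n where "n = 2 * H10_norm \<Omega> u + 1"
  have n: "n > 0" unfolding n_def using H10_norm_nonneg[of u] by linarith
  have ha: "hh ?a \<ge> 0" using h_nonneg by (simp add: hh_eq)
  have "(H has_derivative (\<lambda>d. d * hh ?a)) (at ?a)"
    using H_deriv[of ?a] by (simp add: has_field_derivative_def mult_commute_abs)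
  then obtain \<delta>1 where \<delta>1: "\<delta>1 > 0" "\<And>y. \<bar>y - ?a\<bar> < \<delta>1 \<Longrightarrow> \<bar>H y - H ?a - (y - ?a) * hh ?a\<bar> \<le> (\<epsilon> / n) * \<bar>y - ?a\<bar>"
    unfolding has_derivative_at_alt using \<epsilon> n by (metis divide_pos_pos real_norm_def)
  have \<epsilon>4: "\<epsilon> / 4 > 0" using \<epsilon> by simp
  from NG_frechet[OF u \<epsilon>4]
  obtain \<delta>2 where \<delta>2: "\<delta>2 > 0" "\<And>v. v \<in> H10 \<Omega> \<Longrightarrow> H10_norm \<Omega> v < \<delta>2 \<Longrightarrow>
    \<bar>NG (\<lambda>x. u x + v x) - NG u - (LINT x|M. g x (u x) * v x)\<bar> \<le> \<epsilon> / 4 * H10_norm \<Omega> v" by blast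
  \<comment> \<open>In this order the entries ensure the bound of \<open>d\<close> by
    \<open>n * ?N\<close>, \<open>d\<close> within the range of \<open>\<delta>1\<close>, a small
    quadratic term, and validity of \<open>NG_frechet\<close>.\<close>
  define \<delta> where "\<delta> = min (min 1 (\<delta>1 / n)) (min (\<epsilon> / (2 * (hh ?a + 1))) \<delta>2)"
  show "\<exists>\<delta>>0. \<forall>v\<in>H10 \<Omega>. H10_norm \<Omega> v < \<delta> \<longrightarrow> \<bar>J (\<lambda>x. u x + v x) - J u - dJ u v\<bar> \<le> \<epsilon> * H10_norm \<Omega> v"
  proof (intro exI conjI ballI impI)
    show "\<delta> > 0" unfolding \<delta>_def using \<delta>1(1) \<delta>2(1) n \<epsilon> ha by simp
    fix v assume v: "v \<in> H10 \<Omega>" and lt: "H10_norm \<Omega> v < \<delta>"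
    let ?N = "H10_norm \<Omega> v"
    have N: "?N < 1" "?N < \<delta>1 / n" "?N < \<epsilon> / (2 * (hh ?a + 1))" "?N < \<delta>2" "?N \<ge> 0"
      using lt by (auto simp: \<delta>_def)
    have uv: "(\<lambda>x. u x + v x) \<in> H10 \<Omega>" by (rule H10_add[OF u v])
    define d where "d = 2 * dform u v + ?N\<^sup>2"
    have Duv: "dirichlet \<Omega> (\<lambda>x. u x + v x) = ?a + d"
      using dirichlet_lincomb[OF u v, of 1 1] by (simp add: d_def H10_norm_sq)
    have N2: "?N\<^sup>2 \<le> ?N" using N by (simp add: power2_eq_square mult_left_le)
    have "\<bar>d\<bar> \<le> 2 * (H10_norm \<Omega> u * ?N) + ?N\<^sup>2"
      unfolding d_def using dform_bound[OF u v] zero_le_power2[of ?N] by linarith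
    also have "\<dots> \<le> n * ?N" using N2 by (simp add: n_def algebra_simps)
    finally have dn: "\<bar>d\<bar> \<le> n * ?N" .
    also have "\<dots> < \<delta>1" using N(2) n by (simp add: pos_less_divide_eq mult.commute)
    finally have "\<bar>H (?a + d) - H ?a - d * hh ?a\<bar> \<le> (\<epsilon> / n) * \<bar>d\<bar>" using \<delta>1(2)[of "?a + d"] by simp
    also have "\<dots> \<le> (\<epsilon> / n) * (n * ?N)" using dn \<epsilon> n by (intro mult_left_mono) auto
    also have "\<dots> = \<epsilon> * ?N" using n by simp
    finally have A: "\<bar>H (?a + d) - H ?a - d * hh ?a\<bar> \<le> \<epsilon> * ?N" .
    have "hh ?a * ?N \<le> (hh ?a + 1) * (\<epsilon> / (2 * (hh ?a + 1)))"
      using N ha by (intro mult_mono) auto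
    also have "\<dots> = \<epsilon> / 2" using ha by (simp add: field_simps)
    finally have "hh ?a * ?N * ?N \<le> \<epsilon> / 2 * ?N" using N by (intro mult_right_mono) auto
    then have Bq: "hh ?a * ?N\<^sup>2 \<le> \<epsilon> / 2 * ?N" by (simp add: power2_eq_square mult.assoc)
    have Bq0: "0 \<le> hh ?a * ?N\<^sup>2" using ha by simp
    have Cq: "\<bar>NG (\<lambda>x. u x + v x) - NG u - (LINT x|M. g x (u x) * v x)\<bar> \<le> \<epsilon> / 4 * ?N"
      by (rule \<delta>2(2)[OF v N(4)])
    \<comment> \<open>The three parts cost at most \<open>\<epsilon> / 2\<close>,
      \<open>\<epsilon> / 4\<close> and \<open>\<epsilon> / 4\<close> times the norm of
      \<open>v\<close>.\<close>
    have Jd: "J (\<lambda>x. u x + v x) - J u - dJ u v = 1 / 2 * (H (?a + d) - H ?a - d * hh ?a) + 1 / 2 * (hh ?a * ?N\<^sup>2)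
        - (NG (\<lambda>x. u x + v x) - NG u - (LINT x|M. g x (u x) * v x))"
      unfolding J_eq[OF uv] J_eq[OF u] Duv dJ_def by (simp add: d_def algebra_simps)
    show "\<bar>J (\<lambda>x. u x + v x) - J u - dJ u v\<bar> \<le> \<epsilon> * ?N"
    proof -
      have *: "\<bar>1 / 2 * x + 1 / 2 * y - z\<bar> \<le> E" if "\<bar>x\<bar> \<le> E" "y \<le> E / 2" "0 \<le> y" "\<bar>z\<bar> \<le> E / 4" for x y z E :: real
        using that unfolding abs_le_iff by linarith
      show ?thesis
        unfolding Jd by (rule *) (use A Bq Bq0 Cq in simp_all)
    qed
  qed
qed

text \<open>\<open>H10_derivative\<close> is a choice among functionals that may differ off
  \<open>H10\<close>, so agreement can be expected only there. Along small multiples of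
  \<open>v\<close> both linear maps approximate the same increment, and linearity rescales the
  difference.\<close>

lemma has_H10_derivative_unique:
  assumes L: "has_H10_derivative \<Omega> I L u" and L': "has_H10_derivative \<Omega> I L' u" and v: "v \<in> H10 \<Omega>"
  shows "L v = L' v"
proof (rule ccontr)
  assume ne: "L v \<noteq> L' v"
  let ?N = "H10_norm \<Omega> v"
  have lin: "L (\<lambda>x. c * v x) = c * L v" "L' (\<lambda>x. c * v x) = c * L' v" for c
  proof -
    have "L (\<lambda>x. c * v x + 0 * v x) = c * L v + 0 * L v" "L' (\<lambda>x. c * v x + 0 * v x) = c * L' v + 0 * L' v"
      using L L' v unfolding has_H10_derivative_def by blast+
    then show "L (\<lambda>x. c * v x) = c * L v" "L' (\<lambda>x. c * v x) = c * L' v" by simp_all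
  qed
  \<comment> \<open>The denominator 3 beats the two error terms, leaving two thirds of the assumed
    difference as a bound for itself; adding 1 to the norm allows norm zero.\<close>
  define \<epsilon> where "\<epsilon> = \<bar>L v - L' v\<bar> / (3 * (?N + 1))"
  have N0: "?N \<ge> 0" by simp
  have N1: "?N + 1 > 0" using N0 by linarith
  have \<epsilon>: "\<epsilon> > 0" unfolding \<epsilon>_def using ne N1 by (intro divide_pos_pos) auto
  obtain d where d: "d > 0" "\<And>z. z \<in> H10 \<Omega> \<Longrightarrow> H10_norm \<Omega> z < d \<Longrightarrow> \<bar>I (\<lambda>x. u x + z x) - I u - L z\<bar> \<le> \<epsilon> * H10_norm \<Omega> z"
    using L \<epsilon> unfolding has_H10_derivative_def by blast
  obtain d' where d': "d' > 0" "\<And>z. z \<in> H10 \<Omega> \<Longrightarrow> H10_norm \<Omega> z < d' \<Longrightarrow> \<bar>I (\<lambda>x. u x + z x) - I u - L' z\<bar> \<le> \<epsilon> * H10_norm \<Omega> z"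
    using L' \<epsilon> unfolding has_H10_derivative_def by blast
  define c where "c = min d d' / (2 * (?N + 1))"
  have c: "c > 0" unfolding c_def using d(1) d'(1) N1 by (intro divide_pos_pos) auto
  have "c * ?N \<le> c * (?N + 1)" using c by simp
  also have "\<dots> = min d d' / 2"
  proof -
    have "y / (2 * z) * z = y / 2" if "z > 0" for y z :: real using that by simp
    from this[OF N1] show ?thesis unfolding c_def .
  qed
  finally have small: "c * ?N < d" "c * ?N < d'" using d(1) d'(1) by (auto simp: min_def split: if_splits)
  have z: "(\<lambda>x. c * v x) \<in> H10 \<Omega>" "H10_norm \<Omega> (\<lambda>x. c * v x) = c * ?N"
    using H10_scale[OF v] H10_norm_scale[OF v] c by auto
  have "\<bar>c * L v - c * L' v\<bar> \<le> 2 * (\<epsilon> * (c * ?N))"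
    using d(2)[OF z(1)] d'(2)[OF z(1)] small unfolding z(2) lin by linarith
  moreover have "\<bar>c * L v - c * L' v\<bar> = c * \<bar>L v - L' v\<bar>"
    using c by (simp add: abs_mult flip: right_diff_distrib)
  ultimately have "c * \<bar>L v - L' v\<bar> \<le> c * (2 * \<epsilon> * ?N)" by (simp add: mult_ac)
  then have "\<bar>L v - L' v\<bar> \<le> 2 * \<epsilon> * ?N" using c by simp
  also have "\<dots> \<le> 2 * \<epsilon> * (?N + 1)" using \<epsilon> by simp
  also have "\<dots> = 2 / 3 * \<bar>L v - L' v\<bar>"
  proof -
    have "2 * (y / (3 * z)) * z = 2 / 3 * y" if "z > 0" for y z :: real using that by simp
    from this[OF N1] show ?thesis unfolding \<epsilon>_def .
  qed
  finally show False using ne by simp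
qed

text \<open>The supremum is over reals and says something only when bounded, which the continuity
  part of \<open>has_H10_derivative\<close> provides. Elements of norm zero cannot be normalised,
  but continuity makes \<open>L\<close> vanish on them.\<close>

lemma dual_norm_bound:
  assumes L: "has_H10_derivative \<Omega> I L u" and v: "v \<in> H10 \<Omega>"
  shows "\<bar>L v\<bar> \<le> dual_norm \<Omega> L * H10_norm \<Omega> v"
proof -
  obtain C where C: "\<And>v. v \<in> H10 \<Omega> \<Longrightarrow> \<bar>L v\<bar> \<le> C * H10_norm \<Omega> v"
    using L unfolding has_H10_derivative_def by blast
  show ?thesis
  proof (cases "H10_norm \<Omega> v = 0")
    case True
    then show ?thesis using C[OF v] by simp
  next
    case False
    then have N: "H10_norm \<Omega> v > 0" using H10_norm_nonneg[of v] by linarith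
    let ?c = "1 / H10_norm \<Omega> v"
    have "L (\<lambda>x. ?c * v x + 0 * v x) = ?c * L v + 0 * L v"
      using L v unfolding has_H10_derivative_def by blast
    then have lin: "L (\<lambda>x. ?c * v x) = ?c * L v" by simp
    have z: "(\<lambda>x. ?c * v x) \<in> H10 \<Omega>" "H10_norm \<Omega> (\<lambda>x. ?c * v x) = 1"
      using H10_scale[OF v, of ?c] H10_norm_scale[OF v, of ?c] N by auto
    have bdd: "bdd_above ((\<lambda>v. \<bar>L v\<bar>) ` {v \<in> H10 \<Omega>. H10_norm \<Omega> v \<le> 1})"
    proof (rule bdd_aboveI2[of _ _ "\<bar>C\<bar>"])
      fix w assume w: "w \<in> {v \<in> H10 \<Omega>. H10_norm \<Omega> v \<le> 1}"
      then have "\<bar>L w\<bar> \<le> C * H10_norm \<Omega> w" using C by simp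
      also have "\<dots> \<le> \<bar>C\<bar> * 1" using w by (intro mult_mono) auto
      finally show "\<bar>L w\<bar> \<le> \<bar>C\<bar>" by simp
    qed
    have "\<bar>L (\<lambda>x. ?c * v x)\<bar> \<le> dual_norm \<Omega> L"
      unfolding dual_norm_def by (rule cSUP_upper[OF _ bdd]) (use z in auto)
    then show ?thesis unfolding lin using N by (simp add: abs_mult pos_divide_le_eq)
  qed
qed

text \<open>The critical term is needed from above only: \<open>P (u) * v\<close> is at most
  \<open>\<bar>v\<bar> powr q\<close> plus an excess that tends to 0 in mean, and the sharp Sobolev
  inequality bounds the first part by the lost Dirichlet integral.\<close>

lemma J_palais_smale: "palais_smale \<Omega> J c"
  unfolding palais_smale_def
proof (intro allI impI, elim conjE)
  fix u :: "nat \<Rightarrow> 'a \<Rightarrow> real"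
  assume u: "\<forall>j. u j \<in> H10 \<Omega>" and Jc: "(\<lambda>j. J (u j)) \<longlonglongrightarrow> c"
    and dn: "(\<lambda>j. dual_norm \<Omega> (H10_derivative \<Omega> J (u j))) \<longlonglongrightarrow> 0"
  have uH: "u j \<in> H10 \<Omega>" for j using u by simp
  obtain C where C: "\<And>j. \<bar>J (u j)\<bar> \<le> C"
    using convergent_imp_Bseq[OF convergentI[OF Jc]] by (auto simp: Bseq_def)
  obtain B where "\<And>v. v \<in> H10 \<Omega> \<Longrightarrow> J v \<le> C \<Longrightarrow> H10_norm \<Omega> v \<le> B"
    using J_sublevel_bounded[of C] by blast
  then have B: "H10_norm \<Omega> (u j) \<le> B" for j using uH C[of j] by (simp add: abs_le_iff)
  obtain r w s where r: "strict_mono (r :: nat \<Rightarrow> nat)" and w: "w \<in> H10 \<Omega>" and s: "0 \<le> s"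
    and D: "(\<lambda>n. dirichlet \<Omega> (u (r n))) \<longlonglongrightarrow> dirichlet \<Omega> w + s"
    and Dv: "(\<lambda>n. dirichlet \<Omega> (\<lambda>x. u (r n) x - w x)) \<longlonglongrightarrow> s"
    and fl: "(\<lambda>n. dform (u (r n)) (\<lambda>x. u (r n) x - w x)) \<longlonglongrightarrow> s"
    and fv: "(\<lambda>n. LINT x|M. f x (u (r n) x) * (u (r n) x - w x)) \<longlonglongrightarrow> 0"
    "\<And>n. integrable M (\<lambda>x. f x (u (r n) x) * (u (r n) x - w x))"
    and X: "(\<lambda>n. LINT x|M. max 0 (\<bar>u (r n) x\<bar> powr (q - 1) * \<bar>u (r n) x - w x\<bar> - \<bar>u (r n) x - w x\<bar> powr q)) \<longlonglongrightarrow> 0"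
    "\<And>n. integrable M (\<lambda>x. max 0 (\<bar>u (r n) x\<bar> powr (q - 1) * \<bar>u (r n) x - w x\<bar> - \<bar>u (r n) x - w x\<bar> powr q))"
    by (rule bounded_sequence_limits[of u B, OF uH B]) (rule that)
  define v where "v n x = u (r n) x - w x" for n x
  have vH: "v n \<in> H10 \<Omega>" for n unfolding v_def by (rule H10_diff[OF uH w])
  have L: "has_H10_derivative \<Omega> J (H10_derivative \<Omega> J (u j)) (u j)" for j
    unfolding H10_derivative_def by (rule someI[of _ "dJ (u j)"]) (rule J_has_derivative[OF uH])
  have Leq: "H10_derivative \<Omega> J (u j) z = dJ (u j) z" if "z \<in> H10 \<Omega>" for j z
    by (rule has_H10_derivative_unique[OF L J_has_derivative[OF uH] that])
  have dJ0: "(\<lambda>n. dJ (u (r n)) (v n)) \<longlonglongrightarrow> 0"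
  proof (rule Lim_null_comparison)
    have "(\<lambda>n. dual_norm \<Omega> (H10_derivative \<Omega> J (u (r n)))) \<longlonglongrightarrow> 0"
      using LIMSEQ_subseq_LIMSEQ[OF dn r] by (simp add: o_def)
    then have "(\<lambda>n. \<bar>dual_norm \<Omega> (H10_derivative \<Omega> J (u (r n)))\<bar>) \<longlonglongrightarrow> 0" by (rule tendsto_rabs_zero)
    from tendsto_mult_left_zero[OF this, of "B + H10_norm \<Omega> w"]
    show "(\<lambda>n. \<bar>dual_norm \<Omega> (H10_derivative \<Omega> J (u (r n)))\<bar> * (B + H10_norm \<Omega> w)) \<longlonglongrightarrow> 0" .
    show "\<forall>\<^sub>F n in sequentially. norm (dJ (u (r n)) (v n)) \<le> \<bar>dual_norm \<Omega> (H10_derivative \<Omega> J (u (r n)))\<bar> * (B + H10_norm \<Omega> w)"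
    proof (intro always_eventually allI)
      fix n
      have vN: "H10_norm \<Omega> (v n) \<le> B + H10_norm \<Omega> w"
        using H10_norm_diff_le[OF uH w, of "r n"] B[of "r n"] unfolding v_def[abs_def] by linarith
      have "\<bar>dJ (u (r n)) (v n)\<bar> \<le> dual_norm \<Omega> (H10_derivative \<Omega> J (u (r n))) * H10_norm \<Omega> (v n)"
        unfolding Leq[OF vH, symmetric] by (rule dual_norm_bound[OF L vH])
      also have "\<dots> \<le> \<bar>dual_norm \<Omega> (H10_derivative \<Omega> J (u (r n)))\<bar> * (B + H10_norm \<Omega> w)"
        using vN by (intro mult_mono) auto
      finally show "norm (dJ (u (r n)) (v n)) \<le> \<bar>dual_norm \<Omega> (H10_derivative \<Omega> J (u (r n)))\<bar> * (B + H10_norm \<Omega> w)" by simp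
    qed
  qed
  define t where "t = dirichlet \<Omega> w + s"
  have t: "s \<le> t" by (simp add: t_def)
  have hl: "(\<lambda>n. hh (dirichlet \<Omega> (u (r n)))) \<longlonglongrightarrow> hh t"
  proof -
    have "isCont hh t" using hh_cont by (simp add: continuous_on_eq_continuous_at)
    then show ?thesis unfolding t_def by (rule isCont_tendsto_compose[OF _ D])
  qed
  \<comment> \<open>By the definition of \<open>dJ\<close> this is exactly the critical integral of
    \<open>P (u) * v\<close>, rewritten so that the limit of each term is known.\<close>
  let ?A = "\<lambda>n. hh (dirichlet \<Omega> (u (r n))) * dform (u (r n)) (v n) - (LINT x|M. f x (u (r n) x) * v n x) - dJ (u (r n)) (v n)"
  have A: "?A \<longlonglongrightarrow> hh t * s - 0 - 0"
    using hl fl fv(1) dJ0 unfolding v_def[abs_def] by (intro tendsto_diff tendsto_mult)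
  let ?X = "\<lambda>n x. max 0 (\<bar>u (r n) x\<bar> powr (q - 1) * \<bar>v n x\<bar> - \<bar>v n x\<bar> powr q)"
  have Ale: "?A n \<le> K * dirichlet \<Omega> (v n) powr (q / 2) + (LINT x|M. ?X n x)" for n
  proof -
    have i1: "integrable M (\<lambda>x. f x (u (r n) x) * v n x)" using fv(2) by (simp add: v_def)
    have i2: "integrable M (\<lambda>x. g x (u (r n) x) * v n x)" by (rule g_mult_integrable[OF uH vH])
    have e: "P (u (r n) x) * v n x = g x (u (r n) x) * v n x - f x (u (r n) x) * v n x" for x
      by (simp add: g_def algebra_simps)
    have iP: "integrable M (\<lambda>x. P (u (r n) x) * v n x)" unfolding e using i1 i2 by simp
    have "?A n = (LINT x|M. P (u (r n) x) * v n x)"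
      unfolding e dJ_def using i1 i2 by simp
    also have "\<dots> \<le> (LINT x|M. \<bar>v n x\<bar> powr q + ?X n x)"
    proof (rule integral_mono[OF iP])
      show "integrable M (\<lambda>x. \<bar>v n x\<bar> powr q + ?X n x)"
        using sobolev_H10(1)[OF vH[of n]] X(2)[of n] by (simp add: v_def)
      fix x
      have "P (u (r n) x) * v n x \<le> \<bar>u (r n) x\<bar> powr (q - 1) * \<bar>v n x\<bar>"
        unfolding abs_P[symmetric] abs_mult[symmetric] by simp
      then show "P (u (r n) x) * v n x \<le> \<bar>v n x\<bar> powr q + ?X n x" by linarith
    qed
    also have "\<dots> = (LINT x|M. \<bar>v n x\<bar> powr q) + (LINT x|M. ?X n x)"
      using sobolev_H10(1)[OF vH[of n]] X(2)[of n] by (simp add: v_def)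
    also have "(LINT x|M. \<bar>v n x\<bar> powr q) \<le> K * dirichlet \<Omega> (v n) powr (q / 2)"
      by (rule sobolev_K[OF vH])
    finally show ?thesis by simp
  qed
  have "(\<lambda>n. K * dirichlet \<Omega> (v n) powr (q / 2) + (LINT x|M. ?X n x)) \<longlonglongrightarrow> K * s powr (q / 2) + 0"
    using Dv X(1) q_gt_1 unfolding v_def[abs_def]
    by (intro tendsto_add tendsto_mult tendsto_const tendsto_powr') auto
  from LIMSEQ_le[OF A this] Ale have le: "hh t * s \<le> K * s powr (q / 2)" by auto
  have "s = 0"
  proof (rule ccontr)
    assume "s \<noteq> 0"
    with s have s': "s > 0" by simp
    \<comment> \<open>Since \<open>q > 2\<close> the power is increasing, so the strict inequality
      for \<open>h\<close> at \<open>t\<close> yields one at the smaller number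
      \<open>s\<close>.\<close>
    have "K * s powr (q / 2 - 1) \<le> K * t powr (q / 2 - 1)"
      using K_nonneg t s' q_gt_2 by (intro mult_left_mono powr_mono2) auto
    also have "\<dots> < hh t" using h_gt[of t] s' t by (simp add: hh_eq)
    finally have "K * s powr (q / 2 - 1) * s < hh t * s" using s' by simp
    moreover have "K * s powr (q / 2 - 1) * s = K * s powr (q / 2)"
      using s' by (simp add: powr_diff)
    ultimately show False using le by simp
  qed
  then have "(\<lambda>n. sqrt (dirichlet \<Omega> (\<lambda>x. u (r n) x - w x))) \<longlonglongrightarrow> sqrt 0"
    using Dv by (intro tendsto_real_sqrt) simp
  then have "(\<lambda>j. H10_norm \<Omega> (\<lambda>x. u (r j) x - w x)) \<longlonglongrightarrow> 0"
    by (simp add: H10_norm_def)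
  then show "\<exists>r w. strict_mono r \<and> w \<in> H10 \<Omega> \<and> (\<lambda>j. H10_norm \<Omega> (\<lambda>x. u (r j) x - w x)) \<longlonglongrightarrow> 0"
    using r w by blast
qed

end

section \<open>From the stated hypotheses to the locale assumptions\<close>

context bounded_open_set
begin

text \<open>Lebesgue measure is complete: whatever the function does on the null set, the part of a
  preimage lying there is measurable.\<close>

lemma measurable_off_null_set:
  fixes X X' :: "'a \<Rightarrow> real"
  assumes X': "X' \<in> borel_measurable M" and N: "N \<in> null_sets M" and eq: "\<And>x. x \<in> \<Omega> \<Longrightarrow> x \<notin> N \<Longrightarrow> X x = X' x"
  shows "X \<in> borel_measurable M"
proof (rule measurableI)
  fix A :: "real set" assume A: "A \<in> sets borel"
  have N': "N \<subseteq> \<Omega>" "N \<in> null_sets lebesgue"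
    using N by (auto simp: null_sets_restrict_space)
  have sub: "X -` A \<inter> N \<in> null_sets lebesgue"
    by (rule null_sets_completion_subset[OF _ N'(2)]) auto
  then have "X -` A \<inter> N \<in> sets M"
    using N'(1) by (auto simp: sets_restrict_space_iff null_setsD2)
  moreover have "(X' -` A \<inter> space M) - N \<in> sets M"
    using measurable_sets[OF X' A] N by auto
  moreover have "X -` A \<inter> space M = ((X' -` A \<inter> space M) - N) \<union> (X -` A \<inter> N)"
    using eq N'(1) by auto
  ultimately show "X -` A \<inter> space M \<in> sets M" by (metis sets.Un)
qed auto

end

context sobolev_domain
begin

text \<open>Integrating the lower bounds gives \<open>\<rho> = 2 * \<gamma>\<close> in the first
  case and \<open>\<rho> = q\<close> in the other two. In the third case the two bounds are not
  added: the higher power \<open>\<gamma>\<close> alone dominates any multiple of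
  \<open>t powr (q / 2)\<close> up to a constant, and only there does \<open>C\<close>
  arise.\<close>

lemma growth_conditions:
  assumes hc: "continuous_on {0..} h" and p: "1 < p" "p < q"
    and hyp: "(\<exists>\<eta> \<gamma>. \<eta> > 0 \<and> p / 2 < \<gamma> \<and> \<gamma> < q / 2 \<and> (\<forall>t\<ge>0. h t \<ge> K * t powr (q / 2 - 1) + \<eta> * t powr (\<gamma> - 1)))
       \<or> (\<exists>b. b > K \<and> (\<forall>t\<ge>0. h t \<ge> b * t powr (q / 2 - 1)))
       \<or> (\<exists>b \<gamma>. b > 0 \<and> \<gamma> > q / 2 \<and> (\<forall>t>0. h t > max (K * t powr (q / 2 - 1)) (b * t powr (\<gamma> - 1))))"
  obtains a \<rho> C where "a > 0" "p < \<rho>" "\<And>t. t > 0 \<Longrightarrow> h t > K * t powr (q / 2 - 1)"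
    "\<And>t. 0 \<le> t \<Longrightarrow> 1 / 2 * primitive h t \<ge> K / q * t powr (q / 2) + a * t powr (\<rho> / 2) - C"
proof -
  define k where "k t = h (max 0 t)" for t
  have kc: "continuous_on UNIV k"
    unfolding k_def by (rule continuous_on_compose2[OF hc]) (auto intro!: continuous_intros)
  have kp: "primitive h t = primitive k t" if "0 \<le> t" for t
    by (rule primitive_cong_nonneg[OF _ that]) (simp add: k_def)
  have cont: "continuous_on {0..} (\<lambda>t::real. c * t powr (q / 2) + d * t powr r)" if "r > 0" for c d r :: real
    using q_gt_2 that by (intro continuous_intros powr_continuous_nonneg) auto
  have ge: "c * t powr (q / 2) + d * t powr r \<le> primitive h t"
    if r: "r > 0" and le: "\<And>s. s > 0 \<Longrightarrow> c * (q / 2) * s powr (q / 2 - 1) + d * r * s powr (r - 1) \<le> h s" and t: "0 \<le> t"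
    for c d r t :: real
    unfolding kp[OF t]
  proof (rule primitive_ge[OF kc cont[OF r] _ _ _ t])
    show "((\<lambda>t. c * t powr (q / 2) + d * t powr r) has_real_derivative
        c * (q / 2) * s powr (q / 2 - 1) + d * r * s powr (r - 1)) (at s)" if "s > 0" for s
      using that by (auto intro!: derivative_eq_intros)
    show "c * (q / 2) * s powr (q / 2 - 1) + d * r * s powr (r - 1) \<le> k s" if "s > 0" for s
      using le[OF that] that by (simp add: k_def)
  qed simp
  have qne: "q \<noteq> 0" using q_gt_2 by simp
  from hyp consider
    (1) \<eta> \<gamma> where "\<eta> > 0" "p / 2 < \<gamma>" "\<forall>t\<ge>0. h t \<ge> K * t powr (q / 2 - 1) + \<eta> * t powr (\<gamma> - 1)"
  | (2) b where "b > K" "\<forall>t\<ge>0. h t \<ge> b * t powr (q / 2 - 1)"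
  | (3) b \<gamma> where "b > 0" "\<gamma> > q / 2" "\<forall>t>0. h t > max (K * t powr (q / 2 - 1)) (b * t powr (\<gamma> - 1))"
    by blast
  then show thesis
  proof cases
    case 1
    have \<gamma>0: "\<gamma> > 0" using 1(2) p by simp
    show thesis
    proof (rule that[of "\<eta> / (2 * \<gamma>)" "2 * \<gamma>" 0])
      show "\<eta> / (2 * \<gamma>) > 0" using 1(1) \<gamma>0 by simp
      show "p < 2 * \<gamma>" using 1(2) by simp
      show "h t > K * t powr (q / 2 - 1)" if "t > 0" for t
      proof -
        have "\<eta> * t powr (\<gamma> - 1) > 0" using that 1(1) by simp
        moreover have "h t \<ge> K * t powr (q / 2 - 1) + \<eta> * t powr (\<gamma> - 1)" using 1(3) that by simp
        ultimately show ?thesis by linarith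
      qed
      fix t :: real assume t: "0 \<le> t"
      have "2 * K / q * t powr (q / 2) + \<eta> / \<gamma> * t powr \<gamma> \<le> primitive h t"
        using 1(3) \<gamma>0 qne by (intro ge t) auto
      then have "1 / 2 * (2 * K / q * t powr (q / 2) + \<eta> / \<gamma> * t powr \<gamma>) \<le> 1 / 2 * primitive h t"
        by (rule mult_left_mono) simp
      moreover have "1 / 2 * (2 * K / q * t powr (q / 2) + \<eta> / \<gamma> * t powr \<gamma>) =
          K / q * t powr (q / 2) + \<eta> / (2 * \<gamma>) * t powr (2 * \<gamma> / 2) - 0"
        by (simp add: distrib_left)
      ultimately show "1 / 2 * primitive h t \<ge> K / q * t powr (q / 2) + \<eta> / (2 * \<gamma>) * t powr (2 * \<gamma> / 2) - 0" by linarith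
    qed
  next
    case 2
    show thesis
    proof (rule that[of "(b - K) / q" q 0])
      show "(b - K) / q > 0" using 2(1) q_gt_2 by simp
      show "p < q" by (rule p)
      show "h t > K * t powr (q / 2 - 1)" if "t > 0" for t
      proof -
        have "K * t powr (q / 2 - 1) < b * t powr (q / 2 - 1)" using 2(1) that by simp
        moreover have "h t \<ge> b * t powr (q / 2 - 1)" using 2(2) that by simp
        ultimately show ?thesis by linarith
      qed
      fix t :: real assume t: "0 \<le> t"
      have "2 * b / q * t powr (q / 2) + 0 * t powr 1 \<le> primitive h t"
        using 2(2) qne by (intro ge t) auto
      then have "1 / 2 * (2 * b / q * t powr (q / 2)) \<le> 1 / 2 * primitive h t"
        by (intro mult_left_mono) simp_all
      moreover have "1 / 2 * (2 * b / q * t powr (q / 2)) = K / q * t powr (q / 2) + (b - K) / q * t powr (q / 2) - 0"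
        by (simp add: diff_divide_distrib left_diff_distrib)
      ultimately show "1 / 2 * primitive h t \<ge> K / q * t powr (q / 2) + (b - K) / q * t powr (q / 2) - 0" by linarith
    qed
  next
    case 3
    have \<gamma>0: "\<gamma> > 0" using 3(2) q_gt_2 by simp
    \<comment> \<open>The multiple of \<open>t powr (q / 2)\<close> to be dominated:
      \<open>K / q\<close> for the critical term and 1 as the surplus \<open>a\<close>.\<close>
    define m where "m = K / q + 1"
    have m: "m > 0" using K_nonneg q_gt_2 by (simp add: m_def add_nonneg_pos)
    obtain C where C: "C \<ge> 0" "\<And>t. t \<ge> 0 \<Longrightarrow> t powr (q / 2) \<le> b / (2 * \<gamma> * m) * t powr \<gamma> + C"
      by (rule powr_absorb[of "q / 2" \<gamma> "b / (2 * \<gamma> * m)"]) (use 3 q_gt_2 \<gamma>0 m in auto)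
    show thesis
    proof (rule that[of 1 q "m * C"])
      show "p < q" by (rule p)
      show "h t > K * t powr (q / 2 - 1)" if "t > 0" for t using 3(3) that by simp
      fix t :: real assume t: "0 \<le> t"
      have "0 * t powr (q / 2) + b / \<gamma> * t powr \<gamma> \<le> primitive h t"
        using 3(3) \<gamma>0 by (intro ge t) (auto simp: less_imp_le)
      then have "1 / 2 * (b / \<gamma> * t powr \<gamma>) \<le> 1 / 2 * primitive h t" by (intro mult_left_mono) simp_all
      then have 1: "b / (2 * \<gamma>) * t powr \<gamma> \<le> 1 / 2 * primitive h t" by simp
      have "m * t powr (q / 2) \<le> m * (b / (2 * \<gamma> * m) * t powr \<gamma> + C)"
        using C(2)[OF t] m by (intro mult_left_mono) auto
      also have "\<dots> = b / (2 * \<gamma>) * t powr \<gamma> + m * C" using m by (simp add: distrib_left)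
      finally have 2: "m * t powr (q / 2) \<le> b / (2 * \<gamma>) * t powr \<gamma> + m * C" .
      have "m * t powr (q / 2) = K / q * t powr (q / 2) + 1 * t powr (q / 2)" by (simp add: m_def distrib_right)
      with 1 2 show "1 / 2 * primitive h t \<ge> K / q * t powr (q / 2) + 1 * t powr (q / 2) - m * C" by linarith
    qed simp
  qed
qed

end

theorem theorem2p4:
  fixes \<Omega> :: "'a::euclidean_space set"
    and h :: "real \<Rightarrow> real"
    and f :: "'a \<Rightarrow> real \<Rightarrow> real"
    and c1 c2 p :: real
  assumes "DIM('a) \<ge> 3"
    and "open \<Omega>" "connected \<Omega>" "\<Omega> \<noteq> {}" "bounded \<Omega>"
    and "continuous_on {0..} h" "mono_on {0..} h" "\<forall>t\<ge>0. h t \<ge> 0"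
    and "caratheodory \<Omega> f"
    and "c1 > 0" "c2 > 0" "1 < p" "p < crit_exp DIM('a)"
    and "AE x in lebesgue_on \<Omega>. \<forall>t. \<bar>f x t\<bar> \<le> c1 * \<bar>t\<bar> powr (p - 1) + c2"
    and "(\<exists>\<eta> \<gamma>. \<eta> > 0 \<and> p / 2 < \<gamma> \<and> \<gamma> < crit_exp DIM('a) / 2 \<and>
            (\<forall>t\<ge>0. h t \<ge> sobolev_const \<Omega> powr (- crit_exp DIM('a) / 2) * t powr (crit_exp DIM('a) / 2 - 1)
                        + \<eta> * t powr (\<gamma> - 1)))
       \<or> (\<exists>b. b > sobolev_const \<Omega> powr (- crit_exp DIM('a) / 2) \<and>
            (\<forall>t\<ge>0. h t \<ge> b * t powr (crit_exp DIM('a) / 2 - 1)))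
       \<or> (\<exists>b \<gamma>. b > 0 \<and> \<gamma> > crit_exp DIM('a) / 2 \<and>
            (\<forall>t>0. h t > max (sobolev_const \<Omega> powr (- crit_exp DIM('a) / 2) * t powr (crit_exp DIM('a) / 2 - 1))
                            (b * t powr (\<gamma> - 1))))"
  shows "bdd_below (energy \<Omega> h f ` H10 \<Omega>)
       \<and> coercive \<Omega> (energy \<Omega> h f)
       \<and> (\<forall>c. palais_smale \<Omega> (energy \<Omega> h f) c)
       \<and> (\<exists>u\<in>H10 \<Omega>. \<forall>v\<in>H10 \<Omega>. energy \<Omega> h f u \<le> energy \<Omega> h f v)"
proof -
  interpret D: sobolev_domain \<Omega>
    by unfold_locales (use assms in auto)
  let ?M = "lebesgue_on \<Omega>"
  have pq: "p < D.q" unfolding D.q_def by (rule assms(13))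
  obtain a \<rho> C where G: "a > 0" "p < \<rho>" "\<And>t. t > 0 \<Longrightarrow> h t > D.K * t powr (D.q / 2 - 1)"
    "\<And>t. 0 \<le> t \<Longrightarrow> 1 / 2 * primitive h t \<ge> D.K / D.q * t powr (D.q / 2) + a * t powr (\<rho> / 2) - C"
    by (rule D.growth_conditions[OF assms(6) assms(12) pq assms(15)[folded D.q_def, folded D.K_def]]) (blast intro: that)
  have "AE x in ?M. continuous_on UNIV (f x) \<and> (\<forall>t. \<bar>f x t\<bar> \<le> c1 * \<bar>t\<bar> powr (p - 1) + c2)"
    using assms(9,14) by (auto simp: caratheodory_def)
  then obtain N where N: "{x \<in> space ?M. \<not> (continuous_on UNIV (f x) \<and> (\<forall>t. \<bar>f x t\<bar> \<le> c1 * \<bar>t\<bar> powr (p - 1) + c2))} \<subseteq> N"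
    "emeasure ?M N = 0" "N \<in> sets ?M"
    by (rule AE_E)
  have N0: "N \<in> null_sets ?M" using N by (simp add: null_setsI)
  \<comment> \<open>The value 0 on the exceptional set is continuous in \<open>t\<close> and
    satisfies the growth bound because \<open>c1\<close> and \<open>c2\<close> are positive.\<close>
  define f' where "f' x t = (if x \<in> N then 0 else f x t)" for x t
  have good: "continuous_on UNIV (f x)" "\<bar>f x t\<bar> \<le> c1 * \<bar>t\<bar> powr (p - 1) + c2" if "x \<in> \<Omega>" "x \<notin> N" for x t
    using N(1) that by auto
  interpret L: nonlinearity \<Omega> f' c1 c2 p
  proof unfold_locales
    show "(\<lambda>x. f' x t) \<in> borel_measurable ?M" for t
      unfolding f'_def using assms(9) N(3) by (intro measurable_If_set) (auto simp: caratheodory_def)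
    show "continuous_on UNIV (f' x)" if "x \<in> \<Omega>" for x
    proof (cases "x \<in> N")
      case True
      then have "f' x = (\<lambda>t. 0)" by (simp add: f'_def fun_eq_iff)
      then show ?thesis by simp
    next
      case False
      then have "f' x = f x" by (simp add: f'_def fun_eq_iff)
      then show ?thesis using good(1)[OF that False] by simp
    qed
    show "\<bar>f' x t\<bar> \<le> c1 * \<bar>t\<bar> powr (p - 1) + c2" if "x \<in> \<Omega>" for x t
      using good(2)[OF that, of t] assms(10,11) by (cases "x \<in> N") (auto simp: f'_def)
  qed (use assms in auto)
  have J: "energy \<Omega> h f u = energy \<Omega> h f' u" if u: "u \<in> H10 \<Omega>" for u
  proof -
    have m: "(\<lambda>x. primitive (f' x) (u x)) \<in> borel_measurable ?M"
      using L.F_compose[OF L.H10_measurable[OF u]] by (simp add: L.F_def)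
    have eq: "primitive (f x) (u x) = primitive (f' x) (u x)" if "x \<notin> N" for x
    proof -
      have "f' x = f x" using that by (simp add: f'_def fun_eq_iff)
      then show ?thesis by simp
    qed
    \<comment> \<open>Equality of the integrals needs measurability on both sides; for the original
      nonlinearity it comes from completeness of the measure.\<close>
    have "(LINT x|?M. primitive (f x) (u x)) = (LINT x|?M. primitive (f' x) (u x))"
    proof (rule integral_cong_AE[OF D.measurable_off_null_set[OF m N0 eq] m])
      show "AE x in ?M. primitive (f x) (u x) = primitive (f' x) (u x)"
        using AE_not_in[OF N0] by eventually_elim (rule eq)
    qed
    then show ?thesis by (simp add: energy_def)
  qed
  \<comment> \<open>The locale works with \<open>f'\<close>, but its functional is the energy of the
    original \<open>f\<close>, so its conclusions hold for the latter.\<close>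
  interpret P: kirchhoff_problem \<Omega> f' c1 c2 p h "energy \<Omega> h f" a \<rho> C
    by unfold_locales (use assms(6-8) J G in auto)
  show ?thesis
    using P.J_bdd_below P.J_coercive P.J_palais_smale P.J_has_minimizer by blast
qed

end
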